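(* Let $n,d>0$ be coprime integers and $R=\mathbb{C}[[\varpi^n,\varpi^d]]$. For every integer $c$, the composition of isomorphisms $$\hat{\mathcal{B}}^{\psi(d),0}_{(1^n)}\xrightarrow{\ \iota\ }\hat{\mathcal{B}}^{\psi(d),0}_{(1^n)}\xrightarrow{\ \Phi\ }\overline{\mathcal{J}}_{(1^n)}$$ restricts to an isomorphism $\hat{\mathcal{B}}^{\psi(d),0}_{(1^n),\le c}\xrightarrow{\sim}\overline{\mathcal{J}}_{(1^n),\le c}$; equivalently, $\Phi$ restricts to an isomorphism $\iota\big(\hat{\mathcal{B}}^{\psi(d),0}_{(1^n),\le c}\big)\xrightarrow{\sim}\overline{\mathcal{J}}_{(1^n),\le c}$. That is, the Hikita filtration corresponds to the gap filtration after the involution $\iota$.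
   Context: Picard side. $x=\varpi^n$, $y=\varpi^d$, $S=\mathbb{C}[[\varpi]]$, $K=\mathbb{C}((\varpi))$, $\delta=\dim_{\mathbb{C}}S/R=\frac12(n-1)(d-1)$. $\overline{\mathcal{J}}$ is the (reduced) projective variety whose $\mathbb{C}$-points are the finitely generated $R$-submodules $M\subseteq K$ with $KM=K$ and $\dim_{\mathbb C}(\varpi^{-i}S/M)=\dim_{\mathbb C}(\varpi^{-i}S/R)$ for $i\gg0$. $\overline{\mathcal{J}}_{(1^n)}$ parametrizes pairs $(M,F)$ with $M\in\overline{\mathcal{J}}$ and $F$ a $y$-stable complete flag on $M/xM\simeq\mathbb{C}^n$. The gap of $M$ is $c(M)=\dim_{\mathbb{C}}((SM)/M)$, and $\overline{\mathcal{J}}_{(1^n),\le c}$ is the (reduced) subvariety of pairs $(M,F)$ with $c(M)\le c$ (gap filtration). Affine Springer fiber. $G=\mathrm{GL}_n$, $\hat G$ and $\hat K$ are its loop and arc groups ($\hat G(A)=G(A((x)))$, $\hat K(A)=G(A[[x]])$), $\hat I=\hat K_{(1^n)}\subseteq\hat K$ is the preimage of the upper-triangular Borel under $x\mapsto 0$, $\hat{\mathcal{G}}=\hat G/\hat K$, $\hat{\mathcal{B}}_{(1^n)}=\hat G/\hat I$. Write $d=mn+r$ with $0\le r<n$ and let $\psi(d)=x^m e_r+x^{m+1}e_{r-n}$, where $e_j=\sum_i E_{i,i+j}$ is the $0$-$1$ matrix supported on the $j$-th diagonal; thus for row vectors, $\sf v_i\cdot\psi(d)=x^m\sf v_{i+r}$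 if $i+r\le n$ and $x^{m+1}\sf v_{i+r-n}$ otherwise (for $n=1$, $\psi(d)=x^d$). $\hat{\mathcal{G}}^{\psi(d)}$ (resp. $\hat{\mathcal{B}}^{\psi(d)}_{(1^n)}$) is the reduced ind-scheme of cosets $g\hat K$ (resp. $g\hat I$) with $\mathrm{Ad}(g^{-1})\psi(d)\in\mathrm{Lie}(\hat K)$ (resp. $\mathrm{Lie}(\hat I)$). Map $\Phi$. Let $(\mathsf{v}_i)$ be the standard basis of $\mathbb{C}^n$ (row vectors), and $\mathsf{ab}:\mathbb{C}((x))^n\xrightarrow{\sim}\mathbb{C}((\varpi))$ the $\mathbb{C}((x))$-linear isomorphism ($x=\varpi^n$) with $\mathsf{ab}(\mathsf{v}_i)=\varpi^{i-1}$. The map $g\hat I\mapsto(M_g,F_g)$, where $M_g=\varpi^\delta\,\mathsf{ab}(\mathbb{C}[[x]]^n\cdot g^{-1})$ and $F_g$ is the flag on $M_g/xM_g$ induced by $F^{\mathrm{std}}\cdot g^{-1}$ ($F^{\mathrm{std}}$ the complete flag in $\mathbb{C}^n$ stabilized by upper-triangular matrices acting by right multiplication on row vectors), gives an isomorphism of $\hat{\mathcal{B}}^{\psi(d)}_{(1^n)}$ with the ind-scheme of pairs $(M,F)$ of all indices. $\hat{\mathcal{B}}^{\psi(d),0}_{(1^n)}$ is the preimage of $\overline{\mathcal{J}}_{(1^n)}$ and $\Phi$ the restricted isomorphism. Similarly $\hat{\mathcal{G}}^{\psi(d),0}\subseteq\hat{\mathcal G}^{\psi(d)}$ is the part corresponding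 to $\overline{\mathcal{J}}$ under $g\hat K\mapsto M_g$. Involution. $\iota(g)=J\,(g^{t})^{-1}J$, with $J$ the antidiagonal permutation matrix; it preserves $\hat K$ and $\hat I$ and sends $\psi(d)$ to $-\psi(d)$ on Lie algebras, so it induces an involution of $\hat{\mathcal{B}}^{\psi(d),0}_{(1^n)}$. Hikita filtration. For $\mu\in\mathbb{Z}^n$ let $x^\mu=\mathrm{diag}(x^{\mu_1},\dots,x^{\mu_n})$ and $\hat{\mathcal{G}}_\mu=\hat I x^\mu\hat K/\hat K$. Let $X^0_\bullet=\{\mu\in\mathbb{Z}^n:\sum\mu_i=0\}$; then $\hat{\mathcal{G}}^{\psi(d),0}\subseteq\coprod_{\mu\in X_\bullet^0}\hat{\mathcal{G}}_\mu$. Define a bijection $a:X^0_\bullet\to\mathbb{Z}_{\ge0}^{n-1}$ by $a(0)=0$ and, for $\mu\ne0$, $$a(\mu)=(\mu_{k+1}-\mu_k-1,\dots,\mu_n-\mu_k-1,\mu_1-\mu_k,\dots,\mu_{k-1}-\mu_k),$$ where $k$ is the largest index with $\mu_k=\min_i\mu_i$; write $|a|=a_1+\dots+a_{n-1}$. Then $\hat{\mathcal{B}}^{\psi(d),0}_{(1^n),\le c}$ is the preimage in $\hat{\mathcal{B}}^{\psi(d),0}_{(1^n)}$, under projection to $\hat{\mathcal{G}}$, of $\hat{\mathcal{G}}^{\psi(d),0}\cap\bigcup_{\mu\in X_\bullet^0,\,|a(\mu)|\le c}\hat{\mathcal{G}}_\mu$. *)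

theory Defs
  imports
    "HOL-Analysis.Function_Topology"
    "HOL-Computational_Algebra.Formal_Laurent_Series"
    "HOL-Algebra.Coset"
    "Jordan_Normal_Form.Matrix"
begin

section \<open>Classical varieties as spaces with functions\<close>

text \<open>
  A reduced scheme over the complex numbers is represented by its set of complex points with the
  Zariski topology and the sheaf of regular functions.  \<open>reg X U\<close> consists of total functions, but
  only their values on \<open>U\<close> matter.
\<close>

record 'p variety =
  zar :: "'p topology"
  reg :: "'p set \<Rightarrow> ('p \<Rightarrow> complex) set"

inductive_set poly_funs :: "('p \<Rightarrow> complex) set \<Rightarrow> ('p \<Rightarrow> complex) set"
  for A :: "('p \<Rightarrow> complex) set" where
  const: "(\<lambda>_. a) \<in> poly_funs A"
| gen: "f \<in> A \<Longrightarrow> f \<in> poly_funs A"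
| add: "f \<in> poly_funs A \<Longrightarrow> g \<in> poly_funs A \<Longrightarrow> (\<lambda>p. f p + g p) \<in> poly_funs A"
| mult: "f \<in> poly_funs A \<Longrightarrow> g \<in> poly_funs A \<Longrightarrow> (\<lambda>p. f p * g p) \<in> poly_funs A"

text \<open>
  The structure induced on a set \<open>X\<close> of points of an affine space (possibly with infinitely many
  coordinates) by the set \<open>A\<close> of coordinate functions: regular functions are those
  that are locally quotients of polynomials in finitely many coordinates.
\<close>

definition coord_variety :: "'p set \<Rightarrow> ('p \<Rightarrow> complex) set \<Rightarrow> 'p variety" where
  "coord_variety X A = \<lparr>
     zar = topology_generated_by {{p \<in> X. h p \<noteq> 0} | h. h \<in> poly_funs A},
     reg = (\<lambda>U. {f. \<forall>p\<in>U. \<exists>g\<in>poly_funs A. \<exists>h\<in>poly_funs A.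
                     h p \<noteq> 0 \<and> (\<forall>q\<in>U. h q \<noteq> 0 \<longrightarrow> f q = g q / h q)})\<rparr>"

definition quotient_variety :: "('p \<Rightarrow> 'q) \<Rightarrow> 'p variety \<Rightarrow> 'q variety" where
  "quotient_variety \<pi> X = \<lparr>
     zar = topology (\<lambda>V. V \<subseteq> \<pi> ` topspace (zar X) \<and>
                         openin (zar X) {p \<in> topspace (zar X). \<pi> p \<in> V}),
     reg = (\<lambda>V. {f. f \<circ> \<pi> \<in> reg X {p \<in> topspace (zar X). \<pi> p \<in> V}})\<rparr>"

text \<open>Reduced locally closed subvarieties.\<close>

definition subvariety :: "'p variety \<Rightarrow> 'p set \<Rightarrow> 'p variety" where
  "subvariety X Z = \<lparr>
     zar = subtopology (zar X) Z,
     reg = (\<lambda>V. {f. \<forall>p\<in>V. \<exists>U g. openin (zar X) U \<and> p \<in> U \<and> g \<in> reg X U \<and>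
                     (\<forall>q\<in>U \<inter> V. f q = g q)})\<rparr>"

definition variety_iso :: "('p \<Rightarrow> 'q) \<Rightarrow> 'p variety \<Rightarrow> 'q variety \<Rightarrow> bool" where
  "variety_iso \<phi> X Y \<longleftrightarrow>
     homeomorphic_map (zar X) (zar Y) \<phi> \<and>
     (\<forall>V f. openin (zar Y) V \<longrightarrow>
        (f \<in> reg Y V \<longleftrightarrow> f \<circ> \<phi> \<in> reg X {p \<in> topspace (zar X). \<phi> p \<in> V}))"

lemma topspace_coord_variety: "topspace (zar (coord_variety X A)) = X"
proof -
  have "X \<in> {{p \<in> X. h p \<noteq> 0} | h. h \<in> poly_funs A}"
    by (intro CollectI exI[of _ "\<lambda>_. 1"]) (simp add: poly_funs.const)
  then have "\<Union>{{p \<in> X. h p \<noteq> 0} | h. h \<in> poly_funs A} = X"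
    by blast
  then show ?thesis
    unfolding coord_variety_def variety.simps topology_generated_by_topspace .
qed

lemma openin_quotient_variety:
  "openin (zar (quotient_variety \<pi> X)) V \<longleftrightarrow>
     V \<subseteq> \<pi> ` topspace (zar X) \<and> openin (zar X) {p \<in> topspace (zar X). \<pi> p \<in> V}"
proof -
  have "istopology (\<lambda>V. V \<subseteq> \<pi> ` topspace (zar X) \<and>
                        openin (zar X) {p \<in> topspace (zar X). \<pi> p \<in> V})"
    unfolding istopology_def
  proof (intro conjI allI impI)
    fix S T
    assume a: "S \<subseteq> \<pi> ` topspace (zar X) \<and> openin (zar X) {p \<in> topspace (zar X). \<pi> p \<in> S}"
      and b: "T \<subseteq> \<pi> ` topspace (zar X) \<and> openin (zar X) {p \<in> topspace (zar X). \<pi> p \<in> T}"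
    show "S \<inter> T \<subseteq> \<pi> ` topspace (zar X)" using a by blast
    have "{p \<in> topspace (zar X). \<pi> p \<in> S \<inter> T} =
          {p \<in> topspace (zar X). \<pi> p \<in> S} \<inter> {p \<in> topspace (zar X). \<pi> p \<in> T}" by blast
    then show "openin (zar X) {p \<in> topspace (zar X). \<pi> p \<in> S \<inter> T}"
      using a b by (simp add: openin_Int)
  next
    fix \<K>
    assume a: "\<forall>K\<in>\<K>. K \<subseteq> \<pi> ` topspace (zar X) \<and> openin (zar X) {p \<in> topspace (zar X). \<pi> p \<in> K}"
    show "\<Union>\<K> \<subseteq> \<pi> ` topspace (zar X)" using a by blast
    have "{p \<in> topspace (zar X). \<pi> p \<in> \<Union>\<K>} = \<Union>((\<lambda>K. {p \<in> topspace (zar X). \<pi> p \<in> K}) ` \<K>)"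
      by blast
    then show "openin (zar X) {p \<in> topspace (zar X). \<pi> p \<in> \<Union>\<K>}"
      using a by (metis (no_types, lifting) imageE openin_Union)
  qed
  then show ?thesis
    unfolding quotient_variety_def by simp
qed

section \<open>The Picard side\<close>

text \<open>
  The type \<^typ>\<open>complex fls\<close> is used both for the field of Laurent series in the uniformizer
  \<open>\<varpi>\<close> (then \<^term>\<open>fls_X\<close> is \<open>\<varpi>\<close>) and for the field of Laurent series in
  \<open>x = \<varpi>^n\<close> (then \<^term>\<open>fls_X\<close> is \<open>x\<close>).  Both rings of power series are \<open>pow_ser\<close>.
\<close>

definition pow_ser :: "complex fls set" where
  "pow_ser = range fps_to_fls"

definition shift_set :: "int \<Rightarrow> complex fls set \<Rightarrow> complex fls set" where
  "shift_set k A = (\<lambda>f. fls_X_intpow k * f) ` A"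

text \<open>The image of power series in two variables under \<open>u \<mapsto> \<varpi>^n, v \<mapsto> \<varpi>^d\<close>.\<close>

definition curve_ring :: "nat \<Rightarrow> nat \<Rightarrow> complex fls set" where
  "curve_ring n d =
     {f. \<exists>c :: nat \<Rightarrow> nat \<Rightarrow> complex. \<forall>k.
           fls_nth f k = (\<Sum>(i, j)\<in>{(i, j). int (n * i + d * j) = k}. c i j)}"

text \<open>The submodule generated by \<open>X\<close> over the subring \<open>A\<close>.\<close>

definition lin_span :: "complex fls set \<Rightarrow> complex fls set \<Rightarrow> complex fls set" where
  "lin_span A X = {(\<Sum>t\<in>T. a t * t) | T a. finite T \<and> T \<subseteq> X \<and> a ` T \<subseteq> A}"

text \<open>Complex dimension of \<open>V / W\<close>, for complex subspaces \<open>W \<subseteq> V\<close> of finite relative codimension.\<close>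

definition quot_basis :: "complex fls set \<Rightarrow> complex fls set \<Rightarrow> complex fls set \<Rightarrow> bool" where
  "quot_basis V W T \<longleftrightarrow> finite T \<and> T \<subseteq> V \<and>
     (\<forall>f\<in>V. \<exists>!c. c \<in> T \<rightarrow>\<^sub>E (UNIV :: complex set) \<and> f - (\<Sum>t\<in>T. fls_const (c t) * t) \<in> W)"

definition quot_dim :: "complex fls set \<Rightarrow> complex fls set \<Rightarrow> nat" where
  "quot_dim V W = card (SOME T. quot_basis V W T)"

definition delta :: "nat \<Rightarrow> nat \<Rightarrow> nat" where
  "delta n d = quot_dim pow_ser (curve_ring n d)"

definition Jbar :: "nat \<Rightarrow> nat \<Rightarrow> complex fls set set" where
  "Jbar n d = {M.
     (\<exists>T. finite T \<and> M = lin_span (curve_ring n d) T) \<and>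
     lin_span UNIV M = UNIV \<and>
     (\<forall>\<^sub>F i in at_top. M \<subseteq> shift_set (- int i) pow_ser \<and>
        quot_dim (shift_set (- int i) pow_ser) M =
        quot_dim (shift_set (- int i) pow_ser) (curve_ring n d))}"

text \<open>
  A complete flag on \<open>M / xM\<close> is given by the preimages
  \<open>xM = F ! 0 \<subset> F ! 1 \<subset> \<dots> \<subset> F ! n = M\<close> of its members.
\<close>

definition is_flag :: "nat \<Rightarrow> nat \<Rightarrow> complex fls set \<Rightarrow> complex fls set list \<Rightarrow> bool" where
  "is_flag n d M F \<longleftrightarrow>
     length F = Suc n \<and> F ! 0 = shift_set (int n) M \<and> F ! n = M \<and>
     (\<forall>j<n. F ! j \<subseteq> F ! Suc j) \<and>
     (\<forall>j\<le>n. lin_span (range fls_const) (F ! j) = F ! j \<and>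
             quot_dim (F ! j) (shift_set (int n) M) = j \<and>
             shift_set (int d) (F ! j) \<subseteq> F ! j)"

type_synonym flagged = "complex fls set \<times> complex fls set list"

definition Jflag :: "nat \<Rightarrow> nat \<Rightarrow> flagged set" where
  "Jflag n d = {(M, F). M \<in> Jbar n d \<and> is_flag n d M F}"

definition gap :: "complex fls set \<Rightarrow> nat" where
  "gap M = quot_dim (lin_span pow_ser M) M"

definition Jflag_le :: "nat \<Rightarrow> nat \<Rightarrow> int \<Rightarrow> flagged set" where
  "Jflag_le n d c = {(M, F) \<in> Jflag n d. int (gap M) \<le> c}"

text \<open>
  Every \<open>M\<close> in \<open>Jbar n d\<close> satisfies \<open>\<varpi>^(2 \<delta>) S \<subseteq> M \<subseteq> S\<close> with \<open>M\<close> of codimension \<open>\<delta>\<close> in \<open>S\<close>.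
  So \<open>Jflag n d\<close> is a closed set of points of the variety of partial flags with dimensions
  \<open>\<delta>, \<delta> + 1, \<dots>, \<delta> + n\<close> in \<open>S / \<varpi>^(n + 2 \<delta>) S\<close>.  That flag variety is the quotient, by a parabolic
  subgroup, of the space of linearly independent tuples of \<open>\<delta> + n\<close> vectors: a tuple represents the
  flag of spans of its first \<open>\<delta> + j\<close> members.  Tuples are the matrices of their coordinates in the
  basis \<open>1, \<varpi>, \<varpi>^2, \<dots>\<close>; the members of the flag are replaced by their preimages in \<open>S\<close>.
\<close>

definition frame_span :: "nat \<Rightarrow> complex mat \<Rightarrow> complex fls set" where
  "frame_span m b =
     {(\<Sum>i<m. fls_const (c i) * (\<Sum>j<dim_col b. fls_const (b $$ (i, j)) * fls_X ^ j)) + f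
       | c f. f \<in> shift_set (int (dim_col b)) pow_ser}"

definition frame_flag :: "nat \<Rightarrow> nat \<Rightarrow> complex mat \<Rightarrow> flagged" where
  "frame_flag n d b =
     (frame_span (delta n d + n) b, map (\<lambda>j. frame_span (delta n d + j) b) [0..<Suc n])"

definition frames :: "nat \<Rightarrow> nat \<Rightarrow> complex mat set" where
  "frames n d = {b \<in> carrier_mat (delta n d + n) (n + 2 * delta n d).
     (\<forall>c. (\<forall>j<dim_col b. (\<Sum>i<dim_row b. c i * b $$ (i, j)) = 0) \<longrightarrow> (\<forall>i<dim_row b. c i = 0)) \<and>
     frame_flag n d b \<in> Jflag n d}"

definition Jflag_variety :: "nat \<Rightarrow> nat \<Rightarrow> flagged variety" where
  "Jflag_variety n d = quotient_variety (frame_flag n d)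
     (coord_variety (frames n d)
        {(\<lambda>b. b $$ (i, j)) | i j. i < delta n d + n \<and> j < n + 2 * delta n d})"

section \<open>The affine Springer fiber\<close>

text \<open>Rows, columns and the entries of \<open>\<mu>\<close> are numbered from \<open>0\<close>.\<close>

type_synonym loop_mat = "complex fls mat"

definition loopGL :: "nat \<Rightarrow> loop_mat monoid" where
  "loopGL n = units_of (ring_mat TYPE(complex fls) n ())"

definition arcGL :: "nat \<Rightarrow> loop_mat set" where
  "arcGL n = {g \<in> carrier (loopGL n).
     \<forall>i<n. \<forall>j<n. g $$ (i, j) \<in> pow_ser \<and> (m_inv (loopGL n) g) $$ (i, j) \<in> pow_ser}"

definition iwahori :: "nat \<Rightarrow> loop_mat set" where
  "iwahori n = {g \<in> arcGL n. \<forall>i<n. \<forall>j<i. fls_nth (g $$ (i, j)) 0 = 0}"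

definition lie_arcGL :: "nat \<Rightarrow> loop_mat set" where
  "lie_arcGL n = {A \<in> carrier_mat n n. \<forall>i<n. \<forall>j<n. A $$ (i, j) \<in> pow_ser}"

definition lie_iwahori :: "nat \<Rightarrow> loop_mat set" where
  "lie_iwahori n = {A \<in> lie_arcGL n. \<forall>i<n. \<forall>j<i. fls_nth (A $$ (i, j)) 0 = 0}"

definition diag_unit :: "nat \<Rightarrow> int \<Rightarrow> loop_mat" where
  "diag_unit n k = mat n n (\<lambda>(i, j). if int j = int i + k then 1 else 0)"

definition psi :: "nat \<Rightarrow> nat \<Rightarrow> loop_mat" where
  "psi n d = (let m = d div n; r = d mod n in
     (fls_X ^ m) \<cdot>\<^sub>m diag_unit n (int r) + (fls_X ^ (m + 1)) \<cdot>\<^sub>m diag_unit n (int r - int n))"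

definition adj_inv :: "nat \<Rightarrow> loop_mat \<Rightarrow> loop_mat \<Rightarrow> loop_mat" where
  "adj_inv n g A = m_inv (loopGL n) g * A * g"

definition springer_gr :: "nat \<Rightarrow> nat \<Rightarrow> loop_mat set set" where
  "springer_gr n d = {g <#\<^bsub>loopGL n\<^esub> arcGL n | g.
     g \<in> carrier (loopGL n) \<and> adj_inv n g (psi n d) \<in> lie_arcGL n}"

definition springer_fl :: "nat \<Rightarrow> nat \<Rightarrow> loop_mat set set" where
  "springer_fl n d = {g <#\<^bsub>loopGL n\<^esub> iwahori n | g.
     g \<in> carrier (loopGL n) \<and> adj_inv n g (psi n d) \<in> lie_iwahori n}"

section \<open>The maps\<close>

definition ab :: "nat \<Rightarrow> complex fls vec \<Rightarrow> complex fls" where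
  "ab n v = (\<Sum>i<n. fls_compose_power (vec_index v i) n * fls_X ^ i)"

text \<open>
  For a set \<open>L\<close> of row vectors, \<open>\<varpi>^\<delta> ab (L g\<^sup>-\<^sup>1)\<close>; row vectors act through the transposed matrix.
\<close>

definition row_image :: "nat \<Rightarrow> nat \<Rightarrow> loop_mat \<Rightarrow> complex fls vec set \<Rightarrow> complex fls set" where
  "row_image n d g L = (\<lambda>v. fls_X ^ delta n d *
     ab n (transpose_mat (m_inv (loopGL n) g) *\<^sub>v v)) ` L"

definition std_lattice :: "nat \<Rightarrow> complex fls vec set" where
  "std_lattice n = {v \<in> carrier_vec n. \<forall>i<n. vec_index v i \<in> pow_ser}"

text \<open>
  The preimage in the standard lattice of the \<open>j\<close>-dimensional member of the standard flag, which is
  spanned by the last \<open>j\<close> standard basis vectors.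
\<close>

definition std_flag :: "nat \<Rightarrow> nat \<Rightarrow> complex fls vec set" where
  "std_flag n j = {v \<in> std_lattice n. \<forall>i<n - j. fls_nth (vec_index v i) 0 = 0}"

definition Phi_rep :: "nat \<Rightarrow> nat \<Rightarrow> loop_mat \<Rightarrow> flagged" where
  "Phi_rep n d g =
     (row_image n d g (std_lattice n), map (\<lambda>j. row_image n d g (std_flag n j)) [0..<Suc n])"

text \<open>\<^term>\<open>Phi_rep n d\<close> is constant on cosets, so \<^const>\<open>the_elem\<close> is applied to singletons.\<close>

definition Phi :: "nat \<Rightarrow> nat \<Rightarrow> loop_mat set \<Rightarrow> flagged" where
  "Phi n d C = the_elem (Phi_rep n d ` C)"

definition Phi_gr :: "nat \<Rightarrow> nat \<Rightarrow> loop_mat set \<Rightarrow> complex fls set" where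
  "Phi_gr n d C = the_elem ((\<lambda>g. row_image n d g (std_lattice n)) ` C)"

definition springer_gr0 :: "nat \<Rightarrow> nat \<Rightarrow> loop_mat set set" where
  "springer_gr0 n d = {C \<in> springer_gr n d. Phi_gr n d C \<in> Jbar n d}"

definition springer_fl0 :: "nat \<Rightarrow> nat \<Rightarrow> loop_mat set set" where
  "springer_fl0 n d = {C \<in> springer_fl n d. Phi n d C \<in> Jflag n d}"

text \<open>
  The loop group has the coefficients of the entries of \<open>g\<close> and of \<open>g\<^sup>-\<^sup>1\<close> as coordinates, and the
  affine flag variety is its quotient.
\<close>

definition loop_coords :: "nat \<Rightarrow> (loop_mat \<Rightarrow> complex) set" where
  "loop_coords n =
     {(\<lambda>g. fls_nth (g $$ (i, j)) k) | i j k. i < n \<and> j < n} \<union>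
     {(\<lambda>g. fls_nth ((m_inv (loopGL n) g) $$ (i, j)) k) | i j k. i < n \<and> j < n}"

definition springer_fl0_variety :: "nat \<Rightarrow> nat \<Rightarrow> loop_mat set variety" where
  "springer_fl0_variety n d = quotient_variety (\<lambda>g. g <#\<^bsub>loopGL n\<^esub> iwahori n)
     (coord_variety (\<Union>(springer_fl0 n d)) (loop_coords n))"

definition iota_mat :: "nat \<Rightarrow> loop_mat \<Rightarrow> loop_mat" where
  "iota_mat n g = (let J = mat n n (\<lambda>(i, j). if i + j + 1 = n then 1 else 0) in
     J * m_inv (loopGL n) (transpose_mat g) * J)"

definition iota :: "nat \<Rightarrow> loop_mat set \<Rightarrow> loop_mat set" where
  "iota n C = iota_mat n ` C"

section \<open>The Hikita filtration\<close>

definition cochars0 :: "nat \<Rightarrow> int list set" where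
  "cochars0 n = {\<mu>. length \<mu> = n \<and> sum_list \<mu> = 0}"

definition x_pow :: "int list \<Rightarrow> loop_mat" where
  "x_pow \<mu> = mat (length \<mu>) (length \<mu>) (\<lambda>(i, j). if i = j then fls_X_intpow (\<mu> ! i) else 0)"

definition schubert_cell :: "nat \<Rightarrow> int list \<Rightarrow> loop_mat set set" where
  "schubert_cell n \<mu> = {(b * x_pow \<mu>) <#\<^bsub>loopGL n\<^esub> arcGL n | b. b \<in> iwahori n}"

definition hikita_a :: "int list \<Rightarrow> int list" where
  "hikita_a \<mu> = (let n = length \<mu> in
     if \<forall>i<n. \<mu> ! i = 0 then replicate (n - 1) 0
     else (let k = (GREATEST k. k < n \<and> \<mu> ! k = Min (set \<mu>)) in
       map (\<lambda>i. \<mu> ! i - \<mu> ! k - 1) [Suc k..<n] @ map (\<lambda>i. \<mu> ! i - \<mu> ! k) [0..<k]))"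

text \<open>The projection of \<open>g I\<close> to the affine Grassmannian is \<open>g K = (g I) K\<close>.\<close>

definition springer_fl0_le :: "nat \<Rightarrow> nat \<Rightarrow> int \<Rightarrow> loop_mat set set" where
  "springer_fl0_le n d c = {C \<in> springer_fl0 n d.
     C <#>\<^bsub>loopGL n\<^esub> arcGL n \<in> springer_gr0 n d \<inter>
       (\<Union>\<mu>\<in>{\<mu> \<in> cochars0 n. sum_list (hikita_a \<mu>) \<le> c}. schubert_cell n \<mu>)}"

end

theory Submission
  imports Defs "Jordan_Normal_Form.Determinant" "HOL-Number_Theory.Cong"
begin

text \<open>
  Through \<open>ab\<close> the loop group acts on the right on \<open>K = C((\<varpi>))\<close>; the Iwahori subgroup is the
  stabilizer of all \<open>\<varpi>^k S\<close>, and \<open>\<psi>(d)\<close> acts as multiplication by \<open>\<varpi>^d\<close>.  Relative dimensions of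
  lattices in \<open>K\<close> are counted by sets of degrees.  Choosing elements of minimal degree in each residue
  class modulo \<open>n\<close> gives the decomposition \<open>g = b x^\<mu> k\<close>, from which the index of the lattice of \<open>g\<close>
  is \<open>- |\<mu>|\<close>.  For the lattice \<open>M\<close> of \<open>\<iota>(g)\<close>, \<open>S M\<close> is generated in degree
  \<open>\<delta> + min (n \<mu>_i + n - i)\<close> with \<open>i\<close> counted from \<open>1\<close>, so the gap of \<open>M\<close> is the negative of this
  minimum; the minimum is attained at the last \<open>i\<close> for which \<open>\<mu>_i\<close> is minimal, and it is \<open>- |a(\<mu>)|\<close>.

  For the isomorphism of varieties it suffices that \<open>\<Phi>\<close> lifts locally, in both directions, to maps
  between matrices and frames with rational coordinates.  From matrices to frames, a fixed choice of
  generators works where a minor does not vanish.  From frames to matrices, the last \<open>n\<close> vectors of the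
  frame are the rows of \<open>g\<^sup>-\<^sup>1\<close>, and the entries of \<open>g\<close> are rational because \<open>det g\<close> has valuation \<open>0\<close>.
\<close>

section \<open>Isomorphisms of quotient varieties from local lifts\<close>

text \<open>Degrees carry all the information because each subspace in play lies between two
  lattices \<varpi>^b S and \<varpi>^a S: leading terms can then be cancelled one by one in finitely
  many steps, so an inclusion of subspaces with equal degree sets is an equality. The Iwahori
  subgroup preserves degrees, so the cell of g is visible in its lattice. There are two inversions,
  in M_g and in \<iota>, and they cancel: \<iota> replaces \<mu> by its reversed negative, and the
  degrees of the lattice of \<iota>(g) start at \<mu> itself, read backwards. The reversal is what
  puts the last of several minimal entries in the lowest degree; the closed form of |a(\<mu>)| uses
  that \<mu> sums to 0. On the geometric side the loop group has infinitely many coordinates and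
  unbounded poles. Coordinates of lifts stay rational because M contains \<varpi>^(2 \<delta>) S, so
  that a frame depends on finitely many coefficients of g^-1, and because a determinant of valuation
  0 has its leading coefficient in a fixed place, where it can be inverted.\<close>

definition rational_on :: "'p set \<Rightarrow> ('p \<Rightarrow> complex) set \<Rightarrow> ('p \<Rightarrow> complex) \<Rightarrow> bool" where
  "rational_on U A f \<longleftrightarrow>
     (\<exists>g\<in>poly_funs A. \<exists>h\<in>poly_funs A. \<forall>p\<in>U. h p \<noteq> 0 \<and> f p = g p / h p)"

section \<open>Closure properties of fractions of polynomial functions\<close>

lemma rational_onI:
  assumes "g \<in> poly_funs A" "h \<in> poly_funs A" "\<And>p. p \<in> U \<Longrightarrow> h p \<noteq> 0 \<and> f p = g p / h p"
  shows "rational_on U A f"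
  using assms unfolding rational_on_def by blast

lemma rational_on_cong: "(\<And>p. p \<in> U \<Longrightarrow> f p = g p) \<Longrightarrow> rational_on U A f = rational_on U A g"
  unfolding rational_on_def by simp

lemma rational_on_poly: "f \<in> poly_funs A \<Longrightarrow> rational_on U A f"
  by (rule rational_onI[of f A "\<lambda>_. 1"]) (auto intro: poly_funs.const)

lemma rational_on_const: "rational_on U A (\<lambda>_. c)"
  by (rule rational_on_poly[OF poly_funs.const])

lemma rational_on_gen: "f \<in> A \<Longrightarrow> rational_on U A f"
  by (rule rational_on_poly[OF poly_funs.gen])

lemma rational_on_add:
  assumes "rational_on U A f" "rational_on U A g"
  shows "rational_on U A (\<lambda>p. f p + g p)"
proof -
  obtain a b where ab: "a \<in> poly_funs A" "b \<in> poly_funs A" "\<forall>p\<in>U. b p \<noteq> 0 \<and> f p = a p / b p"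
    using assms(1) unfolding rational_on_def by blast
  obtain c d where cd: "c \<in> poly_funs A" "d \<in> poly_funs A" "\<forall>p\<in>U. d p \<noteq> 0 \<and> g p = c p / d p"
    using assms(2) unfolding rational_on_def by blast
  show ?thesis
    by (rule rational_onI[of "\<lambda>p. a p * d p + c p * b p" _ "\<lambda>p. b p * d p"])
      (use ab cd in \<open>auto intro!: poly_funs.add poly_funs.mult simp: field_simps\<close>)
qed

lemma rational_on_mult:
  assumes "rational_on U A f" "rational_on U A g"
  shows "rational_on U A (\<lambda>p. f p * g p)"
proof -
  obtain a b where ab: "a \<in> poly_funs A" "b \<in> poly_funs A" "\<forall>p\<in>U. b p \<noteq> 0 \<and> f p = a p / b p"
    using assms(1) unfolding rational_on_def by blast
  obtain c d where cd: "c \<in> poly_funs A" "d \<in> poly_funs A" "\<forall>p\<in>U. d p \<noteq> 0 \<and> g p = c p / d p"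
    using assms(2) unfolding rational_on_def by blast
  show ?thesis
    by (rule rational_onI[of "\<lambda>p. a p * c p" _ "\<lambda>p. b p * d p"])
      (use ab cd in \<open>auto intro!: poly_funs.mult\<close>)
qed

lemma rational_on_inverse:
  assumes "rational_on U A f" "\<And>p. p \<in> U \<Longrightarrow> f p \<noteq> 0"
  shows "rational_on U A (\<lambda>p. inverse (f p))"
proof -
  obtain a b where ab: "a \<in> poly_funs A" "b \<in> poly_funs A" "\<forall>p\<in>U. b p \<noteq> 0 \<and> f p = a p / b p"
    using assms(1) unfolding rational_on_def by blast
  show ?thesis
    by (rule rational_onI[of b _ a]) (use ab assms(2) in auto)
qed

lemma rational_on_sum:
  "(\<And>i. i \<in> I \<Longrightarrow> rational_on U A (f i)) \<Longrightarrow> rational_on U A (\<lambda>p. \<Sum>i\<in>I. f i p)"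
  by (induction I rule: infinite_finite_induct) (auto intro: rational_on_const rational_on_add)

lemma poly_funs_sum:
  "(\<And>i. i \<in> I \<Longrightarrow> f i \<in> poly_funs A) \<Longrightarrow> (\<lambda>p. \<Sum>i\<in>I. f i p) \<in> poly_funs A"
  by (induction I rule: infinite_finite_induct) (auto intro: poly_funs.const poly_funs.add)

lemma poly_funs_prod:
  "(\<And>i. i \<in> I \<Longrightarrow> f i \<in> poly_funs A) \<Longrightarrow> (\<lambda>p. \<Prod>i\<in>I. f i p) \<in> poly_funs A"
  by (induction I rule: infinite_finite_induct) (auto intro: poly_funs.const poly_funs.mult)

text \<open>Fractions with a common domain are closed under the operations that build polynomials.
  Hence only the coordinates of a lift have to be examined.\<close>

lemma rational_on_compose:
  assumes "k \<in> poly_funs B" "\<And>\<beta>. \<beta> \<in> B \<Longrightarrow> rational_on U A (\<beta> \<circ> s)"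
  shows "rational_on U A (k \<circ> s)"
  using assms(1)
  by induction (auto simp: o_def intro: rational_on_const rational_on_add rational_on_mult
      assms(2)[unfolded o_def])

text \<open>Sets where one polynomial does not vanish are closed under finite intersections, by
  taking products, so they form a base and not merely a subbase of the topology.\<close>

lemma openin_coord_variety:
  "openin (zar (coord_variety X A)) U \<longleftrightarrow>
     U \<subseteq> X \<and> (\<forall>p\<in>U. \<exists>h\<in>poly_funs A. h p \<noteq> 0 \<and> {q \<in> X. h q \<noteq> 0} \<subseteq> U)" (is "_ \<longleftrightarrow> ?R U")
proof
  let ?B = "{{p \<in> X. h p \<noteq> 0} | h. h \<in> poly_funs A}"
  assume "openin (zar (coord_variety X A)) U"
  then have "generate_topology_on ?B U"
    by (simp add: coord_variety_def openin_topology_generated_by_iff)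
  then show "?R U"
  proof induction
    case Empty
    show ?case by simp
  next
    case (Int a b)
    show ?case
    proof (intro conjI ballI)
      show "a \<inter> b \<subseteq> X" using Int.IH(1) by blast
      fix p assume p: "p \<in> a \<inter> b"
      obtain h where h: "h \<in> poly_funs A" "h p \<noteq> 0" "{q \<in> X. h q \<noteq> 0} \<subseteq> a"
        using Int.IH(1) p by blast
      obtain k where k: "k \<in> poly_funs A" "k p \<noteq> 0" "{q \<in> X. k q \<noteq> 0} \<subseteq> b"
        using Int.IH(2) p by blast
      show "\<exists>h\<in>poly_funs A. h p \<noteq> 0 \<and> {q \<in> X. h q \<noteq> 0} \<subseteq> a \<inter> b"
        by (rule bexI[of _ "\<lambda>p. h p * k p"]) (use h k in \<open>auto intro: poly_funs.mult\<close>)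
    qed
  next
    case (UN K)
    show ?case
    proof (intro conjI ballI)
      show "\<Union>K \<subseteq> X" using UN.IH by blast
      fix p assume "p \<in> \<Union>K"
      then obtain k where "k \<in> K" "p \<in> k" by blast
      then show "\<exists>h\<in>poly_funs A. h p \<noteq> 0 \<and> {q \<in> X. h q \<noteq> 0} \<subseteq> \<Union>K" using UN.IH[of k] by blast
    qed
  next
    case (Basis U)
    then obtain h where "h \<in> poly_funs A" "U = {q \<in> X. h q \<noteq> 0}" by blast
    then show ?case by blast
  qed
next
  assume R: "?R U"
  have "openin (zar (coord_variety X A)) {q \<in> X. h q \<noteq> 0}" if "h \<in> poly_funs A" for h
    unfolding coord_variety_def variety.simps
    by (rule topology_generated_by_Basis) (use that in blast)
  note basic = this
  have "\<exists>V. openin (zar (coord_variety X A)) V \<and> p \<in> V \<and> V \<subseteq> U" if p: "p \<in> U" for p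
  proof -
    obtain h where h: "h \<in> poly_funs A" "h p \<noteq> 0" "{q \<in> X. h q \<noteq> 0} \<subseteq> U" using R p by blast
    moreover have "p \<in> X" using R p by blast
    ultimately show ?thesis using basic[OF h(1)] by blast
  qed
  then show "openin (zar (coord_variety X A)) U" by (subst openin_subopen) blast
qed

text \<open>\<open>\<rho>\<close> and \<open>\<sigma>\<close> map to a common set, and
  \<open>s\<close> solves \<open>\<sigma> \<circ> s = \<rho>\<close> near \<open>p\<close>, with
  coordinates that are single fractions on a whole basic open set. Two such families, one each way,
  replace a comparison of the two quotient constructions.\<close>

definition local_lifts ::
    "('p \<Rightarrow> 'r) \<Rightarrow> 'p set \<Rightarrow> ('p \<Rightarrow> complex) set \<Rightarrow> ('q \<Rightarrow> 'r) \<Rightarrow> 'q set \<Rightarrow> ('q \<Rightarrow> complex) set \<Rightarrow> bool"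
  where "local_lifts \<rho> X A \<sigma> Y B \<longleftrightarrow>
     (\<forall>p\<in>X. \<exists>h\<in>poly_funs A. \<exists>s. h p \<noteq> 0 \<and>
        (\<forall>q\<in>X. h q \<noteq> 0 \<longrightarrow> s q \<in> Y \<and> \<sigma> (s q) = \<rho> q) \<and>
        (\<forall>\<beta>\<in>B. rational_on {q \<in> X. h q \<noteq> 0} A (\<beta> \<circ> s)))"

lemma local_lifts_image: "local_lifts \<rho> X A \<sigma> Y B \<Longrightarrow> \<rho> ` X \<subseteq> \<sigma> ` Y"
  unfolding local_lifts_def by force

lemma local_lifts_open:
  assumes L: "local_lifts \<rho> X A \<sigma> Y B"
    and op: "openin (zar (coord_variety Y B)) {y \<in> Y. \<sigma> y \<in> V}"
  shows "openin (zar (coord_variety X A)) {x \<in> X. \<rho> x \<in> V}"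
  unfolding openin_coord_variety
proof (intro conjI ballI)
  fix p assume p: "p \<in> {x \<in> X. \<rho> x \<in> V}"
  then obtain h s where h: "h \<in> poly_funs A" "h p \<noteq> 0"
    and s: "\<And>q. q \<in> X \<Longrightarrow> h q \<noteq> 0 \<Longrightarrow> s q \<in> Y \<and> \<sigma> (s q) = \<rho> q"
    and r: "\<And>\<beta>. \<beta> \<in> B \<Longrightarrow> rational_on {q \<in> X. h q \<noteq> 0} A (\<beta> \<circ> s)"
    using L unfolding local_lifts_def by blast
  obtain k where k: "k \<in> poly_funs B" "k (s p) \<noteq> 0" "{q \<in> Y. k q \<noteq> 0} \<subseteq> {y \<in> Y. \<sigma> y \<in> V}"
    using op s[of p] h p unfolding openin_coord_variety by force
  obtain G H where G: "G \<in> poly_funs A" "H \<in> poly_funs A"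
      "\<And>q. q \<in> X \<Longrightarrow> h q \<noteq> 0 \<Longrightarrow> H q \<noteq> 0 \<and> k (s q) = G q / H q"
    using rational_on_compose[OF k(1) r] unfolding rational_on_def by auto
  show "\<exists>h\<in>poly_funs A. h p \<noteq> 0 \<and> {q \<in> X. h q \<noteq> 0} \<subseteq> {x \<in> X. \<rho> x \<in> V}"
  \<comment> \<open>Where \<open>h\<close> does not vanish, \<open>k \<circ> s\<close> is the
    fraction \<open>G / H\<close>, so the product of \<open>h\<close> and \<open>G\<close> cuts out
    the points at which the lift exists and lands in the basic open set of \<open>k\<close>.\<close>
  proof (intro bexI[of _ "\<lambda>q. h q * G q"] conjI subsetI)
    show "h p * G p \<noteq> 0" using h k(2) G(3)[of p] p by auto
    fix q assume "q \<in> {q \<in> X. h q * G q \<noteq> 0}"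
    then have q: "q \<in> X" "h q \<noteq> 0" "k (s q) \<noteq> 0" using G(3)[of q] by auto
    then have "s q \<in> {q \<in> Y. k q \<noteq> 0}" using s[of q] by auto
    then show "q \<in> {x \<in> X. \<rho> x \<in> V}" using k(3) s[of q] q by auto
  qed (rule poly_funs.mult[OF h(1) G(1)])
qed auto

lemma local_lifts_reg:
  assumes L: "local_lifts \<rho> X A \<sigma> Y B"
    and f: "f \<circ> \<sigma> \<in> reg (coord_variety Y B) {y \<in> Y. \<sigma> y \<in> V}"
  shows "f \<circ> \<rho> \<in> reg (coord_variety X A) {x \<in> X. \<rho> x \<in> V}"
proof -
  have "\<exists>g\<in>poly_funs A. \<exists>h\<in>poly_funs A. h p \<noteq> 0 \<and>
      (\<forall>q\<in>{x \<in> X. \<rho> x \<in> V}. h q \<noteq> 0 \<longrightarrow> (f \<circ> \<rho>) q = g q / h q)" if p: "p \<in> {x \<in> X. \<rho> x \<in> V}" for p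
  proof -
    obtain h s where h: "h \<in> poly_funs A" "h p \<noteq> 0"
      and s: "\<And>q. q \<in> X \<Longrightarrow> h q \<noteq> 0 \<Longrightarrow> s q \<in> Y \<and> \<sigma> (s q) = \<rho> q"
      and r: "\<And>\<beta>. \<beta> \<in> B \<Longrightarrow> rational_on {q \<in> X. h q \<noteq> 0} A (\<beta> \<circ> s)"
      using L p unfolding local_lifts_def by blast
    have "s p \<in> {y \<in> Y. \<sigma> y \<in> V}" using s[of p] p h by auto
    then obtain g k where k: "g \<in> poly_funs B" "k \<in> poly_funs B" "k (s p) \<noteq> 0"
      "\<And>q. q \<in> Y \<Longrightarrow> \<sigma> q \<in> V \<Longrightarrow> k q \<noteq> 0 \<Longrightarrow> f (\<sigma> q) = g q / k q"
      using f unfolding coord_variety_def variety.simps by fastforce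
    obtain G H where G: "G \<in> poly_funs A" "H \<in> poly_funs A"
      "\<And>q. q \<in> X \<Longrightarrow> h q \<noteq> 0 \<Longrightarrow> H q \<noteq> 0 \<and> k (s q) = G q / H q"
      using rational_on_compose[OF k(2) r] unfolding rational_on_def by auto
    obtain G' H' where G': "G' \<in> poly_funs A" "H' \<in> poly_funs A"
      "\<And>q. q \<in> X \<Longrightarrow> h q \<noteq> 0 \<Longrightarrow> H' q \<noteq> 0 \<and> g (s q) = G' q / H' q"
      using rational_on_compose[OF k(1) r] unfolding rational_on_def by auto
    show ?thesis
    \<comment> \<open>The quotient of \<open>G' / H'\<close> by \<open>G / H\<close>, expanded by
      \<open>h\<close>: this factor makes the denominator vanish wherever \<open>s\<close> need not
      be a lift, so the identity is only tested on the domain of \<open>s\<close>.\<close>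
    proof (rule bexI[of _ "\<lambda>q. h q * (G' q * H q)"], rule bexI[of _ "\<lambda>q. h q * (H' q * G q)"],
        intro conjI ballI impI)
      show "h p * (H' p * G p) \<noteq> 0" using h k(3) G(3)[of p] G'(3)[of p] p by auto
      fix q assume q: "q \<in> {x \<in> X. \<rho> x \<in> V}" "h q * (H' q * G q) \<noteq> 0"
      then have "k (s q) \<noteq> 0" using G(3)[of q] by auto
      then have "f (\<rho> q) = g (s q) / k (s q)" using k(4)[of "s q"] s[of q] q by auto
      also have "\<dots> = (G' q / H' q) / (G q / H q)" using G(3)[of q] G'(3)[of q] q by auto
      also have "\<dots> = h q * (G' q * H q) / (h q * (H' q * G q))" using q by simp
      finally show "(f \<circ> \<rho>) q = h q * (G' q * H q) / (h q * (H' q * G q))" by simp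
    qed (rule poly_funs.mult[OF h(1) poly_funs.mult[OF G'(2) G(1)]]
        poly_funs.mult[OF h(1) poly_funs.mult[OF G'(1) G(2)]])+
  qed
  then show ?thesis unfolding coord_variety_def variety.simps by blast
qed

lemma topspace_quotient_variety:
  "topspace (zar (quotient_variety \<pi> X)) = \<pi> ` topspace (zar X)"
proof
  show "topspace (zar (quotient_variety \<pi> X)) \<subseteq> \<pi> ` topspace (zar X)"
    using openin_topspace[of "zar (quotient_variety \<pi> X)"] unfolding openin_quotient_variety by blast
  have "{p \<in> topspace (zar X). \<pi> p \<in> \<pi> ` topspace (zar X)} = topspace (zar X)" by auto
  then have "openin (zar (quotient_variety \<pi> X)) (\<pi> ` topspace (zar X))"
    unfolding openin_quotient_variety by simp
  then show "\<pi> ` topspace (zar X) \<subseteq> topspace (zar (quotient_variety \<pi> X))" by (rule openin_subset)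
qed

text \<open>Openness and regularity in a quotient are conditions on pullbacks to \<open>X\<close>
  and \<open>Y\<close>, and each family of lifts carries one implication between them. Surjectivity
  is already contained in the lifts; injectivity has to be supplied.\<close>

lemma variety_iso_quotientI:
  assumes inj: "inj_on \<phi> (\<pi>\<^sub>1 ` X)"
    and L1: "local_lifts (\<phi> \<circ> \<pi>\<^sub>1) X A \<pi>\<^sub>2 Y B"
    and L2: "local_lifts \<pi>\<^sub>2 Y B (\<phi> \<circ> \<pi>\<^sub>1) X A"
  shows "variety_iso \<phi> (quotient_variety \<pi>\<^sub>1 (coord_variety X A))
                       (quotient_variety \<pi>\<^sub>2 (coord_variety Y B))" (is "variety_iso _ ?Q1 ?Q2")
proof -
  have top1: "topspace (zar ?Q1) = \<pi>\<^sub>1 ` X" and top2: "topspace (zar ?Q2) = \<pi>\<^sub>2 ` Y"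
    by (simp_all add: topspace_quotient_variety topspace_coord_variety)
  have img: "\<phi> ` \<pi>\<^sub>1 ` X = \<pi>\<^sub>2 ` Y"
    using local_lifts_image[OF L1] local_lifts_image[OF L2] by (auto simp: image_comp)
  have pre: "{p \<in> X. \<pi>\<^sub>1 p \<in> {x \<in> \<pi>\<^sub>1 ` X. \<phi> x \<in> V}} = {p \<in> X. (\<phi> \<circ> \<pi>\<^sub>1) p \<in> V}" for V
    by auto
  have op: "openin (zar ?Q1) {x \<in> topspace (zar ?Q1). \<phi> x \<in> V} \<longleftrightarrow> openin (zar ?Q2) V"
    if V: "V \<subseteq> topspace (zar ?Q2)" for V
  proof -
    have "openin (zar ?Q1) {x \<in> topspace (zar ?Q1). \<phi> x \<in> V} \<longleftrightarrow>
        openin (zar (coord_variety X A)) {p \<in> X. (\<phi> \<circ> \<pi>\<^sub>1) p \<in> V}"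
      unfolding openin_quotient_variety top1 topspace_coord_variety pre by blast
    also have "\<dots> \<longleftrightarrow> openin (zar (coord_variety Y B)) {y \<in> Y. \<pi>\<^sub>2 y \<in> V}"
      using local_lifts_open[OF L1] local_lifts_open[OF L2] by blast
    also have "\<dots> \<longleftrightarrow> openin (zar ?Q2) V"
      unfolding openin_quotient_variety topspace_coord_variety using V top2 by simp
    finally show ?thesis .
  qed
  have "homeomorphic_map (zar ?Q1) (zar ?Q2) \<phi>"
    unfolding homeomorphic_map_def quotient_map_def using op inj img top1 top2 by auto
  moreover have "f \<in> reg ?Q2 V \<longleftrightarrow> f \<circ> \<phi> \<in> reg ?Q1 {p \<in> topspace (zar ?Q1). \<phi> p \<in> V}" for V f
  proof -
    have "f \<in> reg ?Q2 V \<longleftrightarrow> f \<circ> \<pi>\<^sub>2 \<in> reg (coord_variety Y B) {y \<in> Y. \<pi>\<^sub>2 y \<in> V}"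
      by (simp add: quotient_variety_def topspace_coord_variety)
    also have "\<dots> \<longleftrightarrow> f \<circ> (\<phi> \<circ> \<pi>\<^sub>1) \<in> reg (coord_variety X A) {x \<in> X. (\<phi> \<circ> \<pi>\<^sub>1) x \<in> V}"
      using local_lifts_reg[OF L1] local_lifts_reg[OF L2] by blast
    also have "\<dots> \<longleftrightarrow> (f \<circ> \<phi>) \<circ> \<pi>\<^sub>1 \<in> reg (coord_variety X A)
         {p \<in> X. \<pi>\<^sub>1 p \<in> {x \<in> \<pi>\<^sub>1 ` X. \<phi> x \<in> V}}"
      unfolding pre by (simp add: o_assoc)
    also have "\<dots> \<longleftrightarrow> f \<circ> \<phi> \<in> reg ?Q1 {p \<in> topspace (zar ?Q1). \<phi> p \<in> V}"
      unfolding top1 by (simp add: quotient_variety_def topspace_coord_variety)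
    finally show ?thesis .
  qed
  ultimately show ?thesis unfolding variety_iso_def by blast
qed

lemma reg_quotient_coord_cong:
  assumes "f \<in> reg (quotient_variety \<pi> (coord_variety X A)) V" "\<And>p. p \<in> V \<Longrightarrow> f p = g p"
  shows "g \<in> reg (quotient_variety \<pi> (coord_variety X A)) V"
  using assms by (simp add: quotient_variety_def coord_variety_def)

section \<open>Composition of isomorphisms and restriction to subvarieties\<close>

lemma variety_iso_comp:
  assumes "variety_iso \<phi> X Y" "variety_iso \<psi> Y Z"
  shows "variety_iso (\<psi> \<circ> \<phi>) X Z"
proof -
  have h: "homeomorphic_map (zar X) (zar Y) \<phi>" "homeomorphic_map (zar Y) (zar Z) \<psi>"
    using assms unfolding variety_iso_def by blast+
  have "f \<in> reg Z V \<longleftrightarrow> f \<circ> (\<psi> \<circ> \<phi>) \<in> reg X {p \<in> topspace (zar X). (\<psi> \<circ> \<phi>) p \<in> V}"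
    if V: "openin (zar Z) V" for V f
  proof -
    let ?V = "{p \<in> topspace (zar Y). \<psi> p \<in> V}"
    have op: "openin (zar Y) ?V"
      using V h(2) by (metis openin_continuous_map_preimage homeomorphic_imp_continuous_map)
    have eq: "{p \<in> topspace (zar X). \<phi> p \<in> ?V} = {p \<in> topspace (zar X). (\<psi> \<circ> \<phi>) p \<in> V}"
      using homeomorphic_imp_surjective_map[OF h(1)] by auto
    have "f \<in> reg Z V \<longleftrightarrow> f \<circ> \<psi> \<in> reg Y ?V"
      using assms(2) V unfolding variety_iso_def by blast
    also have "\<dots> \<longleftrightarrow> (f \<circ> \<psi>) \<circ> \<phi> \<in> reg X {p \<in> topspace (zar X). \<phi> p \<in> ?V}"
      using assms(1) op unfolding variety_iso_def by blast
    finally show ?thesis unfolding eq o_assoc .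
  qed
  then show ?thesis unfolding variety_iso_def using homeomorphic_map_compose[OF h] by blast
qed

text \<open>Regular functions on a subvariety are local restrictions of ambient ones, and these are
  carried over by the isomorphism or its inverse. \<open>cong\<close> is assumed because functions
  are total: the inverse \<open>\<psi>\<close> undoes \<open>\<phi>\<close> only on points of
  \<open>X\<close>.\<close>

lemma variety_iso_subvariety:
  assumes iso: "variety_iso \<phi> X Y"
    and cong: "\<And>U f g. f \<in> reg X U \<Longrightarrow> (\<And>p. p \<in> U \<Longrightarrow> f p = g p) \<Longrightarrow> g \<in> reg X U"
    and Z: "Z \<subseteq> topspace (zar X)" "\<phi> ` Z = Z'"
  shows "variety_iso \<phi> (subvariety X Z) (subvariety Y Z')"
proof -
  have hom: "homeomorphic_map (zar X) (zar Y) \<phi>"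
    and regs: "\<And>V f. openin (zar Y) V \<Longrightarrow>
       f \<in> reg Y V \<longleftrightarrow> f \<circ> \<phi> \<in> reg X {p \<in> topspace (zar X). \<phi> p \<in> V}"
    using iso unfolding variety_iso_def by blast+
  have bij: "inj_on \<phi> (topspace (zar X))" "\<phi> ` topspace (zar X) = topspace (zar Y)"
    using hom by (auto simp: homeomorphic_imp_surjective_map homeomorphic_imp_injective_map)
  have Z': "Z' \<subseteq> topspace (zar Y)" using Z bij by blast
  have ts: "topspace (subtopology (zar X) Z) = Z" using Z by auto
  define \<psi> where "\<psi> = inv_into (topspace (zar X)) \<phi>"
  have \<psi>: "\<And>p. p \<in> topspace (zar X) \<Longrightarrow> \<psi> (\<phi> p) = p"
    unfolding \<psi>_def using bij(1) by (rule inv_into_f_f)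
  have "f \<in> reg (subvariety Y Z') V \<longleftrightarrow>
      f \<circ> \<phi> \<in> reg (subvariety X Z) {p \<in> topspace (zar (subvariety X Z)). \<phi> p \<in> V}"
    if V: "openin (zar (subvariety Y Z')) V" for V f
  proof -
    have VZ: "V \<subseteq> Z'" using openin_subset[OF V] by (simp add: subvariety_def)
    have eq: "{p \<in> topspace (zar (subvariety X Z)). \<phi> p \<in> V} = {p \<in> Z. \<phi> p \<in> V}"
      using ts by (simp add: subvariety_def)
    show ?thesis unfolding eq
    proof
      assume L: "f \<in> reg (subvariety Y Z') V"
      have "\<exists>U g. openin (zar X) U \<and> p \<in> U \<and> g \<in> reg X U \<and>
               (\<forall>q\<in>U \<inter> {p \<in> Z. \<phi> p \<in> V}. (f \<circ> \<phi>) q = g q)" if p: "p \<in> Z" "\<phi> p \<in> V" for p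
      proof -
        obtain U g where U: "openin (zar Y) U" "\<phi> p \<in> U" "g \<in> reg Y U" "\<forall>q\<in>U \<inter> V. f q = g q"
          using L p unfolding subvariety_def by auto
        show ?thesis
        proof (intro exI conjI)
          show "openin (zar X) {p \<in> topspace (zar X). \<phi> p \<in> U}"
            using U(1) hom by (metis openin_continuous_map_preimage homeomorphic_imp_continuous_map)
          show "g \<circ> \<phi> \<in> reg X {p \<in> topspace (zar X). \<phi> p \<in> U}" using regs U by blast
        qed (use U p Z in auto)
      qed
      then show "f \<circ> \<phi> \<in> reg (subvariety X Z) {p \<in> Z. \<phi> p \<in> V}"
        unfolding subvariety_def by auto
    next
      assume R: "f \<circ> \<phi> \<in> reg (subvariety X Z) {p \<in> Z. \<phi> p \<in> V}"
      have "\<exists>U g. openin (zar Y) U \<and> p \<in> U \<and> g \<in> reg Y U \<and> (\<forall>q\<in>U \<inter> V. f q = g q)"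
        if p: "p \<in> V" for p
      proof -
        obtain p' where p': "p' \<in> Z" "p = \<phi> p'" using p VZ Z by blast
        obtain U g where U: "openin (zar X) U" "p' \<in> U" "g \<in> reg X U"
            "\<And>q. q \<in> Z \<Longrightarrow> \<phi> q \<in> V \<Longrightarrow> q \<in> U \<Longrightarrow> f (\<phi> q) = g q"
        proof -
          have "p' \<in> {p \<in> Z. \<phi> p \<in> V}" using p p' by simp
          then obtain U g where "openin (zar X) U \<and> p' \<in> U \<and> g \<in> reg X U \<and>
              (\<forall>q\<in>U \<inter> {p \<in> Z. \<phi> p \<in> V}. (f \<circ> \<phi>) q = g q)"
            using R unfolding subvariety_def variety.simps mem_Collect_eq by blast
          then show thesis by (intro that[of U g]) auto
        qed
        have sub: "U \<subseteq> topspace (zar X)" using U(1) by (rule openin_subset)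
        have op: "openin (zar Y) (\<phi> ` U)"
          using hom U(1) sub homeomorphic_map_openness_eq by blast
        have pre: "{p \<in> topspace (zar X). \<phi> p \<in> \<phi> ` U} = U"
          using bij(1) sub by (auto dest: inj_onD)
        have "(g \<circ> \<psi>) \<circ> \<phi> \<in> reg X U"
          by (rule cong[OF U(3)]) (use \<psi> sub in auto)
        then have gr: "g \<circ> \<psi> \<in> reg Y (\<phi> ` U)" using regs[OF op] pre by simp
        \<comment> \<open>The point \<open>q\<close> of \<open>V\<close> comes from \<open>Z\<close>
          and also from \<open>U\<close>; by injectivity the two preimages agree, and only then does
          \<open>U(4)\<close> apply.\<close>
        have "f q = (g \<circ> \<psi>) q" if q: "q \<in> \<phi> ` U \<inter> V" for q
        proof -
          obtain q' where q': "q' \<in> U" "q = \<phi> q'" using q by blast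
          moreover obtain q'' where "q'' \<in> Z" "q = \<phi> q''" using q VZ Z by blast
          ultimately have "q' \<in> Z" using bij(1) sub Z by (metis inj_onD subsetD)
          then show ?thesis using U(4)[of q'] q q' \<psi>[of q'] sub by auto
        qed
        then show ?thesis using op gr U(2) p' by blast
      qed
      then show "f \<in> reg (subvariety Y Z') V" unfolding subvariety_def by auto
    qed
  qed
  moreover have "homeomorphic_map (zar (subvariety X Z)) (zar (subvariety Y Z')) \<phi>"
    unfolding subvariety_def variety.simps
    by (rule homeomorphic_map_subtopologies[OF hom]) (use Z Z' bij in auto)
  ultimately show ?thesis unfolding variety_iso_def by blast
qed

section \<open>Complex subspaces of the Laurent series field\<close>

lemma pow_ser_iff: "f \<in> pow_ser \<longleftrightarrow> (\<forall>i<0. fls_nth f i = 0)"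
proof
  assume "f \<in> pow_ser"
  then show "\<forall>i<0. fls_nth f i = 0" by (auto simp: pow_ser_def)
next
  assume *: "\<forall>i<0. fls_nth f i = 0"
  have "f = fps_to_fls (fls_regpart f)"
    by (rule fls_eqI) (use * in auto)
  then show "f \<in> pow_ser" unfolding pow_ser_def by blast
qed

lemma fls_nth_X_intpow_mult: "fls_nth (fls_X_intpow k * (f :: complex fls)) i = fls_nth f (i - k)"
  unfolding fls_X_intpow_times_conv_shift by simp

lemma fls_X_intpow_cancel: "fls_X_intpow k * (fls_X_intpow (- k) * f) = (f :: complex fls)"
  by (rule fls_eqI) (simp only: fls_nth_X_intpow_mult, simp)

lemma fls_X_intpow_cancel': "fls_X_intpow (- k) * (fls_X_intpow k * f) = (f :: complex fls)"
  by (rule fls_eqI) (simp only: fls_nth_X_intpow_mult, simp)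

lemma shift_set_iff: "f \<in> shift_set k A \<longleftrightarrow> fls_X_intpow (-k) * f \<in> A"
proof
  assume "f \<in> shift_set k A"
  then obtain g where "g \<in> A" "f = fls_X_intpow k * g" unfolding shift_set_def by blast
  then show "fls_X_intpow (-k) * f \<in> A" by (simp only: fls_X_intpow_cancel')
next
  assume "fls_X_intpow (-k) * f \<in> A"
  then show "f \<in> shift_set k A"
    unfolding shift_set_def by (rule rev_image_eqI) (rule fls_X_intpow_cancel[symmetric])
qed

abbreviation tails :: "int \<Rightarrow> complex fls set" where
  "tails k \<equiv> shift_set k pow_ser"

lemma tails_iff: "f \<in> tails k \<longleftrightarrow> (\<forall>i<k. fls_nth f i = 0)"
proof -
  have "f \<in> tails k \<longleftrightarrow> (\<forall>i<0. fls_nth f (i + k) = 0)"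
    by (simp only: shift_set_iff pow_ser_iff fls_nth_X_intpow_mult diff_minus_eq_add)
  also have "\<dots> \<longleftrightarrow> (\<forall>i<k. fls_nth f i = 0)"
    by (metis add_less_cancel_right add_0 diff_add_cancel)
  finally show ?thesis .
qed

lemma tails_subdegree: "f \<noteq> 0 \<Longrightarrow> f \<in> tails k \<longleftrightarrow> k \<le> fls_subdegree f"
  unfolding tails_iff
  by (meson fls_eq0_below_subdegree fls_subdegree_geI leI nth_fls_subdegree_nonzero order_less_le_trans)

lemma X_intpow_mult_tails: "fls_X_intpow k * f \<in> tails l \<longleftrightarrow> f \<in> tails (l - k)"
proof -
  have "fls_X_intpow k * f \<in> tails l \<longleftrightarrow> (\<forall>i<l. fls_nth f (i - k) = 0)"
    by (simp only: tails_iff fls_nth_X_intpow_mult)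
  also have "\<dots> \<longleftrightarrow> (\<forall>i<l - k. fls_nth f i = 0)"
    by (metis add_diff_cancel_right' diff_add_cancel diff_strict_right_mono less_diff_eq)
  finally show ?thesis unfolding tails_iff .
qed

lemma tails_mono: "k \<le> l \<Longrightarrow> tails l \<subseteq> tails k"
  by (auto simp: tails_iff)

lemma tails_mult: "f \<in> tails k \<Longrightarrow> g \<in> tails l \<Longrightarrow> f * g \<in> tails (k + l)"
proof (cases "f = 0 \<or> g = 0")
  case False
  then have "f * g \<noteq> 0" by simp
  moreover assume "f \<in> tails k" "g \<in> tails l"
  ultimately show ?thesis using False by (simp add: tails_subdegree fls_subdegree_mult)
qed (auto simp: tails_iff)

lemma fls_in_some_tails: "\<exists>k. f \<in> tails k"
  by (rule exI[of _ "fls_subdegree f"]) (simp add: tails_iff)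

section \<open>Subspaces and the degrees of their elements\<close>

definition subsp :: "complex fls set \<Rightarrow> bool" where
  "subsp V \<longleftrightarrow> 0 \<in> V \<and> (\<forall>f\<in>V. \<forall>g\<in>V. f + g \<in> V) \<and> (\<forall>c. \<forall>f\<in>V. fls_const c * f \<in> V)"

lemma subsp_zero: "subsp V \<Longrightarrow> 0 \<in> V"
  and subsp_add: "subsp V \<Longrightarrow> f \<in> V \<Longrightarrow> g \<in> V \<Longrightarrow> f + g \<in> V"
  and subsp_scale: "subsp V \<Longrightarrow> f \<in> V \<Longrightarrow> fls_const c * f \<in> V"
  unfolding subsp_def by blast+

lemma subsp_diff:
  assumes "subsp V" "f \<in> V" "g \<in> V"
  shows "f - g \<in> V"
proof -
  have "fls_const (- 1) * g = - g" by (simp add: fls_eq_iff)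
  then have "f - g = f + fls_const (- 1) * g" by simp
  then show ?thesis using assms subsp_add subsp_scale by metis
qed

lemma subsp_sum: "subsp V \<Longrightarrow> (\<And>i. i \<in> I \<Longrightarrow> f i \<in> V) \<Longrightarrow> (\<Sum>i\<in>I. f i) \<in> V"
  by (induction I rule: infinite_finite_induct) (auto intro: subsp_zero subsp_add)

lemma subsp_lincomb:
  "subsp V \<Longrightarrow> (\<And>i. i \<in> I \<Longrightarrow> f i \<in> V) \<Longrightarrow> (\<Sum>i\<in>I. fls_const (c i) * f i) \<in> V"
  by (rule subsp_sum) (auto intro: subsp_scale)

lemma subsp_tails: "subsp (tails k)"
  unfolding subsp_def by (auto simp: tails_iff)

lemma subsp_image_mult: "subsp V \<Longrightarrow> subsp ((\<lambda>f. g * f) ` V)"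
  unfolding subsp_def
proof (intro conjI ballI allI; elim conjE)
  assume "0 \<in> V" then show "0 \<in> (*) g ` V" by force
next
  fix x y assume "\<forall>f\<in>V. \<forall>g\<in>V. f + g \<in> V" "x \<in> (*) g ` V" "y \<in> (*) g ` V"
  then show "x + y \<in> (*) g ` V" by (auto simp: distrib_left[symmetric])
next
  fix c x assume V: "\<forall>c. \<forall>f\<in>V. fls_const c * f \<in> V" and "x \<in> (*) g ` V"
  then obtain f where f: "f \<in> V" "x = g * f" by blast
  then have "fls_const c * x = g * (fls_const c * f)" by (simp add: mult.left_commute)
  then show "fls_const c * x \<in> (*) g ` V" using V f by blast
qed

lemma subsp_shift_set: "subsp V \<Longrightarrow> subsp (shift_set k V)"
  unfolding shift_set_def by (rule subsp_image_mult)

text \<open>For M in the compactified Jacobian this is the set of valuations of M, a module over the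
  semigroup of the curve.\<close>

definition degs :: "complex fls set \<Rightarrow> int set" where
  "degs V = fls_subdegree ` (V - {0})"

lemma degsI: "f \<in> V \<Longrightarrow> f \<noteq> 0 \<Longrightarrow> fls_subdegree f \<in> degs V"
  unfolding degs_def by blast

lemma degsE:
  assumes "j \<in> degs V" obtains f where "f \<in> V" "f \<noteq> 0" "fls_subdegree f = j"
  using assms unfolding degs_def by blast

lemma degs_mono: "V \<subseteq> W \<Longrightarrow> degs V \<subseteq> degs W"
  unfolding degs_def by blast

lemma degs_tails: "degs (tails k) = {k..}"
proof
  show "degs (tails k) \<subseteq> {k..}" by (auto elim!: degsE simp: tails_subdegree)
  show "{k..} \<subseteq> degs (tails k)"
  proof
    fix j assume "j \<in> {k..}"
    then have "fls_X_intpow j \<in> tails k" by (simp add: tails_subdegree)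
    then show "j \<in> degs (tails k)"
      using degsI[of "fls_X_intpow j :: complex fls"] by simp
  qed
qed

lemma degs_shift_set: "degs (shift_set k V) = (\<lambda>j. k + j) ` degs V"
proof
  show "degs (shift_set k V) \<subseteq> (\<lambda>j. k + j) ` degs V"
  proof
    fix j assume "j \<in> degs (shift_set k V)"
    then obtain f where f: "f \<in> V" "fls_X_intpow k * f \<noteq> 0" "fls_subdegree (fls_X_intpow k * f) = j"
      unfolding degs_def shift_set_def by blast
    then have "f \<noteq> 0" by auto
    then show "j \<in> (\<lambda>j. k + j) ` degs V" using f degsI[of f V] by force
  qed
  show "(\<lambda>j. k + j) ` degs V \<subseteq> degs (shift_set k V)"
  proof
    fix j assume "j \<in> (\<lambda>j. k + j) ` degs V"
    then obtain f where f: "f \<in> V" "f \<noteq> 0" "j = k + fls_subdegree f" unfolding degs_def by blast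
    have "fls_X_intpow k * f \<in> shift_set k V" using f by (auto simp: shift_set_def)
    moreover have "fls_X_intpow k * f \<noteq> 0" "fls_subdegree (fls_X_intpow k * f) = j" using f by auto
    ultimately show "j \<in> degs (shift_set k V)" using degsI by metis
  qed
qed

lemma subdegree_cancel_leading:
  fixes f t :: "complex fls"
  assumes "f \<noteq> 0" "t \<noteq> 0" "fls_subdegree t = fls_subdegree f"
  defines "g \<equiv> f - fls_const (fls_nth f (fls_subdegree f) / fls_nth t (fls_subdegree f)) * t"
  shows "g \<in> tails (fls_subdegree f + 1)"
  unfolding tails_iff
proof (intro allI impI)
  fix i assume "i < fls_subdegree f + 1"
  then consider "i < fls_subdegree f" | "i = fls_subdegree f" by linarith
  then show "fls_nth g i = 0"
  proof cases
    case 2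
    have "fls_nth t (fls_subdegree t) \<noteq> 0" using assms(2) by simp
    then show ?thesis using 2 assms(3) by (simp add: g_def)
  qed (use assms in \<open>simp add: g_def\<close>)
qed

text \<open>Division with remainder by leading terms: the lowest degree of \<open>f\<close> belongs
  to \<open>degs W\<close> or to \<open>D\<close>, so a multiple of an element of \<open>W\<close>
  or of some \<open>t j\<close> cancels it. The degree grows at each step, and from \<open>b\<close>
  on everything lies in \<open>W\<close>.\<close>

lemma reduce_mod:
  assumes V: "subsp V" and W: "subsp W" "W \<subseteq> V" "tails b \<subseteq> W" and D: "finite D"
    and t: "\<And>j. j \<in> D \<Longrightarrow> t j \<in> V \<and> t j \<noteq> 0 \<and> fls_subdegree (t j) = j"
    and deg: "degs V \<subseteq> degs W \<union> D" and f: "f \<in> V"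
  shows "\<exists>c. f - (\<Sum>j\<in>D. fls_const (c j) * t j) \<in> W"
  using f
proof (induction "nat (b - fls_subdegree f)" arbitrary: f rule: less_induct)
  case less
  show ?case
  proof (cases "f \<in> tails b")
    case True
    then have "f - (\<Sum>j\<in>D. fls_const 0 * t j) \<in> W" using W by auto
    then show ?thesis by (rule exI[of _ "\<lambda>_. 0"])
  next
    case False
    then have f0: "f \<noteq> 0" by (auto simp: tails_iff)
    with False have fb: "fls_subdegree f < b" by (simp add: tails_subdegree)
    have step: "\<exists>c. g - (\<Sum>j\<in>D. fls_const (c j) * t j) \<in> W"
      if g: "g \<in> V" "g \<in> tails (fls_subdegree f + 1)" for g
    proof (cases "g = 0")
      case True
      then have "g - (\<Sum>j\<in>D. fls_const 0 * t j) \<in> W" using W subsp_zero by auto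
      then show ?thesis by (rule exI[of _ "\<lambda>_. 0"])
    next
      case False
      then have "nat (b - fls_subdegree g) < nat (b - fls_subdegree f)"
        using g fb by (simp add: tails_subdegree)
      then show ?thesis using less.hyps g(1) by blast
    qed
    from f0 less.prems deg have "fls_subdegree f \<in> degs W \<union> D" by (blast intro: degsI)
    then show ?thesis
    proof
      assume "fls_subdegree f \<in> degs W"
      then obtain w where w: "w \<in> W" "w \<noteq> 0" "fls_subdegree w = fls_subdegree f" by (rule degsE)
      define a where "a = fls_nth f (fls_subdegree f) / fls_nth w (fls_subdegree f)"
      have aw: "fls_const a * w \<in> W" using W(1) w(1) by (rule subsp_scale)
      have "f - fls_const a * w \<in> V" using V less.prems aw W(2) by (blast intro: subsp_diff)
      then obtain c where c: "f - fls_const a * w - (\<Sum>j\<in>D. fls_const (c j) * t j) \<in> W"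
        using step subdegree_cancel_leading[OF f0 w(2,3)] unfolding a_def by blast
      have "f - (\<Sum>j\<in>D. fls_const (c j) * t j) =
          (f - fls_const a * w - (\<Sum>j\<in>D. fls_const (c j) * t j)) + fls_const a * w" by simp
      then show ?thesis using subsp_add[OF W(1) c aw] by metis
    next
      let ?s = "fls_subdegree f"
      assume s: "?s \<in> D"
      define a where "a = fls_nth f ?s / fls_nth (t ?s) ?s"
      have "f - fls_const a * t ?s \<in> V" using V less.prems t[OF s] by (blast intro: subsp_diff subsp_scale)
      then obtain c where c: "f - fls_const a * t ?s - (\<Sum>j\<in>D. fls_const (c j) * t j) \<in> W"
        using step subdegree_cancel_leading[OF f0] t[OF s] unfolding a_def by blast
      \<comment> \<open>The recursive call may already have used \<open>t ?s\<close>, so the new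
        coefficient is added rather than set.\<close>
      define c' where "c' = c(?s := c ?s + a)"
      have "(\<Sum>j\<in>D. fls_const (c' j) * t j) =
          fls_const (c ?s + a) * t ?s + (\<Sum>j\<in>D - {?s}. fls_const (c j) * t j)"
        using D s by (simp add: c'_def sum.remove)
      also have "\<dots> = fls_const a * t ?s + (\<Sum>j\<in>D. fls_const (c j) * t j)"
        using D s by (simp add: sum.remove[of D ?s] fls_plus_const[symmetric] distrib_right)
      finally have "f - (\<Sum>j\<in>D. fls_const (c' j) * t j) \<in> W" using c by (simp add: algebra_simps)
      then show ?thesis by blast
    qed
  qed
qed

text \<open>With no representatives at all, the reduction ends in \<open>W\<close> itself. This is
  the criterion by which equalities of lattices are proved.\<close>

lemma eq_of_degs_subset:
  assumes "subsp V" "subsp W" "W \<subseteq> V" "tails b \<subseteq> W" "degs V \<subseteq> degs W"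
  shows "V = W"
  using reduce_mod[OF assms(1-4), of "{}"] assms by auto

section \<open>Relative dimensions\<close>

text \<open>Families over an arbitrary index set, in contrast to the sets of vectors in
  \<open>quot_basis\<close>: an image under a matrix keeps its index set, so cardinalities are
  carried along.\<close>

definition basis_mod ::
    "complex fls set \<Rightarrow> complex fls set \<Rightarrow> 'i set \<Rightarrow> ('i \<Rightarrow> complex fls) \<Rightarrow> bool" where
  "basis_mod V W I r \<longleftrightarrow> finite I \<and> (\<forall>i\<in>I. r i \<in> V) \<and>
     (\<forall>f\<in>V. \<exists>c. f - (\<Sum>i\<in>I. fls_const (c i) * r i) \<in> W) \<and>
     (\<forall>c. (\<Sum>i\<in>I. fls_const (c i) * r i) \<in> W \<longrightarrow> (\<forall>i\<in>I. c i = 0))"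

lemma lincomb_diff:
  fixes r :: "'i \<Rightarrow> complex fls"
  shows "(\<Sum>i\<in>I. fls_const (c i - c' i) * r i) =
     (\<Sum>i\<in>I. fls_const (c i) * r i) - (\<Sum>i\<in>I. fls_const (c' i) * r i)"
  by (simp add: sum_subtractf[symmetric] fls_minus_const[symmetric] left_diff_distrib)

text \<open>More unknowns than homogeneous equations. The induction on the equations eliminates one
  unknown \<open>i0\<close> by means of the equation \<open>j\<close>, whose coefficient at
  \<open>i0\<close> is nonzero.\<close>

lemma exists_linear_relation:
  fixes a :: "'i \<Rightarrow> 'j \<Rightarrow> complex"
  assumes "finite J" "finite I" "card J < card I"
  shows "\<exists>c. (\<exists>i\<in>I. c i \<noteq> 0) \<and> (\<forall>j\<in>J. (\<Sum>i\<in>I. c i * a i j) = 0)"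
  using assms
proof (induction J arbitrary: I a rule: finite_induct)
  case empty
  then obtain i where "i \<in> I" by fastforce
  then show ?case by (intro exI[of _ "\<lambda>_. 1"]) auto
next
  case (insert j J)
  show ?case
  proof (cases "\<forall>i\<in>I. a i j = 0")
    case True
    have "card J < card I" using insert by simp
    from insert.IH[OF insert.prems(1) this, of a]
    obtain c where "\<exists>i\<in>I. c i \<noteq> 0" "\<forall>j\<in>J. (\<Sum>i\<in>I. c i * a i j) = 0" by blast
    then show ?thesis using True by (intro exI[of _ c]) auto
  next
    case False
    then obtain i0 where i0: "i0 \<in> I" "a i0 j \<noteq> 0" by blast
    let ?I = "I - {i0}"
    define b where "b i k = a i k - a i j / a i0 j * a i0 k" for i k
    have "card J < card ?I" using insert i0 by simp
    then obtain c where c: "\<exists>i\<in>?I. c i \<noteq> 0" "\<forall>k\<in>J. (\<Sum>i\<in>?I. c i * b i k) = 0"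
      using insert.IH[of ?I b] insert.prems(1) by blast
    \<comment> \<open>The value of the unknown \<open>i0\<close> is \<open>- s\<close>, which solves
      the equation \<open>j\<close> for it; the remaining equations then reduce to those with
      coefficients \<open>b\<close>.\<close>
    define s where "s = (\<Sum>i\<in>?I. c i * a i j) / a i0 j"
    define c' where "c' = c(i0 := - s)"
    have sum: "(\<Sum>i\<in>I. c' i * a i k) = (\<Sum>i\<in>?I. c i * a i k) - s * a i0 k" for k
    proof -
      have "(\<Sum>i\<in>I. c' i * a i k) = c' i0 * a i0 k + (\<Sum>i\<in>?I. c' i * a i k)"
        using insert.prems(1) i0(1) by (rule sum.remove)
      moreover have "(\<Sum>i\<in>?I. c' i * a i k) = (\<Sum>i\<in>?I. c i * a i k)"
        by (rule sum.cong) (auto simp: c'_def)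
      ultimately show ?thesis by (simp add: c'_def)
    qed
    have "(\<Sum>i\<in>I. c' i * a i k) = 0" if "k \<in> insert j J" for k
    proof (cases "k = j")
      case True
      then show ?thesis unfolding sum s_def using i0 by simp
    next
      case False
      then have "0 = (\<Sum>i\<in>?I. c i * b i k)" using c(2) that by simp
      also have "\<dots> = (\<Sum>i\<in>?I. c i * a i k - c i * a i j / a i0 j * a i0 k)"
        by (rule sum.cong) (auto simp: b_def right_diff_distrib)
      also have "\<dots> = (\<Sum>i\<in>?I. c i * a i k) - s * a i0 k"
        by (simp only: sum_subtractf s_def sum_distrib_right[symmetric] sum_divide_distrib[symmetric])
      finally show ?thesis unfolding sum by simp
    qed
    moreover have "\<exists>i\<in>I. c' i \<noteq> 0" using c(1) by (auto simp: c'_def)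
    ultimately show ?thesis by blast
  qed
qed

text \<open>Steinitz: the vectors \<open>r\<close> expand through \<open>s\<close> modulo
  \<open>W\<close>, and if there are more of them than vectors \<open>s\<close>, a linear relation
  among the coefficient rows gives a relation among the \<open>r\<close> modulo
  \<open>W\<close>.\<close>

lemma basis_mod_card_le:
  assumes W: "subsp W" and I: "basis_mod V W I r" and J: "basis_mod V W J s"
  shows "card I \<le> card J"
proof (rule ccontr)
  assume "\<not> card I \<le> card J"
  then have lt: "card J < card I" by simp
  have fin: "finite I" "finite J" using I J by (simp_all add: basis_mod_def)
  have "\<exists>a. \<forall>i\<in>I. r i - (\<Sum>j\<in>J. fls_const (a i j) * s j) \<in> W"
  proof (rule bchoice, intro ballI)
    fix i assume "i \<in> I"
    then have "r i \<in> V" using I by (simp add: basis_mod_def)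
    moreover have "\<forall>f\<in>V. \<exists>c. f - (\<Sum>j\<in>J. fls_const (c j) * s j) \<in> W"
      using J by (simp add: basis_mod_def)
    ultimately show "\<exists>c. r i - (\<Sum>j\<in>J. fls_const (c j) * s j) \<in> W" by simp
  qed
  then obtain a where a: "\<And>i. i \<in> I \<Longrightarrow> r i - (\<Sum>j\<in>J. fls_const (a i j) * s j) \<in> W"
    by blast
  obtain c where c: "\<exists>i\<in>I. c i \<noteq> 0" "\<And>j. j \<in> J \<Longrightarrow> (\<Sum>i\<in>I. c i * a i j) = 0"
  proof -
    have "\<exists>c. (\<exists>i\<in>I. c i \<noteq> 0) \<and> (\<forall>j\<in>J. (\<Sum>i\<in>I. c i * a i j) = 0)"
      by (rule exists_linear_relation[OF fin(2,1) lt])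
    then show thesis by (elim exE conjE) (rule that, assumption, simp)
  qed
  have "(\<Sum>i\<in>I. fls_const (c i) * (r i - (\<Sum>j\<in>J. fls_const (a i j) * s j))) \<in> W"
    by (rule subsp_lincomb[OF W]) (rule a)
  also have "(\<Sum>i\<in>I. fls_const (c i) * (r i - (\<Sum>j\<in>J. fls_const (a i j) * s j))) =
      (\<Sum>i\<in>I. fls_const (c i) * r i) - (\<Sum>i\<in>I. \<Sum>j\<in>J. fls_const (c i * a i j) * s j)"
    by (simp only: right_diff_distrib sum_subtractf sum_distrib_left fls_const_mult_const[symmetric]
        mult.assoc)
  also have "(\<Sum>i\<in>I. \<Sum>j\<in>J. fls_const (c i * a i j) * s j) =
      (\<Sum>j\<in>J. fls_const (\<Sum>i\<in>I. c i * a i j) * s j)"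
  proof -
    have const_sum: "fls_const (sum g I) = (\<Sum>i\<in>I. fls_const (g i))" for g :: "_ \<Rightarrow> complex"
      by (induction I rule: infinite_finite_induct) (auto simp: fls_plus_const[symmetric])
    show ?thesis by (subst sum.swap) (simp add: const_sum sum_distrib_right)
  qed
  also have "\<dots> = 0" using c(2) by simp
  finally have "(\<Sum>i\<in>I. fls_const (c i) * r i) \<in> W" by simp
  moreover have "\<forall>c. (\<Sum>i\<in>I. fls_const (c i) * r i) \<in> W \<longrightarrow> (\<forall>i\<in>I. c i = 0)"
    using I by (simp add: basis_mod_def)
  ultimately show False using c(1) by blast
qed

lemma quot_basis_of_basis_mod:
  assumes W: "subsp W" and I: "basis_mod V W I r"
  shows "inj_on r I" "quot_basis V W (r ` I)"
proof -
  have fin: "finite I" and rV: "\<And>i. i \<in> I \<Longrightarrow> r i \<in> V"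
    and span: "\<And>f. f \<in> V \<Longrightarrow> \<exists>c. f - (\<Sum>i\<in>I. fls_const (c i) * r i) \<in> W"
    and ind: "\<And>c i. (\<Sum>i\<in>I. fls_const (c i) * r i) \<in> W \<Longrightarrow> i \<in> I \<Longrightarrow> c i = 0"
    using I unfolding basis_mod_def by simp_all
  show inj: "inj_on r I"
  proof (rule inj_onI, rule ccontr)
    fix x y assume xy: "x \<in> I" "y \<in> I" "r x = r y" "x \<noteq> y"
    \<comment> \<open>\<open>r x - r y = 0\<close> is a relation with coefficients 1 and -1, against
      independence.\<close>
    define c where "c i = (if i = x then 1 else if i = y then - 1 else 0 :: complex)" for i
    have "(\<Sum>i\<in>I. fls_const (c i) * r i) = (\<Sum>i\<in>{x, y}. fls_const (c i) * r i)"
      by (rule sum.mono_neutral_right) (use fin xy in \<open>auto simp: c_def\<close>)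
    also have "\<dots> = 0" using xy by (simp add: c_def fls_eq_iff)
    finally have "c x = 0" using ind xy subsp_zero[OF W] by metis
    then show False by (simp add: c_def)
  qed
  have reindex: "(\<Sum>t\<in>r ` I. fls_const (e t) * t) = (\<Sum>i\<in>I. fls_const (e (r i)) * r i)" for e
    by (simp add: sum.reindex[OF inj])
  show "quot_basis V W (r ` I)"
    unfolding quot_basis_def
  proof (intro conjI ballI)
    fix f assume f: "f \<in> V"
    obtain c where c: "f - (\<Sum>i\<in>I. fls_const (c i) * r i) \<in> W" using span[OF f] by blast
    define e where "e = restrict (\<lambda>t. c (inv_into I r t)) (r ` I)"
    have e: "e (r i) = c i" if "i \<in> I" for i using that inj by (simp add: e_def)
    show "\<exists>!e. e \<in> r ` I \<rightarrow>\<^sub>E (UNIV :: complex set) \<and> f - (\<Sum>t\<in>r ` I. fls_const (e t) * t) \<in> W"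
    proof (rule ex1I[of _ e], intro conjI)
      show "e \<in> r ` I \<rightarrow>\<^sub>E UNIV" by (auto simp: e_def)
      show "f - (\<Sum>t\<in>r ` I. fls_const (e t) * t) \<in> W" using c unfolding reindex by (simp add: e)
    next
      fix e' assume e': "e' \<in> r ` I \<rightarrow>\<^sub>E UNIV \<and> f - (\<Sum>t\<in>r ` I. fls_const (e' t) * t) \<in> W"
      have "(\<Sum>i\<in>I. fls_const (c i - e' (r i)) * r i) \<in> W"
        using subsp_diff[OF W conjunct2[OF e'] c] unfolding lincomb_diff reindex by simp
      then have ce: "c i = e' (r i)" if "i \<in> I" for i using ind that by fastforce
      show "e' = e"
      proof
        fix t show "e' t = e t"
        proof (cases "t \<in> r ` I")
          case True
          then show ?thesis using ce e by auto
        next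
          case False
          then show ?thesis using e' by (auto simp: e_def PiE_def extensional_def)
        qed
      qed
    qed
  qed (use fin rV in auto)
qed

lemma basis_mod_of_quot_basis:
  assumes "subsp V" "subsp W" "W \<subseteq> V" "quot_basis V W T"
  shows "basis_mod V W T (\<lambda>t. t)"
  unfolding basis_mod_def
proof (intro conjI ballI allI impI)
  have T: "finite T" "T \<subseteq> V"
    "\<And>f. f \<in> V \<Longrightarrow> \<exists>!c. c \<in> T \<rightarrow>\<^sub>E (UNIV :: complex set) \<and> f - (\<Sum>t\<in>T. fls_const (c t) * t) \<in> W"
    using assms(4) unfolding quot_basis_def by blast+
  show "finite T" "\<And>t. t \<in> T \<Longrightarrow> t \<in> V" using T by blast+
  show "\<exists>c. f - (\<Sum>t\<in>T. fls_const (c t) * t) \<in> W" if "f \<in> V" for f using T(3)[OF that] by blast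
  fix c t assume c: "(\<Sum>t\<in>T. fls_const (c t) * t) \<in> W" and t: "t \<in> T"
  \<comment> \<open>Uniqueness in \<open>quot_basis\<close> is about extensional functions, so
    \<open>c\<close> is restricted to \<open>T\<close> and compared with the zero function as a
    second expansion of the element 0.\<close>
  have "\<And>e. e = restrict c T \<Longrightarrow> (\<Sum>t\<in>T. fls_const (e t) * t) = (\<Sum>t\<in>T. fls_const (c t) * t)"
    by (intro sum.cong) auto
  then have "0 - (\<Sum>t\<in>T. fls_const (restrict c T t) * t) \<in> W"
    using subsp_diff[OF assms(2) subsp_zero[OF assms(2)] c] by simp
  moreover have "0 - (\<Sum>t\<in>T. fls_const (restrict (\<lambda>_. 0) T t) * t) \<in> W"
  proof -
    have "(\<Sum>t\<in>T. fls_const (restrict (\<lambda>_. 0) T t) * t) = 0" by (rule sum.neutral) simp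
    then show ?thesis using subsp_zero[OF assms(2)] by simp
  qed
  moreover have "restrict c T \<in> T \<rightarrow>\<^sub>E UNIV" "restrict (\<lambda>_. 0) T \<in> T \<rightarrow>\<^sub>E (UNIV :: complex set)"
    by auto
  ultimately have "restrict c T = restrict (\<lambda>_. 0) T"
    using T(3)[OF subsp_zero[OF assms(1)]] by blast
  then show "c t = 0" using t by (metis restrict_apply')
qed

text \<open>\<open>quot_dim\<close> takes an arbitrary basis; by exchange in both directions its
  size is that of any family which is a basis modulo \<open>W\<close>.\<close>

lemma quot_dim_eq_card:
  assumes "subsp V" "subsp W" "W \<subseteq> V" "basis_mod V W I r"
  shows "quot_dim V W = card I"
proof -
  have "quot_basis V W (SOME T. quot_basis V W T)"
    using quot_basis_of_basis_mod(2)[OF assms(2,4)] by (rule someI)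
  note * = basis_mod_of_quot_basis[OF assms(1-3) this]
  show ?thesis
    unfolding quot_dim_def
    using basis_mod_card_le[OF assms(2) * assms(4)] basis_mod_card_le[OF assms(2,4) *] by simp
qed

lemma finite_degs_diff:
  assumes "V \<subseteq> tails a" "tails b \<subseteq> W"
  shows "finite (degs V - degs W)"
proof (rule finite_subset)
  have "degs V \<subseteq> {a..}" "{b..} \<subseteq> degs W"
    using degs_mono[OF assms(1)] degs_mono[OF assms(2)] unfolding degs_tails by blast+
  then have "x \<in> {a..<b}" if "x \<in> degs V - degs W" for x
    using that by (metis Diff_iff atLeastLessThan_iff atLeast_iff not_le subsetD)
  then show "degs V - degs W \<subseteq> {a..<b}" by blast
qed simp

text \<open>Spanning is division with remainder. For independence, the term of lowest degree with
  nonzero coefficient cannot be cancelled by the others, so a combination in \<open>W\<close> would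
  have a degree outside \<open>degs W\<close>.\<close>

lemma degs_basis_mod:
  assumes V: "subsp V" "V \<subseteq> tails a" and W: "subsp W" "W \<subseteq> V" "tails b \<subseteq> W"
    and t: "\<And>j. j \<in> degs V - degs W \<Longrightarrow> t j \<in> V \<and> t j \<noteq> 0 \<and> fls_subdegree (t j) = j"
  shows "basis_mod V W (degs V - degs W) t"
  unfolding basis_mod_def
proof (intro conjI ballI allI impI)
  let ?D = "degs V - degs W"
  show fin: "finite ?D" using V(2) W(3) by (rule finite_degs_diff)
  show "\<And>j. j \<in> ?D \<Longrightarrow> t j \<in> V" using t by blast
  show "\<exists>c. f - (\<Sum>j\<in>?D. fls_const (c j) * t j) \<in> W" if "f \<in> V" for f
    by (rule reduce_mod[OF V(1) W fin _ _ that]) (use t in auto)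
  fix c j assume c: "(\<Sum>j\<in>?D. fls_const (c j) * t j) \<in> W" and j: "j \<in> ?D"
  show "c j = 0"
  proof (rule ccontr)
    assume nz: "c j \<noteq> 0"
    let ?E = "{j \<in> ?D. c j \<noteq> 0}"
    define m where "m = Min ?E"
    have finE: "finite ?E" by (rule finite_subset[OF _ fin]) blast
    have neE: "?E \<noteq> {}" using j nz by blast
    have m: "m \<in> ?E" unfolding m_def by (rule Min_in[OF finE neE])
    have le: "m \<le> i" if "i \<in> ?D" "c i \<noteq> 0" for i unfolding m_def using Min_le[OF finE] that by simp
    let ?f = "\<Sum>j\<in>?D. fls_const (c j) * t j"
    have nth: "fls_nth ?f i = (\<Sum>j\<in>?D. c j * fls_nth (t j) i)" for i
      by (simp add: fls_nth_sum)
    have zero: "c j * fls_nth (t j) i = 0" if "j \<in> ?D" "i < m \<or> (i = m \<and> j \<noteq> m)" for i j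
    proof (cases "c j = 0")
      case False
      then have "i < j" using le[of j] that by fastforce
      then show ?thesis using t[OF that(1)] by simp
    qed simp
    have "fls_nth ?f m = c m * fls_nth (t m) m"
    proof -
      have "fls_nth ?f m = c m * fls_nth (t m) m + (\<Sum>j\<in>?D - {m}. c j * fls_nth (t j) m)"
        unfolding nth by (rule sum.remove) (use fin m in auto)
      also have "(\<Sum>j\<in>?D - {m}. c j * fls_nth (t j) m) = 0"
        by (rule sum.neutral) (use zero in blast)
      finally show ?thesis by simp
    qed
    moreover have "fls_nth (t m) m \<noteq> 0"
      using m t[of m] nth_fls_subdegree_nonzero[of "t m"] by simp
    ultimately have nzm: "fls_nth ?f m \<noteq> 0" using m by simp
    moreover have "fls_nth ?f i = 0" if "i < m" for i
      unfolding nth by (rule sum.neutral) (use zero that in blast)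
    ultimately have "fls_subdegree ?f = m" by (intro fls_subdegree_eqI) auto
    moreover have "?f \<noteq> 0" using nzm by auto
    ultimately have "m \<in> degs W" using degsI[OF c] by simp
    then show False using m by blast
  qed
qed

text \<open>Turns the dimensions in the definitions (\<delta>, the index, the gap, the steps of a
  flag) into cardinalities of sets of integers.\<close>

lemma quot_dim_degs:
  assumes "subsp V" "V \<subseteq> tails a" "subsp W" "W \<subseteq> V" "tails b \<subseteq> W"
  shows "quot_dim V W = card (degs V - degs W)"
proof -
  have "\<exists>t. \<forall>j\<in>degs V - degs W. t j \<in> V \<and> t j \<noteq> 0 \<and> fls_subdegree (t j) = j"
    by (rule bchoice) (auto elim: degsE)
  then obtain t where "\<And>j. j \<in> degs V - degs W \<Longrightarrow> t j \<in> V \<and> t j \<noteq> 0 \<and> fls_subdegree (t j) = j" by blast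
  then have "basis_mod V W (degs V - degs W) t" using degs_basis_mod[OF assms] by blast
  then show ?thesis by (rule quot_dim_eq_card[OF assms(1,3,4)])
qed

section \<open>The action of matrices on Laurent series\<close>

text \<open>Inverse of \<open>ab\<close>: the component i collects the coefficients at exponents
  congruent to i modulo n. \<open>Abs_fls\<close> returns these coefficients only if they vanish for
  small k, which \<open>fls_nth_abinv\<close> checks.\<close>

definition abinv :: "nat \<Rightarrow> complex fls \<Rightarrow> complex fls vec" where
  "abinv n f = vec n (\<lambda>i. Abs_fls (\<lambda>k. fls_nth f (int n * k + int i)))"

text \<open>The row vector \<open>v\<close> is identified with \<^term>\<open>ab n v\<close>, so matrices act on the right.\<close>

definition row_act :: "nat \<Rightarrow> loop_mat \<Rightarrow> complex fls \<Rightarrow> complex fls" where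
  "row_act n g f = ab n (transpose_mat g *\<^sub>v abinv n f)"

lemma fls_nth_mult_X_power: "fls_nth (f * fls_X ^ i) k = fls_nth (f :: complex fls) (k - int i)"
  unfolding fls_X_power_times_conv_shift by simp

lemma abinv_carrier [simp]: "abinv n f \<in> carrier_vec n" "dim_vec (abinv n f) = n"
  by (simp_all add: abinv_def)

lemma ab_sum: "ab n v = (\<Sum>i<n. fls_compose_power (vec_index v i) n * fls_X ^ i)"
  by (simp add: ab_def)

context
  fixes n :: nat
  assumes n_pos: "0 < n"
begin

lemma fls_nth_abinv:
  assumes "i < n"
  shows "fls_nth (vec_index (abinv n f) i) k = fls_nth f (int n * k + int i)"
proof -
  \<comment> \<open>Below this bound m + 1 is negative, so n (m + 1) \<le> m + 1, and the exponent n
    m + i < n (m + 1) stays under the lowest degree of \<open>f\<close>.\<close>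
  have "fls_nth f (int n * m + int i) = 0" if "m < min 0 (fls_subdegree f) - 1" for m
  proof -
    have "int n * m \<le> 1 * m" by (rule mult_right_mono_neg) (use n_pos that in auto)
    have "int n * (m + 1) \<le> 1 * (m + 1)" by (rule mult_right_mono_neg) (use n_pos that in auto)
    then have "int n * m + int n \<le> m + 1" by (simp add: distrib_left)
    then have "int n * m + int i < fls_subdegree f" using assms that by linarith
    then show ?thesis by simp
  qed
  then have "fls_nth (Abs_fls (\<lambda>k. fls_nth f (int n * k + int i))) k = fls_nth f (int n * k + int i)"
    by (intro nth_Abs_fls_lower_bound) blast
  then show ?thesis using assms by (simp add: abinv_def)
qed

lemma fls_nth_compose_power:
  "fls_nth (fls_compose_power f n) k = (if int n dvd k then fls_nth f (k div int n) else 0)"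
  using n_pos by (rule fls_nth_compose_power)

lemma fls_nth_ab:
  "fls_nth (ab n v) k = fls_nth (vec_index v (nat (k mod int n))) (k div int n)"
proof -
  let ?r = "nat (k mod int n)"
  have r: "int ?r = k mod int n" "?r < n" using n_pos by (auto simp: nat_less_iff)
  have "fls_nth (ab n v) k =
      (\<Sum>i<n. if int n dvd k - int i then fls_nth (vec_index v i) ((k - int i) div int n) else 0)"
    unfolding ab_sum fls_nth_sum fls_nth_mult_X_power fls_nth_compose_power ..
  also have "\<dots> = (\<Sum>i<n. if i = ?r then fls_nth (vec_index v i) (k div int n) else 0)"
  proof (rule sum.cong[OF refl])
    fix i assume "i \<in> {..<n}"
    then have i: "i < n" by simp
    have eq: "int n dvd k - int i \<longleftrightarrow> i = ?r"
    proof -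
      have "int n dvd k - int i \<longleftrightarrow> k mod int n = int i mod int n" by (simp add: mod_eq_dvd_iff)
      also have "\<dots> \<longleftrightarrow> i = ?r" using i r by auto
      finally show ?thesis .
    qed
    have "(k - int ?r) div int n = k div int n"
      unfolding r(1) by (simp add: minus_mod_eq_mult_div)
    then show "(if int n dvd k - int i then fls_nth (vec_index v i) ((k - int i) div int n) else 0)
        = (if i = ?r then fls_nth (vec_index v i) (k div int n) else 0)" unfolding eq by auto
  qed
  also have "\<dots> = fls_nth (vec_index v ?r) (k div int n)" using r by simp
  finally show ?thesis .
qed

lemma ab_abinv: "ab n (abinv n f) = f"
proof (rule fls_eqI)
  fix k
  let ?r = "nat (k mod int n)"
  have r: "int ?r = k mod int n" "?r < n" using n_pos by (auto simp: nat_less_iff)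
  show "fls_nth (ab n (abinv n f)) k = fls_nth f k"
    unfolding fls_nth_ab fls_nth_abinv[OF r(2)] r(1) by simp
qed

lemma abinv_ab:
  assumes "v \<in> carrier_vec n"
  shows "abinv n (ab n v) = v"
proof (rule eq_vecI)
  fix i assume "i < dim_vec v"
  then have i: "i < n" using assms by simp
  show "vec_index (abinv n (ab n v)) i = vec_index v i"
  proof (rule fls_eqI)
    fix k
    have "(int n * k + int i) mod int n = int i" "(int n * k + int i) div int n = k"
      using i by simp_all
    then show "fls_nth (vec_index (abinv n (ab n v)) i) k = fls_nth (vec_index v i) k"
      unfolding fls_nth_abinv[OF i] fls_nth_ab by simp
  qed
qed (use assms in simp)

lemma ab_add:
  assumes "v \<in> carrier_vec n" "w \<in> carrier_vec n"
  shows "ab n (v + w) = ab n v + ab n w"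
  unfolding ab_sum sum.distrib[symmetric]
  by (rule sum.cong) (use assms in \<open>auto simp: distrib_right\<close>)

lemma ab_smult:
  assumes "v \<in> carrier_vec n"
  shows "ab n (c \<cdot>\<^sub>v v) = fls_compose_power c n * ab n v"
  unfolding ab_sum sum_distrib_left by (rule sum.cong) (use assms in \<open>auto simp: mult.assoc\<close>)

lemma abinv_eqI: "v \<in> carrier_vec n \<Longrightarrow> ab n v = f \<Longrightarrow> abinv n f = v"
  using abinv_ab by blast

lemma abinv_add: "abinv n (f + f') = abinv n f + abinv n f'"
  by (rule abinv_eqI) (auto simp: ab_add ab_abinv)

lemma abinv_smult: "abinv n (fls_compose_power c n * f) = c \<cdot>\<^sub>v abinv n f"
  by (rule abinv_eqI) (auto simp: ab_smult ab_abinv)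

section \<open>Multiplicativity and C((x))-linearity of the right action\<close>

lemma row_act_ab:
  "v \<in> carrier_vec n \<Longrightarrow> row_act n g (ab n v) = ab n (transpose_mat g *\<^sub>v v)"
  by (simp add: row_act_def abinv_ab)

lemma row_act_mult:
  assumes "g \<in> carrier_mat n n" "h \<in> carrier_mat n n"
  shows "row_act n (g * h) f = row_act n h (row_act n g f)"
proof -
  have v: "transpose_mat g *\<^sub>v abinv n f \<in> carrier_vec n"
    using assms by (intro mult_mat_vec_carrier[of _ n n]) auto
  have "transpose_mat (g * h) *\<^sub>v abinv n f = transpose_mat h *\<^sub>v (transpose_mat g *\<^sub>v abinv n f)"
    unfolding transpose_mult[OF assms] by (rule assoc_mult_mat_vec[of _ n n _ n]) (use assms in auto)
  then show ?thesis unfolding row_act_def[of n "g * h"] row_act_def[of n g] row_act_ab[OF v] by simp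
qed

lemma row_act_one: "row_act n (1\<^sub>m n) f = f"
  by (simp add: row_act_def ab_abinv)

lemma row_act_add:
  assumes "g \<in> carrier_mat n n"
  shows "row_act n g (f + f') = row_act n g f + row_act n g f'"
proof -
  have "transpose_mat g *\<^sub>v (abinv n f + abinv n f') =
      transpose_mat g *\<^sub>v abinv n f + transpose_mat g *\<^sub>v abinv n f'"
    by (rule mult_add_distrib_mat_vec[of _ n n]) (use assms in auto)
  moreover have "transpose_mat g *\<^sub>v abinv n f'' \<in> carrier_vec n" for f''
    using assms by (intro mult_mat_vec_carrier[of _ n n]) auto
  ultimately show ?thesis unfolding row_act_def abinv_add by (simp add: ab_add)
qed

text \<open>\<open>fls_compose_power c n\<close> is the scalar c(x) with x = \<varpi>^n; a general
  matrix is linear over these scalars, not over all series in \<varpi>.\<close>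

lemma row_act_compose:
  assumes "g \<in> carrier_mat n n"
  shows "row_act n g (fls_compose_power c n * f) = fls_compose_power c n * row_act n g f"
proof -
  have "transpose_mat g *\<^sub>v (c \<cdot>\<^sub>v abinv n f) = c \<cdot>\<^sub>v (transpose_mat g *\<^sub>v abinv n f)"
    by (rule mult_mat_vec[of _ n n]) (use assms in auto)
  moreover have "transpose_mat g *\<^sub>v abinv n f \<in> carrier_vec n"
    using assms by (intro mult_mat_vec_carrier[of _ n n]) auto
  ultimately show ?thesis unfolding row_act_def abinv_smult by (simp add: ab_smult)
qed

lemma row_act_const:
  "g \<in> carrier_mat n n \<Longrightarrow> row_act n g (fls_const c * f) = fls_const c * row_act n g f"
  using row_act_compose[of g "fls_const c" f] n_pos by simp

lemma row_act_X_intpow: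
  "g \<in> carrier_mat n n \<Longrightarrow>
     row_act n g (fls_X_intpow (int n * k) * f) = fls_X_intpow (int n * k) * row_act n g f"
  using row_act_compose[of g "fls_X_intpow k" f]
  unfolding fls_compose_power_X_intpow[OF n_pos] .

lemma row_act_zero: "g \<in> carrier_mat n n \<Longrightarrow> row_act n g 0 = 0"
  using row_act_const[of g 0 0] by simp

lemma row_act_sum:
  "g \<in> carrier_mat n n \<Longrightarrow> row_act n g (\<Sum>i\<in>I. f i) = (\<Sum>i\<in>I. row_act n g (f i))"
  by (induction I rule: infinite_finite_induct) (auto simp: row_act_zero row_act_add)

lemma row_act_diff:
  assumes "g \<in> carrier_mat n n"
  shows "row_act n g (f - f') = row_act n g f - row_act n g f'"
  using row_act_add[OF assms, of "f - f'" f'] by simp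

lemma row_act_expand:
  assumes "g \<in> carrier_mat n n"
  shows "row_act n g f =
    (\<Sum>i<n. fls_compose_power (vec_index (abinv n f) i) n * row_act n g (fls_X ^ i))"
proof -
  have "row_act n g f = row_act n g (ab n (abinv n f))" by (simp add: ab_abinv)
  then show ?thesis unfolding ab_sum by (simp add: row_act_sum[OF assms] row_act_compose[OF assms])
qed

lemma abinv_X_power:
  assumes "i < n"
  shows "abinv n (fls_X ^ i) = unit_vec n i"
proof (rule abinv_eqI)
  have "ab n (unit_vec n i) = (\<Sum>j<n. if j = i then fls_X ^ i else 0)"
    unfolding ab_sum by (rule sum.cong) (use n_pos assms in auto)
  then show "ab n (unit_vec n i) = fls_X ^ i" using assms by simp
qed simp

lemma row_act_X_power:
  assumes "g \<in> carrier_mat n n" "i < n"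
  shows "row_act n g (fls_X ^ i) = ab n (row g i)"
proof -
  have "transpose_mat g *\<^sub>v unit_vec n i = row g i"
    by (rule eq_vecI) (use assms in auto)
  then show ?thesis unfolding row_act_def abinv_X_power[OF assms(2)] by simp
qed

lemma fls_nth_row_act_X_power:
  assumes "g \<in> carrier_mat n n" "i < n"
  shows "fls_nth (row_act n g (fls_X ^ i)) k = fls_nth (g $$ (i, nat (k mod int n))) (k div int n)"
proof -
  have "nat (k mod int n) < n" using n_pos by (auto simp: nat_less_iff)
  then show ?thesis unfolding row_act_X_power[OF assms] fls_nth_ab using assms by simp
qed

lemma fls_nth_mat_entry:
  assumes "g \<in> carrier_mat n n" "i < n" "j < n"
  shows "fls_nth (g $$ (i, j)) k = fls_nth (row_act n g (fls_X ^ i)) (int n * k + int j)"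
proof -
  have "(int n * k + int j) mod int n = int j" "(int n * k + int j) div int n = k"
    using assms by simp_all
  then show ?thesis unfolding fls_nth_row_act_X_power[OF assms(1,2)] by simp
qed

lemma mat_eq_iff_row_act:
  assumes "g \<in> carrier_mat n n" "h \<in> carrier_mat n n"
    and "\<And>i. i < n \<Longrightarrow> row_act n g (fls_X ^ i) = row_act n h (fls_X ^ i)"
  shows "g = h"
proof (rule eq_matI)
  fix i j assume "i < dim_row h" "j < dim_col h"
  then have "i < n" "j < n" using assms by auto
  then show "g $$ (i, j) = h $$ (i, j)"
    by (intro fls_eqI) (simp add: fls_nth_mat_entry assms)
qed (use assms in auto)

section \<open>Effect of the action on degrees; the Lie algebras as stabilizers\<close>

lemma component_in_tails:
  assumes "i < n" "f \<in> tails k"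
  shows "fls_compose_power (vec_index (abinv n f) i) n \<in> tails (k - int i)"
  unfolding tails_iff
proof (intro allI impI)
  fix m assume m: "m < k - int i"
  show "fls_nth (fls_compose_power (vec_index (abinv n f) i) n) m = 0"
  proof (cases "int n dvd m")
    case True
    then have "int n * (m div int n) = m" by simp
    then have "fls_nth (fls_compose_power (vec_index (abinv n f) i) n) m = fls_nth f (m + int i)"
      unfolding fls_nth_compose_power fls_nth_abinv[OF assms(1)] using True by simp
    then show ?thesis using assms(2) m by (simp add: tails_iff)
  qed (simp add: fls_nth_compose_power)
qed

text \<open>It suffices to test the basis 1, \<varpi>, ..., \<varpi>^(n-1): the scalar with which
  \<varpi>^i occurs in \<open>f\<close> starts no earlier than degree k - i, so the loss
  \<open>p\<close> on the basis bounds the loss on every lattice.\<close>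

lemma row_act_tails:
  assumes g: "g \<in> carrier_mat n n" and p: "\<And>i. i < n \<Longrightarrow> row_act n g (fls_X ^ i) \<in> tails (int i - p)"
    and f: "f \<in> tails k"
  shows "row_act n g f \<in> tails (k - p)"
  unfolding row_act_expand[OF g, of f]
proof (rule subsp_sum[OF subsp_tails])
  fix i assume "i \<in> {..<n}"
  then have "fls_compose_power (vec_index (abinv n f) i) n * row_act n g (fls_X ^ i)
      \<in> tails ((k - int i) + (int i - p))"
    by (intro tails_mult component_in_tails p f) auto
  then show "fls_compose_power (vec_index (abinv n f) i) n * row_act n g (fls_X ^ i) \<in> tails (k - p)"
    by simp
qed

lemma row_act_bounded:
  assumes g: "g \<in> carrier_mat n n"
  obtains p where "\<And>k f. f \<in> tails k \<Longrightarrow> row_act n g f \<in> tails (k - p)"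
proof -
  \<comment> \<open>The exponents i are less than n, so subtracting this \<open>p\<close> from i
    leaves at most the least degree occurring among the images of the basis.\<close>
  define p where "p = int n - Min (insert 0 ((\<lambda>i. fls_subdegree (row_act n g (fls_X ^ i))) ` {..<n}))"
  have "row_act n g (fls_X ^ i) \<in> tails (int i - p)" if "i < n" for i
  proof -
    have "int n - p \<le> fls_subdegree (row_act n g (fls_X ^ i))"
      unfolding p_def using that by simp
    then have "int i - p \<le> fls_subdegree (row_act n g (fls_X ^ i))" using that by simp
    then show ?thesis unfolding tails_iff by (meson fls_eq0_below_subdegree order_less_le_trans)
  qed
  then show thesis using that row_act_tails[OF g] by blast
qed

lemma X_power_tails: "fls_X ^ i \<in> tails (int i)"
  by (simp add: tails_iff)

text \<open>The coefficient of x^k in the entry (i, j) is the coefficient of \<varpi>^(n k + j) in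
  the image of \<varpi>^i. This exponent is less than i exactly if k < 0, or k = 0 and j < i, and
  these are the coefficients that have to vanish on the Lie algebra.\<close>

lemma lie_iwahori_iff:
  assumes g: "g \<in> carrier_mat n n"
  shows "g \<in> lie_iwahori n \<longleftrightarrow> (\<forall>k. \<forall>f\<in>tails k. row_act n g f \<in> tails k)"
proof
  assume *: "g \<in> lie_iwahori n"
  have "row_act n g (fls_X ^ i) \<in> tails (int i - 0)" if i: "i < n" for i
    unfolding tails_iff
  proof (intro allI impI)
    fix k assume k: "k < int i - 0"
    have r: "nat (k mod int n) < n" using n_pos by (auto simp: nat_less_iff)
    show "fls_nth (row_act n g (fls_X ^ i)) k = 0"
    proof (cases "k < 0")
      case True
      then have "k div int n < 0" using n_pos by (simp add: div_neg_pos_less0)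
      then show ?thesis unfolding fls_nth_row_act_X_power[OF g i]
        using * i r by (simp add: lie_iwahori_def lie_arcGL_def pow_ser_iff)
    next
      case False
      then have "k div int n = 0" "nat (k mod int n) < i" using k i by (auto simp: nat_less_iff)
      then show ?thesis unfolding fls_nth_row_act_X_power[OF g i] using * i by (simp add: lie_iwahori_def)
    qed
  qed
  then show "\<forall>k. \<forall>f\<in>tails k. row_act n g f \<in> tails k" using row_act_tails[OF g, of 0] by simp
next
  assume *: "\<forall>k. \<forall>f\<in>tails k. row_act n g f \<in> tails k"
  have rows: "row_act n g (fls_X ^ i) \<in> tails (int i)" for i
    using * X_power_tails by blast
  have z: "fls_nth (g $$ (i, j)) k = 0" if "i < n" "j < n" "k < 0 \<or> (k = 0 \<and> j < i)" for i j k
  proof -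
    have "int n * k + int j < int i"
    proof (cases "k = 0")
      case False
      then have "int n * (k + 1) \<le> 0" using that by (intro mult_nonneg_nonpos) auto
      then show ?thesis using that by (simp add: distrib_left)
    qed (use that in auto)
    then show ?thesis unfolding fls_nth_mat_entry[OF g that(1,2)] using rows by (simp add: tails_iff)
  qed
  then show "g \<in> lie_iwahori n" using g unfolding lie_iwahori_def lie_arcGL_def pow_ser_iff by auto
qed

lemma lie_arcGL_iff:
  assumes g: "g \<in> carrier_mat n n"
  shows "g \<in> lie_arcGL n \<longleftrightarrow> (\<forall>f\<in>tails 0. row_act n g f \<in> tails 0)"
proof
  assume *: "g \<in> lie_arcGL n"
  have rows: "row_act n g (fls_X ^ i) \<in> tails 0" if i: "i < n" for i
    unfolding tails_iff
  proof (intro allI impI)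
    fix k :: int assume k: "k < 0"
    have r: "nat (k mod int n) < n" using n_pos by (auto simp: nat_less_iff)
    have "k div int n < 0" using n_pos k by (simp add: div_neg_pos_less0)
    then show "fls_nth (row_act n g (fls_X ^ i)) k = 0" unfolding fls_nth_row_act_X_power[OF g i]
      using * i r by (simp add: lie_arcGL_def pow_ser_iff)
  qed
  show "\<forall>f\<in>tails 0. row_act n g f \<in> tails 0"
  proof
    fix f :: "complex fls" assume f: "f \<in> tails 0"
    have pow: "fls_compose_power (vec_index (abinv n f) i) n \<in> tails 0" if i: "i < n" for i
      unfolding tails_iff fls_nth_compose_power fls_nth_abinv[OF i]
    proof (intro allI impI)
      fix m :: int assume m: "m < 0"
      show "(if int n dvd m then fls_nth f (int n * (m div int n) + int i) else 0) = 0"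
      proof (cases "int n dvd m")
        case True
        then have eq: "int n * (m div int n) = m" by simp
        have "m div int n < 0" using n_pos m by (simp add: div_neg_pos_less0)
        then have "m div int n + 1 \<le> 0" by simp
        then have "int n * (m div int n + 1) \<le> 0" by (intro mult_nonneg_nonpos) auto
        then have "m + int n \<le> 0" using eq by (simp add: distrib_left)
        then show ?thesis using f i eq True by (simp add: tails_iff)
      qed simp
    qed
    show "row_act n g f \<in> tails 0"
      unfolding row_act_expand[OF g, of f]
    proof (rule subsp_sum[OF subsp_tails])
      fix i assume "i \<in> {..<n}"
      then have "fls_compose_power (vec_index (abinv n f) i) n * row_act n g (fls_X ^ i) \<in> tails (0 + 0)"
        by (intro tails_mult pow rows) auto
      then show "fls_compose_power (vec_index (abinv n f) i) n * row_act n g (fls_X ^ i) \<in> tails 0"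
        by simp
    qed
  qed
next
  assume *: "\<forall>f\<in>tails 0. row_act n g f \<in> tails 0"
  have rows: "row_act n g (fls_X ^ i) \<in> tails 0" for i
    using * X_power_tails[of i] tails_mono[of 0 "int i"] by (meson of_nat_0_le_iff subsetD)
  have "fls_nth (g $$ (i, j)) k = 0" if "i < n" "j < n" "k < 0" for i j k
  proof -
    have "int n * (k + 1) \<le> 0" using that by (intro mult_nonneg_nonpos) auto
    then have "int n * k + int j < 0" using that by (simp add: distrib_left)
    then show ?thesis unfolding fls_nth_mat_entry[OF g that(1,2)] using rows by (simp add: tails_iff)
  qed
  then show "g \<in> lie_arcGL n" using g unfolding lie_arcGL_def pow_ser_iff by auto
qed

end

section \<open>The loop group\<close>

lemma loopGL_simps [simp]:
  "mult (loopGL n) = (*)" "one (loopGL n) = 1\<^sub>m n"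
  unfolding loopGL_def by (simp_all add: units_of_mult units_of_one ring_mat_simps)

lemma group_loopGL: "group (loopGL n)"
proof -
  interpret ring "ring_mat TYPE(complex fls) n ()" by (rule ring_mat)
  show ?thesis unfolding loopGL_def by (rule units_group)
qed

abbreviation loop_inv :: "nat \<Rightarrow> loop_mat \<Rightarrow> loop_mat" where
  "loop_inv n \<equiv> m_inv (loopGL n)"

lemma loopGL_iff:
  "g \<in> carrier (loopGL n) \<longleftrightarrow>
     g \<in> carrier_mat n n \<and> (\<exists>h\<in>carrier_mat n n. h * g = 1\<^sub>m n \<and> g * h = 1\<^sub>m n)"
  unfolding loopGL_def units_of_carrier Units_def by (auto simp: ring_mat_simps)

lemma loopGL_carrier_mat: "g \<in> carrier (loopGL n) \<Longrightarrow> g \<in> carrier_mat n n"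
  by (simp add: loopGL_iff)

lemma loopGL_mult: "g \<in> carrier (loopGL n) \<Longrightarrow> h \<in> carrier (loopGL n) \<Longrightarrow> g * h \<in> carrier (loopGL n)"
  using monoid.m_closed[OF group.is_monoid[OF group_loopGL], of g n h] by simp

lemma loop_inv_closed: "g \<in> carrier (loopGL n) \<Longrightarrow> loop_inv n g \<in> carrier (loopGL n)"
  by (rule group.inv_closed[OF group_loopGL])

lemma loop_inv_carrier_mat: "g \<in> carrier (loopGL n) \<Longrightarrow> loop_inv n g \<in> carrier_mat n n"
  by (rule loopGL_carrier_mat[OF loop_inv_closed])

lemma loop_inv_left: "g \<in> carrier (loopGL n) \<Longrightarrow> loop_inv n g * g = 1\<^sub>m n"
  using group.l_inv[OF group_loopGL, of g n] by simp

lemma loop_inv_right: "g \<in> carrier (loopGL n) \<Longrightarrow> g * loop_inv n g = 1\<^sub>m n"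
  using group.r_inv[OF group_loopGL, of g n] by simp

lemma loop_inv_inv: "g \<in> carrier (loopGL n) \<Longrightarrow> loop_inv n (loop_inv n g) = g"
  by (rule group.inv_inv[OF group_loopGL])

lemma loop_inv_mult:
  "g \<in> carrier (loopGL n) \<Longrightarrow> h \<in> carrier (loopGL n) \<Longrightarrow>
     loop_inv n (g * h) = loop_inv n h * loop_inv n g"
  using group.inv_mult_group[OF group_loopGL, of g n h] by simp

lemma loop_inv_unique:
  assumes "g \<in> carrier_mat n n" "h \<in> carrier_mat n n" "g * h = 1\<^sub>m n"
  shows "g \<in> carrier (loopGL n)" "h \<in> carrier (loopGL n)" "loop_inv n g = h" "loop_inv n h = g"
proof -
  have hg: "h * g = 1\<^sub>m n" by (rule mat_mult_left_right_inverse[OF assms])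
  show g: "g \<in> carrier (loopGL n)" unfolding loopGL_iff using assms hg by blast
  show h: "h \<in> carrier (loopGL n)" unfolding loopGL_iff using assms hg by blast
  show "loop_inv n g = h" by (rule group.inv_equality[OF group_loopGL]) (use g h hg in auto)
  show "loop_inv n h = g" by (rule group.inv_equality[OF group_loopGL]) (use g h assms in auto)
qed

lemma det_nonzero_loopGL: "g \<in> carrier_mat n n \<Longrightarrow> det g \<noteq> 0 \<Longrightarrow> g \<in> carrier (loopGL n)"
  unfolding loopGL_def units_of_carrier by (rule det_non_zero_imp_unit)

section \<open>Chains of lattices and the Iwahori subgroup\<close>

text \<open>The part of \<open>h\<close> of degree at least \<open>b - a\<close> maps
  \<open>M\<close> into \<open>tails b\<close>. The rest is a polynomial whose monomials stabilise
  \<open>M\<close>, so stability under power series is reduced to stability under shifts.\<close>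

lemma subsp_mult_closed:
  assumes M: "subsp M" "tails b \<subseteq> M" "M \<subseteq> tails a"
    and h: "h \<in> tails 0" "\<And>k. fls_nth h k \<noteq> 0 \<Longrightarrow> shift_set k M \<subseteq> M" and m: "m \<in> M"
  shows "h * m \<in> M"
proof -
  define N where "N = nat (b - a)"
  define p where "p = (\<Sum>k<N. fls_const (fls_nth h (int k)) * fls_X_intpow (int k))"
  have nth: "fls_nth p i = (\<Sum>k<N. if i = int k then fls_nth h (int k) else 0)" for i
    unfolding p_def fls_nth_sum by (rule sum.cong) auto
  have "fls_nth (h - p) i = 0" if i: "i < int N" for i
  proof (cases "i < 0")
    case True
    then have "fls_nth p i = 0" unfolding nth by (intro sum.neutral) auto
    then show ?thesis using h(1) True by (simp add: tails_iff)
  next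
    case False
    have "fls_nth p i = (\<Sum>k<N. if k = nat i then fls_nth h i else 0)"
      unfolding nth by (rule sum.cong) (use False in auto)
    also have "\<dots> = fls_nth h i" using i False by (simp add: nat_less_iff)
    finally show ?thesis by simp
  qed
  then have "h - p \<in> tails (int N)" by (simp add: tails_iff)
  moreover have "m \<in> tails a" using m M by blast
  ultimately have "(h - p) * m \<in> tails (int N + a)" by (rule tails_mult)
  moreover have "tails (int N + a) \<subseteq> tails b" by (rule tails_mono) (simp add: N_def)
  ultimately have 1: "(h - p) * m \<in> M" using M by blast
  have 2: "p * m \<in> M"
    unfolding p_def sum_distrib_right
  proof (rule subsp_sum[OF M(1)])
    fix k
    show "fls_const (fls_nth h (int k)) * fls_X_intpow (int k) * m \<in> M"
    proof (cases "fls_nth h (int k) = 0")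
      case False
      have "fls_X_intpow (int k) * m \<in> shift_set (int k) M"
        using m unfolding shift_set_def by blast
      then have "fls_X_intpow (int k) * m \<in> M" using h(2) False by blast
      then show ?thesis unfolding mult.assoc by (rule subsp_scale[OF M(1)])
    qed (simp add: subsp_zero[OF M(1)])
  qed
  have "h * m = (h - p) * m + p * m" by (simp add: algebra_simps)
  then show ?thesis using subsp_add[OF M(1) 1 2] by simp
qed

lemma arcGL_lie_iff:
  "g \<in> arcGL n \<longleftrightarrow> g \<in> carrier (loopGL n) \<and> g \<in> lie_arcGL n \<and> loop_inv n g \<in> lie_arcGL n"
  unfolding arcGL_def lie_arcGL_def using loopGL_carrier_mat loop_inv_carrier_mat by blast

lemma iwahori_lie_iff: "g \<in> iwahori n \<longleftrightarrow> g \<in> arcGL n \<and> g \<in> lie_iwahori n"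
  unfolding iwahori_def lie_iwahori_def using arcGL_lie_iff by blast

lemma arcGL_loopGL: "g \<in> arcGL n \<Longrightarrow> g \<in> carrier (loopGL n)"
  by (simp add: arcGL_def)

lemma iwahori_arcGL: "g \<in> iwahori n \<Longrightarrow> g \<in> arcGL n"
  by (simp add: iwahori_def)

lemma iwahori_loopGL: "g \<in> iwahori n \<Longrightarrow> g \<in> carrier (loopGL n)"
  by (rule arcGL_loopGL[OF iwahori_arcGL])

text \<open>Up to the factor \<varpi>^\<delta>, k = 0 gives M_g and k = n - j the j-th member of its
  flag.\<close>

definition lattice_chain :: "nat \<Rightarrow> loop_mat \<Rightarrow> int \<Rightarrow> complex fls set" where
  "lattice_chain n g k = row_act n (loop_inv n g) ` tails k"

context
  fixes n :: nat
  assumes n_pos: "0 < n"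
begin

section \<open>Invertible matrices acting on subspaces and lattices\<close>

lemma row_act_inv:
  assumes "g \<in> carrier (loopGL n)"
  shows "row_act n (loop_inv n g) (row_act n g f) = f"
    and "row_act n g (row_act n (loop_inv n g) f) = f"
  using assms loopGL_carrier_mat[OF assms] loop_inv_carrier_mat[OF assms]
  by (simp_all add: row_act_mult[OF n_pos, symmetric] loop_inv_left loop_inv_right row_act_one[OF n_pos])

lemma row_act_inv_image:
  assumes "g \<in> carrier (loopGL n)"
  shows "row_act n (loop_inv n g) ` row_act n g ` V = V"
    and "row_act n g ` row_act n (loop_inv n g) ` V = V"
  by (simp_all add: image_image row_act_inv[OF assms])

lemma row_act_mem_image_iff:
  assumes "g \<in> carrier (loopGL n)"
  shows "row_act n g f \<in> row_act n g ` V \<longleftrightarrow> f \<in> V"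
proof
  assume "row_act n g f \<in> row_act n g ` V"
  then obtain v where v: "v \<in> V" "row_act n g f = row_act n g v" by blast
  have "f = row_act n (loop_inv n g) (row_act n g f)" by (simp only: row_act_inv(1)[OF assms])
  also have "\<dots> = v" unfolding v(2) by (rule row_act_inv(1)[OF assms])
  finally show "f \<in> V" using v(1) by simp
qed (rule imageI)

lemma row_act_mult_image:
  assumes "g \<in> carrier_mat n n" "h \<in> carrier_mat n n"
  shows "row_act n (g * h) ` V = row_act n h ` row_act n g ` V"
  by (simp add: image_image row_act_mult[OF n_pos assms])

lemma subsp_row_act:
  assumes g: "g \<in> carrier_mat n n" and V: "subsp V"
  shows "subsp (row_act n g ` V)"
  unfolding subsp_def
proof (intro conjI ballI allI)
  show "0 \<in> row_act n g ` V"
    using subsp_zero[OF V] row_act_zero[OF n_pos g] by force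
  fix x y assume "x \<in> row_act n g ` V" "y \<in> row_act n g ` V"
  then obtain a b where "a \<in> V" "x = row_act n g a" "b \<in> V" "y = row_act n g b" by blast
  then have "x + y = row_act n g (a + b)" "a + b \<in> V"
    by (simp_all add: row_act_add[OF n_pos g] subsp_add[OF V])
  then show "x + y \<in> row_act n g ` V" by blast
next
  fix c x assume "x \<in> row_act n g ` V"
  then obtain a where "a \<in> V" "x = row_act n g a" by blast
  then have "fls_const c * x = row_act n g (fls_const c * a)" "fls_const c * a \<in> V"
    by (simp_all add: row_act_const[OF n_pos g] subsp_scale[OF V])
  then show "fls_const c * x \<in> row_act n g ` V" by blast
qed

lemma row_act_lincomb:
  assumes "g \<in> carrier_mat n n"
  shows "row_act n g (\<Sum>i\<in>I. fls_const (c i) * r i) = (\<Sum>i\<in>I. fls_const (c i) * row_act n g (r i))"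
  by (simp add: row_act_sum[OF n_pos assms] row_act_const[OF n_pos assms])

lemma basis_mod_row_act:
  assumes g: "g \<in> carrier (loopGL n)" and b: "basis_mod V W I r"
  shows "basis_mod (row_act n g ` V) (row_act n g ` W) I (\<lambda>i. row_act n g (r i))"
proof -
  note gm = loopGL_carrier_mat[OF g]
  have fin: "finite I" and rV: "\<And>i. i \<in> I \<Longrightarrow> r i \<in> V"
    and span: "\<And>f. f \<in> V \<Longrightarrow> \<exists>c. f - (\<Sum>i\<in>I. fls_const (c i) * r i) \<in> W"
    and ind: "\<And>c i. (\<Sum>i\<in>I. fls_const (c i) * r i) \<in> W \<Longrightarrow> i \<in> I \<Longrightarrow> c i = 0"
    using b unfolding basis_mod_def by simp_all
  have "\<exists>c. x - (\<Sum>i\<in>I. fls_const (c i) * row_act n g (r i)) \<in> row_act n g ` W"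
    if "x \<in> row_act n g ` V" for x
  proof -
    obtain f where f: "f \<in> V" "x = row_act n g f" using \<open>x \<in> row_act n g ` V\<close> by (elim imageE)
    obtain c where c: "f - (\<Sum>i\<in>I. fls_const (c i) * r i) \<in> W" using span[OF f(1)] by (elim exE)
    have "x - (\<Sum>i\<in>I. fls_const (c i) * row_act n g (r i)) =
        row_act n g (f - (\<Sum>i\<in>I. fls_const (c i) * r i))"
      unfolding row_act_diff[OF n_pos gm] row_act_lincomb[OF gm] f(2) ..
    then show ?thesis using c by (intro exI[of _ c]) simp
  qed
  moreover have "\<forall>i\<in>I. c i = 0"
    if "(\<Sum>i\<in>I. fls_const (c i) * row_act n g (r i)) \<in> row_act n g ` W" for c
    using that unfolding row_act_lincomb[OF gm, symmetric] row_act_mem_image_iff[OF g]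
    using ind by blast
  ultimately show ?thesis unfolding basis_mod_def using fin rV by simp
qed

lemma row_act_sandwich:
  assumes g: "g \<in> carrier (loopGL n)" and V: "tails b \<subseteq> V" "V \<subseteq> tails a"
  obtains a' b' where "row_act n g ` V \<subseteq> tails a'" "tails b' \<subseteq> row_act n g ` V"
proof -
  obtain p where p: "\<And>k f. f \<in> tails k \<Longrightarrow> row_act n g f \<in> tails (k - p)"
    using row_act_bounded[OF n_pos loopGL_carrier_mat[OF g]] by blast
  obtain q where q: "\<And>k f. f \<in> tails k \<Longrightarrow> row_act n (loop_inv n g) f \<in> tails (k - q)"
    using row_act_bounded[OF n_pos loop_inv_carrier_mat[OF g]] by blast
  have "row_act n g ` V \<subseteq> tails (a - p)" using p V by blast
  moreover have "tails (b + q) \<subseteq> row_act n g ` V"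
  proof
    fix f assume "f \<in> tails (b + q)"
    from q[OF this] have "row_act n (loop_inv n g) f \<in> V" using V by auto
    then have "row_act n g (row_act n (loop_inv n g) f) \<in> row_act n g ` V" by blast
    then show "f \<in> row_act n g ` V" unfolding row_act_inv(2)[OF g] .
  qed
  ultimately show thesis by (rule that)
qed

text \<open>An injective endomorphism of the finite-dimensional space V / W is surjective. Since
  \<open>g\<close> fixes \<open>W\<close>, the images of a basis are a basis of the image modulo
  \<open>W\<close>, and the dimensions are compared through degrees.\<close>

lemma row_act_image_eq:
  assumes g: "g \<in> carrier (loopGL n)" and V: "subsp V" "V \<subseteq> tails a"
    and W: "subsp W" "W \<subseteq> V" "tails b \<subseteq> W"
    and gV: "row_act n g ` V \<subseteq> V" and gW: "row_act n g ` W = W"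
  shows "row_act n g ` V = V"
proof -
  note gm = loopGL_carrier_mat[OF g]
  let ?gV = "row_act n g ` V"
  have WgV: "W \<subseteq> ?gV" using gW W(2) by blast
  have sg: "subsp ?gV" using gm V(1) by (rule subsp_row_act)
  have "\<exists>t. \<forall>j\<in>degs V - degs W. t j \<in> V \<and> t j \<noteq> 0 \<and> fls_subdegree (t j) = j"
    by (rule bchoice) (auto elim: degsE)
  then obtain t where "\<And>j. j \<in> degs V - degs W \<Longrightarrow> t j \<in> V \<and> t j \<noteq> 0 \<and> fls_subdegree (t j) = j"
    by blast
  then have "basis_mod V W (degs V - degs W) t" using degs_basis_mod[OF V W] by blast
  from basis_mod_row_act[OF g this]
  have "basis_mod ?gV W (degs V - degs W) (\<lambda>i. row_act n g (t i))" unfolding gW .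
  from quot_dim_eq_card[OF sg W(1) WgV this]
  have "card (degs ?gV - degs W) = card (degs V - degs W)"
    using quot_dim_degs[OF sg _ W(1) WgV W(3), of a] gV V(2) by simp
  moreover have "finite (degs V - degs W)" using V(2) W(3) by (rule finite_degs_diff)
  moreover have "degs ?gV - degs W \<subseteq> degs V - degs W" using degs_mono[OF gV] by blast
  ultimately have "degs ?gV - degs W = degs V - degs W" by (metis card_subset_eq)
  then have "degs V \<subseteq> degs ?gV" using degs_mono[OF WgV] by blast
  moreover have "tails b \<subseteq> ?gV" using W(3) WgV by blast
  ultimately have "V = ?gV" by (intro eq_of_degs_subset[OF V(1) sg gV]) auto
  then show ?thesis ..
qed

lemma arcGL_iff:
  assumes g: "g \<in> carrier (loopGL n)"
  shows "g \<in> arcGL n \<longleftrightarrow> row_act n g ` tails 0 = tails 0"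
proof
  assume "g \<in> arcGL n"
  then have "g \<in> lie_arcGL n" "loop_inv n g \<in> lie_arcGL n" by (auto simp: arcGL_lie_iff)
  then have *: "row_act n g ` tails 0 \<subseteq> tails 0" "row_act n (loop_inv n g) ` tails 0 \<subseteq> tails 0"
    using lie_arcGL_iff[OF n_pos] loopGL_carrier_mat[OF g] loop_inv_carrier_mat[OF g] by blast+
  then have "row_act n g ` row_act n (loop_inv n g) ` tails 0 \<subseteq> row_act n g ` tails 0" by blast
  then show "row_act n g ` tails 0 = tails 0" unfolding row_act_inv_image[OF g] using * by blast
next
  assume *: "row_act n g ` tails 0 = tails 0"
  then have "row_act n (loop_inv n g) ` tails 0 = tails 0" using row_act_inv_image(1)[OF g, of "tails 0"] by simp
  then show "g \<in> arcGL n"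
    unfolding arcGL_lie_iff lie_arcGL_iff[OF n_pos loopGL_carrier_mat[OF g]]
      lie_arcGL_iff[OF n_pos loop_inv_carrier_mat[OF g]] using * g by blast
qed

lemma row_act_shift_image:
  assumes g: "g \<in> carrier_mat n n"
  shows "row_act n g ` shift_set (int n * l) V = shift_set (int n * l) (row_act n g ` V)"
  unfolding shift_set_def image_image row_act_X_intpow[OF n_pos g] ..

lemma shift_set_shift_set: "shift_set k (shift_set l V) = shift_set (k + l) V"
proof -
  have "fls_X_intpow k * (fls_X_intpow l * f) = fls_X_intpow (k + l) * f" for f :: "complex fls"
    by (simp only: mult.assoc[symmetric] fls_X_intpow_times_fls_X_intpow)
  then show ?thesis unfolding shift_set_def image_image by (simp only:)
qed

text \<open>The vanishing below the diagonal is demanded of \<open>g\<close> alone, hence gives only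
  inclusions. Equality follows by dimension from a lattice \<varpi>^(n l) S inside \<varpi>^k S: it
  is the multiple of S by a power of x, hence fixed by the arc group.\<close>

lemma iwahori_iff:
  assumes g: "g \<in> carrier (loopGL n)"
  shows "g \<in> iwahori n \<longleftrightarrow> (\<forall>k. row_act n g ` tails k = tails k)"
proof
  assume *: "g \<in> iwahori n"
  show "\<forall>k. row_act n g ` tails k = tails k"
  proof
    fix k
    have sub: "row_act n g ` tails k \<subseteq> tails k"
      using * lie_iwahori_iff[OF n_pos loopGL_carrier_mat[OF g]] unfolding iwahori_lie_iff by blast
    define l where "l = max k 0"
    have "row_act n g ` tails 0 = tails 0" using * arcGL_iff[OF g] iwahori_arcGL by blast
    then have "row_act n g ` tails (int n * l) = tails (int n * l)"
      using row_act_shift_image[OF loopGL_carrier_mat[OF g], of l "tails 0"]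
      by (simp add: shift_set_shift_set)
    moreover have "k \<le> int n * l"
    proof -
      have "1 * l \<le> int n * l" by (rule mult_right_mono) (use n_pos l_def in auto)
      then show ?thesis by (simp add: l_def)
    qed
    ultimately show "row_act n g ` tails k = tails k"
      by (intro row_act_image_eq[OF g subsp_tails order_refl subsp_tails tails_mono order_refl sub])
  qed
next
  assume *: "\<forall>k. row_act n g ` tails k = tails k"
  then have "g \<in> arcGL n" using arcGL_iff[OF g] by blast
  moreover have "g \<in> lie_iwahori n"
    unfolding lie_iwahori_iff[OF n_pos loopGL_carrier_mat[OF g]] using * by blast
  ultimately show "g \<in> iwahori n" unfolding iwahori_lie_iff by blast
qed

lemma row_act_inv_fix:
  "g \<in> carrier (loopGL n) \<Longrightarrow> row_act n g ` V = V \<Longrightarrow> row_act n (loop_inv n g) ` V = V"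
  using row_act_inv_image(1)[of g V] by simp

lemma arcGL_inv: "g \<in> arcGL n \<Longrightarrow> loop_inv n g \<in> arcGL n"
  using arcGL_iff arcGL_loopGL loop_inv_closed row_act_inv_fix by metis

lemma iwahori_inv: "g \<in> iwahori n \<Longrightarrow> loop_inv n g \<in> iwahori n"
  using iwahori_iff iwahori_loopGL loop_inv_closed row_act_inv_fix by metis

lemma arcGL_mult:
  assumes "g \<in> arcGL n" "h \<in> arcGL n"
  shows "g * h \<in> arcGL n"
proof -
  have G: "g \<in> carrier (loopGL n)" "h \<in> carrier (loopGL n)" using assms arcGL_loopGL by blast+
  then have "row_act n (g * h) ` tails 0 = tails 0"
    using assms arcGL_iff loopGL_carrier_mat row_act_mult_image by metis
  then show ?thesis using arcGL_iff[OF loopGL_mult[OF G]] by blast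
qed

lemma iwahori_mult:
  assumes "g \<in> iwahori n" "h \<in> iwahori n"
  shows "g * h \<in> iwahori n"
proof -
  have G: "g \<in> carrier (loopGL n)" "h \<in> carrier (loopGL n)" using assms iwahori_loopGL by blast+
  then have "row_act n (g * h) ` tails k = tails k" for k
    using assms iwahori_iff loopGL_carrier_mat row_act_mult_image by metis
  then show ?thesis using iwahori_iff[OF loopGL_mult[OF G]] by blast
qed

lemma one_loopGL: "1\<^sub>m n \<in> carrier (loopGL n)"
  using monoid.one_closed[OF group.is_monoid[OF group_loopGL]] by simp

lemma one_iwahori: "1\<^sub>m n \<in> iwahori n"
  unfolding iwahori_iff[OF one_loopGL] by (simp add: row_act_one[OF n_pos])

lemma one_arcGL: "1\<^sub>m n \<in> arcGL n"
  by (rule iwahori_arcGL[OF one_iwahori])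

lemma subgroup_iwahori: "subgroup (iwahori n) (loopGL n)"
  by (rule subgroup.intro)
    (auto intro: iwahori_mult iwahori_inv one_iwahori iwahori_loopGL)

lemma subgroup_arcGL: "subgroup (arcGL n) (loopGL n)"
  by (rule subgroup.intro)
    (auto intro: arcGL_mult arcGL_inv one_arcGL arcGL_loopGL)

lemma iwahori_tails_iff:
  assumes "g \<in> iwahori n"
  shows "row_act n g f \<in> tails k \<longleftrightarrow> f \<in> tails k"
  using row_act_mem_image_iff[OF iwahori_loopGL[OF assms], of f "tails k"]
    assms iwahori_iff[OF iwahori_loopGL[OF assms]] by simp

lemma row_act_eq_0_iff:
  assumes "g \<in> carrier (loopGL n)"
  shows "row_act n g f = 0 \<longleftrightarrow> f = 0"
  using row_act_inv(1)[OF assms, of f] row_act_zero[OF n_pos loop_inv_carrier_mat[OF assms]]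
    row_act_zero[OF n_pos loopGL_carrier_mat[OF assms]] by auto

lemma iwahori_subdegree:
  assumes "g \<in> iwahori n"
  shows "fls_subdegree (row_act n g f) = fls_subdegree f"
proof (cases "f = 0")
  case True
  then show ?thesis using row_act_zero[OF n_pos loopGL_carrier_mat[OF iwahori_loopGL[OF assms]]] by simp
next
  case False
  then have "row_act n g f \<noteq> 0" using row_act_eq_0_iff[OF iwahori_loopGL[OF assms]] by simp
  then have "k \<le> fls_subdegree (row_act n g f) \<longleftrightarrow> k \<le> fls_subdegree f" for k
    using iwahori_tails_iff[OF assms] False by (simp add: tails_subdegree[symmetric])
  then show ?thesis by (metis order_refl antisym)
qed

text \<open>The reason why cells show in degrees: a left factor of g from the Iwahori subgroup
  changes the lattice of g only by a degree-preserving bijection.\<close>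

lemma degs_iwahori:
  assumes "g \<in> iwahori n"
  shows "degs (row_act n g ` V) = degs V"
proof -
  have "row_act n g ` V - {0} = row_act n g ` (V - {0})"
    using row_act_eq_0_iff[OF iwahori_loopGL[OF assms]] by auto
  then show ?thesis unfolding degs_def by (simp add: image_image iwahori_subdegree[OF assms])
qed

section \<open>Iwahori elements with prescribed rows\<close>

definition mat_of_series :: "(nat \<Rightarrow> complex fls) \<Rightarrow> loop_mat" where
  "mat_of_series r = mat n n (\<lambda>(i, j). vec_index (abinv n (r i)) j)"

lemma mat_of_series_carrier [simp]: "mat_of_series r \<in> carrier_mat n n"
  by (simp add: mat_of_series_def)

lemma row_act_mat_of_series:
  assumes "i < n"
  shows "row_act n (mat_of_series r) (fls_X ^ i) = r i"
proof -
  have "row (mat_of_series r) i = abinv n (r i)"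
    by (rule eq_vecI) (use assms in \<open>auto simp: mat_of_series_def\<close>)
  then show ?thesis
    using row_act_X_power[OF n_pos mat_of_series_carrier assms] ab_abinv[OF n_pos] by simp
qed

lemma loopGL_of_injective:
  assumes B: "B \<in> carrier_mat n n" and inj: "\<And>f. row_act n B f = 0 \<Longrightarrow> f = 0"
  shows "B \<in> carrier (loopGL n)"
proof (rule det_nonzero_loopGL[OF B], rule notI)
  assume "det B = 0"
  then have "det (transpose_mat B) = 0" using det_transpose[OF B] by simp
  then obtain v where v: "v \<in> carrier_vec n" "v \<noteq> 0\<^sub>v n" "transpose_mat B *\<^sub>v v = 0\<^sub>v n"
    using det_0_iff_vec_prod_zero_field[of "transpose_mat B" n] B by auto
  have z: "ab n (0\<^sub>v n) = 0" unfolding ab_sum by simp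
  have "row_act n B (ab n v) = 0" unfolding row_act_ab[OF n_pos v(1)] v(3) z ..
  then have "ab n v = 0" by (rule inj)
  then have "v = abinv n 0" using abinv_ab[OF n_pos v(1)] by simp
  also have "\<dots> = 0\<^sub>v n" using abinv_ab[OF n_pos, of "0\<^sub>v n"] z by simp
  finally show False using v(2) by simp
qed

text \<open>Images of monomials \<varpi>^(n q + i) have the right degree by C((x))-linearity, and
  comparison with the leading monomial extends this to all series. So the matrix is injective, keeps
  degrees, and by equality of degree sets maps each \<varpi>^k S onto itself.\<close>

lemma iwahori_of_series:
  assumes r: "\<And>i. i < n \<Longrightarrow> r i \<noteq> 0 \<and> fls_subdegree (r i) = int i"
  shows "mat_of_series r \<in> iwahori n"
proof -
  let ?B = "mat_of_series r"
  have p: "row_act n ?B f \<in> tails k" if "f \<in> tails k" for f k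
  proof -
    have "row_act n ?B (fls_X ^ i) \<in> tails (int i - 0)" if "i < n" for i
      using r[OF that] by (simp add: row_act_mat_of_series[OF that] tails_subdegree)
    from row_act_tails[OF n_pos mat_of_series_carrier this that] show ?thesis by simp
  qed
  have up: "row_act n ?B f \<notin> tails (fls_subdegree f + 1)" if f: "f \<noteq> 0" for f
  proof
    assume a: "row_act n ?B f \<in> tails (fls_subdegree f + 1)"
    define s where "s = fls_subdegree f"
    define i where "i = nat (s mod int n)"
    define q where "q = s div int n"
    have i: "i < n" "s = int n * q + int i" using n_pos by (auto simp: i_def q_def nat_less_iff)
    \<comment> \<open>The monomial in the degree of \<open>f\<close>. If the image of
      \<open>f\<close> had larger degree, so would the image of the leading term
      \<open>fls_const c * e\<close>, whose degree is known to be \<open>s\<close>.\<close>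
    define e :: "complex fls" where "e = fls_X_intpow (int n * q) * fls_X ^ i"
    have e: "e \<noteq> 0" "fls_subdegree e = s" "row_act n ?B e = fls_X_intpow (int n * q) * r i"
      using i by (auto simp: e_def row_act_X_intpow[OF n_pos mat_of_series_carrier]
        row_act_mat_of_series)
    define c where "c = fls_nth f s / fls_nth e s"
    have "fls_nth f s \<noteq> 0" "fls_nth e s \<noteq> 0"
      using f e by (metis nth_fls_subdegree_nonzero s_def)+
    then have c: "c \<noteq> 0" by (simp add: c_def)
    have "f - fls_const c * e \<in> tails (s + 1)"
      using subdegree_cancel_leading[OF f e(1)] e(2) unfolding c_def s_def by simp
    from p[OF this] have "row_act n ?B f - fls_const c * row_act n ?B e \<in> tails (s + 1)"
      by (simp add: row_act_diff[OF n_pos mat_of_series_carrier] row_act_const[OF n_pos mat_of_series_carrier])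
    from subsp_diff[OF subsp_tails _ this] a
    have "fls_const c * row_act n ?B e \<in> tails (s + 1)" unfolding s_def by fastforce
    moreover have "fls_const c * row_act n ?B e \<noteq> 0" "fls_subdegree (fls_const c * row_act n ?B e) = s"
      unfolding e(3) using c r[OF i(1)] i(2) by (auto simp: fls_subdegree_mult)
    ultimately show False by (simp add: tails_subdegree)
  qed
  have inj: "f = 0" if "row_act n ?B f = 0" for f
    using up[of f] that subsp_zero[OF subsp_tails] by fastforce
  have G: "?B \<in> carrier (loopGL n)" using mat_of_series_carrier inj by (rule loopGL_of_injective)
  have "row_act n ?B ` tails k = tails k" for k
  proof -
    have sub: "row_act n ?B ` tails k \<subseteq> tails k" using p by blast
    obtain a b where ab: "row_act n ?B ` tails k \<subseteq> tails a" "tails b \<subseteq> row_act n ?B ` tails k"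
      by (rule row_act_sandwich[OF G order_refl order_refl])
    have "degs (tails k) \<subseteq> degs (row_act n ?B ` tails k)"
    proof
      fix j assume "j \<in> degs (tails k)"
      then obtain f where f: "f \<in> tails k" "f \<noteq> 0" "fls_subdegree f = j" by (rule degsE)
      then have nz: "row_act n ?B f \<noteq> 0" using inj by blast
      have "f \<in> tails j" using f by (simp add: tails_subdegree)
      then have "row_act n ?B f \<in> tails j" by (rule p)
      then have "fls_subdegree (row_act n ?B f) = j"
        using up[OF f(2)] nz f(3) by (simp add: tails_subdegree)
      then show "j \<in> degs (row_act n ?B ` tails k)" using degsI[OF imageI[OF f(1), of "row_act n ?B"] nz] by simp
    qed
    then have "tails k = row_act n ?B ` tails k"
      by (intro eq_of_degs_subset[OF subsp_tails subsp_row_act[OF mat_of_series_carrier subsp_tails] sub ab(2)])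
    then show ?thesis ..
  qed
  then show ?thesis using iwahori_iff[OF G] by blast
qed

end

section \<open>Iwahori decomposition of the loop group\<close>

text \<open>Under \<open>ab\<close> this is the direct sum of the x^(\<nu>_i) C[[x]] v_i, indices
  from 0: an exponent n q + i occurs only from q = \<nu>_i on.\<close>

definition cochar_lattice :: "nat \<Rightarrow> int list \<Rightarrow> complex fls set" where
  "cochar_lattice n \<nu> = {f. \<forall>k. k div int n < \<nu> ! nat (k mod int n) \<longrightarrow> fls_nth f k = 0}"

section \<open>Cocharacters and normal forms of lattices\<close>

lemma x_pow_carrier: "length \<nu> = n \<Longrightarrow> x_pow \<nu> \<in> carrier_mat n n"
  by (simp add: x_pow_def)

context
  fixes n :: nat
  assumes n_pos: "0 < n"
begin

lemma nat_mod_less: "nat (k mod int n) < n"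
  using n_pos by (auto simp: nat_less_iff)

lemma int_nat_mod: "int (nat (k mod int n)) = k mod int n"
  using n_pos by simp

lemma fls_nth_row_act_x_pow:
  assumes "length \<nu> = n"
  shows "fls_nth (row_act n (x_pow \<nu>) f) k = fls_nth f (k - int n * \<nu> ! nat (k mod int n))"
proof -
  let ?r = "nat (k mod int n)"
  have "vec_index (transpose_mat (x_pow \<nu>) *\<^sub>v abinv n f) ?r =
      (\<Sum>j<n. (if j = ?r then fls_X_intpow (\<nu> ! j) else 0) * vec_index (abinv n f) j)"
    using assms nat_mod_less[of k] by (simp add: x_pow_def scalar_prod_def atLeast0LessThan)
  also have "\<dots> = (\<Sum>j<n. if j = ?r then fls_X_intpow (\<nu> ! ?r) * vec_index (abinv n f) ?r else 0)"
    by (rule sum.cong) auto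
  also have "\<dots> = fls_X_intpow (\<nu> ! ?r) * vec_index (abinv n f) ?r"
    using nat_mod_less[of k] by simp
  finally have "fls_nth (row_act n (x_pow \<nu>) f) k =
      fls_nth (vec_index (abinv n f) ?r) (k div int n - \<nu> ! ?r)"
    unfolding row_act_def fls_nth_ab[OF n_pos] by (simp only: fls_nth_X_intpow_mult)
  also have "\<dots> = fls_nth f (int n * (k div int n - \<nu> ! ?r) + k mod int n)"
    unfolding fls_nth_abinv[OF n_pos nat_mod_less] int_nat_mod ..
  also have "int n * (k div int n - \<nu> ! ?r) + k mod int n = k - int n * \<nu> ! ?r"
    by (simp add: right_diff_distrib)
  finally show ?thesis .
qed

lemma row_act_x_pow_inverse:
  assumes "length \<nu> = n"
  shows "row_act n (x_pow (map uminus \<nu>)) (row_act n (x_pow \<nu>) f) = f"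
proof (rule fls_eqI)
  fix k
  let ?r = "nat (k mod int n)"
  have "(k + int n * \<nu> ! ?r) mod int n = k mod int n" by simp
  then show "fls_nth (row_act n (x_pow (map uminus \<nu>)) (row_act n (x_pow \<nu>) f)) k = fls_nth f k"
    using assms nat_mod_less[of k] by (simp add: fls_nth_row_act_x_pow)
qed

lemma x_pow_loopGL:
  assumes "length \<nu> = n"
  shows "x_pow \<nu> \<in> carrier (loopGL n)" "loop_inv n (x_pow \<nu>) = x_pow (map uminus \<nu>)"
proof -
  have c: "x_pow \<nu> \<in> carrier_mat n n" "x_pow (map uminus \<nu>) \<in> carrier_mat n n"
    using assms by (simp_all add: x_pow_carrier)
  have "x_pow \<nu> * x_pow (map uminus \<nu>) = 1\<^sub>m n"
    by (rule mat_eq_iff_row_act[OF n_pos])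
      (use c in \<open>auto simp: row_act_mult[OF n_pos] row_act_one[OF n_pos] row_act_x_pow_inverse[OF assms]\<close>)
  from loop_inv_unique[OF c this]
  show "x_pow \<nu> \<in> carrier (loopGL n)" "loop_inv n (x_pow \<nu>) = x_pow (map uminus \<nu>)" by blast+
qed

lemma row_act_x_pow_image:
  assumes "length \<nu> = n"
  shows "row_act n (x_pow \<nu>) ` tails 0 = cochar_lattice n \<nu>"
proof
  show "row_act n (x_pow \<nu>) ` tails 0 \<subseteq> cochar_lattice n \<nu>"
  proof
    fix x assume "x \<in> row_act n (x_pow \<nu>) ` tails 0"
    then obtain f where f: "f \<in> tails 0" "x = row_act n (x_pow \<nu>) f" by blast
    have "fls_nth x k = 0" if "k div int n < \<nu> ! nat (k mod int n)" for k
    proof -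
      have "int n * (k div int n + 1) \<le> int n * \<nu> ! nat (k mod int n)"
        by (rule mult_left_mono) (use that in auto)
      then have "int n * (k div int n) + int n \<le> int n * \<nu> ! nat (k mod int n)"
        by (simp add: distrib_left)
      moreover have "k mod int n < int n" using n_pos by simp
      moreover have "k = int n * (k div int n) + k mod int n" by simp
      ultimately have "k - int n * \<nu> ! nat (k mod int n) < 0" by linarith
      then show ?thesis using f unfolding f(2) fls_nth_row_act_x_pow[OF assms] by (simp add: tails_iff)
    qed
    then show "x \<in> cochar_lattice n \<nu>" by (simp add: cochar_lattice_def)
  qed
next
  let ?m = "map uminus \<nu>"
  have len: "length ?m = n" using assms by simp
  show "cochar_lattice n \<nu> \<subseteq> row_act n (x_pow \<nu>) ` tails 0"
  proof
    fix f assume f: "f \<in> cochar_lattice n \<nu>"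
    have "fls_nth (row_act n (x_pow ?m) f) k = 0" if "k < 0" for k
    proof -
      let ?r = "nat (k mod int n)"
      have "(k + int n * \<nu> ! ?r) div int n = k div int n + \<nu> ! ?r"
        "(k + int n * \<nu> ! ?r) mod int n = k mod int n" using n_pos by simp_all
      moreover have "k div int n < 0" using n_pos that by (simp add: div_neg_pos_less0)
      ultimately have "fls_nth f (k + int n * \<nu> ! ?r) = 0"
        using f by (auto simp: cochar_lattice_def)
      then show ?thesis unfolding fls_nth_row_act_x_pow[OF len] using assms nat_mod_less[of k] by simp
    qed
    then have "row_act n (x_pow ?m) f \<in> tails 0" by (simp add: tails_iff)
    moreover have "row_act n (x_pow \<nu>) (row_act n (x_pow ?m) f) = f"
      using row_act_x_pow_inverse[OF len] by (simp add: o_def)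
    ultimately show "f \<in> row_act n (x_pow \<nu>) ` tails 0" by (metis imageI)
  qed
qed

lemma degs_cochar_lattice:
  "degs (cochar_lattice n \<nu>) = {j. \<nu> ! nat (j mod int n) \<le> j div int n}" (is "_ = ?D")
proof
  show "degs (cochar_lattice n \<nu>) \<subseteq> ?D"
  proof
    fix j assume "j \<in> degs (cochar_lattice n \<nu>)"
    then obtain f where f: "f \<in> cochar_lattice n \<nu>" "f \<noteq> 0" "fls_subdegree f = j" by (rule degsE)
    then have "fls_nth f j \<noteq> 0" using nth_fls_subdegree_nonzero by blast
    then show "j \<in> ?D" using f(1) by (auto simp: cochar_lattice_def not_less[symmetric])
  qed
  show "?D \<subseteq> degs (cochar_lattice n \<nu>)"
  proof
    fix j assume "j \<in> ?D"
    then have "fls_X_intpow j \<in> cochar_lattice n \<nu>" by (auto simp: cochar_lattice_def)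
    then show "j \<in> degs (cochar_lattice n \<nu>)" using degsI[of "fls_X_intpow j :: complex fls"] by simp
  qed
qed

lemma shift_set_multiple_subset:
  assumes "shift_set k M \<subseteq> M"
  shows "shift_set (k * int l) M \<subseteq> M"
proof (induction l)
  case (Suc l)
  have "shift_set (k * int (Suc l)) M = shift_set k (shift_set (k * int l) M)"
    by (simp add: shift_set_shift_set[OF n_pos] distrib_left)
  also have "\<dots> \<subseteq> shift_set k M" using Suc unfolding shift_set_def by blast
  finally show ?case using assms by blast
qed (simp add: shift_set_def)

text \<open>
  Elements of minimal degree in each residue class modulo \<open>n\<close> form a basis of a lattice
  over the power series in \<open>\<varpi>^n\<close>.
\<close>

lemma lattice_normal_form:
  assumes M: "subsp M" "tails b \<subseteq> M" "M \<subseteq> tails a" "shift_set (int n) M \<subseteq> M"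
  obtains B \<nu> where "B \<in> iwahori n" "length \<nu> = n" "M = row_act n B ` cochar_lattice n \<nu>"
proof -
  have stable: "j + int n * int l \<in> degs M" if "j \<in> degs M" for j l
  proof -
    have "j + int n * int l \<in> degs (shift_set (int n * int l) M)"
      unfolding degs_shift_set using that by (intro image_eqI[of _ _ j]) auto
    then show ?thesis using degs_mono[OF shift_set_multiple_subset[OF M(4), of l]] by blast
  qed
  have bound: "a \<le> j" if "j \<in> degs M" for j
    using degs_mono[OF M(3)] that unfolding degs_tails by auto
  have "\<exists>j. j \<in> degs M \<and> j mod int n = int i \<and> (\<forall>j'\<in>degs M. j' mod int n = int i \<longrightarrow> j \<le> j')"
    if i: "i < n" for i
  proof -
    let ?P = "\<lambda>m::nat. a + int m \<in> degs M \<and> (a + int m) mod int n = int i"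
    \<comment> \<open>An exponent in the residue class of i not below \<open>b\<close>, where every
      degree occurs in \<open>M\<close>; together with the lower bound \<open>a\<close> this gives
      the class a least degree.\<close>
    define j0 where "j0 = int n * max b 0 + int i"
    have "1 * max b 0 \<le> int n * max b 0" by (rule mult_right_mono) (use n_pos in auto)
    then have "b \<le> j0" by (simp add: j0_def)
    then have j0: "j0 \<in> degs M" using degs_mono[OF M(2)] unfolding degs_tails by auto
    have "j0 mod int n = int i" using i by (simp add: j0_def)
    then have "?P (nat (j0 - a))" using j0 bound[OF j0] by simp
    then have P: "?P (LEAST m. ?P m)" by (rule LeastI)
    have "a + int (LEAST m. ?P m) \<le> j'" if j': "j' \<in> degs M" "j' mod int n = int i" for j'
    proof -
      have "?P (nat (j' - a))" using j' bound[OF j'(1)] by simp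
      then have "(LEAST m. ?P m) \<le> nat (j' - a)" by (rule Least_le)
      then show ?thesis using bound[OF j'(1)] by linarith
    qed
    then show ?thesis using P by blast
  qed
  then have "\<exists>jj. \<forall>i\<in>{..<n}. jj i \<in> degs M \<and> jj i mod int n = int i \<and>
      (\<forall>j'\<in>degs M. j' mod int n = int i \<longrightarrow> jj i \<le> j')"
    by (intro bchoice) simp
  then obtain jj where jj: "\<And>i. i < n \<Longrightarrow> jj i \<in> degs M" "\<And>i. i < n \<Longrightarrow> jj i mod int n = int i"
    "\<And>i j'. i < n \<Longrightarrow> j' \<in> degs M \<Longrightarrow> j' mod int n = int i \<Longrightarrow> jj i \<le> j'" by auto
  have "\<exists>F. \<forall>i\<in>{..<n}. F i \<in> M \<and> F i \<noteq> 0 \<and> fls_subdegree (F i) = jj i"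
    by (rule bchoice) (use jj(1) in \<open>auto elim!: degsE\<close>)
  then obtain F where F: "\<And>i. i < n \<Longrightarrow> F i \<in> M \<and> F i \<noteq> 0 \<and> fls_subdegree (F i) = jj i" by auto
  define \<nu> where "\<nu> = map (\<lambda>i. jj i div int n) [0..<n]"
  have len: "length \<nu> = n" by (simp add: \<nu>_def)
  have \<nu>: "jj i = int n * \<nu> ! i + int i" if "i < n" for i
    using that jj(2)[OF that] mult_div_mod_eq[of "int n" "jj i"] by (simp add: \<nu>_def)
  \<comment> \<open>Dividing \<open>F i\<close> by a power of x moves its degree to i, as required
    of the rows of an Iwahori element.\<close>
  define r where "r i = fls_X_intpow (- (int n * \<nu> ! i)) * F i" for i
  define B where "B = mat_of_series n r"
  have B: "B \<in> iwahori n"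
    unfolding B_def
  proof (rule iwahori_of_series[OF n_pos])
    fix i assume i: "i < n"
    have "r i \<noteq> 0" unfolding r_def mult_eq_0_iff using F[OF i] fls_X_intpow_nonzero by blast
    moreover have "fls_subdegree (r i) = int i"
      unfolding r_def fls_subdegree_mult_fls_X_intpow[OF conjunct1[OF conjunct2[OF F[OF i]]]]
      using F[OF i] \<nu>[OF i] by simp
    ultimately show "r i \<noteq> 0 \<and> fls_subdegree (r i) = int i" by blast
  qed
  note BG = iwahori_loopGL[OF B]
  note Bm = loopGL_carrier_mat[OF BG]
  let ?M' = "row_act n B ` cochar_lattice n \<nu>"
  have degs: "degs M \<subseteq> degs (cochar_lattice n \<nu>)"
  proof
    fix j assume j: "j \<in> degs M"
    let ?i = "nat (j mod int n)"
    have "jj ?i \<le> j" using jj(3)[OF nat_mod_less j] int_nat_mod by simp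
    then have "jj ?i div int n \<le> j div int n" using n_pos by (intro zdiv_mono1) auto
    then show "j \<in> degs (cochar_lattice n \<nu>)"
      unfolding degs_cochar_lattice using nat_mod_less[of j] by (simp add: \<nu>_def)
  qed
  have sub: "?M' \<subseteq> M"
  proof
    fix x assume "x \<in> ?M'"
    then obtain f where f: "f \<in> cochar_lattice n \<nu>" "x = row_act n B f" by blast
    show "x \<in> M"
      unfolding f(2) row_act_expand[OF n_pos Bm, of f]
    proof (rule subsp_sum[OF M(1)])
      fix i assume "i \<in> {..<n}"
      then have i: "i < n" by simp
      let ?c = "fls_compose_power (vec_index (abinv n f) i) n"
      \<comment> \<open>The scalar of \<varpi>^i in \<open>f\<close>, divided by x^(\<nu>_i). It is
        a power series in x because \<open>f\<close> lies in the lattice of \<nu>, so multiplying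
        \<open>F i\<close> by it stays in \<open>M\<close>.\<close>
      let ?h = "fls_X_intpow (- (int n * \<nu> ! i)) * ?c"
      have nth: "fls_nth ?h k = (if int n dvd k then fls_nth f (k + int n * \<nu> ! i + int i) else 0)" for k
      proof -
        have "fls_nth ?h k = fls_nth ?c (k + int n * \<nu> ! i)"
          by (simp only: fls_nth_X_intpow_mult) simp
        moreover have dv: "int n dvd k + int n * \<nu> ! i \<longleftrightarrow> int n dvd k"
          by (rule dvd_add_left_iff) simp
        moreover have "int n * ((k + int n * \<nu> ! i) div int n) = k + int n * \<nu> ! i" if "int n dvd k"
          by (rule dvd_mult_div_cancel) (use that in simp)
        ultimately show ?thesis
          unfolding fls_nth_compose_power[OF n_pos] fls_nth_abinv[OF n_pos i] by presburger
      qed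
      have neg: "fls_nth ?h k = 0" if k: "k < 0" for k
      proof (cases "int n dvd k")
        case True
        then obtain l where l: "k = int n * l" by (elim dvdE)
        then have "l < 0" using k n_pos by (simp add: mult_less_0_iff)
        have "k + int n * \<nu> ! i + int i = int i + int n * (l + \<nu> ! i)" by (simp add: l distrib_left)
        then have "(k + int n * \<nu> ! i + int i) div int n = l + \<nu> ! i"
          "(k + int n * \<nu> ! i + int i) mod int n = int i" using i by simp_all
        then have "fls_nth f (k + int n * \<nu> ! i + int i) = 0"
          using f(1) \<open>l < 0\<close> by (simp add: cochar_lattice_def)
        then show ?thesis unfolding nth by simp
      qed (simp only: nth if_False)
      have "?h * F i \<in> M"
      proof (rule subsp_mult_closed[OF M(1-3)])
        show "?h \<in> tails 0" unfolding tails_iff using neg by blast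
        fix k assume k: "fls_nth ?h k \<noteq> 0"
        have "int n dvd k" using k unfolding nth by (simp split: if_splits)
        have "0 \<le> k" using neg[of k] k by (meson not_less)
        obtain l where l: "k = int n * l" using \<open>int n dvd k\<close> by (elim dvdE)
        have "0 \<le> l" using \<open>0 \<le> k\<close> l n_pos by (simp add: zero_le_mult_iff)
        then have kl: "k = int n * int (nat l)" using l by simp
        show "shift_set k M \<subseteq> M" unfolding kl by (rule shift_set_multiple_subset[OF M(4)])
      qed (use F[OF i] in blast)
      moreover have "?c * row_act n B (fls_X ^ i) = ?h * F i"
        unfolding B_def row_act_mat_of_series[OF n_pos i] r_def by (simp only: ac_simps)
      ultimately show "?c * row_act n B (fls_X ^ i) \<in> M" by (simp only:)
    qed
  qed
  have G: "x_pow \<nu> * B \<in> carrier (loopGL n)" by (rule loopGL_mult[OF x_pow_loopGL(1)[OF len] BG])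
  have M': "?M' = row_act n (x_pow \<nu> * B) ` tails 0"
    unfolding row_act_mult_image[OF n_pos x_pow_carrier[OF len] Bm] row_act_x_pow_image[OF len] ..
  obtain b' where b': "tails b' \<subseteq> ?M'"
    using row_act_sandwich[OF n_pos G order_refl order_refl, of 0] unfolding M' by blast
  have sp: "subsp ?M'" unfolding M' by (rule subsp_row_act[OF n_pos loopGL_carrier_mat[OF G] subsp_tails])
  \<comment> \<open>Minimality of the \<open>jj i\<close> gave the inclusion of degrees, since
    \<open>B\<close> leaves degrees unchanged.\<close>
  have "M = ?M'"
    by (rule eq_of_degs_subset[OF M(1) sp sub b']) (use degs in \<open>simp add: degs_iwahori[OF n_pos B]\<close>)
  then show thesis by (rule that[OF B len])
qed

section \<open>The decomposition of a loop and the degrees of its lattice\<close>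

lemma subsp_lattice_chain: "g \<in> carrier (loopGL n) \<Longrightarrow> subsp (lattice_chain n g k)"
  unfolding lattice_chain_def by (rule subsp_row_act[OF n_pos loop_inv_carrier_mat subsp_tails])

lemma lattice_chain_shift:
  assumes "g \<in> carrier (loopGL n)"
  shows "lattice_chain n g (int n * l + k) = shift_set (int n * l) (lattice_chain n g k)"
  unfolding lattice_chain_def row_act_shift_image[OF n_pos loop_inv_carrier_mat[OF assms], symmetric]
    shift_set_shift_set[OF n_pos] ..

lemma lattice_chain_mono: "k \<le> l \<Longrightarrow> lattice_chain n g l \<subseteq> lattice_chain n g k"
  unfolding lattice_chain_def by (rule image_mono[OF tails_mono])

text \<open>If the lattice of \<open>g\<close> is the lattice of \<nu> acted on by B, then x^\<nu> B
  g maps S onto S, hence is an element k of the arc group. Solving for \<open>g\<close> gives \<mu>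
  = - \<nu>: the sign comes from the inverse in the definition of the lattice.\<close>

lemma loopGL_decomposition:
  assumes g: "g \<in> carrier (loopGL n)"
  obtains b \<mu> k where "b \<in> iwahori n" "length \<mu> = n" "k \<in> arcGL n" "g = b * x_pow \<mu> * k"
proof -
  let ?M = "lattice_chain n g 0"
  obtain a c where ac: "?M \<subseteq> tails a" "tails c \<subseteq> ?M"
    using row_act_sandwich[OF n_pos loop_inv_closed[OF g] order_refl order_refl, of 0]
    unfolding lattice_chain_def by blast
  have "shift_set (int n) ?M = lattice_chain n g (int n)"
    using lattice_chain_shift[OF g, of 1 0] by simp
  also have "\<dots> \<subseteq> ?M" by (rule lattice_chain_mono) simp
  finally obtain B \<nu> where B: "B \<in> iwahori n" and len: "length \<nu> = n"
    and M: "?M = row_act n B ` cochar_lattice n \<nu>"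
    by (rule lattice_normal_form[OF subsp_lattice_chain[OF g] ac(2,1)])
  note BG = iwahori_loopGL[OF B]
  note xG = x_pow_loopGL[OF len]
  define k where "k = x_pow \<nu> * B * g"
  have xB: "x_pow \<nu> * B \<in> carrier (loopGL n)" by (rule loopGL_mult[OF xG(1) BG])
  have kG: "k \<in> carrier (loopGL n)" unfolding k_def by (rule loopGL_mult[OF xB g])
  have "row_act n k ` tails 0 = row_act n g ` ?M"
    unfolding k_def M row_act_mult_image[OF n_pos loopGL_carrier_mat[OF xB] loopGL_carrier_mat[OF g]]
      row_act_mult_image[OF n_pos x_pow_carrier[OF len] loopGL_carrier_mat[OF BG]]
      row_act_x_pow_image[OF len] ..
  also have "\<dots> = tails 0" unfolding lattice_chain_def by (rule row_act_inv_image(2)[OF n_pos g])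
  finally have k: "k \<in> arcGL n" using arcGL_iff[OF n_pos kG] by blast
  have "loop_inv n B * x_pow (map uminus \<nu>) * k = loop_inv n (x_pow \<nu> * B) * (x_pow \<nu> * B * g)"
    unfolding loop_inv_mult[OF xG(1) BG] xG(2) k_def ..
  also have "\<dots> = loop_inv n (x_pow \<nu> * B) * (x_pow \<nu> * B) * g"
    by (rule assoc_mult_mat[symmetric, of _ n n _ n _ n])
      (use xB g in \<open>auto intro: loopGL_carrier_mat loop_inv_carrier_mat\<close>)
  also have "\<dots> = g" unfolding loop_inv_left[OF xB] using loopGL_carrier_mat[OF g] by simp
  finally have "g = loop_inv n B * x_pow (map uminus \<nu>) * k" ..
  then show thesis using that[of "loop_inv n B" "map uminus \<nu>" k] iwahori_inv[OF n_pos B] len k by simp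
qed

lemma lattice_chain_decomposition:
  assumes "b \<in> iwahori n" "length \<mu> = n" "k \<in> arcGL n"
  shows "lattice_chain n (b * x_pow \<mu> * k) 0 =
    row_act n (loop_inv n b) ` cochar_lattice n (map uminus \<mu>)"
proof -
  note bG = iwahori_loopGL[OF assms(1)] and kG = arcGL_loopGL[OF assms(3)]
    and xG = x_pow_loopGL[OF assms(2)]
  have len: "length (map uminus \<mu>) = n" using assms(2) by simp
  have bx: "b * x_pow \<mu> \<in> carrier (loopGL n)" by (rule loopGL_mult[OF bG xG(1)])
  have "loop_inv n (b * x_pow \<mu> * k) = loop_inv n k * (x_pow (map uminus \<mu>) * loop_inv n b)"
    unfolding loop_inv_mult[OF bx kG] loop_inv_mult[OF bG xG(1)] xG(2) ..
  moreover have "row_act n (loop_inv n k) ` tails 0 = tails 0"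
    using arcGL_inv[OF n_pos assms(3)] arcGL_iff[OF n_pos loop_inv_closed[OF kG]] by blast
  moreover have "x_pow (map uminus \<mu>) * loop_inv n b \<in> carrier_mat n n"
    using x_pow_carrier[OF len] loop_inv_carrier_mat[OF bG] by (rule mult_carrier_mat)
  ultimately show ?thesis
    unfolding lattice_chain_def
    by (simp add: row_act_mult_image[OF n_pos] loop_inv_carrier_mat[OF bG] loop_inv_carrier_mat[OF kG]
        x_pow_carrier[OF len] row_act_x_pow_image[OF len])
qed

lemma degs_lattice_chain:
  assumes "b \<in> iwahori n" "length \<mu> = n" "k \<in> arcGL n"
  shows "degs (lattice_chain n (b * x_pow \<mu> * k) 0) = {j. - \<mu> ! nat (j mod int n) \<le> j div int n}"
  unfolding lattice_chain_decomposition[OF assms] degs_iwahori[OF n_pos iwahori_inv[OF n_pos assms(1)]]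
    degs_cochar_lattice using nat_mod_less assms(2) by simp

text \<open>The exponents n q + i missing in the class of i have - N \<le> q < \<nu>_i, so there are
  \<nu>_i + N of them.\<close>

lemma card_degs_complement:
  assumes len: "length \<nu> = n" and N: "\<And>i. i < n \<Longrightarrow> - N \<le> \<nu> ! i"
  shows "int (card ({- (int n * N)..} - {j. \<nu> ! nat (j mod int n) \<le> j div int n})) =
    int n * N + sum_list \<nu>"
proof -
  let ?S = "SIGMA i:{..<n}. {- N..<\<nu> ! i}"
  let ?f = "\<lambda>(i, q). int n * q + int i"
  have dm: "(int n * q + int i) div int n = q" "(int n * q + int i) mod int n = int i" if "i < n" for i q
    using that by simp_all
  have inj: "inj_on ?f ?S"
  proof (rule inj_onI, clarsimp)
    fix i q i' q' assume a: "i < n" "i' < n" "int n * q + int i = int n * q' + int i'"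
    show "i = i' \<and> q = q'" using dm[OF a(1), of q] dm[OF a(2), of q'] a(3) by simp
  qed
  have img: "?f ` ?S = {- (int n * N)..} - {j. \<nu> ! nat (j mod int n) \<le> j div int n}"
  proof
    show "?f ` ?S \<subseteq> {- (int n * N)..} - {j. \<nu> ! nat (j mod int n) \<le> j div int n}"
    proof
      fix x assume "x \<in> ?f ` ?S"
      then obtain i q where x: "x = int n * q + int i" and a: "i < n" "- N \<le> q" "q < \<nu> ! i" by auto
      have "int n * - N \<le> int n * q" by (rule mult_left_mono) (use a in auto)
      then show "x \<in> {- (int n * N)..} - {j. \<nu> ! nat (j mod int n) \<le> j div int n}"
        using a by (simp add: x dm not_le)
    qed
    show "{- (int n * N)..} - {j. \<nu> ! nat (j mod int n) \<le> j div int n} \<subseteq> ?f ` ?S"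
    proof
      fix j assume j: "j \<in> {- (int n * N)..} - {j. \<nu> ! nat (j mod int n) \<le> j div int n}"
      have "(int n * - N) div int n \<le> j div int n" using j n_pos by (intro zdiv_mono1) auto
      moreover have "(int n * - N) div int n = - N" using n_pos by (intro nonzero_mult_div_cancel_left) simp
      ultimately have "- N \<le> j div int n" by (simp only:)
      then have "(nat (j mod int n), j div int n) \<in> ?S" using j nat_mod_less by auto
      moreover have "j = ?f (nat (j mod int n), j div int n)" using int_nat_mod by simp
      ultimately show "j \<in> ?f ` ?S" by (rule rev_image_eqI)
    qed
  qed
  have "card (?f ` ?S) = (\<Sum>i<n. nat (\<nu> ! i + N))"
    unfolding card_image[OF inj] by (subst card_SigmaI) auto
  then have "int (card (?f ` ?S)) = (\<Sum>i<n. \<nu> ! i + N)"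
  proof -
    have "(\<Sum>i<n. int (nat (\<nu> ! i + N))) = (\<Sum>i<n. \<nu> ! i + N)"
    proof (rule sum.cong[OF refl])
      fix i assume "i \<in> {..<n}"
      then show "int (nat (\<nu> ! i + N)) = \<nu> ! i + N" using N[of i] by simp
    qed
    then show ?thesis using \<open>card (?f ` ?S) = _\<close> by simp
  qed
  also have "\<dots> = int n * N + sum_list \<nu>"
    by (simp add: sum.distrib sum_list_sum_nth len atLeast0LessThan)
  finally show ?thesis unfolding img .
qed

end

section \<open>The curve singularity and its compactified Jacobian\<close>

definition val_semigroup :: "nat \<Rightarrow> nat \<Rightarrow> int set" where
  "val_semigroup n d = {k. \<exists>i j. k = int (n * i + d * j)}"

lemma tails_0: "tails 0 = pow_ser"
  by (auto simp: tails_iff pow_ser_iff)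

lemma shift_set_mono: "V \<subseteq> W \<Longrightarrow> shift_set k V \<subseteq> shift_set k W"
  unfolding shift_set_def by blast

lemma shift_set_comm: "shift_set k (shift_set l V) = shift_set l (shift_set k V)"
  unfolding shift_set_def image_image mult.left_commute[of "fls_X_intpow k"] ..

lemma shift_set_subset_iff: "shift_set k V \<subseteq> shift_set k W \<longleftrightarrow> V \<subseteq> W"
proof
  assume a: "shift_set k V \<subseteq> shift_set k W"
  show "V \<subseteq> W"
  proof
    fix f assume "f \<in> V"
    then have "fls_X_intpow k * f \<in> shift_set k V" unfolding shift_set_def by blast
    then have "fls_X_intpow k * f \<in> shift_set k W" using a by blast
    then show "f \<in> W" unfolding shift_set_iff[of _ k] by (simp only: fls_X_intpow_cancel')
  qed
qed (rule shift_set_mono)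

lemma shift_set_tails: "shift_set k (tails l) = tails (k + l)"
proof -
  have "f \<in> shift_set k (tails l) \<longleftrightarrow> f \<in> tails (k + l)" for f
    unfolding shift_set_iff[of f k] X_intpow_mult_tails by (simp add: add.commute)
  then show ?thesis by blast
qed

lemma card_complement_shift:
  fixes a a' b :: int
  assumes "D \<subseteq> {a..}" "a' \<le> a" "{b..} \<subseteq> D"
  shows "int (card ({a'..} - D)) = int (card ({a..} - D)) + (a - a')"
proof -
  have "{a..} - D \<subseteq> {a..<b}"
  proof
    fix x assume "x \<in> {a..} - D"
    then show "x \<in> {a..<b}" using assms(3) by (cases "b \<le> x") auto
  qed
  then have fin: "finite ({a..} - D)" by (rule finite_subset) simp
  have eq: "{a'..} - D = {a'..<a} \<union> ({a..} - D)" using assms(1,2) by auto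
  have "card ({a'..} - D) = card {a'..<a} + card ({a..} - D)"
    unfolding eq by (rule card_Un_disjoint) (use fin in auto)
  then show ?thesis using assms(2) by simp
qed

lemma lin_span_const_iff: "lin_span (range fls_const) V = V \<longleftrightarrow> subsp V"
proof
  assume a: "lin_span (range fls_const) V = V"
  have mem: "(\<Sum>t\<in>T. a t * t) \<in> V" if "finite T" "T \<subseteq> V" "a ` T \<subseteq> range fls_const" for T a
    using a that unfolding lin_span_def by blast
  show "subsp V"
    unfolding subsp_def
  proof (intro conjI ballI allI)
    show "0 \<in> V" using mem[of "{}" "\<lambda>_. 0"] by simp
    fix c f assume "f \<in> V"
    then show "fls_const c * f \<in> V" using mem[of "{f}" "\<lambda>_. fls_const c"] by simp
  next
    fix f g assume f: "f \<in> V" and g: "g \<in> V"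
    show "f + g \<in> V"
    \<comment> \<open>\<open>lin_span\<close> sums over a set, in which equal summands would merge;
      the case \<open>f = g\<close> is the multiple by 2.\<close>
    proof (cases "f = g")
      case True
      have "fls_const 2 * f \<in> V" using mem[of "{f}" "\<lambda>_. fls_const 2"] f by (simp del: fls_const_numeral)
      moreover have "fls_const 2 * f = f + g" unfolding True by (simp add: fls_eq_iff)
      ultimately show ?thesis by simp
    next
      case False
      have "fls_const 1 \<in> range (fls_const :: complex \<Rightarrow> complex fls)" by blast
      then have "(\<Sum>t\<in>{f, g}. fls_const 1 * t) \<in> V" using f g by (intro mem) auto
      then show ?thesis using False by simp
    qed
  qed
next
  assume V: "subsp V"
  show "lin_span (range fls_const) V = V"
  proof
    show "lin_span (range fls_const) V \<subseteq> V"
    proof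
      fix f assume "f \<in> lin_span (range fls_const) V"
      then obtain T a where f: "f = (\<Sum>t\<in>T. a t * t)" "T \<subseteq> V" "a ` T \<subseteq> range fls_const"
        unfolding lin_span_def by blast
      have "a t * t \<in> V" if t: "t \<in> T" for t
      proof -
        obtain c where "a t = fls_const c" using f(3) t by blast
        then show ?thesis using subsp_scale[OF V] f(2) t by auto
      qed
      then show "f \<in> V" unfolding f(1) by (rule subsp_sum[OF V])
    qed
    show "V \<subseteq> lin_span (range fls_const) V"
    proof
      fix f assume f: "f \<in> V"
      have "f = (\<Sum>t\<in>{f}. fls_const 1 * t)" by simp
      then show "f \<in> lin_span (range fls_const) V"
        unfolding lin_span_def using f
        by (intro CollectI exI[of _ "{f}"] exI[of _ "\<lambda>_. fls_const 1"]) auto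
    qed
  qed
qed

context
  fixes n d :: nat
  assumes n_pos: "0 < n" and d_pos: "0 < d" and cop: "coprime n d"
begin

section \<open>The semigroup of values and the ring of the curve\<close>

lemma val_semigroup_nonneg: "k \<in> val_semigroup n d \<Longrightarrow> 0 \<le> k"
  by (auto simp: val_semigroup_def)

text \<open>Choose j < n with d j congruent to k modulo n; then d j < n d \<le> k, and k - d j is a
  multiple of n. The bound n d is cruder than the conductor (n - 1)(d - 1).\<close>

lemma val_semigroup_large:
  assumes "int (n * d) \<le> k"
  shows "k \<in> val_semigroup n d"
proof -
  obtain x where x: "[d * x = nat k] (mod n)"
  proof -
    obtain y where "[d * y = 1] (mod n)"
      using cong_solve_coprime_nat[of d n] cop by (auto simp: coprime_commute)
    then have "[d * y * nat k = 1 * nat k] (mod n)" by (rule cong_scalar_right)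
    then show thesis using that[of "y * nat k"] by (simp add: mult.assoc)
  qed
  define j where "j = x mod n"
  have "[d * j = d * x] (mod n)" unfolding j_def by (simp add: cong_def mod_mult_right_eq)
  then have c: "[nat k = d * j] (mod n)" using x by (meson cong_trans cong_sym)
  have "d * j \<le> d * n" unfolding j_def using n_pos by (intro mult_left_mono) (auto intro: less_imp_le)
  then have "int (d * j) \<le> int (n * d)" unfolding of_nat_le_iff by (simp only: mult.commute)
  then have le: "d * j \<le> nat k" using assms by linarith
  have "n dvd nat k - d * j" using c le by (simp add: cong_altdef_nat)
  then obtain i where "nat k - d * j = n * i" by (elim dvdE)
  then have "nat k = n * i + d * j" using le by simp
  moreover have "0 \<le> k" using assms by (meson of_nat_0_le_iff order_trans)
  ultimately have "k = int (n * i + d * j)" by (metis nat_0_le)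
  then show ?thesis unfolding val_semigroup_def by blast
qed

lemma curve_ring_iff: "f \<in> curve_ring n d \<longleftrightarrow> (\<forall>k. fls_nth f k \<noteq> 0 \<longrightarrow> k \<in> val_semigroup n d)"
proof
  assume "f \<in> curve_ring n d"
  then obtain c :: "nat \<Rightarrow> nat \<Rightarrow> complex" where c: "\<And>k. fls_nth f k = (\<Sum>(i, j)\<in>{(i, j). int (n * i + d * j) = k}. c i j)"
    unfolding curve_ring_def by blast
  show "\<forall>k. fls_nth f k \<noteq> 0 \<longrightarrow> k \<in> val_semigroup n d"
  proof (intro allI impI)
    fix k assume "fls_nth f k \<noteq> 0"
    then have "{(i, j). int (n * i + d * j) = k} \<noteq> {}" unfolding c by (metis sum.empty)
    then show "k \<in> val_semigroup n d" unfolding val_semigroup_def by auto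
  qed
next
  assume *: "\<forall>k. fls_nth f k \<noteq> 0 \<longrightarrow> k \<in> val_semigroup n d"
  let ?S = "\<lambda>k. {(i, j). int (n * i + d * j) = k}"
  define rep where "rep k = (SOME p. p \<in> ?S k)" for k
  \<comment> \<open>An exponent may have several representations n i + d j; the whole coefficient is
    placed at one chosen representation so that the sum over all of them returns it.\<close>
  define c where "c i j = (if rep (int (n * i + d * j)) = (i, j) then fls_nth f (int (n * i + d * j)) else 0)" for i j
  have "fls_nth f k = (\<Sum>(i, j)\<in>?S k. c i j)" for k
  proof -
    have fin: "finite (?S k)"
    proof (rule finite_subset)
      show "?S k \<subseteq> {..nat k} \<times> {..nat k}"
      proof
        fix p assume "p \<in> ?S k"
        then obtain i j where p: "p = (i, j)" and "k = int (n * i + d * j)" by blast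
        then have "nat k = n * i + d * j" by (simp only: nat_int)
        moreover have "i \<le> n * i" "j \<le> d * j" using n_pos d_pos by simp_all
        ultimately have "i \<le> nat k" "j \<le> nat k" by linarith+
        then show "p \<in> {..nat k} \<times> {..nat k}" unfolding p by simp
      qed
    qed simp
    have "(\<Sum>(i, j)\<in>?S k. c i j) = (\<Sum>p\<in>?S k. if p = rep k then fls_nth f k else 0)"
    proof (rule sum.cong[OF refl])
      fix p assume "p \<in> ?S k"
      then obtain i j where p: "p = (i, j)" and k: "int (n * i + d * j) = k" by blast
      have "c i j = (if rep k = (i, j) then fls_nth f k else 0)" unfolding c_def k ..
      then show "(case p of (i, j) \<Rightarrow> c i j) = (if p = rep k then fls_nth f k else 0)"
        unfolding p prod.case by (simp only: eq_commute)
    qed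
    also have "\<dots> = (if rep k \<in> ?S k then fls_nth f k else 0)" using fin by simp
    also have "\<dots> = fls_nth f k"
    proof (cases "fls_nth f k = 0")
      case False
      then have "\<exists>p. p \<in> ?S k" using * unfolding val_semigroup_def by fastforce
      then have "rep k \<in> ?S k" unfolding rep_def by (rule someI_ex)
      then show ?thesis by simp
    qed simp
    finally show ?thesis ..
  qed
  then show "f \<in> curve_ring n d" unfolding curve_ring_def by blast
qed

lemma subsp_curve_ring: "subsp (curve_ring n d)"
  unfolding subsp_def
proof (intro conjI ballI allI)
  fix f g c assume f: "f \<in> curve_ring n d" and g: "g \<in> curve_ring n d"
  have "k \<in> val_semigroup n d" if "fls_nth (f + g) k \<noteq> 0" for k
  proof -
    have "fls_nth f k \<noteq> 0 \<or> fls_nth g k \<noteq> 0" using that by auto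
    then show ?thesis using f g curve_ring_iff by blast
  qed
  then show "f + g \<in> curve_ring n d" using curve_ring_iff by blast
next
  fix f c assume f: "f \<in> curve_ring n d"
  have "k \<in> val_semigroup n d" if "fls_nth (fls_const c * f) k \<noteq> 0" for k
  proof -
    have "fls_nth f k \<noteq> 0" using that by auto
    then show ?thesis using f curve_ring_iff by blast
  qed
  then show "fls_const c * f \<in> curve_ring n d" using curve_ring_iff by blast
qed (simp add: curve_ring_iff)

lemma curve_ring_tails: "curve_ring n d \<subseteq> tails 0" "tails (int (n * d)) \<subseteq> curve_ring n d"
proof -
  show "curve_ring n d \<subseteq> tails 0"
  proof
    fix f assume f: "f \<in> curve_ring n d"
    have "fls_nth f k = 0" if "k < 0" for k
      using f that val_semigroup_nonneg[of k] curve_ring_iff[of f] by (meson not_less)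
    then show "f \<in> tails 0" by (simp add: tails_iff)
  qed
  show "tails (int (n * d)) \<subseteq> curve_ring n d"
  proof
    fix f assume f: "f \<in> tails (int (n * d))"
    have "k \<in> val_semigroup n d" if "fls_nth f k \<noteq> 0" for k
      using f that val_semigroup_large[of k] unfolding tails_iff by (meson not_less)
    then show "f \<in> curve_ring n d" using curve_ring_iff by blast
  qed
qed

lemma degs_curve_ring: "degs (curve_ring n d) = val_semigroup n d"
proof
  show "degs (curve_ring n d) \<subseteq> val_semigroup n d"
    unfolding degs_def using curve_ring_iff nth_fls_subdegree_nonzero by blast
  show "val_semigroup n d \<subseteq> degs (curve_ring n d)"
  proof
    fix j assume "j \<in> val_semigroup n d"
    then have "fls_X_intpow j \<in> curve_ring n d" by (auto simp: curve_ring_iff)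
    then show "j \<in> degs (curve_ring n d)" using degsI[of "fls_X_intpow j :: complex fls"] by simp
  qed
qed

lemma val_semigroup_ge: "{int (n * d)..} \<subseteq> val_semigroup n d"
  using val_semigroup_large by auto

lemma delta_eq: "delta n d = card ({0..} - val_semigroup n d)"
proof -
  have "quot_dim (tails 0) (curve_ring n d) = card ({0..} - val_semigroup n d)"
    using quot_dim_degs[OF subsp_tails order_refl subsp_curve_ring curve_ring_tails]
    unfolding degs_tails degs_curve_ring .
  then show ?thesis unfolding delta_def tails_0 .
qed

lemma quot_dim_tails_curve_ring:
  "quot_dim (tails (- int i)) (curve_ring n d) = i + delta n d"
proof -
  have "tails 0 \<subseteq> tails (- int i)" by (rule tails_mono) simp
  then have "curve_ring n d \<subseteq> tails (- int i)" using curve_ring_tails(1) by blast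
  from quot_dim_degs[OF subsp_tails order_refl subsp_curve_ring this curve_ring_tails(2)]
  have "quot_dim (tails (- int i)) (curve_ring n d) = card ({- int i..} - val_semigroup n d)"
    by (simp add: degs_tails degs_curve_ring)
  moreover have "int (card ({- int i..} - val_semigroup n d)) =
      int (card ({0..} - val_semigroup n d)) + (0 - - int i)"
    by (rule card_complement_shift[OF _ _ val_semigroup_ge]) (auto dest: val_semigroup_nonneg)
  ultimately show ?thesis unfolding delta_eq by linarith
qed

lemma shift_val_semigroup:
  assumes "shift_set (int n) M \<subseteq> M" "shift_set (int d) M \<subseteq> M" "k \<in> val_semigroup n d"
  shows "shift_set k M \<subseteq> M"
proof -
  obtain i j where k: "k = int n * int i + int d * int j" using assms(3) unfolding val_semigroup_def by auto
  have "shift_set k M = shift_set (int n * int i) (shift_set (int d * int j) M)"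
    unfolding k shift_set_shift_set[OF n_pos] ..
  also have "\<dots> \<subseteq> shift_set (int n * int i) M"
    by (rule shift_set_mono[OF shift_set_multiple_subset[OF n_pos assms(2)]])
  also have "\<dots> \<subseteq> M" by (rule shift_set_multiple_subset[OF n_pos assms(1)])
  finally show ?thesis .
qed

lemma X_intpow_curve_ring: "k \<in> val_semigroup n d \<Longrightarrow> fls_X_intpow k \<in> curve_ring n d"
  by (auto simp: curve_ring_iff)

lemma n_val_semigroup: "int n \<in> val_semigroup n d" and d_val_semigroup: "int d \<in> val_semigroup n d"
  unfolding val_semigroup_def by (force intro: exI[of _ 1] exI[of _ 0])+

text \<open>\<open>subsp_mult_closed\<close> with the ring itself as the subspace: the monomials of
  \<open>f\<close> have exponents in the semigroup, and these shift the ring into itself.\<close>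

lemma curve_ring_mult:
  assumes "f \<in> curve_ring n d" "g \<in> curve_ring n d"
  shows "f * g \<in> curve_ring n d"
proof -
  have closed: "shift_set k (curve_ring n d) \<subseteq> curve_ring n d" if k: "k \<in> val_semigroup n d" for k
  proof
    fix h assume "h \<in> shift_set k (curve_ring n d)"
    then obtain h' where h': "h' \<in> curve_ring n d" "h = fls_X_intpow k * h'" unfolding shift_set_def by blast
    have "l \<in> val_semigroup n d" if "fls_nth h l \<noteq> 0" for l
    proof -
      have "fls_nth h' (l - k) \<noteq> 0" using that unfolding h'(2) by (simp only: fls_nth_X_intpow_mult) simp
      then have "l - k \<in> val_semigroup n d" using h'(1) curve_ring_iff by blast
      then obtain i j where "l - k = int (n * i + d * j)" unfolding val_semigroup_def by blast
      moreover obtain i' j' where "k = int (n * i' + d * j')" using k unfolding val_semigroup_def by blast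
      ultimately have "l = int (n * (i + i') + d * (j + j'))" by (simp add: algebra_simps)
      then show ?thesis unfolding val_semigroup_def by blast
    qed
    then show "h \<in> curve_ring n d" using curve_ring_iff by blast
  qed
  show ?thesis
    by (rule subsp_mult_closed[OF subsp_curve_ring curve_ring_tails(2,1) _ _ assms(2)])
      (use assms(1) curve_ring_iff curve_ring_tails closed in blast)+
qed

section \<open>Finitely generated modules over the curve ring\<close>

lemma Jbar_submodule:
  assumes M: "M = lin_span (curve_ring n d) T" "finite T" and span: "lin_span UNIV M = UNIV"
  shows "subsp M" "\<exists>b. tails b \<subseteq> M" "\<exists>a. M \<subseteq> tails a"
    "shift_set (int n) M \<subseteq> M" "shift_set (int d) M \<subseteq> M"
proof -
  let ?R = "curve_ring n d"
  have M_iff: "f \<in> M \<longleftrightarrow> (\<exists>a. a ` T \<subseteq> ?R \<and> f = (\<Sum>t\<in>T. a t * t))" for f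
  proof
    assume "f \<in> M"
    then obtain T' a where a: "f = (\<Sum>t\<in>T'. a t * t)" "T' \<subseteq> T" "a ` T' \<subseteq> ?R"
      unfolding M(1) lin_span_def by blast
    \<comment> \<open>\<open>lin_span\<close> lets the set of summands vary; extension by 0 makes
      all combinations range over the whole of \<open>T\<close>.\<close>
    define a' where "a' t = (if t \<in> T' then a t else 0)" for t
    have "(\<Sum>t\<in>T. a' t * t) = (\<Sum>t\<in>T'. a t * t)"
      by (rule sum.mono_neutral_cong_right) (use a(2) M(2) in \<open>auto simp: a'_def\<close>)
    moreover have "a' ` T \<subseteq> ?R" using a(3) subsp_zero[OF subsp_curve_ring] by (auto simp: a'_def)
    ultimately show "\<exists>a. a ` T \<subseteq> ?R \<and> f = (\<Sum>t\<in>T. a t * t)" using a(1) by metis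
  qed (use M in \<open>auto simp: lin_span_def\<close>)
  have mult: "r * f \<in> M" if r: "r \<in> ?R" and f: "f \<in> M" for r f
  proof -
    obtain a where a: "a ` T \<subseteq> ?R" "f = (\<Sum>t\<in>T. a t * t)" using f M_iff by blast
    have "r * f = (\<Sum>t\<in>T. (r * a t) * t)" unfolding a(2) sum_distrib_left by (simp add: mult.assoc)
    moreover have "(\<lambda>t. r * a t) ` T \<subseteq> ?R" using curve_ring_mult r a(1) by blast
    ultimately show ?thesis unfolding M_iff by (intro exI[of _ "\<lambda>t. r * a t"]) simp
  qed
  show "subsp M"
    unfolding subsp_def
  proof (intro conjI ballI allI)
    show "0 \<in> M" unfolding M_iff
      by (rule exI[of _ "\<lambda>_. 0"]) (use subsp_zero[OF subsp_curve_ring] in auto)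
    fix f assume f: "f \<in> M"
    have "fls_const c \<in> ?R" for c :: complex
      unfolding curve_ring_iff val_semigroup_def by (auto intro!: exI[of _ 0])
    then show "fls_const c * f \<in> M" for c using mult f by blast
    fix g assume "g \<in> M"
    then obtain b where b: "b ` T \<subseteq> ?R" "g = (\<Sum>t\<in>T. b t * t)" using M_iff by blast
    obtain a where a: "a ` T \<subseteq> ?R" "f = (\<Sum>t\<in>T. a t * t)" using f M_iff by blast
    have "(\<lambda>t. a t + b t) ` T \<subseteq> ?R" using a(1) b(1) subsp_add[OF subsp_curve_ring] by blast
    then show "f + g \<in> M" unfolding M_iff a(2) b(2)
      by (intro exI[of _ "\<lambda>t. a t + b t"]) (simp add: distrib_right sum.distrib)
  qed
  show "shift_set (int n) M \<subseteq> M" "shift_set (int d) M \<subseteq> M"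
    unfolding shift_set_def
    using mult X_intpow_curve_ring[OF n_val_semigroup] X_intpow_curve_ring[OF d_val_semigroup] by blast+
  obtain m where m: "m \<in> M" "m \<noteq> 0"
  proof (rule ccontr)
    assume "\<not> thesis"
    then have "M \<subseteq> {0}" using that by blast
    then have "f = 0" if "f \<in> lin_span UNIV M" for f
      using that unfolding lin_span_def by (auto intro!: sum.neutral)
    then have "(1 :: complex fls) = 0" unfolding span by blast
    then show False by simp
  qed
  show "\<exists>b. tails b \<subseteq> M"
  proof (intro exI subsetI)
    \<comment> \<open>Any nonzero \<open>m\<close> of \<open>M\<close> serves: \<open>f / m\<close>
      is zero or of degree at least n d, so it lies in the ring, and \<open>f\<close> is its product
      with \<open>m\<close>.\<close>
    fix f assume f: "f \<in> tails (int (n * d) + fls_subdegree m)"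
    have "f / m \<in> tails (int (n * d))"
    proof (cases "f = 0")
      case False
      then have "f / m \<noteq> 0" "fls_subdegree (f / m) = fls_subdegree f - fls_subdegree m"
        using m by (auto simp: fls_divide_subdegree)
      then show ?thesis using f False by (simp add: tails_subdegree)
    qed (simp add: tails_iff)
    then have "f / m * m \<in> M" using curve_ring_tails(2) mult m(1) by blast
    then show "f \<in> M" using m(2) by simp
  qed
  define a where "a = Min (insert 0 (fls_subdegree ` T))"
  have "a \<le> fls_subdegree t" if "t \<in> T" for t
    unfolding a_def using that M(2) by (intro Min_le) auto
  then have T: "t \<in> tails a" if "t \<in> T" for t
    using that unfolding tails_iff by (meson fls_eq0_below_subdegree order_less_le_trans)
  have "M \<subseteq> tails a"
  proof
    fix f assume "f \<in> M"
    then obtain c where c: "c ` T \<subseteq> ?R" "f = (\<Sum>t\<in>T. c t * t)" using M_iff by blast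
    have "c t * t \<in> tails a" if "t \<in> T" for t
      using tails_mult[of "c t" 0 t a] T[OF that] c(1) curve_ring_tails(1) that by auto
    then show "f \<in> tails a" unfolding c(2) by (rule subsp_sum[OF subsp_tails])
  qed
  then show "\<exists>a. M \<subseteq> tails a" by blast
qed

text \<open>The elements of least degree in the n residue classes generate \<open>M\<close> already
  over the power series in x, which form a subring of R.\<close>

lemma submodule_finitely_generated:
  assumes M: "subsp M" "tails b \<subseteq> M" "M \<subseteq> tails a" "shift_set (int n) M \<subseteq> M" "shift_set (int d) M \<subseteq> M"
  shows "\<exists>T. finite T \<and> M = lin_span (curve_ring n d) T"
proof -
  let ?R = "curve_ring n d"
  obtain B \<nu> where B: "B \<in> iwahori n" and len: "length \<nu> = n" and MB: "M = row_act n B ` cochar_lattice n \<nu>"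
    by (rule lattice_normal_form[OF n_pos M(1-4)])
  note Bm = loopGL_carrier_mat[OF iwahori_loopGL[OF B]]
  define F where "F i = row_act n B (fls_X_intpow (int n * \<nu> ! i) * fls_X ^ i)" for i
  have FM: "F i \<in> M" if i: "i < n" for i
  proof -
    have "fls_X_intpow (int n * \<nu> ! i) * fls_X ^ i \<in> cochar_lattice n \<nu>"
      unfolding cochar_lattice_def
    proof (intro CollectI allI impI)
      fix k assume k: "k div int n < \<nu> ! nat (k mod int n)"
      have "k \<noteq> int n * \<nu> ! i + int i"
      proof
        assume e: "k = int n * \<nu> ! i + int i"
        have "k div int n = \<nu> ! i" "k mod int n = int i" unfolding e using i by simp_all
        then show False using k by simp
      qed
      then show "fls_nth (fls_X_intpow (int n * \<nu> ! i) * fls_X ^ i) k = (0 :: complex)"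
        by (simp only: fls_nth_X_intpow_mult) auto
    qed
    then show ?thesis unfolding MB F_def by blast
  qed
  \<comment> \<open>Coefficients in \<open>lin_span\<close> are attached to the generators
    themselves, so these must be pairwise distinct; their degrees differ modulo n.\<close>
  have inj: "inj_on F {..<n}"
  proof (rule inj_onI)
    fix i j assume ij: "i \<in> {..<n}" "j \<in> {..<n}" "F i = F j"
    have "fls_subdegree (F i) = int n * \<nu> ! i + int i" for i
      unfolding F_def iwahori_subdegree[OF n_pos B]
      by (subst fls_subdegree_mult_fls_X_intpow) auto
    then have "(int n * \<nu> ! i + int i) mod int n = (int n * \<nu> ! j + int j) mod int n" using ij(3) by metis
    then show "i = j" using ij by simp
  qed
  have "M = lin_span ?R (F ` {..<n})"
  proof
    show "lin_span ?R (F ` {..<n}) \<subseteq> M"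
    proof
      fix f assume "f \<in> lin_span ?R (F ` {..<n})"
      then obtain T c where f: "f = (\<Sum>t\<in>T. c t * t)" "T \<subseteq> F ` {..<n}" "c ` T \<subseteq> ?R"
        unfolding lin_span_def by blast
      have "c t * t \<in> M" if t: "t \<in> T" for t
      proof (rule subsp_mult_closed[OF M(1-3)])
        have "c t \<in> ?R" using f(3) t by blast
        then show "c t \<in> tails 0" "\<And>k. fls_nth (c t) k \<noteq> 0 \<Longrightarrow> shift_set k M \<subseteq> M"
          using curve_ring_tails(1) curve_ring_iff shift_val_semigroup[OF M(4,5)] by blast+
        show "t \<in> M" using f(2) t FM by blast
      qed
      then show "f \<in> M" unfolding f(1) by (rule subsp_sum[OF M(1)])
    qed
    show "M \<subseteq> lin_span ?R (F ` {..<n})"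
    proof
      fix m assume "m \<in> M"
      then obtain f where f: "f \<in> cochar_lattice n \<nu>" "m = row_act n B f" unfolding MB by blast
      let ?c = "\<lambda>i. fls_compose_power (vec_index (abinv n f) i) n"
      let ?h = "\<lambda>i. fls_X_intpow (- (int n * \<nu> ! i)) * ?c i"
      define c where "c t = ?h (inv_into {..<n} F t)" for t
      have F: "F i = fls_X_intpow (int n * \<nu> ! i) * row_act n B (fls_X ^ i)" for i
        unfolding F_def by (rule row_act_X_intpow[OF n_pos Bm])
      have "m = (\<Sum>i<n. ?h i * F i)"
        unfolding f(2) row_act_expand[OF n_pos Bm, of f]
      proof (rule sum.cong[OF refl])
        fix i
        have "?h i * F i = ?c i * (fls_X_intpow (- (int n * \<nu> ! i)) *
            (fls_X_intpow (int n * \<nu> ! i) * row_act n B (fls_X ^ i)))"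
          unfolding F by (simp only: ac_simps)
        then show "?c i * row_act n B (fls_X ^ i) = ?h i * F i" by (simp only: fls_X_intpow_cancel')
      qed
      also have "\<dots> = (\<Sum>i<n. c (F i) * F i)"
        by (rule sum.cong) (use inj in \<open>auto simp: c_def\<close>)
      also have "\<dots> = (\<Sum>t\<in>F ` {..<n}. c t * t)" by (simp add: sum.reindex[OF inj])
      finally have m: "m = (\<Sum>t\<in>F ` {..<n}. c t * t)" .
      have "?h i \<in> ?R" if i: "i < n" for i
        unfolding curve_ring_iff
      proof (intro allI impI)
        fix k assume k: "fls_nth (?h i) k \<noteq> 0"
        have "fls_nth (?h i) k = fls_nth (?c i) (k + int n * \<nu> ! i)"
          by (simp only: fls_nth_X_intpow_mult) simp
        then have c: "int n dvd k + int n * \<nu> ! i"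
          "fls_nth f (int n * ((k + int n * \<nu> ! i) div int n) + int i) \<noteq> 0"
          using k unfolding fls_nth_compose_power[OF n_pos] fls_nth_abinv[OF n_pos i] by (metis (full_types))+
        then have "int n dvd k" by (metis dvd_add_left_iff dvd_triv_left)
        then obtain l where l: "k = int n * l" by (elim dvdE)
        have "(k + int n * \<nu> ! i) div int n = l + \<nu> ! i" using n_pos by (simp add: l distrib_left[symmetric])
        with c(2) have nz: "fls_nth f (int n * (l + \<nu> ! i) + int i) \<noteq> 0" by simp
        have "(int n * (l + \<nu> ! i) + int i) div int n = l + \<nu> ! i"
          "(int n * (l + \<nu> ! i) + int i) mod int n = int i" using i by simp_all
        then have "\<not> l + \<nu> ! i < \<nu> ! i" using f(1) nz unfolding cochar_lattice_def by force
        then have "k = int (n * nat l + d * 0)" unfolding l by simp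
        then show "k \<in> val_semigroup n d" unfolding val_semigroup_def by blast
      qed
      then have "c ` F ` {..<n} \<subseteq> ?R" using inj by (auto simp: c_def)
      then show "m \<in> lin_span ?R (F ` {..<n})"
        unfolding lin_span_def using m by blast
    qed
  qed
  then show ?thesis by (intro exI[of _ "F ` {..<n}"]) simp
qed

lemma lin_span_UNIV:
  assumes "tails b \<subseteq> M"
  shows "lin_span UNIV M = UNIV"
proof -
  have "f \<in> lin_span UNIV M" for f
  proof -
    let ?t = "fls_X_intpow b :: complex fls"
    have t: "?t \<in> M" using assms by (auto simp: tails_iff)
    have "f / ?t * ?t = f" by (rule nonzero_eq_divide_eq[THEN iffD1, OF fls_X_intpow_nonzero refl])
    then have "f = (\<Sum>s\<in>{?t}. f / ?t * s)" by (simp only: sum.insert_if finite.emptyI empty_iff if_False sum.empty add_0_right)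
    then show ?thesis unfolding lin_span_def
      using t by (intro CollectI exI[of _ "{?t}"] exI[of _ "\<lambda>_. f / ?t"]) auto
  qed
  then show ?thesis by blast
qed

lemma quot_dim_tails:
  assumes "subsp M" "tails b \<subseteq> M" "M \<subseteq> tails k"
  shows "quot_dim (tails k) M = card ({k..} - degs M)"
  using quot_dim_degs[OF subsp_tails order_refl assms(1,3,2)] by (simp add: degs_tails)

lemma degs_ge: "tails b \<subseteq> M \<Longrightarrow> {b..} \<subseteq> degs M"
  using degs_mono[of "tails b" M] by (simp add: degs_tails)

lemma degs_le: "M \<subseteq> tails a \<Longrightarrow> degs M \<subseteq> {a..}"
  using degs_mono[of M "tails a"] by (simp add: degs_tails)

text \<open>Lowering the bound by one adds one missing degree both for M and for R, so equality for
  large i amounts to a single count at any lower bound a of M. For a \<le> 0 the number \<delta> - a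
  is the count for R.\<close>

lemma Jbar_iff:
  "M \<in> Jbar n d \<longleftrightarrow> subsp M \<and> (\<exists>b. tails b \<subseteq> M) \<and>
     shift_set (int n) M \<subseteq> M \<and> shift_set (int d) M \<subseteq> M \<and>
     (\<exists>a. M \<subseteq> tails a \<and> int (card ({a..} - degs M)) = int (delta n d) - a)" (is "_ \<longleftrightarrow> ?R")
proof
  assume "M \<in> Jbar n d"
  then obtain T where T: "finite T" "M = lin_span (curve_ring n d) T" and span: "lin_span UNIV M = UNIV"
    and ev: "\<forall>\<^sub>F i in at_top. M \<subseteq> tails (- int i) \<and>
        quot_dim (tails (- int i)) M = quot_dim (tails (- int i)) (curve_ring n d)"
    unfolding Jbar_def by blast
  note sub = Jbar_submodule[OF T(2,1) span]
  obtain i where i: "M \<subseteq> tails (- int i)"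
      "quot_dim (tails (- int i)) M = quot_dim (tails (- int i)) (curve_ring n d)"
    using eventually_happens'[OF _ ev] by auto
  obtain b where b: "tails b \<subseteq> M" using sub(2) by blast
  have "int (card ({- int i..} - degs M)) = int (delta n d) - (- int i)"
    using i(2) unfolding quot_dim_tails[OF sub(1) b i(1)] quot_dim_tails_curve_ring by simp
  then show ?R using sub i(1) by blast
next
  assume R: ?R
  then obtain a b where M: "subsp M" "tails b \<subseteq> M" "M \<subseteq> tails a"
    "shift_set (int n) M \<subseteq> M" "shift_set (int d) M \<subseteq> M"
    "int (card ({a..} - degs M)) = int (delta n d) - a" by blast
  have "M \<subseteq> tails (- int i) \<and> quot_dim (tails (- int i)) M = quot_dim (tails (- int i)) (curve_ring n d)"
    if i: "nat (- a) \<le> i" for i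
  proof -
    have le: "- int i \<le> a" using i by simp
    then have Mi: "M \<subseteq> tails (- int i)" using M(3) tails_mono by blast
    have "int (card ({- int i..} - degs M)) = int (card ({a..} - degs M)) + (a - - int i)"
      by (rule card_complement_shift[OF degs_le[OF M(3)] le degs_ge[OF M(2)]])
    then have "int (card ({- int i..} - degs M)) = int (i + delta n d)" using M(6) by simp
    then show ?thesis
      using Mi unfolding quot_dim_tails[OF M(1,2) Mi] quot_dim_tails_curve_ring by linarith
  qed
  then have "\<forall>\<^sub>F i in at_top. M \<subseteq> tails (- int i) \<and>
        quot_dim (tails (- int i)) M = quot_dim (tails (- int i)) (curve_ring n d)"
    unfolding eventually_at_top_linorder by blast
  then show "M \<in> Jbar n d"
    unfolding Jbar_def using submodule_finitely_generated[OF M(1-5)] lin_span_UNIV[OF M(2)] by blast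
qed

end

section \<open>Bounds, gaps and dimensions for lattices in the compactified Jacobian\<close>

lemma int_set_has_least:
  fixes D :: "int set"
  assumes "D \<subseteq> {a..}" "D \<noteq> {}"
  obtains m where "m \<in> D" "\<And>j. j \<in> D \<Longrightarrow> m \<le> j"
proof -
  let ?P = "\<lambda>m::nat. a + int m \<in> D"
  obtain j0 where j0: "j0 \<in> D" using assms(2) by blast
  then have "?P (nat (j0 - a))" using assms(1) by auto
  then have P: "?P (LEAST m. ?P m)" by (rule LeastI)
  have "a + int (LEAST m. ?P m) \<le> j" if j: "j \<in> D" for j
  proof -
    have a: "a \<le> j" using assms(1) j by auto
    then have "?P (nat (j - a))" using j by simp
    then have "(LEAST m. ?P m) \<le> nat (j - a)" by (rule Least_le)
    then show ?thesis using a by linarith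
  qed
  then show thesis using that[OF P] by blast
qed

lemma subset_tails_of_degs: "degs V \<subseteq> {a..} \<Longrightarrow> V \<subseteq> tails a"
proof
  fix f assume a: "degs V \<subseteq> {a..}" and f: "f \<in> V"
  show "f \<in> tails a"
  proof (cases "f = 0")
    case False
    then have "fls_subdegree f \<in> {a..}" using a degsI[OF f] by blast
    then show ?thesis using False by (simp add: tails_subdegree)
  qed (simp add: tails_iff)
qed

text \<open>The intersection with \<open>tails c\<close> has all degrees from \<open>c\<close> on,
  so it is all of \<open>tails c\<close>.\<close>

lemma subset_of_degs_tail:
  assumes M: "subsp M" "tails b \<subseteq> M" and d: "{c..} \<subseteq> degs M"
  shows "tails c \<subseteq> M"
proof -
  let ?W = "M \<inter> tails c"
  have W: "subsp ?W" using M(1) subsp_tails[of c] unfolding subsp_def by blast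
  have "degs (tails c) \<subseteq> degs ?W"
  proof
    fix j assume "j \<in> degs (tails c)"
    then have j: "c \<le> j" by (simp add: degs_tails)
    then have "j \<in> degs M" using d by auto
    then obtain f where f: "f \<in> M" "f \<noteq> 0" "fls_subdegree f = j" by (rule degsE)
    then have "f \<in> ?W" using j by (simp add: tails_subdegree)
    then show "j \<in> degs ?W" using degsI f by blast
  qed
  moreover have "tails (max b c) \<subseteq> ?W" using M(2) tails_mono[of b "max b c"] tails_mono[of c "max b c"] by auto
  ultimately have "tails c = ?W" by (intro eq_of_degs_subset[OF subsp_tails W]) auto
  then show ?thesis by blast
qed

lemma mem_l_coset: "x \<in> g <#\<^bsub>loopGL n\<^esub> H \<longleftrightarrow> (\<exists>h\<in>H. x = g * h)"
  unfolding l_coset_def by auto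

context
  fixes n d :: nat
  assumes n_pos: "0 < n" and d_pos: "0 < d" and cop: "coprime n d"
begin

lemma finite_gaps: "finite ({0..} - val_semigroup n d)"
proof (rule finite_subset)
  show "{0..} - val_semigroup n d \<subseteq> {0..<int (n * d)}"
  proof
    fix x assume "x \<in> {0..} - val_semigroup n d"
    then show "x \<in> {0..<int (n * d)}"
      using val_semigroup_large[OF n_pos d_pos cop, of x] by (cases "int (n * d) \<le> x") auto
  qed
qed simp

lemma degs_add:
  assumes "shift_set (int n) M \<subseteq> M" "shift_set (int d) M \<subseteq> M" "k \<in> val_semigroup n d" "j \<in> degs M"
  shows "k + j \<in> degs M"
proof -
  have "k + j \<in> degs (shift_set k M)" unfolding degs_shift_set using assms(4) by blast
  then show ?thesis
    using degs_mono[OF shift_val_semigroup[OF n_pos d_pos cop assms(1-3)]] by blast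
qed

lemma Jbar_facts:
  assumes "M \<in> Jbar n d"
  shows "subsp M" "shift_set (int n) M \<subseteq> M" "shift_set (int d) M \<subseteq> M"
    "M \<subseteq> tails 0" "tails (2 * int (delta n d)) \<subseteq> M" "card ({0..} - degs M) = delta n d"
proof -
  obtain a b where M: "subsp M" "tails b \<subseteq> M" "M \<subseteq> tails a"
    "shift_set (int n) M \<subseteq> M" "shift_set (int d) M \<subseteq> M"
    "int (card ({a..} - degs M)) = int (delta n d) - a"
    using assms unfolding Jbar_iff[OF n_pos d_pos cop] by blast
  show "subsp M" "shift_set (int n) M \<subseteq> M" "shift_set (int d) M \<subseteq> M" by fact+
  let ?D = "degs M" and ?G = "val_semigroup n d"
  note add = degs_add[OF M(4,5)]
  have Da: "?D \<subseteq> {a..}" using M(3) by (rule degs_le[OF n_pos d_pos cop])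
  have Db: "{b..} \<subseteq> ?D" using M(2) by (rule degs_ge[OF n_pos d_pos cop])
  obtain m where m: "m \<in> ?D" "\<And>j. j \<in> ?D \<Longrightarrow> m \<le> j" using int_set_has_least[OF Da] Db by blast
  have am: "a \<le> m" using Da m(1) by auto
  \<comment> \<open>Along with m all of m plus the semigroup consists of degrees, so at most
    \<delta> degrees above m are missing. Compared with the exact count \<delta> - a this forces m
    \<ge> 0, that is M \<subseteq> S.\<close>
  have "{a..} - ?D \<subseteq> {a..<m} \<union> (\<lambda>g. g + m) ` ({0..} - ?G)"
  proof
    fix j assume j: "j \<in> {a..} - ?D"
    show "j \<in> {a..<m} \<union> (\<lambda>g. g + m) ` ({0..} - ?G)"
    proof (cases "j < m")
      case False
      have "j - m \<notin> ?G" using add[of "j - m" m] m(1) j by auto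
      then have "j - m \<in> {0..} - ?G" using False by simp
      then show ?thesis by (intro UnI2 image_eqI[of _ _ "j - m"]) auto
    qed (use j in auto)
  qed
  then have "card ({a..} - ?D) \<le> card ({a..<m} \<union> (\<lambda>g. g + m) ` ({0..} - ?G))"
    using finite_gaps by (intro card_mono) auto
  also have "\<dots> \<le> card {a..<m} + card ((\<lambda>g. g + m) ` ({0..} - ?G))" by (rule card_Un_le)
  also have "card ((\<lambda>g. g + m) ` ({0..} - ?G)) \<le> delta n d"
    unfolding delta_eq[OF n_pos d_pos cop] by (rule card_image_le[OF finite_gaps])
  finally have "int (card ({a..} - ?D)) \<le> (m - a) + int (delta n d)" using am by simp
  then have m0: "0 \<le> m" using M(6) by linarith
  then have D0: "?D \<subseteq> {0..}" using m(2) by force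
  then show M0: "M \<subseteq> tails 0" by (rule subset_tails_of_degs)
  show card: "card ({0..} - ?D) = delta n d"
  proof (cases "a \<le> 0")
    case True
    then show ?thesis using card_complement_shift[OF D0 True Db] M(6) by linarith
  next
    case False
    then show ?thesis using card_complement_shift[OF Da _ Db, of 0] M(6) by linarith
  qed
  have fin: "finite ({0..} - ?D)"
  proof (rule finite_subset)
    show "{0..} - ?D \<subseteq> {0..<b}"
    proof
      fix x assume "x \<in> {0..} - ?D"
      then show "x \<in> {0..<b}" using Db by (cases "b \<le> x") auto
    qed
  qed simp
  \<comment> \<open>If \<open>j\<close> is not a degree, neither is \<open>j - k\<close> for \<open>k\<close> in the semigroup; a large \<open>j\<close> would thus
    give more than \<open>\<delta>\<close> gaps.\<close>
  have "{2 * int (delta n d)..} \<subseteq> ?D"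
  proof (rule subsetI, rule ccontr)
    fix j assume j: "j \<in> {2 * int (delta n d)..}" "j \<notin> ?D"
    have fj: "finite ({0..j} \<inter> ?G)" by simp
    have "(\<lambda>k. j - k) ` ({0..j} \<inter> ?G) \<subseteq> {0..} - ?D"
    proof
      fix x assume "x \<in> (\<lambda>k. j - k) ` ({0..j} \<inter> ?G)"
      then obtain k where k: "x = j - k" "k \<in> {0..j}" "k \<in> ?G" by blast
      have "x \<notin> ?D" using add[OF k(3), of x] k(1) j(2) by auto
      then show "x \<in> {0..} - ?D" using k by simp
    qed
    then have "card ((\<lambda>k. j - k) ` ({0..j} \<inter> ?G)) \<le> delta n d"
      unfolding card[symmetric] by (rule card_mono[OF fin])
    moreover have "card ((\<lambda>k. j - k) ` ({0..j} \<inter> ?G)) = card ({0..j} \<inter> ?G)"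
      by (rule card_image) (auto simp: inj_on_def)
    moreover have "card {0..j} \<le> card ({0..j} \<inter> ?G) + card ({0..} - ?G)"
    proof -
      have "card {0..j} \<le> card (({0..j} \<inter> ?G) \<union> ({0..} - ?G))"
        by (rule card_mono) (use finite_gaps in auto)
      also have "\<dots> \<le> card ({0..j} \<inter> ?G) + card ({0..} - ?G)" by (rule card_Un_le)
      finally show ?thesis .
    qed
    ultimately have "card {0..j} \<le> 2 * delta n d" unfolding delta_eq[OF n_pos d_pos cop, symmetric] by linarith
    then show False using j(1) by simp
  qed
  then show "tails (2 * int (delta n d)) \<subseteq> M" by (rule subset_of_degs_tail[OF M(1,2)])
qed

text \<open>S M = \<varpi>^m S with m the least degree. Of the \<delta> missing degrees of M in S,
  the m ones below m are missing in S M as well, and the others make up the gap.\<close>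

lemma gap_Jbar:
  assumes M: "M \<in> Jbar n d" and m: "m \<in> degs M" "\<And>j. j \<in> degs M \<Longrightarrow> m \<le> j"
  shows "int (gap M) = int (delta n d) - m"
proof -
  note facts = Jbar_facts[OF M]
  have D: "degs M \<subseteq> {m..}" using m(2) by auto
  have Mm: "M \<subseteq> tails m" by (rule subset_tails_of_degs[OF D])
  have "lin_span pow_ser M = tails m"
  proof
    show "lin_span pow_ser M \<subseteq> tails m"
    proof
      fix f assume "f \<in> lin_span pow_ser M"
      then obtain T a where f: "f = (\<Sum>t\<in>T. a t * t)" "T \<subseteq> M" "a ` T \<subseteq> pow_ser"
        unfolding lin_span_def by blast
      have "a t * t \<in> tails m" if t: "t \<in> T" for t
      proof -
        have "a t \<in> tails 0" "t \<in> tails m" using f t Mm unfolding tails_0 by blast+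
        from tails_mult[OF this] show ?thesis by simp
      qed
      then show "f \<in> tails m" unfolding f(1) by (rule subsp_sum[OF subsp_tails])
    qed
    show "tails m \<subseteq> lin_span pow_ser M"
    proof
      fix f assume f: "f \<in> tails m"
      obtain t where t: "t \<in> M" "t \<noteq> 0" "fls_subdegree t = m" using m(1) by (rule degsE)
      have "f / t \<in> tails 0"
      proof (cases "f = 0")
        case False
        then have "f / t \<noteq> 0" "fls_subdegree (f / t) = fls_subdegree f - m"
          using t by (auto simp: fls_divide_subdegree)
        then show ?thesis using f False by (simp add: tails_subdegree)
      qed (simp add: tails_iff)
      then have "f / t \<in> pow_ser" unfolding tails_0 .
      moreover have "f = (\<Sum>s\<in>{t}. f / t * s)" using t by simp
      ultimately show "f \<in> lin_span pow_ser M"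
        unfolding lin_span_def using t(1)
        by (intro CollectI exI[of _ "{t}"] exI[of _ "\<lambda>_. f / t"]) auto
    qed
  qed
  then have "gap M = card ({m..} - degs M)"
    unfolding gap_def using quot_dim_tails[OF n_pos d_pos cop facts(1,5) Mm] by simp
  moreover have "0 \<le> m" using m(1) degs_le[OF n_pos d_pos cop facts(4)] by auto
  then have "int (card ({0..} - degs M)) = int (card ({m..} - degs M)) + (m - 0)"
    by (rule card_complement_shift[OF D _ degs_ge[OF n_pos d_pos cop facts(5)]])
  ultimately show ?thesis using facts(6) by simp
qed

lemma Jflag_facts:
  assumes MF: "(M, F) \<in> Jflag n d" and j: "j \<le> n"
  shows "subsp (F ! j)" "F ! 0 = shift_set (int n) M" "F ! n = M" "F ! j \<subseteq> M" "F ! 0 \<subseteq> F ! j"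
    "\<And>i. i \<le> j \<Longrightarrow> F ! i \<subseteq> F ! j"
    "tails (int n + 2 * int (delta n d)) \<subseteq> F ! 0"
    "card (degs (F ! j) - {int n + 2 * int (delta n d)..}) = delta n d + j"
proof -
  have M: "M \<in> Jbar n d" and fl: "is_flag n d M F" using MF unfolding Jflag_def by auto
  note facts = Jbar_facts[OF M]
  have F: "F ! 0 = shift_set (int n) M" "F ! n = M" "\<And>i. i < n \<Longrightarrow> F ! i \<subseteq> F ! Suc i"
    "\<And>i. i \<le> n \<Longrightarrow> subsp (F ! i)" "\<And>i. i \<le> n \<Longrightarrow> quot_dim (F ! i) (shift_set (int n) M) = i"
    using fl unfolding is_flag_def lin_span_const_iff by blast+
  have mono: "i \<le> k \<Longrightarrow> k \<le> n \<Longrightarrow> F ! i \<subseteq> F ! k" for i k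
  proof (induction k rule: dec_induct)
    case (step k)
    then show ?case using F(3)[of k] by auto
  qed simp
  show s: "subsp (F ! j)" using F(4) j by blast
  show "F ! 0 = shift_set (int n) M" "F ! n = M" by fact+
  show jM: "F ! j \<subseteq> M" using mono[of j n] j F(2) by simp
  show "\<And>i. i \<le> j \<Longrightarrow> F ! i \<subseteq> F ! j" using mono j by blast
  show F0j: "F ! 0 \<subseteq> F ! j" using mono[of 0 j] j by simp
  let ?N = "int n + 2 * int (delta n d)" and ?D = "degs M"
  have "shift_set (int n) (tails (2 * int (delta n d))) \<subseteq> shift_set (int n) M"
    by (rule shift_set_mono[OF facts(5)])
  then show N0: "tails ?N \<subseteq> F ! 0" unfolding shift_set_tails F(1) .
  have s0: "subsp (F ! 0)" using F(4)[of 0] by simp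
  have F00: "F ! j \<subseteq> tails 0" using jM facts(4) by blast
  have c1: "card (degs (F ! j) - degs (F ! 0)) = j"
    using quot_dim_degs[OF s F00 s0 F0j N0] F(5)[OF j] unfolding F(1) by simp
  \<comment> \<open>The degrees of \<varpi>^n M below n + 2 \<delta> are translates of those of M
    below 2 \<delta>, and of these 2 \<delta> integers exactly \<delta> are missing.\<close>
  have c2: "card (degs (F ! 0) - {?N..}) = delta n d"
  proof -
    have D0: "?D \<subseteq> {0..}" by (rule degs_le[OF n_pos d_pos cop facts(4)])
    have D2: "{2 * int (delta n d)..} \<subseteq> ?D" by (rule degs_ge[OF n_pos d_pos cop facts(5)])
    have "degs (F ! 0) - {?N..} = (\<lambda>j. int n + j) ` (?D - {2 * int (delta n d)..})"
      unfolding F(1) degs_shift_set by auto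
    then have "card (degs (F ! 0) - {?N..}) = card (?D - {2 * int (delta n d)..})"
      by (simp add: card_image inj_on_def)
    also have "?D - {2 * int (delta n d)..} = {0..<2 * int (delta n d)} - ({0..} - ?D)"
      using D0 by auto
    also have "card \<dots> = card {0..<2 * int (delta n d)} - card ({0..} - ?D)"
    proof (rule card_Diff_subset)
      show sub: "{0..} - ?D \<subseteq> {0..<2 * int (delta n d)}"
      proof
        fix x assume "x \<in> {0..} - ?D"
        then show "x \<in> {0..<2 * int (delta n d)}"
          using D2 by (cases "2 * int (delta n d) \<le> x") auto
      qed
      show "finite ({0..} - ?D)" by (rule finite_subset[OF sub]) simp
    qed
    also have "\<dots> = delta n d" unfolding facts(6) by simp
    finally show ?thesis .
  qed
  have eq: "degs (F ! j) - {?N..} = (degs (F ! j) - degs (F ! 0)) \<union> (degs (F ! 0) - {?N..})"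
    using degs_mono[OF F0j] degs_ge[OF n_pos d_pos cop N0] by blast
  have f1: "finite (degs (F ! j) - degs (F ! 0))" by (rule finite_degs_diff[OF F00 N0])
  have "F ! 0 \<subseteq> tails 0" using F00 F0j by blast
  then have f2: "finite (degs (F ! 0) - {?N..})"
    using finite_degs_diff[of "F ! 0" 0 ?N "tails ?N"] unfolding degs_tails by blast
  show "card (degs (F ! j) - {?N..}) = delta n d + j"
    unfolding eq by (subst card_Un_disjoint[OF f1 f2]) (blast, simp only: c1 c2 add.commute)
qed

section \<open>The map to flagged lattices\<close>

text \<open>The standard flag is spanned by the last basis vectors, so its j-th member consists of
  the exponents from n - j on.\<close>

lemma ab_std_flag:
  assumes "j \<le> n"
  shows "ab n ` std_flag n j = tails (int (n - j))"
proof -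
  have iff: "v \<in> std_flag n j \<longleftrightarrow> ab n v \<in> tails (int (n - j))" if v: "v \<in> carrier_vec n" for v
  proof
    assume a: "v \<in> std_flag n j"
    then have p: "\<And>i k. i < n \<Longrightarrow> k < 0 \<Longrightarrow> fls_nth (vec_index v i) k = 0"
      and z: "\<And>i. i < n - j \<Longrightarrow> fls_nth (vec_index v i) 0 = 0"
      unfolding std_flag_def std_lattice_def pow_ser_iff by blast+
    show "ab n v \<in> tails (int (n - j))"
      unfolding tails_iff fls_nth_ab[OF n_pos]
    proof (intro allI impI)
      fix k assume k: "k < int (n - j)"
      show "fls_nth (vec_index v (nat (k mod int n))) (k div int n) = 0"
      proof (cases "k < 0")
        case True
        then have "k div int n < 0" using n_pos by (simp add: div_neg_pos_less0)
        then show ?thesis by (rule p[OF nat_mod_less[OF n_pos]])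
      next
        case False
        then have "k div int n = 0" "nat (k mod int n) < n - j" using k by auto
        then show ?thesis using z by simp
      qed
    qed
  next
    assume a: "ab n v \<in> tails (int (n - j))"
    have nth: "fls_nth (vec_index v i) k = fls_nth (ab n v) (int n * k + int i)" if "i < n" for i k
    proof -
      have "(int n * k + int i) mod int n = int i" "(int n * k + int i) div int n = k"
        using that by simp_all
      then show ?thesis unfolding fls_nth_ab[OF n_pos] by simp
    qed
    have "fls_nth (vec_index v i) k = 0" if "i < n" "k < 0" for i k
    proof -
      have "int n * (k + 1) \<le> 0" using that by (intro mult_nonneg_nonpos) auto
      then have "int n * k + int i < int (n - j)" using that by (simp add: distrib_left)
      then show ?thesis using a unfolding nth[OF that(1)] tails_iff by blast
    qed
    moreover have "fls_nth (vec_index v i) 0 = 0" if "i < n - j" for i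
      using a that nth[of i 0] unfolding tails_iff by simp
    ultimately show "v \<in> std_flag n j"
      using v unfolding std_flag_def std_lattice_def pow_ser_iff by blast
  qed
  show ?thesis
  proof
    show "ab n ` std_flag n j \<subseteq> tails (int (n - j))"
      using iff unfolding std_flag_def std_lattice_def by blast
    show "tails (int (n - j)) \<subseteq> ab n ` std_flag n j"
    proof
      fix f assume "f \<in> tails (int (n - j))"
      then have "abinv n f \<in> std_flag n j" using iff[of "abinv n f"] by (simp add: ab_abinv[OF n_pos])
      then have "ab n (abinv n f) \<in> ab n ` std_flag n j" by blast
      then show "f \<in> ab n ` std_flag n j" by (simp only: ab_abinv[OF n_pos])
    qed
  qed
qed

section \<open>The lattices of a loop and their dependence on its coset\<close>

lemma std_flag_full: "std_flag n n = std_lattice n"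
  by (simp add: std_flag_def)

lemma row_image_eq:
  assumes "L \<subseteq> carrier_vec n"
  shows "row_image n d g L = shift_set (int (delta n d)) (row_act n (loop_inv n g) ` ab n ` L)"
  unfolding row_image_def shift_set_def image_image
proof (rule image_cong[OF refl])
  fix v assume "v \<in> L"
  then show "fls_X ^ delta n d * ab n (transpose_mat (loop_inv n g) *\<^sub>v v) =
      fls_X_intpow (int (delta n d)) * row_act n (loop_inv n g) (ab n v)"
    using assms row_act_ab[OF n_pos, of v "loop_inv n g"] by (auto simp: fls_X_power_conv_shift_1)
qed

lemma row_image_std_flag:
  assumes "j \<le> n"
  shows "row_image n d g (std_flag n j) = shift_set (int (delta n d)) (lattice_chain n g (int (n - j)))"
proof -
  have "std_flag n j \<subseteq> carrier_vec n" unfolding std_flag_def std_lattice_def by blast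
  then show ?thesis unfolding lattice_chain_def by (simp add: row_image_eq ab_std_flag[OF assms])
qed

lemma row_image_std_lattice:
  "row_image n d g (std_lattice n) = shift_set (int (delta n d)) (lattice_chain n g 0)"
  using row_image_std_flag[of n] by (simp add: std_flag_full)

lemma Phi_rep_eq:
  "Phi_rep n d g = (shift_set (int (delta n d)) (lattice_chain n g 0),
     map (\<lambda>j. shift_set (int (delta n d)) (lattice_chain n g (int (n - j)))) [0..<Suc n])"
  unfolding Phi_rep_def row_image_std_lattice
  by (auto simp: row_image_std_flag simp del: upt_Suc)

lemma lattice_chain_mult:
  assumes "g \<in> carrier (loopGL n)" "b \<in> carrier (loopGL n)" "row_act n b ` tails k = tails k"
  shows "lattice_chain n (g * b) k = lattice_chain n g k"
  unfolding lattice_chain_def loop_inv_mult[OF assms(1,2)]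
    row_act_mult_image[OF n_pos loop_inv_carrier_mat[OF assms(2)] loop_inv_carrier_mat[OF assms(1)]]
    row_act_inv_fix[OF n_pos assms(2,3)] ..

lemma lattice_chain_iwahori:
  assumes "g \<in> carrier (loopGL n)" "b \<in> iwahori n"
  shows "lattice_chain n (g * b) k = lattice_chain n g k"
  using lattice_chain_mult[OF assms(1) iwahori_loopGL[OF assms(2)]]
    iwahori_iff[OF n_pos iwahori_loopGL[OF assms(2)]] assms(2) by blast

lemma lattice_chain_arcGL:
  assumes "g \<in> carrier (loopGL n)" "k \<in> arcGL n"
  shows "lattice_chain n (g * k) 0 = lattice_chain n g 0"
  using lattice_chain_mult[OF assms(1) arcGL_loopGL[OF assms(2)]]
    arcGL_iff[OF n_pos arcGL_loopGL[OF assms(2)]] assms(2) by blast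

lemma self_mem_coset:
  assumes "g \<in> carrier (loopGL n)"
  shows "g \<in> g <#\<^bsub>loopGL n\<^esub> iwahori n" "g \<in> g <#\<^bsub>loopGL n\<^esub> arcGL n"
proof -
  have e: "g = g * 1\<^sub>m n" using loopGL_carrier_mat[OF assms] by simp
  show "g \<in> g <#\<^bsub>loopGL n\<^esub> iwahori n"
    unfolding mem_l_coset by (rule bexI[of _ "1\<^sub>m n"]) (rule e, rule one_iwahori[OF n_pos])
  show "g \<in> g <#\<^bsub>loopGL n\<^esub> arcGL n"
    unfolding mem_l_coset by (rule bexI[of _ "1\<^sub>m n"]) (rule e, rule one_arcGL[OF n_pos])
qed

lemma Phi_coset:
  assumes g: "g \<in> carrier (loopGL n)"
  shows "Phi n d (g <#\<^bsub>loopGL n\<^esub> iwahori n) = Phi_rep n d g"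
  unfolding Phi_def
proof (rule the_elem_image_unique)
  show "g <#\<^bsub>loopGL n\<^esub> iwahori n \<noteq> {}" using self_mem_coset(1)[OF g] by blast
  fix x assume "x \<in> g <#\<^bsub>loopGL n\<^esub> iwahori n"
  then obtain b where b: "b \<in> iwahori n" "x = g * b" unfolding mem_l_coset by blast
  show "Phi_rep n d x = Phi_rep n d g" unfolding b(2) Phi_rep_eq lattice_chain_iwahori[OF g b(1)] ..
qed

lemma Phi_gr_coset:
  assumes g: "g \<in> carrier (loopGL n)"
  shows "Phi_gr n d (g <#\<^bsub>loopGL n\<^esub> arcGL n) = shift_set (int (delta n d)) (lattice_chain n g 0)"
  unfolding Phi_gr_def row_image_std_lattice
proof (rule the_elem_image_unique)
  show "g <#\<^bsub>loopGL n\<^esub> arcGL n \<noteq> {}" using self_mem_coset(2)[OF g] by blast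
  fix x assume "x \<in> g <#\<^bsub>loopGL n\<^esub> arcGL n"
  then obtain k where k: "k \<in> arcGL n" "x = g * k" unfolding mem_l_coset by blast
  show "shift_set (int (delta n d)) (lattice_chain n x 0) = shift_set (int (delta n d)) (lattice_chain n g 0)"
    unfolding k(2) lattice_chain_arcGL[OF g k(1)] ..
qed

section \<open>\<psi>(d) as multiplication by \<varpi>^d, and flags stable under it\<close>

lemma psi_carrier: "psi n d \<in> carrier_mat n n"
  unfolding psi_def Let_def diag_unit_def by simp

text \<open>Writing d = n m + r, the product of \<varpi>^d and \<varpi>^i has exponent n m + (i +
  r). If i + r reaches n, a carry turns x^m into x^(m+1) and moves the column to i + r - n: these
  are the two diagonals of \<psi>(d).\<close>

lemma row_act_psi: "row_act n (psi n d) f = fls_X_intpow (int d) * f"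
proof -
  let ?m = "d div n" and ?r = "d mod n"
  have r: "?r < n" using n_pos by simp
  have X: "row_act n (psi n d) (fls_X ^ i) = fls_X_intpow (int d) * fls_X ^ i" if i: "i < n" for i
  proof (rule fls_eqI)
    fix k
    define q where "q = k div int n"
    define j where "j = nat (k mod int n)"
    have j: "j < n" "k = int n * q + int j" using n_pos by (auto simp: q_def j_def nat_less_iff)
    have dd: "int d = int n * int ?m + int ?r"
      by (simp only: of_nat_mult[symmetric] of_nat_add[symmetric] mult_div_mod_eq)
    have entry: "psi n d $$ (i, j) = fls_X ^ ?m * (if int j = int i + int ?r then 1 else 0) +
        fls_X ^ (?m + 1) * (if int j = int i + (int ?r - int n) then 1 else 0)"
      using i j(1) by (simp add: psi_def Let_def diag_unit_def del: power_Suc)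
    have "fls_nth (row_act n (psi n d) (fls_X ^ i)) k = fls_nth (psi n d $$ (i, j)) q"
      unfolding fls_nth_row_act_X_power[OF n_pos psi_carrier i] q_def j_def ..
    also have "\<dots> = (if int j = int i + int ?r \<and> q = int ?m then 1 else 0) +
        (if int j = int i + (int ?r - int n) \<and> q = int ?m + 1 then 1 else 0)"
      unfolding entry by (auto simp del: power_Suc power_Suc2)
    also have "\<dots> = (if k = int d + int i then 1 else 0)"
    proof -
      have A: "k = int d + int i" if "int j = int i + int ?r" "q = int ?m"
        using that j(2) dd by simp
      have B: "k = int d + int i" if "int j = int i + (int ?r - int n)" "q = int ?m + 1"
        using that j(2) dd by (simp add: distrib_left)
      have C: "(int j = int i + int ?r \<and> q = int ?m) \<or> (int j = int i + (int ?r - int n) \<and> q = int ?m + 1)"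
        if k: "k = int d + int i"
      proof (cases "i + ?r < n")
        case True
        have e: "k = int n * int ?m + int (i + ?r)" using k dd by simp
        have "k div int n = int ?m" "k mod int n = int (i + ?r)" unfolding e using True by simp_all
        then show ?thesis unfolding q_def j_def by auto
      next
        case False
        then have l: "i + ?r - n < n" using i r by linarith
        have e: "k = int n * (int ?m + 1) + int (i + ?r - n)"
          using k dd False by (simp add: distrib_left of_nat_diff)
        have "k div int n = int ?m + 1" "k mod int n = int (i + ?r - n)" unfolding e using l by simp_all
        then show ?thesis unfolding q_def j_def using False by (auto simp: of_nat_diff)
      qed
      have "\<not> ((int j = int i + int ?r \<and> q = int ?m) \<and> (int j = int i + (int ?r - int n) \<and> q = int ?m + 1))"
        by auto
      then show ?thesis using A B C by (auto split: if_splits)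
    qed
    also have "\<dots> = fls_nth (fls_X_intpow (int d) * fls_X ^ i) k"
      by (simp only: fls_nth_X_intpow_mult fls_X_power_nth) auto
    finally show "fls_nth (row_act n (psi n d) (fls_X ^ i)) k = fls_nth (fls_X_intpow (int d) * fls_X ^ i) k" .
  qed
  have "row_act n (psi n d) f =
      (\<Sum>i<n. fls_X_intpow (int d) * (fls_compose_power (vec_index (abinv n f) i) n * fls_X ^ i))"
    unfolding row_act_expand[OF n_pos psi_carrier, of f]
  proof (rule sum.cong[OF refl])
    fix i assume "i \<in> {..<n}"
    then have i: "i < n" by simp
    show "fls_compose_power (vec_index (abinv n f) i) n * row_act n (psi n d) (fls_X ^ i) =
        fls_X_intpow (int d) * (fls_compose_power (vec_index (abinv n f) i) n * fls_X ^ i)"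
      unfolding X[OF i] by (rule mult.left_commute)
  qed
  also have "\<dots> = fls_X_intpow (int d) * ab n (abinv n f)"
    unfolding ab_sum sum_distrib_left ..
  finally show ?thesis unfolding ab_abinv[OF n_pos] .
qed

lemma adj_inv_carrier:
  "g \<in> carrier (loopGL n) \<Longrightarrow> adj_inv n g (psi n d) \<in> carrier_mat n n"
  unfolding adj_inv_def
  by (intro mult_carrier_mat[of _ n n _ n] psi_carrier loop_inv_carrier_mat loopGL_carrier_mat)

text \<open>As matrices act from the right, g^-1 \<psi> g takes \<varpi>^k S to its lattice under
  g^-1, multiplies there by \<varpi>^d, and returns by g.\<close>

lemma adj_inv_lie_iwahori_iff:
  assumes g: "g \<in> carrier (loopGL n)"
  shows "adj_inv n g (psi n d) \<in> lie_iwahori n \<longleftrightarrow>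
    (\<forall>k. shift_set (int d) (lattice_chain n g k) \<subseteq> lattice_chain n g k)"
proof -
  note gm = loopGL_carrier_mat[OF g] and im = loop_inv_carrier_mat[OF g]
  have act: "row_act n (adj_inv n g (psi n d)) f =
      row_act n g (fls_X_intpow (int d) * row_act n (loop_inv n g) f)" for f
    unfolding adj_inv_def row_act_mult[OF n_pos mult_carrier_mat[OF im psi_carrier] gm]
      row_act_mult[OF n_pos im psi_carrier] row_act_psi ..
  have "(\<forall>f\<in>tails k. row_act n (adj_inv n g (psi n d)) f \<in> tails k) \<longleftrightarrow>
      shift_set (int d) (lattice_chain n g k) \<subseteq> lattice_chain n g k" for k
  proof -
    have "x \<in> lattice_chain n g k \<longleftrightarrow> row_act n g x \<in> tails k" for x
    proof -
      have "row_act n (loop_inv n g) (row_act n g x) \<in> lattice_chain n g k \<longleftrightarrow> row_act n g x \<in> tails k"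
        unfolding lattice_chain_def by (rule row_act_mem_image_iff[OF n_pos loop_inv_closed[OF g]])
      then show ?thesis unfolding row_act_inv(1)[OF n_pos g] .
    qed
    then show ?thesis unfolding act shift_set_def lattice_chain_def[of n g k] image_image by blast
  qed
  then show ?thesis unfolding lie_iwahori_iff[OF n_pos adj_inv_carrier[OF g]] by blast
qed

lemma lie_iwahori_arcGL: "A \<in> lie_iwahori n \<Longrightarrow> A \<in> lie_arcGL n"
  by (simp add: lie_iwahori_def)

lemma quot_dim_lattice_chain:
  assumes g: "g \<in> carrier (loopGL n)" and j: "j \<le> n"
  shows "quot_dim (shift_set c (lattice_chain n g (int (n - j)))) (shift_set c (lattice_chain n g (int n))) = j"
proof -
  let ?V = "lattice_chain n g (int (n - j))" and ?W = "lattice_chain n g (int n)"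
  have sub: "tails (int n) \<subseteq> tails (int (n - j))" by (rule tails_mono) simp
  have "\<exists>t. \<forall>i\<in>degs (tails (int (n - j))) - degs (tails (int n)).
      t i \<in> tails (int (n - j)) \<and> t i \<noteq> 0 \<and> fls_subdegree (t i) = i"
    by (rule bchoice) (auto elim: degsE)
  then obtain t where "\<And>i. i \<in> degs (tails (int (n - j))) - degs (tails (int n)) \<Longrightarrow>
      t i \<in> tails (int (n - j)) \<and> t i \<noteq> 0 \<and> fls_subdegree (t i) = i" by blast
  from degs_basis_mod[OF subsp_tails order_refl subsp_tails sub order_refl this]
  have "basis_mod (tails (int (n - j))) (tails (int n)) (degs (tails (int (n - j))) - degs (tails (int n))) t"
    by blast
  from basis_mod_row_act[OF n_pos loop_inv_closed[OF g] this]
  have b: "basis_mod ?V ?W (degs (tails (int (n - j))) - degs (tails (int n)))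
      (\<lambda>i. row_act n (loop_inv n g) (t i))" unfolding lattice_chain_def .
  have s: "subsp ?V" "subsp ?W" by (rule subsp_lattice_chain[OF n_pos g])+
  have WV: "?W \<subseteq> ?V" by (rule lattice_chain_mono[OF n_pos]) simp
  have "card (degs (tails (int (n - j))) - degs (tails (int n))) = j"
  proof -
    have "degs (tails (int (n - j))) - degs (tails (int n)) = {int (n - j)..<int n}"
      unfolding degs_tails by auto
    then show ?thesis using j by (simp add: of_nat_diff)
  qed
  then have q: "quot_dim ?V ?W = j" using quot_dim_eq_card[OF s WV b] by simp
  obtain a where a: "?V \<subseteq> tails a"
    using row_act_sandwich[OF n_pos loop_inv_closed[OF g] order_refl order_refl]
    unfolding lattice_chain_def by blast
  obtain b where b: "tails b \<subseteq> ?W"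
    using row_act_sandwich[OF n_pos loop_inv_closed[OF g] order_refl order_refl]
    unfolding lattice_chain_def by blast
  \<comment> \<open>The factor \<varpi>^c is not part of the matrix action used so far, so the
    dimension is converted to a count of degrees, which a shift only translates.\<close>
  have "card (degs ?V - degs ?W) = j" using quot_dim_degs[OF s(1) a s(2) WV b] q by simp
  moreover have "degs (shift_set c ?V) - degs (shift_set c ?W) = (\<lambda>j. c + j) ` (degs ?V - degs ?W)"
    unfolding degs_shift_set by auto
  moreover have "tails (c + b) \<subseteq> shift_set c ?W" "shift_set c ?V \<subseteq> tails (c + a)"
    unfolding shift_set_tails[symmetric] by (rule shift_set_mono[OF b] shift_set_mono[OF a])+
  ultimately show ?thesis
    using quot_dim_degs[OF subsp_shift_set[OF s(1)] _ subsp_shift_set[OF s(2)] shift_set_mono[OF WV]]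
    by (simp add: card_image inj_on_def)
qed

text \<open>For the chain of an invertible matrix the nesting, the subspace property and the
  dimensions of a flag are automatic; what remains is that M lies in the compactified Jacobian and
  that the members are stable under \<varpi>^d. The n + 1 members cover a period of the chain, so
  stability spreads to all k.\<close>

lemma Phi_rep_Jflag_iff:
  assumes g: "g \<in> carrier (loopGL n)"
  shows "Phi_rep n d g \<in> Jflag n d \<longleftrightarrow>
    shift_set (int (delta n d)) (lattice_chain n g 0) \<in> Jbar n d \<and> adj_inv n g (psi n d) \<in> lie_iwahori n"
proof -
  let ?c = "int (delta n d)"
  let ?L = "\<lambda>k. shift_set ?c (lattice_chain n g k)"
  let ?F = "map (\<lambda>j. ?L (int (n - j))) [0..<Suc n]"
  have Fj: "?F ! j = ?L (int (n - j))" if "j \<le> n" for j using that by (simp del: upt_Suc)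
  have sh: "?L (int n) = shift_set (int n) (?L 0)"
    using lattice_chain_shift[OF n_pos g, of 1 0] by (simp add: shift_set_comm[of ?c])
  have stable: "shift_set (int d) (?L k) \<subseteq> ?L k \<longleftrightarrow>
      shift_set (int d) (lattice_chain n g k) \<subseteq> lattice_chain n g k" for k
    unfolding shift_set_comm[of "int d"] by (rule shift_set_subset_iff)
  have periodic: "(\<forall>k. shift_set (int d) (lattice_chain n g k) \<subseteq> lattice_chain n g k) \<longleftrightarrow>
      (\<forall>j\<le>n. shift_set (int d) (lattice_chain n g (int (n - j))) \<subseteq> lattice_chain n g (int (n - j)))"
    (is "?A \<longleftrightarrow> ?B")
  proof
    assume B: ?B
    show ?A
    proof
      fix k
      let ?i = "nat (k mod int n)"
      have i: "n - (n - ?i) = ?i" "int ?i = k mod int n"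
        using nat_mod_less[OF n_pos, of k] int_nat_mod[OF n_pos, of k] by auto
      have "shift_set (int d) (lattice_chain n g (int ?i)) \<subseteq> lattice_chain n g (int ?i)"
        using B[rule_format, of "n - ?i"] unfolding i(1) by simp
      moreover have "lattice_chain n g k = shift_set (int n * (k div int n)) (lattice_chain n g (int ?i))"
        unfolding i(2) lattice_chain_shift[OF n_pos g, symmetric] by simp
      ultimately show "shift_set (int d) (lattice_chain n g k) \<subseteq> lattice_chain n g k"
        by (simp only: shift_set_comm[of "int d"] shift_set_subset_iff)
    qed
  qed blast
  have "is_flag n d (?L 0) ?F \<longleftrightarrow> (\<forall>j\<le>n. shift_set (int d) (?L (int (n - j))) \<subseteq> ?L (int (n - j)))"
  proof -
    have "?F ! j \<subseteq> ?F ! Suc j" if "j < n" for j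
    proof -
      have "?L (int (n - j)) \<subseteq> ?L (int (n - Suc j))"
        by (rule shift_set_mono[OF lattice_chain_mono[OF n_pos]]) simp
      then show ?thesis using that Fj[of j] Fj[of "Suc j"] by simp
    qed
    moreover have "lin_span (range fls_const) (?F ! j) = ?F ! j" if "j \<le> n" for j
      unfolding lin_span_const_iff Fj[OF that] by (rule subsp_shift_set[OF subsp_lattice_chain[OF n_pos g]])
    moreover have "quot_dim (?F ! j) (shift_set (int n) (?L 0)) = j" if "j \<le> n" for j
      unfolding Fj[OF that] sh[symmetric] by (rule quot_dim_lattice_chain[OF g that])
    moreover have "length ?F = Suc n" "?F ! 0 = shift_set (int n) (?L 0)" "?F ! n = ?L 0"
      using Fj[of 0] Fj[of n] sh by simp_all
    moreover have "(\<forall>j\<le>n. shift_set (int d) (?F ! j) \<subseteq> ?F ! j) \<longleftrightarrow>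
        (\<forall>j\<le>n. shift_set (int d) (?L (int (n - j))) \<subseteq> ?L (int (n - j)))"
      using Fj by metis
    ultimately show ?thesis unfolding is_flag_def by meson
  qed
  then show ?thesis
    unfolding Phi_rep_eq Jflag_def adj_inv_lie_iwahori_iff[OF g] periodic stable by simp
qed

text \<open>The preimage in the loop group of the index 0 part of the affine Springer fiber;
  \<open>springer_fl0_variety\<close> is its quotient by the Iwahori subgroup.\<close>

definition springer_matrices :: "loop_mat set" where
  "springer_matrices = {g \<in> carrier (loopGL n). Phi_rep n d g \<in> Jflag n d}"

lemma springer_matrices_loopGL: "g \<in> springer_matrices \<Longrightarrow> g \<in> carrier (loopGL n)"
  by (simp add: springer_matrices_def)

lemma springer_fl0_eq: "springer_fl0 n d = (\<lambda>g. g <#\<^bsub>loopGL n\<^esub> iwahori n) ` springer_matrices"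
proof
  show "springer_fl0 n d \<subseteq> (\<lambda>g. g <#\<^bsub>loopGL n\<^esub> iwahori n) ` springer_matrices"
    unfolding springer_fl0_def springer_fl_def springer_matrices_def by (auto simp: Phi_coset)
  show "(\<lambda>g. g <#\<^bsub>loopGL n\<^esub> iwahori n) ` springer_matrices \<subseteq> springer_fl0 n d"
  proof
    fix C assume "C \<in> (\<lambda>g. g <#\<^bsub>loopGL n\<^esub> iwahori n) ` springer_matrices"
    then obtain g where g: "C = g <#\<^bsub>loopGL n\<^esub> iwahori n" "g \<in> carrier (loopGL n)" "Phi_rep n d g \<in> Jflag n d"
      unfolding springer_matrices_def by blast
    then have "adj_inv n g (psi n d) \<in> lie_iwahori n" using Phi_rep_Jflag_iff by blast
    then show "C \<in> springer_fl0 n d"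
      unfolding springer_fl0_def springer_fl_def using g Phi_coset[OF g(2)] by auto
  qed
qed

lemma Union_springer_fl0: "\<Union>(springer_fl0 n d) = springer_matrices"
proof
  show "\<Union>(springer_fl0 n d) \<subseteq> springer_matrices"
  proof
    fix x assume "x \<in> \<Union>(springer_fl0 n d)"
    then obtain g b where g: "g \<in> springer_matrices" "b \<in> iwahori n" "x = g * b"
      unfolding springer_fl0_eq by (auto simp: mem_l_coset)
    note G = springer_matrices_loopGL[OF g(1)]
    have "Phi_rep n d x = Phi_rep n d g" unfolding g(3) Phi_rep_eq lattice_chain_iwahori[OF G g(2)] ..
    then show "x \<in> springer_matrices"
      using g loopGL_mult[OF G iwahori_loopGL[OF g(2)]] by (simp add: springer_matrices_def)
  qed
  show "springer_matrices \<subseteq> \<Union>(springer_fl0 n d)"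
    unfolding springer_fl0_eq using self_mem_coset(1)[OF springer_matrices_loopGL] by blast
qed

end

section \<open>The involution\<close>

text \<open>The product J A^t J, the reflection of A in the antidiagonal. It reverses products, and
  \<iota>(g) is its value at g^-1.\<close>

definition antitranspose :: "nat \<Rightarrow> 'a mat \<Rightarrow> 'a mat" where
  "antitranspose n A = mat n n (\<lambda>(i, j). A $$ (n - Suc j, n - Suc i))"

lemma antitranspose_carrier [simp]: "antitranspose n A \<in> carrier_mat n n"
  by (simp add: antitranspose_def)

lemma antitranspose_dim [simp]: "dim_row (antitranspose n A) = n" "dim_col (antitranspose n A) = n"
  by (simp_all add: antitranspose_def)

lemma antitranspose_index [simp]:
  "i < n \<Longrightarrow> j < n \<Longrightarrow> antitranspose n A $$ (i, j) = A $$ (n - Suc j, n - Suc i)"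
  by (simp add: antitranspose_def)

lemma antitranspose_antitranspose:
  assumes "A \<in> carrier_mat n n"
  shows "antitranspose n (antitranspose n A) = A"
  by (rule eq_matI) (use assms in auto)

lemma antitranspose_one: "antitranspose n (1\<^sub>m n :: loop_mat) = 1\<^sub>m n"
  by (rule eq_matI) auto

lemma antitranspose_mult:
  fixes A B :: loop_mat
  assumes A: "A \<in> carrier_mat n n" and B: "B \<in> carrier_mat n n"
  shows "antitranspose n (A * B) = antitranspose n B * antitranspose n A"
proof (rule eq_matI)
  fix i j assume "i < dim_row (antitranspose n B * antitranspose n A)"
    "j < dim_col (antitranspose n B * antitranspose n A)"
  then have ij: "i < n" "j < n" by (simp_all add: antitranspose_def)
  have "antitranspose n (A * B) $$ (i, j) = (\<Sum>k<n. A $$ (n - Suc j, k) * B $$ (k, n - Suc i))"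
    using ij A B by (simp add: scalar_prod_def atLeast0LessThan)
  also have "\<dots> = (\<Sum>k<n. A $$ (n - Suc j, n - Suc k) * B $$ (n - Suc k, n - Suc i))"
    by (rule sum.nat_diff_reindex[symmetric])
  also have "\<dots> = (\<Sum>k<n. antitranspose n B $$ (i, k) * antitranspose n A $$ (k, j))"
    by (rule sum.cong) (use ij in \<open>auto simp: mult.commute\<close>)
  also have "\<dots> = (antitranspose n B * antitranspose n A) $$ (i, j)"
  proof -
    have "dim_row (antitranspose n B) = n" "dim_col (antitranspose n B) = n"
      "dim_row (antitranspose n A) = n" "dim_col (antitranspose n A) = n"
      by (simp_all add: antitranspose_def)
    then show ?thesis using ij by (simp add: scalar_prod_def atLeast0LessThan)
  qed
  finally show "antitranspose n (A * B) $$ (i, j) = (antitranspose n B * antitranspose n A) $$ (i, j)" .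
qed (auto simp: antitranspose_def)

lemma antitranspose_loopGL:
  assumes "g \<in> carrier (loopGL n)"
  shows "antitranspose n g \<in> carrier (loopGL n)"
    "loop_inv n (antitranspose n g) = antitranspose n (loop_inv n g)"
proof -
  have "antitranspose n g * antitranspose n (loop_inv n g) = 1\<^sub>m n"
    using antitranspose_mult[OF loop_inv_carrier_mat[OF assms] loopGL_carrier_mat[OF assms]]
    by (simp add: loop_inv_left[OF assms] antitranspose_one)
  from loop_inv_unique[OF antitranspose_carrier antitranspose_carrier this]
  show "antitranspose n g \<in> carrier (loopGL n)"
    "loop_inv n (antitranspose n g) = antitranspose n (loop_inv n g)" by blast+
qed

lemma iota_mat_eq:
  assumes g: "g \<in> carrier (loopGL n)"
  shows "iota_mat n g = antitranspose n (loop_inv n g)"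
proof -
  define J :: loop_mat where "J = mat n n (\<lambda>(i, j). if i + j + 1 = n then 1 else 0)"
  have J: "J \<in> carrier_mat n n" by (simp add: J_def)
  let ?A = "transpose_mat (loop_inv n g)"
  note gm = loopGL_carrier_mat[OF g] and im = loop_inv_carrier_mat[OF g]
  have A: "?A \<in> carrier_mat n n" using im by simp
  have "transpose_mat g * ?A = 1\<^sub>m n"
    using transpose_mult[OF im gm] by (simp add: loop_inv_left[OF g])
  from loop_inv_unique(3)[OF _ A this] gm have inv: "loop_inv n (transpose_mat g) = ?A" by simp
  have entry: "J $$ (i, k) = (if k = n - Suc i then 1 else 0)" "J $$ (k, i) = (if k = n - Suc i then 1 else 0)"
    if "i < n" "k < n" for i k
    using that by (auto simp: J_def)
  have JA: "(J * ?A) $$ (i, j) = ?A $$ (n - Suc i, j)" if ij: "i < n" "j < n" for i j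
  proof -
    have "(J * ?A) $$ (i, j) = (\<Sum>k<n. J $$ (i, k) * ?A $$ (k, j))"
      using ij J A by (simp add: scalar_prod_def atLeast0LessThan)
    also have "\<dots> = (\<Sum>k<n. if k = n - Suc i then ?A $$ (n - Suc i, j) else 0)"
      by (rule sum.cong) (use ij entry(1) in auto)
    also have "\<dots> = ?A $$ (n - Suc i, j)" using ij by simp
    finally show ?thesis .
  qed
  have "J * ?A * J = antitranspose n (loop_inv n g)"
  proof (rule eq_matI)
    fix i j assume "i < dim_row (antitranspose n (loop_inv n g))" "j < dim_col (antitranspose n (loop_inv n g))"
    then have ij: "i < n" "j < n" by (simp_all add: antitranspose_def)
    have JAc: "J * ?A \<in> carrier_mat n n" using J A by (rule mult_carrier_mat)
    have "(J * ?A * J) $$ (i, j) = (\<Sum>k<n. (J * ?A) $$ (i, k) * J $$ (k, j))"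
    proof -
      have "(J * ?A * J) $$ (i, j) = row (J * ?A) i \<bullet> col J j" using ij JAc J by (intro index_mult_mat(1)) auto
      also have "\<dots> = (\<Sum>k<n. row (J * ?A) i $ k * col J j $ k)"
        using J by (simp add: scalar_prod_def atLeast0LessThan)
      also have "\<dots> = (\<Sum>k<n. (J * ?A) $$ (i, k) * J $$ (k, j))"
        by (rule sum.cong[OF refl]) (use ij JAc J in \<open>simp del: index_mult_mat\<close>)
      finally show ?thesis .
    qed
    also have "\<dots> = (\<Sum>k<n. if k = n - Suc j then ?A $$ (n - Suc i, n - Suc j) else 0)"
      by (rule sum.cong) (use ij entry(2) JA in auto)
    also have "\<dots> = ?A $$ (n - Suc i, n - Suc j)" using ij by simp
    also have "\<dots> = antitranspose n (loop_inv n g) $$ (i, j)"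
    proof -
      have "n - Suc i < n" "n - Suc j < n" using ij by auto
      then show ?thesis using ij im by simp
    qed
    finally show "(J * ?A * J) $$ (i, j) = antitranspose n (loop_inv n g) $$ (i, j)" .
  qed (use J in \<open>auto simp: antitranspose_def\<close>)
  then show ?thesis unfolding iota_mat_def Let_def inv J_def .
qed

lemma iota_mat_loopGL:
  assumes "g \<in> carrier (loopGL n)"
  shows "iota_mat n g \<in> carrier (loopGL n)" "loop_inv n (iota_mat n g) = antitranspose n g"
    "iota_mat n (iota_mat n g) = g"
proof -
  show G: "iota_mat n g \<in> carrier (loopGL n)"
    unfolding iota_mat_eq[OF assms] by (rule antitranspose_loopGL(1)[OF loop_inv_closed[OF assms]])
  show inv: "loop_inv n (iota_mat n g) = antitranspose n g"
    unfolding iota_mat_eq[OF assms] antitranspose_loopGL(2)[OF loop_inv_closed[OF assms]] loop_inv_inv[OF assms] ..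
  show "iota_mat n (iota_mat n g) = g"
    unfolding iota_mat_eq[OF G] inv by (rule antitranspose_antitranspose[OF loopGL_carrier_mat[OF assms]])
qed

lemma iota_mat_mult:
  assumes "g \<in> carrier (loopGL n)" "h \<in> carrier (loopGL n)"
  shows "iota_mat n (g * h) = iota_mat n g * iota_mat n h"
  unfolding iota_mat_eq[OF assms(1)] iota_mat_eq[OF assms(2)] iota_mat_eq[OF loopGL_mult[OF assms]]
    loop_inv_mult[OF assms]
  by (rule antitranspose_mult[OF loop_inv_carrier_mat[OF assms(2)] loop_inv_carrier_mat[OF assms(1)]])

section \<open>\<iota> on the arc group, the Iwahori subgroup, cocharacters and cosets\<close>

lemma antitranspose_lie_arcGL: "A \<in> lie_arcGL n \<Longrightarrow> antitranspose n A \<in> lie_arcGL n"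
  unfolding lie_arcGL_def by auto

lemma antitranspose_lie_iwahori: "A \<in> lie_iwahori n \<Longrightarrow> antitranspose n A \<in> lie_iwahori n"
proof -
  assume A: "A \<in> lie_iwahori n"
  have "fls_nth (antitranspose n A $$ (i, j)) 0 = 0" if ij: "i < n" "j < i" for i j
  proof -
    have "n - Suc j < n" "n - Suc i < n - Suc j" using ij by auto
    then have "fls_nth (A $$ (n - Suc j, n - Suc i)) 0 = 0" using A unfolding lie_iwahori_def by blast
    then show ?thesis using ij by simp
  qed
  then show ?thesis using A antitranspose_lie_arcGL unfolding lie_iwahori_def by blast
qed

context
  fixes n :: nat
  assumes n_pos: "0 < n"
begin

lemma iota_mat_arcGL:
  assumes "g \<in> arcGL n"
  shows "iota_mat n g \<in> arcGL n"
proof -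
  note G = arcGL_loopGL[OF assms]
  have g: "g \<in> lie_arcGL n" "loop_inv n g \<in> lie_arcGL n" using assms by (auto simp: arcGL_lie_iff)
  show ?thesis
    unfolding arcGL_lie_iff iota_mat_loopGL(2)[OF G]
    using iota_mat_loopGL(1)[OF G] iota_mat_eq[OF G] antitranspose_lie_arcGL g by metis
qed

lemma iota_mat_iwahori:
  assumes "g \<in> iwahori n"
  shows "iota_mat n g \<in> iwahori n"
proof -
  note G = iwahori_loopGL[OF assms]
  have "loop_inv n g \<in> lie_iwahori n" using iwahori_inv[OF n_pos assms] by (simp add: iwahori_lie_iff)
  then show ?thesis
    unfolding iwahori_lie_iff using iota_mat_arcGL[OF iwahori_arcGL[OF assms]]
      iota_mat_eq[OF G] antitranspose_lie_iwahori by metis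
qed

text \<open>Inversion negates \<mu>, and reflection in the antidiagonal reverses it.\<close>

lemma iota_mat_x_pow:
  assumes len: "length \<mu> = n"
  shows "iota_mat n (x_pow \<mu>) = x_pow (rev (map uminus \<mu>))"
  unfolding iota_mat_eq[OF x_pow_loopGL(1)[OF n_pos len]] x_pow_loopGL(2)[OF n_pos len]
  by (rule eq_matI) (use len in \<open>auto simp: antitranspose_def x_pow_def rev_nth\<close>)

lemma iota_coset:
  assumes g: "g \<in> carrier (loopGL n)"
  shows "iota n (g <#\<^bsub>loopGL n\<^esub> iwahori n) = iota_mat n g <#\<^bsub>loopGL n\<^esub> iwahori n"
proof
  note hom = iota_mat_mult[OF g iwahori_loopGL]
  show "iota n (g <#\<^bsub>loopGL n\<^esub> iwahori n) \<subseteq> iota_mat n g <#\<^bsub>loopGL n\<^esub> iwahori n"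
  proof
    fix x assume "x \<in> iota n (g <#\<^bsub>loopGL n\<^esub> iwahori n)"
    then obtain y where y: "y \<in> g <#\<^bsub>loopGL n\<^esub> iwahori n" "x = iota_mat n y"
      unfolding iota_def by (rule imageE)
    then obtain b where b: "b \<in> iwahori n" "x = iota_mat n (g * b)" unfolding mem_l_coset by blast
    show "x \<in> iota_mat n g <#\<^bsub>loopGL n\<^esub> iwahori n"
      unfolding b(2) hom[OF b(1)] mem_l_coset using iota_mat_iwahori[OF b(1)] by blast
  qed
  show "iota_mat n g <#\<^bsub>loopGL n\<^esub> iwahori n \<subseteq> iota n (g <#\<^bsub>loopGL n\<^esub> iwahori n)"
  proof
    fix x assume "x \<in> iota_mat n g <#\<^bsub>loopGL n\<^esub> iwahori n"
    then obtain b where b: "b \<in> iwahori n" "x = iota_mat n g * b" unfolding mem_l_coset by blast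
    have "x = iota_mat n (g * iota_mat n b)"
      unfolding hom[OF iota_mat_iwahori[OF b(1)]] iota_mat_loopGL(3)[OF iwahori_loopGL[OF b(1)]] b(2) ..
    moreover have "g * iota_mat n b \<in> g <#\<^bsub>loopGL n\<^esub> iwahori n"
      unfolding mem_l_coset using iota_mat_iwahori[OF b(1)] by blast
    ultimately show "x \<in> iota n (g <#\<^bsub>loopGL n\<^esub> iwahori n)" unfolding iota_def by (rule image_eqI)
  qed
qed

lemma iota_decomposition:
  assumes "b \<in> iwahori n" "length \<mu> = n" "k \<in> arcGL n"
  shows "iota_mat n (b * x_pow \<mu> * k) = iota_mat n b * x_pow (rev (map uminus \<mu>)) * iota_mat n k"
  unfolding iota_mat_mult[OF loopGL_mult[OF iwahori_loopGL[OF assms(1)] x_pow_loopGL(1)[OF n_pos assms(2)]]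
      arcGL_loopGL[OF assms(3)]]
    iota_mat_mult[OF iwahori_loopGL[OF assms(1)] x_pow_loopGL(1)[OF n_pos assms(2)]]
    iota_mat_x_pow[OF assms(2)] ..

end

section \<open>The Hikita filtration and the gap filtration\<close>

text \<open>Because the entries sum to 0, the differences \<mu>_i - \<mu>_k add up to - n \<mu>_k,
  and each of the n - 1 - k indices after k subtracts 1 more. So |a(\<mu>)| is minus the exponent n
  \<mu>_k + (n - 1 - k), the form in which it meets the gap.\<close>

lemma hikita_sum:
  assumes n_pos: "0 < n" and len: "length \<mu> = n" and sum: "sum_list \<mu> = 0"
  obtains k where "k < n" "\<And>i. i < n \<Longrightarrow> \<mu> ! k \<le> \<mu> ! i" "\<And>i. i < n \<Longrightarrow> \<mu> ! i = \<mu> ! k \<Longrightarrow> i \<le> k"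
    "sum_list (hikita_a \<mu>) = - (int n * \<mu> ! k + int (n - Suc k))"
proof (cases "\<forall>i<n. \<mu> ! i = 0")
  case True
  have "hikita_a \<mu> = replicate (n - 1) 0" using True len by (simp add: hikita_a_def Let_def)
  then have s: "sum_list (hikita_a \<mu>) = 0" by (simp add: sum_list_replicate)
  \<comment> \<open>For \<mu> = 0 all entries are minimal; the last index n - 1 makes the formula
    give 0, in accordance with a(0) = 0.\<close>
  show thesis
    by (rule that[of "n - 1"]) (use True n_pos s in auto)
next
  case False
  let ?P = "\<lambda>k. k < n \<and> \<mu> ! k = Min (set \<mu>)"
  define k where "k = (GREATEST k. ?P k)"
  have ne: "set \<mu> \<noteq> {}" using len n_pos by auto
  then have "Min (set \<mu>) \<in> set \<mu>" by simp
  then obtain k0 where "?P k0" using len by (auto simp: in_set_conv_nth)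
  then have k: "?P k" unfolding k_def by (rule GreatestI_nat[where b = n]) auto
  have greatest: "i \<le> k" if "?P i" for i
    unfolding k_def using that by (rule Greatest_le_nat[where b = n]) auto
  have min: "\<mu> ! k \<le> \<mu> ! i" if "i < n" for i using k that len by auto
  have "hikita_a \<mu> = map (\<lambda>i. \<mu> ! i - \<mu> ! k - 1) [Suc k..<n] @ map (\<lambda>i. \<mu> ! i - \<mu> ! k) [0..<k]"
    unfolding hikita_a_def Let_def k_def len if_not_P[OF False] ..
  then have "sum_list (hikita_a \<mu>) =
      (\<Sum>i\<in>{Suc k..<n}. \<mu> ! i - \<mu> ! k - 1) + (\<Sum>i\<in>{0..<k}. \<mu> ! i - \<mu> ! k)"
    by (simp add: interv_sum_list_conv_sum_set_nat)
  also have "(\<Sum>i\<in>{Suc k..<n}. \<mu> ! i - \<mu> ! k - 1) =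
      (\<Sum>i\<in>{Suc k..<n}. \<mu> ! i - \<mu> ! k) - int (n - Suc k)"
    by (simp add: sum_subtractf)
  also have "(\<Sum>i\<in>{Suc k..<n}. \<mu> ! i - \<mu> ! k) = (\<Sum>i\<in>{k..<n}. \<mu> ! i - \<mu> ! k)"
    using k by (simp add: sum.atLeast_Suc_lessThan)
  finally have "sum_list (hikita_a \<mu>) =
      ((\<Sum>i\<in>{0..<k}. \<mu> ! i - \<mu> ! k) + (\<Sum>i\<in>{k..<n}. \<mu> ! i - \<mu> ! k)) - int (n - Suc k)" by simp
  also have "(\<Sum>i\<in>{0..<k}. \<mu> ! i - \<mu> ! k) + (\<Sum>i\<in>{k..<n}. \<mu> ! i - \<mu> ! k) =
      (\<Sum>i\<in>{0..<n}. \<mu> ! i - \<mu> ! k)"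
    by (rule sum.atLeastLessThan_concat) (use k in auto)
  also have "\<dots> = - (int n * \<mu> ! k)"
    using sum by (simp add: sum_subtractf sum_list_sum_nth len)
  finally have "sum_list (hikita_a \<mu>) = - (int n * \<mu> ! k + int (n - Suc k))" by simp
  then show thesis using that[of k] k min greatest by auto
qed

context
  fixes n d :: nat
  assumes n_pos: "0 < n" and d_pos: "0 < d" and cop: "coprime n d"
begin

text \<open>Stability under \<varpi>^n and \<varpi>^d is already given, so only the index is at
  stake: from a common lower bound on, n N minus the sum of \<mu> degrees are missing, whereas n N
  are required.\<close>

lemma Jbar_decomposition:
  assumes b: "b \<in> iwahori n" and len: "length \<mu> = n" and k: "k \<in> arcGL n"
    and adj: "adj_inv n (b * x_pow \<mu> * k) (psi n d) \<in> lie_iwahori n"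
  shows "shift_set (int (delta n d)) (lattice_chain n (b * x_pow \<mu> * k) 0) \<in> Jbar n d \<longleftrightarrow> sum_list \<mu> = 0"
proof -
  define g where "g = b * x_pow \<mu> * k"
  have g: "g \<in> carrier (loopGL n)"
    unfolding g_def
    by (intro loopGL_mult iwahori_loopGL[OF b] x_pow_loopGL(1)[OF n_pos len] arcGL_loopGL[OF k])
  let ?L = "lattice_chain n g 0" and ?\<delta> = "int (delta n d)"
  let ?M = "shift_set ?\<delta> ?L"
  define \<nu> where "\<nu> = map uminus \<mu>"
  have len\<nu>: "length \<nu> = n" using len by (simp add: \<nu>_def)
  have degs: "degs ?L = {j. \<nu> ! nat (j mod int n) \<le> j div int n}"
    unfolding g_def degs_lattice_chain[OF n_pos b len k] \<nu>_def using nat_mod_less[OF n_pos] len by simp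
  \<comment> \<open>- N bounds all entries of \<nu> from below; the summand \<delta> makes the
    resulting bound \<delta> - n N for the shifted lattice nonpositive, so that it can be compared
    with 0.\<close>
  define N where "N = ?\<delta> + (\<Sum>i<n. \<bar>\<nu> ! i\<bar>)"
  have N: "- N \<le> \<nu> ! i" if "i < n" for i
  proof -
    have "\<bar>\<nu> ! i\<bar> \<le> (\<Sum>i<n. \<bar>\<nu> ! i\<bar>)" by (rule member_le_sum) (use that in auto)
    then show ?thesis unfolding N_def by linarith
  qed
  let ?a = "?\<delta> - int n * N"
  have "1 * N \<le> int n * N"
    by (rule mult_right_mono) (use n_pos in \<open>auto simp: N_def intro!: add_nonneg_nonneg sum_nonneg\<close>)
  moreover have "?\<delta> \<le> N" unfolding N_def by (simp add: sum_nonneg)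
  ultimately have a0: "?a \<le> 0" by linarith
  have lower: "degs ?L \<subseteq> {- (int n * N)..}"
  proof
    fix j assume "j \<in> degs ?L"
    then have "- N \<le> j div int n" using N[OF nat_mod_less[OF n_pos, of j]] unfolding degs by simp
    then have "int n * - N \<le> int n * (j div int n)" by (rule mult_left_mono) simp
    also have "\<dots> \<le> j" using n_pos by (simp add: minus_mod_eq_mult_div[symmetric])
    finally show "j \<in> {- (int n * N)..}" by simp
  qed
  have "{?a..} - degs ?M = (\<lambda>j. ?\<delta> + j) ` ({- (int n * N)..} - degs ?L)"
  proof -
    have "(\<lambda>j. ?\<delta> + j) ` {- (int n * N)..} = {?a..}"
      using image_add_atLeast[of ?\<delta> "- (int n * N)"] by simp
    moreover have "(\<lambda>j. ?\<delta> + j) ` ({- (int n * N)..} - degs ?L) =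
        (\<lambda>j. ?\<delta> + j) ` {- (int n * N)..} - (\<lambda>j. ?\<delta> + j) ` degs ?L"
      by (rule image_set_diff) (simp add: inj_def)
    ultimately show ?thesis unfolding degs_shift_set by simp
  qed
  then have "card ({?a..} - degs ?M) = card ({- (int n * N)..} - degs ?L)"
    by (simp add: card_image inj_on_def)
  then have card: "int (card ({?a..} - degs ?M)) = int n * N + sum_list \<nu>"
    unfolding degs using card_degs_complement[OF n_pos len\<nu> N] by simp
  have sum\<nu>: "sum_list \<nu> = - sum_list \<mu>" unfolding \<nu>_def by (induction \<mu>) auto
  have Ma: "?M \<subseteq> tails ?a"
  proof -
    have "?M \<subseteq> shift_set ?\<delta> (tails (- (int n * N)))"
      by (rule shift_set_mono[OF subset_tails_of_degs[OF lower]])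
    then show ?thesis unfolding shift_set_tails by simp
  qed
  show ?thesis unfolding g_def[symmetric]
  proof
    assume M: "?M \<in> Jbar n d"
    note facts = Jbar_facts[OF n_pos d_pos cop M]
    have "int (card ({?a..} - degs ?M)) = int (card ({0..} - degs ?M)) + (0 - ?a)"
      by (rule card_complement_shift[OF degs_le[OF n_pos d_pos cop facts(4)] a0
          degs_ge[OF n_pos d_pos cop facts(5)]])
    then show "sum_list \<mu> = 0" using card facts(6) sum\<nu> by simp
  next
    assume s: "sum_list \<mu> = 0"
    obtain b' where b': "tails b' \<subseteq> ?L"
      using row_act_sandwich[OF n_pos loop_inv_closed[OF g] order_refl order_refl]
      unfolding lattice_chain_def by blast
    have "tails (?\<delta> + b') \<subseteq> ?M" unfolding shift_set_tails[symmetric] by (rule shift_set_mono[OF b'])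
    moreover have "shift_set (int n) ?M \<subseteq> ?M"
    proof -
      have "shift_set (int n) ?L = lattice_chain n g (int n)"
        using lattice_chain_shift[OF n_pos g, of 1 0] by simp
      also have "\<dots> \<subseteq> ?L" by (rule lattice_chain_mono[OF n_pos]) simp
      finally show ?thesis unfolding shift_set_comm[of "int n"] by (rule shift_set_mono)
    qed
    moreover have "shift_set (int d) ?M \<subseteq> ?M"
    proof -
      have "shift_set (int d) ?L \<subseteq> ?L"
        using adj unfolding g_def[symmetric] adj_inv_lie_iwahori_iff[OF n_pos d_pos cop g] by (rule spec)
      then show ?thesis unfolding shift_set_comm[of "int d"] by (rule shift_set_mono)
    qed
    moreover have "int (card ({?a..} - degs ?M)) = ?\<delta> - ?a" using card s sum\<nu> by simp
    ultimately show "?M \<in> Jbar n d"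
      unfolding Jbar_iff[OF n_pos d_pos cop]
      using subsp_shift_set[OF subsp_lattice_chain[OF n_pos g]] Ma by blast
  qed
qed

text \<open>\<psi>(d) is constant along diagonals, and reflection in the antidiagonal maps each
  diagonal to itself.\<close>

lemma antitranspose_psi: "antitranspose n (psi n d) = psi n d"
proof (rule eq_matI)
  fix i j assume "i < dim_row (psi n d)" "j < dim_col (psi n d)"
  then have ij: "i < n" "j < n" using psi_carrier[OF n_pos d_pos cop] by auto
  have e: "int (n - Suc i) = int (n - Suc j) + k \<longleftrightarrow> int j = int i + k" for k
    using ij by (auto simp: of_nat_diff)
  show "antitranspose n (psi n d) $$ (i, j) = psi n d $$ (i, j)"
    using ij by (simp add: psi_def Let_def diag_unit_def e del: of_nat_Suc)
qed (use psi_carrier[OF n_pos d_pos cop] in auto)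

text \<open>The Springer condition is thereby invariant under \<iota>. \<open>antitranspose\<close>
  is the negative of the differential of \<iota>, which is why no sign appears although \<iota>
  sends \<psi>(d) to - \<psi>(d).\<close>

lemma adj_inv_iota:
  assumes g: "g \<in> carrier (loopGL n)"
  shows "adj_inv n (iota_mat n g) (psi n d) = antitranspose n (adj_inv n g (psi n d))"
proof -
  note gm = loopGL_carrier_mat[OF g] and im = loop_inv_carrier_mat[OF g] and pm = psi_carrier[OF n_pos d_pos cop]
  have "antitranspose n (loop_inv n g * psi n d * g) =
      antitranspose n g * (psi n d * antitranspose n (loop_inv n g))"
    unfolding antitranspose_mult[OF mult_carrier_mat[OF im pm] gm] antitranspose_mult[OF im pm]
      antitranspose_psi ..
  also have "\<dots> = antitranspose n g * psi n d * antitranspose n (loop_inv n g)"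
    by (rule assoc_mult_mat[symmetric, of _ n n _ n _ n]) (use pm in auto)
  finally show ?thesis
    unfolding adj_inv_def iota_mat_loopGL(2)[OF g] unfolding iota_mat_eq[OF g] by (rule sym)
qed

lemma iota_springer_matrices:
  assumes g: "g \<in> springer_matrices n d"
  shows "iota_mat n g \<in> springer_matrices n d"
proof -
  note G = springer_matrices_loopGL[OF n_pos d_pos cop g]
  note iG = iota_mat_loopGL(1)[OF G]
  have J: "shift_set (int (delta n d)) (lattice_chain n g 0) \<in> Jbar n d"
    and adj: "adj_inv n g (psi n d) \<in> lie_iwahori n"
    using g Phi_rep_Jflag_iff[OF n_pos d_pos cop G] unfolding springer_matrices_def[OF n_pos d_pos cop] by auto
  have adj': "adj_inv n (iota_mat n g) (psi n d) \<in> lie_iwahori n"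
    unfolding adj_inv_iota[OF G] by (rule antitranspose_lie_iwahori[OF adj])
  obtain b \<mu> k where dec: "b \<in> iwahori n" "length \<mu> = n" "k \<in> arcGL n" "g = b * x_pow \<mu> * k"
    by (rule loopGL_decomposition[OF n_pos G])
  have s: "sum_list \<mu> = 0" using Jbar_decomposition[OF dec(1-3)] J adj unfolding dec(4) by blast
  have s': "sum_list (rev (map uminus \<mu>)) = 0"
  proof -
    have "sum_list (map uminus \<mu>) = - sum_list \<mu>" by (induction \<mu>) auto
    then show ?thesis using s by (simp add: sum_list_rev)
  qed
  have "shift_set (int (delta n d)) (lattice_chain n (iota_mat n g) 0) \<in> Jbar n d"
    using Jbar_decomposition[OF iota_mat_iwahori[OF n_pos dec(1)] _ iota_mat_arcGL[OF n_pos dec(3)],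
        of "rev (map uminus \<mu>)"] adj' s' dec(2)
    unfolding dec(4) iota_decomposition[OF n_pos dec(1-3)] by simp
  then show ?thesis
    using iG adj' Phi_rep_Jflag_iff[OF n_pos d_pos cop iG] unfolding springer_matrices_def[OF n_pos d_pos cop] by blast
qed

text \<open>\<iota> reverses and negates \<mu>, and passing to the lattice negates again, so with
  indices from 0 the degrees in the residue class of i, before the shift by \<delta>, start at n
  \<mu>_(n-1-i) + i. The least degree after the shift is \<delta> - |a(\<mu>)|, and the gap is
  \<delta> minus that.\<close>

lemma gap_iota:
  assumes g: "g \<in> springer_matrices n d"
    and dec: "b \<in> iwahori n" "length \<mu> = n" "k \<in> arcGL n" "g = b * x_pow \<mu> * k"
  shows "sum_list \<mu> = 0" "int (gap (fst (Phi_rep n d (iota_mat n g)))) = sum_list (hikita_a \<mu>)"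
proof -
  note G = springer_matrices_loopGL[OF n_pos d_pos cop g]
  let ?\<delta> = "int (delta n d)"
  have J: "shift_set ?\<delta> (lattice_chain n g 0) \<in> Jbar n d"
    and adj: "adj_inv n g (psi n d) \<in> lie_iwahori n"
    using g Phi_rep_Jflag_iff[OF n_pos d_pos cop G] unfolding springer_matrices_def[OF n_pos d_pos cop] by auto
  show s: "sum_list \<mu> = 0" using Jbar_decomposition[OF dec(1-3)] J adj unfolding dec(4) by blast
  let ?M = "shift_set ?\<delta> (lattice_chain n (iota_mat n g) 0)"
  have M: "?M \<in> Jbar n d"
    using iota_springer_matrices[OF g] Phi_rep_Jflag_iff[OF n_pos d_pos cop iota_mat_loopGL(1)[OF G]]
    unfolding springer_matrices_def[OF n_pos d_pos cop] by blast
  have len': "length (rev (map uminus \<mu>)) = n" using dec(2) by simp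
  have rn: "n - Suc (nat (j mod int n)) < n" for j using n_pos by simp
  have "degs (lattice_chain n (iota_mat n g) 0) = {j. \<mu> ! (n - Suc (nat (j mod int n))) \<le> j div int n}"
    unfolding dec(4) iota_decomposition[OF n_pos dec(1-3)]
      degs_lattice_chain[OF n_pos iota_mat_iwahori[OF n_pos dec(1)] len' iota_mat_arcGL[OF n_pos dec(3)]]
    using nat_mod_less[OF n_pos] dec(2) rn by (simp add: rev_nth)
  then have degs: "degs ?M = (\<lambda>j. ?\<delta> + j) ` {j. \<mu> ! (n - Suc (nat (j mod int n))) \<le> j div int n}"
    unfolding degs_shift_set by simp
  obtain l where l: "l < n" "\<And>i. i < n \<Longrightarrow> \<mu> ! l \<le> \<mu> ! i" "\<And>i. i < n \<Longrightarrow> \<mu> ! i = \<mu> ! l \<Longrightarrow> i \<le> l"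
    "sum_list (hikita_a \<mu>) = - (int n * \<mu> ! l + int (n - Suc l))"
    using hikita_sum[OF n_pos dec(2) s] by blast
  \<comment> \<open>After the reversal the residue n - 1 - l belongs to the entry \<mu>_l.\<close>
  define m where "m = int n * \<mu> ! l + int (n - Suc l)"
  have "n - Suc l < n" using n_pos by simp
  then have m: "m div int n = \<mu> ! l" "m mod int n = int (n - Suc l)" unfolding m_def by simp_all
  have m_mem: "?\<delta> + m \<in> degs ?M"
  proof -
    have "n - Suc (nat (m mod int n)) = l" unfolding m(2) using l(1) by simp
    then show ?thesis unfolding degs using m(1) by simp
  qed
  have m_least: "?\<delta> + m \<le> x" if "x \<in> degs ?M" for x
  proof -
    obtain j where j: "x = ?\<delta> + j" "\<mu> ! (n - Suc (nat (j mod int n))) \<le> j div int n"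
      using \<open>x \<in> degs ?M\<close> unfolding degs by blast
    let ?r = "nat (j mod int n)"
    have r: "?r < n" "int ?r = j mod int n" using nat_mod_less[OF n_pos] int_nat_mod[OF n_pos] by auto
    have rn: "n - Suc ?r < n" using n_pos by simp
    have je: "j = int n * (j div int n) + int ?r" unfolding r(2) by simp
    have "m \<le> j"
    \<comment> \<open>With equal quotients the residue decides, and it is smallest for the last
      minimal entry; a larger quotient gains at least n, more than any residue.\<close>
    proof (cases "j div int n = \<mu> ! l")
      case True
      then have "\<mu> ! (n - Suc ?r) = \<mu> ! l" using j(2) l(2)[OF rn] by simp
      then have "n - Suc ?r \<le> l" by (rule l(3)[OF rn])
      then have "n - Suc l \<le> ?r" using r(1) by linarith
      then show ?thesis using je unfolding True m_def by linarith
    next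
      case False
      then have "\<mu> ! l + 1 \<le> j div int n" using j(2) l(2)[OF rn] by linarith
      then have "int n * (\<mu> ! l + 1) \<le> int n * (j div int n)" by (rule mult_left_mono) simp
      moreover have "int n * (\<mu> ! l + 1) = int n * \<mu> ! l + int n" by (simp add: distrib_left)
      ultimately have "int n * \<mu> ! l + int n \<le> j" using je of_nat_0_le_iff[of ?r] by linarith
      then show ?thesis unfolding m_def by linarith
    qed
    then show ?thesis unfolding j(1) by simp
  qed
  have "int (gap ?M) = ?\<delta> - (?\<delta> + m)" by (rule gap_Jbar[OF n_pos d_pos cop M m_mem m_least])
  then show "int (gap (fst (Phi_rep n d (iota_mat n g)))) = sum_list (hikita_a \<mu>)"
    unfolding Phi_rep_eq[OF n_pos d_pos cop] l(4) m_def by simp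
qed

text \<open>From a given cell a decomposition of g is read off; conversely
  \<open>loopGL_decomposition\<close> provides one and thereby a cell. \<open>gap_iota\<close>
  evaluates the gap for either.\<close>

lemma springer_fl0_le_iff:
  assumes g: "g \<in> springer_matrices n d"
  shows "g <#\<^bsub>loopGL n\<^esub> iwahori n \<in> springer_fl0_le n d c \<longleftrightarrow>
    int (gap (fst (Phi_rep n d (iota_mat n g)))) \<le> c"
proof -
  note G = springer_matrices_loopGL[OF n_pos d_pos cop g]
  let ?C = "g <#\<^bsub>loopGL n\<^esub> iwahori n"
  have CK: "?C <#>\<^bsub>loopGL n\<^esub> arcGL n = g <#\<^bsub>loopGL n\<^esub> arcGL n"
  proof
    show "?C <#>\<^bsub>loopGL n\<^esub> arcGL n \<subseteq> g <#\<^bsub>loopGL n\<^esub> arcGL n"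
    proof
      fix x assume "x \<in> ?C <#>\<^bsub>loopGL n\<^esub> arcGL n"
      then obtain b k where bk: "b \<in> iwahori n" "k \<in> arcGL n" "x = (g * b) * k"
        unfolding set_mult_def l_coset_def by auto
      have "x = g * (b * k)"
        unfolding bk(3)
        by (rule assoc_mult_mat[OF loopGL_carrier_mat[OF G] loopGL_carrier_mat[OF iwahori_loopGL[OF bk(1)]]
            loopGL_carrier_mat[OF arcGL_loopGL[OF bk(2)]]])
      then show "x \<in> g <#\<^bsub>loopGL n\<^esub> arcGL n"
        unfolding mem_l_coset
        by (rule bexI[of _ "b * k"]) (rule arcGL_mult[OF n_pos iwahori_arcGL[OF bk(1)] bk(2)])
    qed
    show "g <#\<^bsub>loopGL n\<^esub> arcGL n \<subseteq> ?C <#>\<^bsub>loopGL n\<^esub> arcGL n"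
    proof
      fix x assume "x \<in> g <#\<^bsub>loopGL n\<^esub> arcGL n"
      then obtain k where k: "k \<in> arcGL n" "x = g * k" unfolding mem_l_coset by blast
      then show "x \<in> ?C <#>\<^bsub>loopGL n\<^esub> arcGL n"
        unfolding set_mult_def using self_mem_coset(1)[OF n_pos d_pos cop G] by auto
    qed
  qed
  have fl0: "?C \<in> springer_fl0 n d" unfolding springer_fl0_eq[OF n_pos d_pos cop] using g by blast
  have J: "shift_set (int (delta n d)) (lattice_chain n g 0) \<in> Jbar n d"
    and adj: "adj_inv n g (psi n d) \<in> lie_iwahori n"
    using g Phi_rep_Jflag_iff[OF n_pos d_pos cop G] unfolding springer_matrices_def[OF n_pos d_pos cop] by auto
  have gr0: "g <#\<^bsub>loopGL n\<^esub> arcGL n \<in> springer_gr0 n d"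
    unfolding springer_gr0_def springer_gr_def
    using G J lie_iwahori_arcGL[OF n_pos d_pos cop adj] Phi_gr_coset[OF n_pos d_pos cop G] by auto
  have "?C \<in> springer_fl0_le n d c \<longleftrightarrow>
      (\<exists>\<mu>\<in>cochars0 n. sum_list (hikita_a \<mu>) \<le> c \<and> g <#\<^bsub>loopGL n\<^esub> arcGL n \<in> schubert_cell n \<mu>)"
    unfolding springer_fl0_le_def mem_Collect_eq CK using fl0 gr0 by auto
  also have "\<dots> \<longleftrightarrow> int (gap (fst (Phi_rep n d (iota_mat n g)))) \<le> c"
  proof
    assume "\<exists>\<mu>\<in>cochars0 n. sum_list (hikita_a \<mu>) \<le> c \<and> g <#\<^bsub>loopGL n\<^esub> arcGL n \<in> schubert_cell n \<mu>"
    then obtain \<mu> b where \<mu>: "\<mu> \<in> cochars0 n" "sum_list (hikita_a \<mu>) \<le> c" and b: "b \<in> iwahori n"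
      and eq: "g <#\<^bsub>loopGL n\<^esub> arcGL n = (b * x_pow \<mu>) <#\<^bsub>loopGL n\<^esub> arcGL n"
      unfolding schubert_cell_def by blast
    have len: "length \<mu> = n" using \<mu>(1) by (simp add: cochars0_def)
    have "g \<in> (b * x_pow \<mu>) <#\<^bsub>loopGL n\<^esub> arcGL n"
      using self_mem_coset(2)[OF n_pos d_pos cop G] unfolding eq .
    then obtain k where k: "k \<in> arcGL n" "g = b * x_pow \<mu> * k" unfolding mem_l_coset by blast
    show "int (gap (fst (Phi_rep n d (iota_mat n g)))) \<le> c"
      using gap_iota(2)[OF g b len k] \<mu>(2) by simp
  next
    assume gap: "int (gap (fst (Phi_rep n d (iota_mat n g)))) \<le> c"
    obtain b \<mu> k where dec: "b \<in> iwahori n" "length \<mu> = n" "k \<in> arcGL n" "g = b * x_pow \<mu> * k"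
      by (rule loopGL_decomposition[OF n_pos G])
    note gi = gap_iota[OF g dec]
    have \<mu>: "\<mu> \<in> cochars0 n" using gi(1) dec(2) by (simp add: cochars0_def)
    have bx: "b * x_pow \<mu> \<in> carrier (loopGL n)"
      by (rule loopGL_mult[OF iwahori_loopGL[OF dec(1)] x_pow_loopGL(1)[OF n_pos dec(2)]])
    have "g \<in> (b * x_pow \<mu>) <#\<^bsub>loopGL n\<^esub> arcGL n" unfolding mem_l_coset using dec(3,4) by blast
    then have "(b * x_pow \<mu>) <#\<^bsub>loopGL n\<^esub> arcGL n = g <#\<^bsub>loopGL n\<^esub> arcGL n"
      by (rule group.l_repr_independence[OF group_loopGL _ bx subgroup_arcGL[OF n_pos]])
    then have "g <#\<^bsub>loopGL n\<^esub> arcGL n \<in> schubert_cell n \<mu>"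
      unfolding schubert_cell_def using dec(1) by blast
    then show "\<exists>\<mu>\<in>cochars0 n. sum_list (hikita_a \<mu>) \<le> c \<and> g <#\<^bsub>loopGL n\<^esub> arcGL n \<in> schubert_cell n \<mu>"
      using \<mu> gi(2) gap by auto
  qed
  finally show ?thesis .
qed

end

section \<open>Laurent series depending rationally on parameters\<close>

text \<open>The common pole bound is part of the notion: it makes each coefficient of a product a
  fixed finite sum of products of coefficients, uniformly in the point.\<close>

definition fls_rational ::
    "'p set \<Rightarrow> ('p \<Rightarrow> complex) set \<Rightarrow> ('p \<Rightarrow> complex fls) \<Rightarrow> bool" where
  "fls_rational U A G \<longleftrightarrow>
     (\<exists>p. \<forall>b\<in>U. G b \<in> tails p) \<and> (\<forall>k. rational_on U A (\<lambda>b. fls_nth (G b) k))"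

lemma fls_rationalI:
  "(\<And>b. b \<in> U \<Longrightarrow> G b \<in> tails p) \<Longrightarrow> (\<And>k. rational_on U A (\<lambda>b. fls_nth (G b) k)) \<Longrightarrow>
     fls_rational U A G"
  unfolding fls_rational_def by blast

lemma fls_rational_nth: "fls_rational U A G \<Longrightarrow> rational_on U A (\<lambda>b. fls_nth (G b) k)"
  by (simp add: fls_rational_def)

lemma fls_rational_const: "fls_rational U A (\<lambda>_. c)"
proof -
  obtain p where "c \<in> tails p" using fls_in_some_tails by blast
  then show ?thesis by (intro fls_rationalI[of _ _ p] rational_on_const)
qed

lemma fls_rational_add:
  assumes "fls_rational U A F" "fls_rational U A G"
  shows "fls_rational U A (\<lambda>b. F b + G b)"
proof -
  obtain p q where p: "\<And>b. b \<in> U \<Longrightarrow> F b \<in> tails p" and q: "\<And>b. b \<in> U \<Longrightarrow> G b \<in> tails q"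
    using assms unfolding fls_rational_def by blast
  show ?thesis
  proof (rule fls_rationalI[where p = "min p q"])
    fix b assume b: "b \<in> U"
    then have "F b \<in> tails (min p q)" "G b \<in> tails (min p q)"
      using p q tails_mono[of "min p q" p] tails_mono[of "min p q" q] by auto
    then show "F b + G b \<in> tails (min p q)" by (rule subsp_add[OF subsp_tails])
  next
    fix k
    show "rational_on U A (\<lambda>b. fls_nth (F b + G b) k)"
      unfolding fls_plus_nth by (intro rational_on_add fls_rational_nth assms)
  qed
qed

lemma fls_times_nth_tails:
  fixes f g :: "complex fls"
  assumes f: "f \<in> tails p" and g: "g \<in> tails q"
  shows "fls_nth (f * g) k = (\<Sum>i=p..k - q. fls_nth f i * fls_nth g (k - i))"
proof (cases "f = 0 \<or> g = 0")
  case False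
  then have le: "p \<le> fls_subdegree f" "q \<le> fls_subdegree g"
    using f g by (simp_all add: tails_subdegree)
  have "fls_nth (f * g) k = (\<Sum>i=fls_subdegree f..k - fls_subdegree g. fls_nth f i * fls_nth g (k - i))"
    by (rule fls_times_nth(2))
  also have "\<dots> = (\<Sum>i=p..k - q. fls_nth f i * fls_nth g (k - i))"
  proof (rule sum.mono_neutral_left)
    show "\<forall>i\<in>{p..k - q} - {fls_subdegree f..k - fls_subdegree g}. fls_nth f i * fls_nth g (k - i) = 0"
    proof
      fix i assume "i \<in> {p..k - q} - {fls_subdegree f..k - fls_subdegree g}"
      then have "i < fls_subdegree f \<or> k - i < fls_subdegree g" by auto
      then show "fls_nth f i * fls_nth g (k - i) = 0" by auto
    qed
  qed (use le in auto)
  finally show ?thesis .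
qed auto

lemma fls_rational_mult:
  assumes "fls_rational U A F" "fls_rational U A G"
  shows "fls_rational U A (\<lambda>b. F b * G b)"
proof -
  obtain p q where p: "\<And>b. b \<in> U \<Longrightarrow> F b \<in> tails p" and q: "\<And>b. b \<in> U \<Longrightarrow> G b \<in> tails q"
    using assms unfolding fls_rational_def by blast
  show ?thesis
  proof (rule fls_rationalI)
    show "F b * G b \<in> tails (p + q)" if "b \<in> U" for b by (rule tails_mult[OF p[OF that] q[OF that]])
    fix k
    have "rational_on U A (\<lambda>b. \<Sum>i=p..k - q. fls_nth (F b) i * fls_nth (G b) (k - i))"
      by (intro rational_on_sum rational_on_mult fls_rational_nth assms)
    moreover have "rational_on U A (\<lambda>b. fls_nth (F b * G b) k) =
        rational_on U A (\<lambda>b. \<Sum>i=p..k - q. fls_nth (F b) i * fls_nth (G b) (k - i))"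
      by (rule rational_on_cong) (rule fls_times_nth_tails[OF p q])
    ultimately show "rational_on U A (\<lambda>b. fls_nth (F b * G b) k)" by simp
  qed
qed

lemma fls_rational_sum:
  "(\<And>i. i \<in> I \<Longrightarrow> fls_rational U A (G i)) \<Longrightarrow> fls_rational U A (\<lambda>b. \<Sum>i\<in>I. G i b)"
  by (induction I rule: infinite_finite_induct) (auto intro: fls_rational_const fls_rational_add)

lemma fls_rational_prod:
  "(\<And>i. i \<in> I \<Longrightarrow> fls_rational U A (G i)) \<Longrightarrow> fls_rational U A (\<lambda>b. \<Prod>i\<in>I. G i b)"
  by (induction I rule: infinite_finite_induct) (auto intro: fls_rational_const fls_rational_mult)

lemma fls_rational_det:
  assumes H: "\<And>b. H b \<in> carrier_mat n n"
    and r: "\<And>i j. i < n \<Longrightarrow> j < n \<Longrightarrow> fls_rational U A (\<lambda>b. H b $$ (i, j))"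
  shows "fls_rational U A (\<lambda>b. det (H b))"
  unfolding det_def'[OF H]
proof (intro fls_rational_sum fls_rational_mult fls_rational_prod fls_rational_const r)
  fix p i assume "p \<in> {p. p permutes {0..<n}}" "i \<in> {0..<n}"
  then show "i < n" "p i < n" using permutes_in_image[of p "{0..<n}" i] by auto
qed

text \<open>The equation for D times its inverse determines the coefficients of the inverse
  recursively, dividing only by the leading coefficient of D. That this sits in degree 0 at every
  point of \<open>U\<close> keeps the recursion uniform.\<close>

lemma fls_rational_inverse:
  assumes D: "fls_rational U A D" and u: "\<And>b. b \<in> U \<Longrightarrow> D b \<noteq> 0 \<and> fls_subdegree (D b) = 0"
  shows "fls_rational U A (\<lambda>b. inverse (D b))"
proof -
  have D0: "D b \<in> tails 0" if "b \<in> U" for b using u[OF that] by (simp add: tails_subdegree)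
  have E0: "inverse (D b) \<in> tails 0" if "b \<in> U" for b
    using u[OF that] by (simp add: tails_subdegree fls_inverse_subdegree)
  have lead: "fls_nth (D b) 0 \<noteq> 0" if "b \<in> U" for b
    using u[OF that] nth_fls_subdegree_nonzero[of "D b"] by simp
  have nat: "rational_on U A (\<lambda>b. fls_nth (inverse (D b)) (int k))" for k
  proof (induction k rule: less_induct)
    case (less k)
    have rec: "fls_nth (inverse (D b)) (int k) = inverse (fls_nth (D b) 0) *
        ((if k = 0 then 1 else 0) +
         (- 1) * (\<Sum>i\<in>{1..k}. fls_nth (D b) (int i) * fls_nth (inverse (D b)) (int (k - i))))"
      if b: "b \<in> U" for b
    proof -
      have "(\<Sum>i=0..int k - 0. fls_nth (D b) i * fls_nth (inverse (D b)) (int k - i)) =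
          fls_nth (D b * inverse (D b)) (int k)"
        by (rule fls_times_nth_tails[OF D0[OF b] E0[OF b], symmetric])
      also have "\<dots> = (if k = 0 then 1 else 0)" using u[OF b] by simp
      also have "(\<Sum>i=0..int k - 0. fls_nth (D b) i * fls_nth (inverse (D b)) (int k - i)) =
          (\<Sum>i\<in>{0..k}. fls_nth (D b) (int i) * fls_nth (inverse (D b)) (int (k - i)))"
        by (rule sum.reindex_bij_witness[of _ int nat]) auto
      also have "\<dots> = fls_nth (D b) 0 * fls_nth (inverse (D b)) (int k) +
          (\<Sum>i\<in>{1..k}. fls_nth (D b) (int i) * fls_nth (inverse (D b)) (int (k - i)))"
        by (subst sum.atLeast_Suc_atMost) auto
      finally have "fls_nth (D b) 0 * fls_nth (inverse (D b)) (int k) = (if k = 0 then 1 else 0) +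
         (- 1) * (\<Sum>i\<in>{1..k}. fls_nth (D b) (int i) * fls_nth (inverse (D b)) (int (k - i)))"
        by (simp add: algebra_simps)
      from arg_cong[OF this, of "\<lambda>z. inverse (fls_nth (D b) 0) * z"] show ?thesis
        unfolding mult.assoc[symmetric] left_inverse[OF lead[OF b]] mult_1 .
    qed
    have "rational_on U A (\<lambda>b. inverse (fls_nth (D b) 0) *
        ((if k = 0 then 1 else 0) +
         (- 1) * (\<Sum>i\<in>{1..k}. fls_nth (D b) (int i) * fls_nth (inverse (D b)) (int (k - i)))))"
      by (intro rational_on_mult rational_on_add rational_on_sum rational_on_inverse rational_on_const
          fls_rational_nth[OF D] lead less.IH) auto
    moreover have "rational_on U A (\<lambda>b. fls_nth (inverse (D b)) (int k)) =
        rational_on U A (\<lambda>b. inverse (fls_nth (D b) 0) *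
        ((if k = 0 then 1 else 0) +
         (- 1) * (\<Sum>i\<in>{1..k}. fls_nth (D b) (int i) * fls_nth (inverse (D b)) (int (k - i)))))"
      by (rule rational_on_cong) (rule rec)
    ultimately show ?case by simp
  qed
  show ?thesis
  proof (rule fls_rationalI[OF E0])
    fix k
    show "rational_on U A (\<lambda>b. fls_nth (inverse (D b)) k)"
    proof (cases "k < 0")
      case True
      have "rational_on U A (\<lambda>b. fls_nth (inverse (D b)) k) = rational_on U A (\<lambda>_. 0)"
        by (rule rational_on_cong) (use E0 True in \<open>simp add: tails_iff\<close>)
      then show ?thesis by (simp add: rational_on_const)
    next
      case False
      then show ?thesis using nat[of "nat k"] by simp
    qed
  qed
qed

lemma fls_rational_cong:
  assumes "\<And>b. b \<in> U \<Longrightarrow> F b = G b" "fls_rational U A G"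
  shows "fls_rational U A F"
proof -
  have "rational_on U A (\<lambda>b. fls_nth (F b) k) = rational_on U A (\<lambda>b. fls_nth (G b) k)" for k
    by (rule rational_on_cong) (simp add: assms(1))
  then show ?thesis using assms unfolding fls_rational_def by simp
qed

text \<open>Cramer's rule: the entries of the inverse are cofactors divided by the
  determinant.\<close>

lemma fls_rational_loop_inv:
  assumes n: "0 < n" and H: "\<And>b. H b \<in> carrier_mat n n"
    and r: "\<And>i j. i < n \<Longrightarrow> j < n \<Longrightarrow> fls_rational U A (\<lambda>b. H b $$ (i, j))"
    and u: "\<And>b. b \<in> U \<Longrightarrow> det (H b) \<noteq> 0 \<and> fls_subdegree (det (H b)) = 0"
    and ij: "i < n" "j < n"
  shows "fls_rational U A (\<lambda>b. loop_inv n (H b) $$ (i, j))"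
proof -
  have adj: "loop_inv n (H b) $$ (i, j) = inverse (det (H b)) * ((- 1) ^ (j + i) * det (mat_delete (H b) j i))"
    if b: "b \<in> U" for b
  proof -
    let ?B = "inverse (det (H b)) \<cdot>\<^sub>m adj_mat (H b)"
    note ad = adj_mat[OF H]
    have B: "?B \<in> carrier_mat n n" using ad(1) by simp
    have "H b * ?B = inverse (det (H b)) \<cdot>\<^sub>m (det (H b) \<cdot>\<^sub>m 1\<^sub>m n)"
      unfolding mult_smult_distrib[OF H ad(1)] ad(2) ..
    also have "\<dots> = 1\<^sub>m n"
      by (rule eq_matI) (use u[OF b] in auto)
    finally have "loop_inv n (H b) = ?B" by (rule loop_inv_unique(3)[OF H B])
    moreover have "dim_row (H b) = n" "dim_col (H b) = n" using H[of b] by auto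
    ultimately show ?thesis using ij by (simp add: adj_mat_def cofactor_def)
  qed
  have del: "fls_rational U A (\<lambda>b. det (mat_delete (H b) j i))"
  proof (rule fls_rational_det[of _ "n - 1"])
    show "mat_delete (H b) j i \<in> carrier_mat (n - 1) (n - 1)" for b
      using H[of b] by (rule mat_delete_carrier)
    fix k l assume kl: "k < n - 1" "l < n - 1"
    have "mat_delete (H b) j i $$ (k, l) =
        H b $$ (if k < j then k else Suc k, if l < i then l else Suc l)" for b
      using H[of b] kl by (simp add: mat_delete_def)
    then show "fls_rational U A (\<lambda>b. mat_delete (H b) j i $$ (k, l))" using r kl by simp
  qed
  show ?thesis
    by (rule fls_rational_cong, rule adj, assumption)
      (intro fls_rational_mult fls_rational_inverse fls_rational_det[OF H r] fls_rational_const del u)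
qed

section \<open>Determinants of lattices\<close>

lemma det_lie_arcGL:
  assumes "g \<in> lie_arcGL n"
  shows "det g \<in> tails 0"
proof -
  have g: "g \<in> carrier_mat n n" "\<And>i j. i < n \<Longrightarrow> j < n \<Longrightarrow> g $$ (i, j) \<in> tails 0"
    using assms unfolding lie_arcGL_def tails_0 by auto
  have one: "1 \<in> tails 0" "-1 \<in> tails 0" by (auto simp: tails_iff)
  have mult: "f * h \<in> tails 0" if "f \<in> tails 0" "h \<in> tails 0" for f h
    using tails_mult[OF that] by simp
  have prod: "(\<Prod>i\<in>I. f i) \<in> tails 0" if "\<And>i. i \<in> I \<Longrightarrow> f i \<in> tails 0" for f :: "nat \<Rightarrow> _" and I
    using that by (induction I rule: infinite_finite_induct) (auto intro: one mult)
  show ?thesis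
    unfolding det_def'[OF g(1)]
  proof (intro subsp_sum[OF subsp_tails] mult prod g(2))
    fix p assume "p \<in> {p. p permutes {0..<n}}"
    show "signof p \<in> tails 0" by (cases p rule: sign_cases) (simp_all add: one)
    fix i assume "i \<in> {0..<n}"
    then show "i < n" "p i < n" using \<open>p \<in> _\<close> permutes_in_image[of p "{0..<n}" i] by auto
  qed
qed

lemma det_loopGL:
  assumes "g \<in> carrier (loopGL n)"
  shows "det g * det (loop_inv n g) = 1"
  using det_mult[OF loopGL_carrier_mat[OF assms] loop_inv_carrier_mat[OF assms]]
  by (simp add: loop_inv_right[OF assms])

lemma det_loopGL_nonzero: "g \<in> carrier (loopGL n) \<Longrightarrow> det g \<noteq> 0"
  using det_loopGL by fastforce

lemma subdegree_det_inv:
  assumes "g \<in> carrier (loopGL n)"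
  shows "fls_subdegree (det g) + fls_subdegree (det (loop_inv n g)) = 0"
  using fls_subdegree_mult[OF det_loopGL_nonzero[OF assms] det_loopGL_nonzero[OF loop_inv_closed[OF assms]]]
  by (simp add: det_loopGL[OF assms])

text \<open>The determinant and its inverse are both power series.\<close>

lemma subdegree_det_arcGL:
  assumes "g \<in> arcGL n"
  shows "fls_subdegree (det g) = 0"
proof -
  note G = arcGL_loopGL[OF assms]
  have "det g \<in> tails 0" "det (loop_inv n g) \<in> tails 0"
    using assms det_lie_arcGL by (auto simp: arcGL_lie_iff)
  then have "0 \<le> fls_subdegree (det g)" "0 \<le> fls_subdegree (det (loop_inv n g))"
    using det_loopGL_nonzero[OF G] det_loopGL_nonzero[OF loop_inv_closed[OF G]]
    by (simp_all add: tails_subdegree)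
  then show ?thesis using subdegree_det_inv[OF G] by linarith
qed

lemma det_x_pow:
  assumes "length \<mu> = n"
  shows "det (x_pow \<mu>) = fls_X_intpow (sum_list \<mu>)"
proof -
  have "upper_triangular (x_pow \<mu>)" unfolding upper_triangular_def x_pow_def by auto
  from det_upper_triangular[OF this x_pow_carrier[OF assms]]
  have "det (x_pow \<mu>) = prod_list (diag_mat (x_pow \<mu>))" .
  also have "diag_mat (x_pow \<mu>) = map fls_X_intpow \<mu>"
    by (rule nth_equalityI) (auto simp: diag_mat_def x_pow_def)
  also have "prod_list (map fls_X_intpow \<mu>) = (fls_X_intpow (sum_list \<mu>) :: complex fls)"
  proof (induction \<mu>)
    case (Cons a \<mu>)
    show ?case unfolding list.map prod_list.Cons sum_list.Cons Cons.IH
      by (rule fls_X_intpow_times_fls_X_intpow)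
  qed simp
  finally show ?thesis .
qed

text \<open>The determinants of the Iwahori and arc factors are units of C[[x]], and that of x^\<mu>
  is x to the sum of the entries of \<mu>, which is 1 in index 0.\<close>

lemma subdegree_det_springer_matrices:
  assumes n_pos: "0 < n" "0 < d" "coprime n d" and g: "g \<in> springer_matrices n d"
  shows "fls_subdegree (det (loop_inv n g)) = 0"
proof -
  note G = springer_matrices_loopGL[OF n_pos g]
  obtain b \<mu> k where dec: "b \<in> iwahori n" "length \<mu> = n" "k \<in> arcGL n" "g = b * x_pow \<mu> * k"
    by (rule loopGL_decomposition[OF n_pos(1) G])
  have s: "sum_list \<mu> = 0" by (rule gap_iota(1)[OF n_pos g dec])
  note bG = iwahori_loopGL[OF dec(1)] and kG = arcGL_loopGL[OF dec(3)]
    and xG = x_pow_loopGL(1)[OF n_pos(1) dec(2)]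
  have "det g = det b * det (x_pow \<mu>) * det k"
    unfolding dec(4) det_mult[OF loopGL_carrier_mat[OF loopGL_mult[OF bG xG]] loopGL_carrier_mat[OF kG]]
      det_mult[OF loopGL_carrier_mat[OF bG] loopGL_carrier_mat[OF xG]] ..
  also have "\<dots> = det b * det k" unfolding det_x_pow[OF dec(2)] s by simp
  finally have "fls_subdegree (det g) = fls_subdegree (det b) + fls_subdegree (det k)"
    using fls_subdegree_mult[OF det_loopGL_nonzero[OF bG] det_loopGL_nonzero[OF kG]] by simp
  also have "\<dots> = 0"
    using subdegree_det_arcGL[OF dec(3)] subdegree_det_arcGL[OF iwahori_arcGL[OF dec(1)]] by simp
  finally show ?thesis using subdegree_det_inv[OF G] by simp
qed

section \<open>Frames\<close>

definition row_series :: "complex mat \<Rightarrow> nat \<Rightarrow> complex fls" where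
  "row_series b i = (\<Sum>j<dim_col b. fls_const (b $$ (i, j)) * fls_X ^ j)"

lemma frame_span_eq:
  "frame_span m b = {(\<Sum>i<m. fls_const (c i) * row_series b i) + f | c f. f \<in> tails (int (dim_col b))}"
  by (simp add: frame_span_def row_series_def)

lemma fls_nth_row_series:
  "fls_nth (row_series b i) k = (if 0 \<le> k \<and> k < int (dim_col b) then b $$ (i, nat k) else 0)"
proof -
  have "fls_nth (row_series b i) k = (\<Sum>j<dim_col b. if int j = k then b $$ (i, j) else 0)"
    unfolding row_series_def fls_nth_sum by (rule sum.cong) auto
  also have "\<dots> = (if 0 \<le> k \<and> k < int (dim_col b) then b $$ (i, nat k) else 0)"
  proof (cases "0 \<le> k")
    case True
    have "(\<Sum>j<dim_col b. if int j = k then b $$ (i, j) else 0) =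
        (\<Sum>j<dim_col b. if j = nat k then b $$ (i, nat k) else 0)"
      by (rule sum.cong) (use True in auto)
    then show ?thesis using True by (simp add: nat_less_iff)
  qed (auto intro!: sum.neutral)
  finally show ?thesis .
qed

definition independent_rows :: "complex mat \<Rightarrow> bool" where
  "independent_rows b \<longleftrightarrow>
     (\<forall>c. (\<forall>j<dim_col b. (\<Sum>i<dim_row b. c i * b $$ (i, j)) = 0) \<longrightarrow> (\<forall>i<dim_row b. c i = 0))"

lemma subsp_frame_span: "subsp (frame_span m b)"
  unfolding subsp_def
proof (intro conjI ballI allI)
  show "0 \<in> frame_span m b"
    unfolding frame_span_eq using subsp_zero[OF subsp_tails]
    by (intro CollectI exI[of _ "\<lambda>_. 0"] exI[of _ 0]) auto
  fix f g assume "f \<in> frame_span m b" "g \<in> frame_span m b"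
  then obtain c u c' u' where f: "f = (\<Sum>i<m. fls_const (c i) * row_series b i) + u" "u \<in> tails (int (dim_col b))"
    and g: "g = (\<Sum>i<m. fls_const (c' i) * row_series b i) + u'" "u' \<in> tails (int (dim_col b))"
    unfolding frame_span_eq by blast
  have "f + g = (\<Sum>i<m. fls_const (c i + c' i) * row_series b i) + (u + u')"
    unfolding f(1) g(1) by (simp add: fls_plus_const[symmetric] distrib_right sum.distrib)
  moreover have "u + u' \<in> tails (int (dim_col b))" by (rule subsp_add[OF subsp_tails f(2) g(2)])
  ultimately show "f + g \<in> frame_span m b" unfolding frame_span_eq
    by (intro CollectI exI[of _ "\<lambda>i. c i + c' i"] exI[of _ "u + u'"] conjI)
next
  fix a f assume "f \<in> frame_span m b"
  then obtain c u where f: "f = (\<Sum>i<m. fls_const (c i) * row_series b i) + u" "u \<in> tails (int (dim_col b))"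
    unfolding frame_span_eq by blast
  have "fls_const a * f = (\<Sum>i<m. fls_const (a * c i) * row_series b i) + fls_const a * u"
    unfolding f(1)
    by (simp add: distrib_left sum_distrib_left fls_const_mult_const[symmetric] mult.assoc
        del: fls_const_mult_const)
  moreover have "fls_const a * u \<in> tails (int (dim_col b))" by (rule subsp_scale[OF subsp_tails f(2)])
  ultimately show "fls_const a * f \<in> frame_span m b" unfolding frame_span_eq
    by (intro CollectI exI[of _ "\<lambda>i. a * c i"] exI[of _ "fls_const a * u"] conjI)
qed

lemma tails_frame_span: "tails (int (dim_col b)) \<subseteq> frame_span m b"
proof
  fix f assume "f \<in> tails (int (dim_col b))"
  then show "f \<in> frame_span m b" unfolding frame_span_eq
    by (intro CollectI exI[of _ "\<lambda>_. 0"] exI[of _ f]) auto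
qed

lemma row_series_frame_span:
  assumes "i < m" shows "row_series b i \<in> frame_span m b"
proof -
  have "(\<Sum>k<m. fls_const (if k = i then 1 else 0) * row_series b k) =
      (\<Sum>k<m. if k = i then row_series b i else 0)"
    by (rule sum.cong) auto
  also have "\<dots> = row_series b i" using assms by simp
  finally show ?thesis unfolding frame_span_eq
    using subsp_zero[OF subsp_tails]
    by (intro CollectI exI[of _ "\<lambda>k. if k = i then 1 else 0"] exI[of _ 0]) simp
qed

lemma row_series_tails: "row_series b i \<in> tails 0"
  unfolding tails_iff fls_nth_row_series by simp

lemma frame_span_tails: "frame_span m b \<subseteq> tails 0"
proof
  fix f assume "f \<in> frame_span m b"
  then obtain c u where f: "f = (\<Sum>i<m. fls_const (c i) * row_series b i) + u" "u \<in> tails (int (dim_col b))"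
    unfolding frame_span_eq by blast
  have "u \<in> tails 0" using f(2) tails_mono[of 0 "int (dim_col b)"] by auto
  then show "f \<in> tails 0" unfolding f(1)
    by (intro subsp_add[OF subsp_tails] subsp_lincomb[OF subsp_tails] row_series_tails)
qed

lemma independent_rows_lincomb:
  assumes b: "independent_rows b" and m: "m \<le> dim_row b"
    and c: "(\<Sum>i<m. fls_const (c i) * row_series b i) \<in> tails (int (dim_col b))"
    and i: "i < m"
  shows "c i = 0"
proof -
  define c' where "c' i = (if i < m then c i else 0)" for i
  have "(\<Sum>i<dim_row b. c' i * b $$ (i, j)) = 0" if j: "j < dim_col b" for j
  proof -
    have "(\<Sum>i<dim_row b. c' i * b $$ (i, j)) = (\<Sum>i<m. c i * b $$ (i, j))"
      by (rule sum.mono_neutral_cong_right) (use m in \<open>auto simp: c'_def\<close>)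
    also have "\<dots> = fls_nth (\<Sum>i<m. fls_const (c i) * row_series b i) (int j)"
      using j by (simp add: fls_nth_sum fls_nth_row_series)
    also have "\<dots> = 0" using c j unfolding tails_iff by simp
    finally show ?thesis .
  qed
  then have "\<forall>i<dim_row b. c' i = 0" using b unfolding independent_rows_def by blast
  moreover have "i < dim_row b" using i m by simp
  ultimately have "c' i = 0" by blast
  then show ?thesis using i by (simp add: c'_def)
qed

lemma basis_mod_frame:
  assumes "independent_rows b" "m \<le> dim_row b"
  shows "basis_mod (frame_span m b) (tails (int (dim_col b))) {..<m} (row_series b)"
  unfolding basis_mod_def
proof (intro conjI ballI allI impI)
  show "\<And>i. i \<in> {..<m} \<Longrightarrow> row_series b i \<in> frame_span m b" by (simp add: row_series_frame_span)
  fix f assume "f \<in> frame_span m b"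
  then obtain c u where "f = (\<Sum>i<m. fls_const (c i) * row_series b i) + u" "u \<in> tails (int (dim_col b))"
    unfolding frame_span_eq by blast
  then show "\<exists>c. f - (\<Sum>i\<in>{..<m}. fls_const (c i) * row_series b i) \<in> tails (int (dim_col b))"
    by (intro exI[of _ c]) simp
qed (use independent_rows_lincomb[OF assms] in auto)

lemma card_degs_frame_span:
  assumes "independent_rows b" "m \<le> dim_row b"
  shows "card (degs (frame_span m b) - {int (dim_col b)..}) = m"
  using quot_dim_eq_card[OF subsp_frame_span subsp_tails tails_frame_span basis_mod_frame[OF assms]]
    quot_dim_degs[OF subsp_frame_span frame_span_tails subsp_tails tails_frame_span order_refl]
  by (simp add: degs_tails)

text \<open>Containment and equal dimension modulo \<varpi>^N S, with N the number of
  columns.\<close>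

lemma frame_span_eqI:
  assumes b: "independent_rows b" "m \<le> dim_row b"
    and V: "subsp V" "tails (int (dim_col b)) \<subseteq> V" "V \<subseteq> tails a"
    and rows: "\<And>i. i < m \<Longrightarrow> row_series b i \<in> V"
    and card: "card (degs V - {int (dim_col b)..}) = m"
  shows "frame_span m b = V"
proof -
  let ?N = "int (dim_col b)"
  have sub: "frame_span m b \<subseteq> V"
  proof
    fix f assume "f \<in> frame_span m b"
    then obtain c u where f: "f = (\<Sum>i<m. fls_const (c i) * row_series b i) + u" "u \<in> tails ?N"
      unfolding frame_span_eq by blast
    have "u \<in> V" using f(2) V(2) by blast
    then show "f \<in> V" unfolding f(1)
      by (intro subsp_add[OF V(1)] subsp_lincomb[OF V(1)] rows) auto
  qed
  have "finite (degs V - {?N..})"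
    using finite_degs_diff[OF V(3) order_refl, of ?N] by (simp add: degs_tails)
  moreover have "degs (frame_span m b) - {?N..} \<subseteq> degs V - {?N..}" using degs_mono[OF sub] by blast
  ultimately have eq: "degs (frame_span m b) - {?N..} = degs V - {?N..}"
    using card_degs_frame_span[OF b] card by (intro card_subset_eq) simp_all
  have "{?N..} \<subseteq> degs (frame_span m b)"
    using degs_mono[OF tails_frame_span[of b m]] by (simp add: degs_tails)
  then have "degs V \<subseteq> degs (frame_span m b)" using eq by blast
  then have "V = frame_span m b"
    by (rule eq_of_degs_subset[OF V(1) subsp_frame_span sub tails_frame_span])
  then show ?thesis ..
qed

text \<open>The columns \<open>J\<close> are the degrees of the row space, that is, its pivot
  columns. A vector in the left kernel of this minor gives an element of the row space with zero
  coefficient in every pivot degree, hence without a leading term in the range of columns;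
  independence makes the vector 0.\<close>

lemma independent_rows_minor:
  assumes b: "independent_rows b"
  obtains J where "\<And>a. a < dim_row b \<Longrightarrow> J a < dim_col b"
    "det (mat (dim_row b) (dim_row b) (\<lambda>(a, c). b $$ (a, J c))) \<noteq> 0"
proof -
  let ?R = "dim_row b" and ?N = "int (dim_col b)"
  let ?D = "degs (frame_span ?R b) - {?N..}"
  have card: "card ?D = ?R" by (rule card_degs_frame_span[OF b order_refl])
  have fin: "finite ?D"
    using finite_degs_diff[OF frame_span_tails[of ?R b] order_refl, of ?N] by (simp add: degs_tails)
  obtain e where e: "bij_betw e {..<?R} ?D"
    using ex_bij_betw_nat_finite[OF fin] card by (auto simp: atLeast0LessThan)
  define J where "J a = nat (e a)" for a
  have pos: "0 \<le> x" if "x \<in> ?D" for x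
    using that degs_mono[OF frame_span_tails[of ?R b]] by (auto simp: degs_tails)
  have J: "J a < dim_col b" "int (J a) = e a" if "a < ?R" for a
  proof -
    have "e a \<in> ?D" using bij_betwE[OF e] that by simp
    then show "J a < dim_col b" "int (J a) = e a" using pos[of "e a"] unfolding J_def by auto
  qed
  define Q where "Q = mat ?R ?R (\<lambda>(a, c). b $$ (a, J c))"
  have Q: "Q \<in> carrier_mat ?R ?R" by (simp add: Q_def)
  have "det Q \<noteq> 0"
  proof
    assume "det Q = 0"
    then have "det (transpose_mat Q) = 0" using det_transpose[OF Q] by simp
    then obtain v where v: "v \<in> carrier_vec ?R" "v \<noteq> 0\<^sub>v ?R" "transpose_mat Q *\<^sub>v v = 0\<^sub>v ?R"
      using det_0_iff_vec_prod_zero_field[of "transpose_mat Q" ?R] Q by auto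
    define f where "f = (\<Sum>i<?R. fls_const (vec_index v i) * row_series b i)"
    have fJ: "fls_nth f (int (J c)) = 0" if c: "c < ?R" for c
    proof -
      have "fls_nth f (int (J c)) = (\<Sum>i<?R. vec_index v i * b $$ (i, J c))"
        unfolding f_def using J(1)[OF c] by (simp add: fls_nth_sum fls_nth_row_series)
      also have "\<dots> = vec_index (transpose_mat Q *\<^sub>v v) c"
        using c v(1) by (simp add: Q_def scalar_prod_def atLeast0LessThan mult.commute)
      also have "\<dots> = 0" using c unfolding v(3) by simp
      finally show ?thesis .
    qed
    have fV: "f \<in> frame_span ?R b"
      unfolding f_def by (intro subsp_lincomb[OF subsp_frame_span] row_series_frame_span) simp
    have "f \<in> tails ?N"
    proof (rule ccontr)
      assume nt: "f \<notin> tails ?N"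
      then have f0: "f \<noteq> 0" using subsp_zero[OF subsp_tails] by auto
      then have "fls_subdegree f \<in> ?D" using degsI[OF fV f0] nt by (simp add: tails_subdegree)
      then have "fls_subdegree f \<in> e ` {..<?R}" using bij_betw_imp_surj_on[OF e] by simp
      then obtain c where c: "c < ?R" "fls_subdegree f = e c" by blast
      have "fls_nth f (fls_subdegree f) = 0"
        unfolding c(2) J(2)[OF c(1), symmetric] by (rule fJ[OF c(1)])
      then show False using f0 by simp
    qed
    then have "vec_index v i = 0" if "i < ?R" for i
      unfolding f_def by (rule independent_rows_lincomb[OF b order_refl _ that])
    then have "v = 0\<^sub>v ?R" using v(1) by (intro eq_vecI) auto
    then show False using v(2) by simp
  qed
  then show thesis using that[of J] J(1) unfolding Q_def by blast
qed

lemma independent_rows_of_minor: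
  assumes J: "\<And>a. a < dim_row b \<Longrightarrow> J a < dim_col b"
    and det: "det (mat (dim_row b) (dim_row b) (\<lambda>(a, c). b $$ (a, J c))) \<noteq> 0"
  shows "independent_rows b"
  unfolding independent_rows_def
proof (intro allI impI)
  let ?R = "dim_row b"
  let ?Q = "mat ?R ?R (\<lambda>(a, c). b $$ (a, J c))"
  fix c i assume c: "\<forall>j<dim_col b. (\<Sum>i<?R. c i * b $$ (i, j)) = 0" and i: "i < ?R"
  have Q: "?Q \<in> carrier_mat ?R ?R" by simp
  have "transpose_mat ?Q *\<^sub>v vec ?R c = 0\<^sub>v ?R"
  proof (rule eq_vecI)
    fix k assume "k < dim_vec (0\<^sub>v ?R :: complex vec)"
    then have k: "k < ?R" by simp
    have "vec_index (transpose_mat ?Q *\<^sub>v vec ?R c) k = (\<Sum>i<?R. c i * b $$ (i, J k))"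
      using k by (simp add: scalar_prod_def atLeast0LessThan mult.commute)
    also have "\<dots> = 0" using c J[OF k] by blast
    finally show "vec_index (transpose_mat ?Q *\<^sub>v vec ?R c) k = vec_index (0\<^sub>v ?R) k" using k by simp
  qed simp
  moreover have "det (transpose_mat ?Q) \<noteq> 0" using det det_transpose[OF Q] by simp
  moreover have "transpose_mat ?Q \<in> carrier_mat ?R ?R" by simp
  ultimately have "vec ?R c = 0\<^sub>v ?R"
    using det_0_iff_vec_prod_zero_field[of "transpose_mat ?Q" ?R] vec_carrier[of ?R c] by blast
  then have "vec_index (vec ?R c) i = vec_index (0\<^sub>v ?R) i" by (rule arg_cong)
  then show "c i = 0" using i by simp
qed

section \<open>Local lifts between matrices and frames\<close>

lemma X_intpow_mult_shift_set: "f \<in> V \<Longrightarrow> fls_X_intpow k * f \<in> shift_set k V"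
  unfolding shift_set_def by (rule imageI)

lemma sum_lessThan_add:
  fixes f :: "nat \<Rightarrow> 'a::comm_monoid_add"
  shows "(\<Sum>a<m + k. f a) = (\<Sum>a<m. f a) + (\<Sum>j<k. f (m + j))"
  by (induction k) (simp_all add: add.assoc)

lemma fls_truncate:
  assumes "p \<in> tails 0"
  shows "p - (\<Sum>l<K. fls_const (fls_nth p (int l)) * fls_X ^ l) \<in> tails (int K)"
  unfolding tails_iff
proof (intro allI impI)
  fix k assume k: "k < int K"
  let ?s = "\<Sum>l<K. fls_const (fls_nth p (int l)) * fls_X ^ l"
  have "fls_nth ?s k = (\<Sum>l<K. if int l = k then fls_nth p k else 0)"
    unfolding fls_nth_sum by (rule sum.cong) auto
  also have "\<dots> = fls_nth p k"
  proof (cases "k < 0")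
    case True
    then show ?thesis using assms by (auto simp: tails_iff intro!: sum.neutral)
  next
    case False
    have "(\<Sum>l<K. if int l = k then fls_nth p k else 0) = (\<Sum>l<K. if l = nat k then fls_nth p k else 0)"
      by (rule sum.cong) (use False in auto)
    then show ?thesis using k False by (simp add: nat_less_iff)
  qed
  finally show "fls_nth (p - ?s) k = 0" by simp
qed

lemma basis_mod_reindex:
  assumes b: "basis_mod V W D t" and e: "bij_betw e I D"
  shows "basis_mod V W I (\<lambda>i. t (e i))"
proof -
  have fin: "finite D" and tV: "\<And>j. j \<in> D \<Longrightarrow> t j \<in> V"
    and span: "\<And>f. f \<in> V \<Longrightarrow> \<exists>c. f - (\<Sum>j\<in>D. fls_const (c j) * t j) \<in> W"
    and ind: "\<And>c j. (\<Sum>j\<in>D. fls_const (c j) * t j) \<in> W \<Longrightarrow> j \<in> D \<Longrightarrow> c j = 0"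
    using b unfolding basis_mod_def by simp_all
  have sum: "(\<Sum>i\<in>I. fls_const (c (e i)) * t (e i)) = (\<Sum>j\<in>D. fls_const (c j) * t j)" for c
    using sum.reindex_bij_betw[OF e, of "\<lambda>j. fls_const (c j) * t j"] .
  have eD: "e i \<in> D" if "i \<in> I" for i using bij_betwE[OF e] that by blast
  show ?thesis
    unfolding basis_mod_def
  proof (intro conjI ballI allI impI)
    show "finite I" using bij_betw_finite[OF e] fin by simp
    show "\<And>i. i \<in> I \<Longrightarrow> t (e i) \<in> V" using tV eD by blast
    fix f assume "f \<in> V"
    then obtain c where "f - (\<Sum>j\<in>D. fls_const (c j) * t j) \<in> W" using span by (elim exE[OF span])
    then show "\<exists>c. f - (\<Sum>i\<in>I. fls_const (c i) * t (e i)) \<in> W"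
      unfolding sum[symmetric] by (rule exI[of _ "\<lambda>i. c (e i)"])
  next
    fix c i assume c: "(\<Sum>i\<in>I. fls_const (c i) * t (e i)) \<in> W" and i: "i \<in> I"
    define c' where "c' j = c (inv_into I e j)" for j
    have inv: "c' (e i) = c i" if "i \<in> I" for i
      unfolding c'_def using bij_betw_inv_into_left[OF e that] by simp
    have "(\<Sum>i\<in>I. fls_const (c i) * t (e i)) = (\<Sum>i\<in>I. fls_const (c' (e i)) * t (e i))"
      by (rule sum.cong) (simp_all add: inv)
    then have "(\<Sum>j\<in>D. fls_const (c' j) * t j) \<in> W" using c unfolding sum by simp
    then have "c' (e i) = 0" by (rule ind[OF _ eD[OF i]])
    then show "c i = 0" unfolding inv[OF i] .
  qed
qed

lemma exists_basis_mod:
  assumes "subsp V" "V \<subseteq> tails a" "subsp W" "W \<subseteq> V" "tails b \<subseteq> W" "card (degs V - degs W) = m"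
  obtains r where "basis_mod V W {..<m} r"
proof -
  have "\<exists>t. \<forall>j\<in>degs V - degs W. t j \<in> V \<and> t j \<noteq> 0 \<and> fls_subdegree (t j) = j"
    by (rule bchoice) (auto elim: degsE)
  then obtain t where "\<And>j. j \<in> degs V - degs W \<Longrightarrow> t j \<in> V \<and> t j \<noteq> 0 \<and> fls_subdegree (t j) = j" by blast
  then have t: "basis_mod V W (degs V - degs W) t" using degs_basis_mod[OF assms(1-5)] by blast
  obtain e where "bij_betw e {0..<card (degs V - degs W)} (degs V - degs W)"
    using ex_bij_betw_nat_finite[OF finite_degs_diff[OF assms(2,5)]] by blast
  then have "bij_betw e {..<m} (degs V - degs W)" unfolding assms(6) by (simp add: atLeast0LessThan)
  from basis_mod_reindex[OF t this] show thesis by (rule that)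
qed

lemma poly_funs_det:
  assumes H: "\<And>b. H b \<in> carrier_mat m m"
    and r: "\<And>i j. i < m \<Longrightarrow> j < m \<Longrightarrow> (\<lambda>b. H b $$ (i, j)) \<in> poly_funs A"
  shows "(\<lambda>b. det (H b)) \<in> poly_funs A"
  unfolding det_def'[OF H]
proof (intro poly_funs_sum poly_funs.mult poly_funs_prod poly_funs.const r)
  fix p i assume "p \<in> {p. p permutes {0..<m}}" "i \<in> {0..<m}"
  then show "i < m" "p i < m" using permutes_in_image[of p "{0..<m}" i] by auto
qed

context
  fixes n d :: nat
  assumes n_pos: "0 < n" and d_pos: "0 < d" and cop: "coprime n d"
begin

section \<open>From loop matrices to frames\<close>

lemma frames_iff:
  "b \<in> frames n d \<longleftrightarrow> b \<in> carrier_mat (delta n d + n) (n + 2 * delta n d) \<and>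
     independent_rows b \<and> frame_flag n d b \<in> Jflag n d"
  unfolding frames_def independent_rows_def by blast

lemma component_power_series:
  assumes i: "i < n" and f: "f \<in> tails 0"
  shows "fls_compose_power (vec_index (abinv n f) i) n \<in> tails 0"
  unfolding tails_iff
proof (intro allI impI)
  fix k :: int assume k: "k < 0"
  show "fls_nth (fls_compose_power (vec_index (abinv n f) i) n) k = 0"
  proof (cases "int n dvd k")
    case True
    then obtain l where l: "k = int n * l" by (elim dvdE)
    then have "l < 0" using k n_pos by (simp add: mult_less_0_iff)
    then have "int n * (l + 1) \<le> 0" by (intro mult_nonneg_nonpos) auto
    then have "k + int i < 0" using i unfolding l by (simp add: distrib_left)
    moreover have "int n * (k div int n) = k" using True by simp
    ultimately show ?thesis using f
      unfolding fls_nth_compose_power[OF n_pos] fls_nth_abinv[OF n_pos i] tails_iff by simp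
  qed (simp add: fls_nth_compose_power[OF n_pos])
qed

definition shifted_chain :: "loop_mat \<Rightarrow> int \<Rightarrow> complex fls set" where
  "shifted_chain g k = shift_set (int (delta n d)) (lattice_chain n g k)"

text \<open>For h = g^-1 this maps S onto M_g, the factor \<varpi>^\<delta> included.\<close>

definition shifted_act :: "loop_mat \<Rightarrow> complex fls \<Rightarrow> complex fls" where
  "shifted_act h f = fls_X_intpow (int (delta n d)) * row_act n h f"

lemma shifted_act_lincomb:
  "h \<in> carrier_mat n n \<Longrightarrow>
     shifted_act h (\<Sum>i\<in>I. fls_const (c i) * f i) = (\<Sum>i\<in>I. fls_const (c i) * shifted_act h (f i))"
  unfolding shifted_act_def row_act_lincomb[OF n_pos] sum_distrib_left
  by (rule sum.cong[OF refl]) (rule mult.left_commute)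

lemma shifted_act_add:
  "h \<in> carrier_mat n n \<Longrightarrow> shifted_act h (f + f') = shifted_act h f + shifted_act h f'"
  unfolding shifted_act_def row_act_add[OF n_pos] by (rule distrib_left)

lemma shifted_act_X_intpow:
  "h \<in> carrier_mat n n \<Longrightarrow>
     shifted_act h (fls_X_intpow (int n * k) * f) = fls_X_intpow (int n * k) * shifted_act h f"
  unfolding shifted_act_def row_act_X_intpow[OF n_pos] by (rule mult.left_commute)

lemma shifted_chain_eq: "shifted_chain g k = shifted_act (loop_inv n g) ` tails k"
  unfolding shifted_chain_def shifted_act_def lattice_chain_def shift_set_def image_image ..

lemma shifted_act_mem_iff:
  assumes g: "g \<in> carrier (loopGL n)"
  shows "shifted_act (loop_inv n g) f \<in> shifted_chain g k \<longleftrightarrow> f \<in> tails k"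
proof -
  have "shifted_act (loop_inv n g) f \<in> shifted_chain g k \<longleftrightarrow> row_act n (loop_inv n g) f \<in> lattice_chain n g k"
    unfolding shifted_chain_def shifted_act_def shift_set_iff[of _ "int (delta n d)"]
    by (simp only: fls_X_intpow_cancel')
  also have "\<dots> \<longleftrightarrow> f \<in> tails k"
    unfolding lattice_chain_def by (rule row_act_mem_image_iff[OF n_pos loop_inv_closed[OF g]])
  finally show ?thesis .
qed

lemma Phi_rep_shifted_chain:
  "Phi_rep n d g = (shifted_chain g 0, map (\<lambda>j. shifted_chain g (int (n - j))) [0..<Suc n])"
  unfolding Phi_rep_eq[OF n_pos d_pos cop] shifted_chain_def ..

lemma shifted_chain_facts:
  assumes g: "g \<in> springer_matrices n d" and j: "j \<le> n"
  shows "subsp (shifted_chain g (int (n - j)))" "shifted_chain g (int (n - j)) \<subseteq> tails 0"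
    "tails (int (n + 2 * delta n d)) \<subseteq> shifted_chain g (int n)"
    "shifted_chain g (int n) \<subseteq> shifted_chain g (int (n - j))"
    "card (degs (shifted_chain g (int (n - j))) - {int (n + 2 * delta n d)..}) = delta n d + j"
proof -
  let ?F = "map (\<lambda>j. shifted_chain g (int (n - j))) [0..<Suc n]"
  have fl: "(shifted_chain g 0, ?F) \<in> Jflag n d"
    using g unfolding springer_matrices_def[OF n_pos d_pos cop] Phi_rep_shifted_chain by blast
  have F: "?F ! i = shifted_chain g (int (n - i))" if "i \<le> n" for i using that by (simp del: upt_Suc)
  note facts = Jflag_facts[OF n_pos d_pos cop fl j]
  have "shifted_chain g 0 \<in> Jbar n d" using fl unfolding Jflag_def by blast
  note J0 = Jbar_facts(4)[OF n_pos d_pos cop this]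
  have F0: "?F ! 0 = shifted_chain g (int n)" using F[of 0] by simp
  have N: "int n + 2 * int (delta n d) = int (n + 2 * delta n d)" by simp
  show "subsp (shifted_chain g (int (n - j)))" using facts(1) unfolding F[OF j] .
  show "shifted_chain g (int (n - j)) \<subseteq> tails 0" using facts(4) J0 unfolding F[OF j] by blast
  show "tails (int (n + 2 * delta n d)) \<subseteq> shifted_chain g (int n)" using facts(7) unfolding F0 N .
  show "shifted_chain g (int n) \<subseteq> shifted_chain g (int (n - j))" using facts(5) unfolding F0 F[OF j] .
  show "card (degs (shifted_chain g (int (n - j))) - {int (n + 2 * delta n d)..}) = delta n d + j"
    using facts(8) unfolding F[OF j] N .
qed

text \<open>The coefficient of \<varpi>^k in the image of \<varpi>^l under g^-1, spelled out through
  an entry of g^-1 so that it is literally a coordinate function; \<open>act_coeff_eq\<close>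
  supplies this meaning for invertible g.\<close>

definition act_coeff :: "nat \<Rightarrow> int \<Rightarrow> loop_mat \<Rightarrow> complex" where
  "act_coeff l k g = fls_nth (loop_inv n g $$ (l mod n, nat ((k - int n * int (l div n)) mod int n)))
     ((k - int n * int (l div n)) div int n)"

lemma act_coeff_poly: "act_coeff l k \<in> poly_funs (loop_coords n)"
proof (rule poly_funs.gen)
  have "l mod n < n" "nat ((k - int n * int (l div n)) mod int n) < n"
    using n_pos nat_mod_less[OF n_pos] by simp_all
  then show "act_coeff l k \<in> loop_coords n"
    unfolding loop_coords_def act_coeff_def by blast
qed

lemma act_coeff_eq:
  assumes g: "g \<in> carrier (loopGL n)"
  shows "act_coeff l k g = fls_nth (row_act n (loop_inv n g) (fls_X ^ l)) k"
proof -
  note im = loop_inv_carrier_mat[OF g]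
  have lm: "l mod n < n" using n_pos by simp
  have "(fls_X ^ l :: complex fls) = fls_X_intpow (int n * int (l div n)) * fls_X ^ (l mod n)"
  proof (rule fls_eqI)
    fix j
    have "int l = int n * int (l div n) + int (l mod n)"
      by (simp only: of_nat_mult[symmetric] of_nat_add[symmetric] mult_div_mod_eq)
    then show "fls_nth (fls_X ^ l :: complex fls) j =
        fls_nth (fls_X_intpow (int n * int (l div n)) * fls_X ^ (l mod n)) j"
      unfolding fls_nth_X_intpow_mult fls_X_power_nth by auto
  qed
  then have "row_act n (loop_inv n g) (fls_X ^ l) =
      fls_X_intpow (int n * int (l div n)) * row_act n (loop_inv n g) (fls_X ^ (l mod n))"
    by (simp only: row_act_X_intpow[OF n_pos im])
  then show ?thesis
    unfolding act_coeff_def by (simp only: fls_nth_X_intpow_mult fls_nth_row_act_X_power[OF n_pos im lm])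
qed

text \<open>With N = n + 2 \<delta>, coefficients of \<open>p\<close> from n N on do not reach the N
  columns, because their contribution lies in x^N M, a subset of \<varpi>^(n N) S. Cutting
  \<open>p\<close> there makes the entry a polynomial in finitely many coordinates, the same for all
  g.\<close>

definition frame_entry :: "complex fls \<Rightarrow> nat \<Rightarrow> loop_mat \<Rightarrow> complex" where
  "frame_entry p m g = (\<Sum>l<n * (n + 2 * delta n d).
     fls_nth p (int l) * act_coeff l (int m - int (delta n d)) g)"

lemma frame_entry_poly: "frame_entry p m \<in> poly_funs (loop_coords n)"
  unfolding frame_entry_def
  by (intro poly_funs_sum poly_funs.mult poly_funs.const act_coeff_poly)

lemma frame_entry_eq:
  assumes g: "g \<in> springer_matrices n d" and p: "p \<in> tails 0" and m: "m < n + 2 * delta n d"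
  shows "frame_entry p m g = fls_nth (shifted_act (loop_inv n g) p) (int m)"
proof -
  note G = springer_matrices_loopGL[OF n_pos d_pos cop g]
  note im = loop_inv_carrier_mat[OF G]
  let ?N = "n + 2 * delta n d"
  let ?p = "\<Sum>l<n * ?N. fls_const (fls_nth p (int l)) * fls_X ^ l"
  have "p - ?p \<in> tails (int (n * ?N))" by (rule fls_truncate[OF p])
  then have "shifted_act (loop_inv n g) (p - ?p) \<in> shifted_chain g (int (n * ?N))"
    unfolding shifted_act_mem_iff[OF G] .
  also have "shifted_chain g (int (n * ?N)) = shift_set (int n * int ?N) (shifted_chain g 0)"
    unfolding shifted_chain_def
    using lattice_chain_shift[OF n_pos G, of "int ?N" 0] by (simp add: shift_set_comm)
  also have "\<dots> \<subseteq> shift_set (int n * int ?N) (tails 0)"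
    using shifted_chain_facts(2)[OF g order_refl] by (intro shift_set_mono) simp
  also have "\<dots> \<subseteq> tails (int ?N)"
  proof -
    have "1 * int ?N \<le> int n * int ?N" by (rule mult_right_mono) (use n_pos in auto)
    then show ?thesis unfolding shift_set_tails by (intro tails_mono) simp
  qed
  finally have z: "fls_nth (shifted_act (loop_inv n g) (p - ?p)) (int m) = 0"
    using m unfolding tails_iff by simp
  have "shifted_act (loop_inv n g) p = shifted_act (loop_inv n g) (?p + (p - ?p))" by simp
  also have "\<dots> = (\<Sum>l<n * ?N. fls_const (fls_nth p (int l)) * shifted_act (loop_inv n g) (fls_X ^ l)) +
      shifted_act (loop_inv n g) (p - ?p)"
    unfolding shifted_act_add[OF im] shifted_act_lincomb[OF im] ..
  finally have "fls_nth (shifted_act (loop_inv n g) p) (int m) =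
      (\<Sum>l<n * ?N. fls_nth p (int l) * fls_nth (shifted_act (loop_inv n g) (fls_X ^ l)) (int m))"
    using z by (simp add: fls_nth_sum)
  also have "\<dots> = frame_entry p m g"
    unfolding frame_entry_def
  proof (rule sum.cong[OF refl])
    fix l
    have "fls_nth (shifted_act (loop_inv n g) (fls_X ^ l)) (int m) = act_coeff l (int m - int (delta n d)) g"
      unfolding shifted_act_def act_coeff_eq[OF G] by (rule fls_nth_X_intpow_mult)
    then show "fls_nth p (int l) * fls_nth (shifted_act (loop_inv n g) (fls_X ^ l)) (int m) =
        fls_nth p (int l) * act_coeff l (int m - int (delta n d)) g" by simp
  qed
  finally show ?thesis ..
qed

definition frame_of :: "(nat \<Rightarrow> complex fls) \<Rightarrow> loop_mat \<Rightarrow> complex mat" where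
  "frame_of p g = mat (delta n d + n) (n + 2 * delta n d) (\<lambda>(a, m). frame_entry (p a) m g)"

lemma frame_of_dim [simp]:
  "dim_row (frame_of p g) = delta n d + n" "dim_col (frame_of p g) = n + 2 * delta n d"
  by (simp_all add: frame_of_def)

lemma row_series_frame_of:
  assumes g: "g \<in> springer_matrices n d" and p: "p a \<in> tails 0" and a: "a < delta n d + n"
  shows "row_series (frame_of p g) a - shifted_act (loop_inv n g) (p a) \<in> tails (int (n + 2 * delta n d))"
  unfolding tails_iff
proof (intro allI impI)
  note G = springer_matrices_loopGL[OF n_pos d_pos cop g]
  let ?w = "shifted_act (loop_inv n g) (p a)"
  fix k assume k: "k < int (n + 2 * delta n d)"
  have "?w \<in> shifted_chain g 0" using p unfolding shifted_act_mem_iff[OF G] .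
  then have w0: "?w \<in> tails 0" using shifted_chain_facts(2)[OF g order_refl] by auto
  have "fls_nth (row_series (frame_of p g) a) k = fls_nth ?w k"
  proof (cases "k < 0")
    case True
    then show ?thesis using w0 unfolding fls_nth_row_series tails_iff by simp
  next
    case False
    then have m: "nat k < n + 2 * delta n d" "int (nat k) = k" using k by auto
    have "fls_nth (row_series (frame_of p g) a) k = frame_entry (p a) (nat k) g"
      unfolding fls_nth_row_series using k False m(1) a by (simp add: frame_of_def)
    then show ?thesis using frame_entry_eq[OF g p m(1)] unfolding m(2) by simp
  qed
  then show "fls_nth (row_series (frame_of p g) a - ?w) k = 0" by simp
qed

text \<open>The first \<delta> generators lie in \<varpi>^n S and produce xM modulo \<varpi>^(n + 2
  \<delta>) S; then \<varpi>^(n-1), ..., 1 enter one at a time, each enlarging the flag by one step.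
  The exponents descend because the j-th member is the image of \<varpi>^(n-j) S. Independence of
  the rows makes the dimensions agree.\<close>

lemma frame_flag_frame_of:
  assumes g: "g \<in> springer_matrices n d" and ind: "independent_rows (frame_of p g)"
    and p1: "\<And>a. a < delta n d \<Longrightarrow> p a \<in> tails (int n)"
    and p2: "\<And>j. j < n \<Longrightarrow> p (delta n d + j) = fls_X ^ (n - Suc j)"
  shows "frame_of p g \<in> frames n d" "frame_flag n d (frame_of p g) = Phi_rep n d g"
proof -
  note G = springer_matrices_loopGL[OF n_pos d_pos cop g]
  let ?b = "frame_of p g"
  have p0: "p a \<in> tails 0" if "a < delta n d + n" for a
  proof (cases "a < delta n d")
    case True
    then show ?thesis using p1[OF True] tails_mono[of 0 "int n"] by auto
  next
    case False
    then have "p a = fls_X ^ (n - Suc (a - delta n d))" using p2[of "a - delta n d"] that by simp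
    then show ?thesis by (simp add: tails_iff)
  qed
  have span: "frame_span (delta n d + j) ?b = shifted_chain g (int (n - j))" if j: "j \<le> n" for j
  proof (rule frame_span_eqI[OF ind])
    note facts = shifted_chain_facts[OF g j]
    let ?V = "shifted_chain g (int (n - j))"
    show "delta n d + j \<le> dim_row ?b" using j by simp
    show "subsp ?V" by (rule facts(1))
    show N: "tails (int (dim_col ?b)) \<subseteq> ?V" using facts(3,4) by simp
    show "?V \<subseteq> tails 0" by (rule facts(2))
    show "card (degs ?V - {int (dim_col ?b)..}) = delta n d + j" using facts(5) by simp
    fix a assume a: "a < delta n d + j"
    then have a': "a < delta n d + n" using j by simp
    have "p a \<in> tails (int (n - j))"
    proof (cases "a < delta n d")
      case True
      then show ?thesis using p1[OF True] tails_mono[of "int (n - j)" "int n"] by auto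
    next
      case False
      then have pa: "p a = fls_X ^ (n - Suc (a - delta n d))" using p2[of "a - delta n d"] a' by simp
      have "int (n - j) \<le> int (n - Suc (a - delta n d))" using a False j by simp
      then show ?thesis unfolding pa by (auto simp: tails_iff)
    qed
    then have w: "shifted_act (loop_inv n g) (p a) \<in> ?V" unfolding shifted_act_mem_iff[OF G] .
    have "row_series ?b a - shifted_act (loop_inv n g) (p a) \<in> ?V"
      using row_series_frame_of[OF g, of p a, OF p0[OF a'] a'] N by auto
    from subsp_add[OF facts(1) this w] show "row_series ?b a \<in> ?V" by simp
  qed
  have "frame_flag n d ?b = (shifted_chain g 0, map (\<lambda>j. shifted_chain g (int (n - j))) [0..<Suc n])"
    unfolding frame_flag_def using span by (auto simp del: upt_Suc)
  then show fl: "frame_flag n d ?b = Phi_rep n d g" unfolding Phi_rep_shifted_chain .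
  show "?b \<in> frames n d"
    unfolding frames_iff fl
    using g ind unfolding springer_matrices_def[OF n_pos d_pos cop] by (simp add: frame_of_def)
qed

text \<open>At \<open>g\<close> the generators are chosen as preimages of a basis of xM modulo
  \<varpi>^(n + 2 \<delta>) S, and then kept fixed while the matrix varies. A minor that is nonzero
  at \<open>g\<close> guarantees independence wherever it does not vanish.\<close>

lemma local_lifts_springer_frames:
  "local_lifts (Phi_rep n d) (springer_matrices n d) (loop_coords n) (frame_flag n d) (frames n d)
     {(\<lambda>b. b $$ (i, j)) | i j. i < delta n d + n \<and> j < n + 2 * delta n d}"
  unfolding local_lifts_def
proof
  fix g assume g: "g \<in> springer_matrices n d"
  note G = springer_matrices_loopGL[OF n_pos d_pos cop g]
  note im = loop_inv_carrier_mat[OF G]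
  let ?\<delta> = "delta n d" and ?N = "n + 2 * delta n d"
  have s0: "subsp (shifted_chain g (int n))" and t0: "shifted_chain g (int n) \<subseteq> tails 0"
    and N0: "tails (int ?N) \<subseteq> shifted_chain g (int n)"
    and c0: "card (degs (shifted_chain g (int n)) - degs (tails (int ?N))) = ?\<delta>"
    using shifted_chain_facts[OF g, of 0] unfolding degs_tails by simp_all
  obtain r where r: "basis_mod (shifted_chain g (int n)) (tails (int ?N)) {..<?\<delta>} r"
    using exists_basis_mod[OF s0 t0 subsp_tails N0 order_refl c0] by blast
  have rV: "\<And>a. a < ?\<delta> \<Longrightarrow> r a \<in> shifted_chain g (int n)"
    and rind: "\<And>c a. (\<Sum>a<?\<delta>. fls_const (c a) * r a) \<in> tails (int ?N) \<Longrightarrow> a < ?\<delta> \<Longrightarrow> c a = 0"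
    using r unfolding basis_mod_def by simp_all
  have "\<exists>u. \<forall>a\<in>{..<?\<delta>}. u a \<in> tails (int n) \<and> shifted_act (loop_inv n g) (u a) = r a"
  proof (rule bchoice, rule ballI)
    fix a assume "a \<in> {..<?\<delta>}"
    then have "r a \<in> shifted_act (loop_inv n g) ` tails (int n)" using rV unfolding shifted_chain_eq by simp
    then obtain x where "r a = shifted_act (loop_inv n g) x" "x \<in> tails (int n)" by (rule imageE)
    then show "\<exists>u. u \<in> tails (int n) \<and> shifted_act (loop_inv n g) u = r a" by (intro exI[of _ x]) simp
  qed
  then obtain u where u': "\<forall>a\<in>{..<?\<delta>}. u a \<in> tails (int n) \<and> shifted_act (loop_inv n g) (u a) = r a"
    by (rule exE)
  then have u: "\<And>a. a < ?\<delta> \<Longrightarrow> u a \<in> tails (int n)"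
    "\<And>a. a < ?\<delta> \<Longrightarrow> shifted_act (loop_inv n g) (u a) = r a" by simp_all
  define p where "p a = (if a < ?\<delta> then u a else fls_X ^ (n - Suc (a - ?\<delta>)))" for a
  have p1: "\<And>a. a < ?\<delta> \<Longrightarrow> p a \<in> tails (int n)" and p2: "\<And>j. j < n \<Longrightarrow> p (?\<delta> + j) = fls_X ^ (n - Suc j)"
    using u by (simp_all add: p_def)
  have p0: "p a \<in> tails 0" for a
  proof (cases "a < ?\<delta>")
    case True
    then show ?thesis using p1[OF True] tails_mono[of 0 "int n"] by auto
  qed (simp add: p_def tails_iff)
  \<comment> \<open>A relation is first read modulo xM, where the images of \<varpi>^(n-1), ..., 1
    are independent; what is left is a relation of the basis \<open>r\<close> modulo \<varpi>^(n + 2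
    \<delta>) S.\<close>
  have ind: "independent_rows (frame_of p g)"
    unfolding independent_rows_def frame_of_dim
  proof (intro allI impI)
    fix c i assume c: "\<forall>j<?N. (\<Sum>i<?\<delta> + n. c i * frame_of p g $$ (i, j)) = 0" and i: "i < ?\<delta> + n"
    let ?w = "\<lambda>a. shifted_act (loop_inv n g) (p a)"
    have rs: "(\<Sum>a<?\<delta> + n. fls_const (c a) * row_series (frame_of p g) a) \<in> tails (int ?N)"
      unfolding tails_iff
    proof (intro allI impI)
      fix k assume k: "k < int ?N"
      show "fls_nth (\<Sum>a<?\<delta> + n. fls_const (c a) * row_series (frame_of p g) a) k = 0"
        using c k by (cases "k < 0") (simp_all add: fls_nth_sum fls_nth_row_series)
    qed
    have diff: "(\<Sum>a<?\<delta> + n. fls_const (c a) * (row_series (frame_of p g) a - ?w a)) \<in> tails (int ?N)"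
      by (rule subsp_lincomb[OF subsp_tails]) (use row_series_frame_of[OF g p0] in simp)
    have "(\<Sum>a<?\<delta> + n. fls_const (c a) * ?w a) \<in> tails (int ?N)"
      using subsp_diff[OF subsp_tails rs diff] by (simp add: right_diff_distrib sum_subtractf)
    then have tot: "(\<Sum>a<?\<delta>. fls_const (c a) * r a) +
        (\<Sum>j<n. fls_const (c (?\<delta> + j)) * shifted_act (loop_inv n g) (fls_X ^ (n - Suc j))) \<in> tails (int ?N)"
      unfolding sum_lessThan_add using u(2) p2 by (simp add: p_def)
    let ?q = "\<Sum>j<n. fls_const (c (?\<delta> + j)) * fls_X ^ (n - Suc j)"
    have "(\<Sum>a<?\<delta>. fls_const (c a) * r a) \<in> shifted_chain g (int n)"
      by (rule subsp_lincomb[OF s0]) (use rV in simp)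
    from subsp_diff[OF s0 _ this] tot N0
    have "shifted_act (loop_inv n g) ?q \<in> shifted_chain g (int n)"
      unfolding shifted_act_lincomb[OF im] by fastforce
    then have q: "?q \<in> tails (int n)" unfolding shifted_act_mem_iff[OF G] .
    have cj: "c (?\<delta> + j) = 0" if j: "j < n" for j
    proof -
      have "fls_nth ?q (int (n - Suc j)) = (\<Sum>k<n. if k = j then c (?\<delta> + j) else 0)"
        unfolding fls_nth_sum by (rule sum.cong) (use j in auto)
      also have "\<dots> = c (?\<delta> + j)" using j by simp
      finally show ?thesis using q j unfolding tails_iff by simp
    qed
    then have "(\<Sum>a<?\<delta>. fls_const (c a) * r a) \<in> tails (int ?N)" using tot by simp
    note ca = rind[OF this]
    show "c i = 0"
    proof (cases "i < ?\<delta>")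
      case False
      then show ?thesis using cj[of "i - ?\<delta>"] i by simp
    qed (rule ca)
  qed
  obtain J where J: "\<And>a. a < dim_row (frame_of p g) \<Longrightarrow> J a < dim_col (frame_of p g)"
    "det (mat (dim_row (frame_of p g)) (dim_row (frame_of p g)) (\<lambda>(a, c). frame_of p g $$ (a, J c))) \<noteq> 0"
    using independent_rows_minor[OF ind] by blast
  let ?R = "?\<delta> + n"
  have JN: "J a < ?N" if "a < ?R" for a using J(1)[of a] that by simp
  define minor where "minor q = det (mat ?R ?R (\<lambda>(a, c). frame_of p q $$ (a, J c)))" for q
  have minor_poly: "minor \<in> poly_funs (loop_coords n)"
    unfolding minor_def
  proof (rule poly_funs_det)
    fix a c assume ac: "a < ?R" "c < ?R"
    have "(\<lambda>q. mat ?R ?R (\<lambda>(a, c). frame_of p q $$ (a, J c)) $$ (a, c)) = frame_entry (p a) (J c)"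
      by (rule ext) (use ac JN in \<open>simp add: frame_of_def\<close>)
    then show "(\<lambda>q. mat ?R ?R (\<lambda>(a, c). frame_of p q $$ (a, J c)) $$ (a, c)) \<in> poly_funs (loop_coords n)"
      by (simp only: frame_entry_poly)
  qed simp
  have minor_ind: "independent_rows (frame_of p q)" if "minor q \<noteq> 0" for q
    by (rule independent_rows_of_minor[of _ J]) (use JN that in \<open>simp_all add: minor_def\<close>)
  show "\<exists>h\<in>poly_funs (loop_coords n). \<exists>s. h g \<noteq> 0 \<and>
      (\<forall>q\<in>springer_matrices n d. h q \<noteq> 0 \<longrightarrow> s q \<in> frames n d \<and> frame_flag n d (s q) = Phi_rep n d q) \<and>
      (\<forall>\<beta>\<in>{(\<lambda>b. b $$ (i, j)) | i j. i < ?\<delta> + n \<and> j < ?N}.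
         rational_on {q \<in> springer_matrices n d. h q \<noteq> 0} (loop_coords n) (\<beta> \<circ> s))"
  proof (rule bexI[OF _ minor_poly], rule exI[of _ "frame_of p"], intro conjI ballI impI)
    show "minor g \<noteq> 0" using J(2) unfolding minor_def frame_of_dim .
    fix q assume q: "q \<in> springer_matrices n d" "minor q \<noteq> 0"
    show "frame_of p q \<in> frames n d" "frame_flag n d (frame_of p q) = Phi_rep n d q"
      using frame_flag_frame_of[OF q(1) minor_ind[OF q(2)] p1 p2] by blast+
  next
    fix \<beta> assume "\<beta> \<in> {(\<lambda>b :: complex mat. b $$ (i, j)) | i j. i < ?\<delta> + n \<and> j < ?N}"
    then obtain i j where \<beta>: "\<beta> = (\<lambda>b. b $$ (i, j))" "i < ?\<delta> + n" "j < ?N" by blast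
    have "\<beta> \<circ> frame_of p = frame_entry (p i) j"
      by (rule ext) (use \<beta> in \<open>simp add: frame_of_def\<close>)
    then show "rational_on {q \<in> springer_matrices n d. minor q \<noteq> 0} (loop_coords n) (\<beta> \<circ> frame_of p)"
      by (simp only: rational_on_poly frame_entry_poly)
  qed
qed

section \<open>From frames to loop matrices\<close>

definition frame_matrix :: "complex mat \<Rightarrow> loop_mat" where
  "frame_matrix b = mat_of_series n
     (\<lambda>i. fls_X_intpow (- int (delta n d)) * row_series b (delta n d + (n - Suc i)))"

lemma frame_matrix_carrier: "frame_matrix b \<in> carrier_mat n n"
  unfolding frame_matrix_def by (rule mat_of_series_carrier[OF n_pos])

lemma shifted_act_frame_matrix:
  assumes "i < n"
  shows "shifted_act (frame_matrix b) (fls_X ^ i) = row_series b (delta n d + (n - Suc i))"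
  unfolding shifted_act_def frame_matrix_def row_act_mat_of_series[OF n_pos assms]
  by (rule fls_X_intpow_cancel)

text \<open>Inverse to \<open>frame_of\<close>: the last n rows in reversed order, divided by
  \<varpi>^\<delta>, are the candidate for g^-1. The other rows span xM modulo \<varpi>^(n + 2
  \<delta>) S, so the last n generate M modulo xM, and hence M over C[[x]] by an argument as in
  Nakayama's lemma.\<close>

lemma frame_matrix_lattices:
  assumes b: "b \<in> frames n d"
  shows "frame_matrix b \<in> carrier (loopGL n)"
    "\<And>j. j \<le> n \<Longrightarrow> shifted_act (frame_matrix b) ` tails (int (n - j)) = frame_span (delta n d + j) b"
proof -
  let ?\<delta> = "delta n d" and ?N = "n + 2 * delta n d" and ?H = "frame_matrix b"
  note Hm = frame_matrix_carrier[of b]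
  have ind: "independent_rows b" and fl: "frame_flag n d b \<in> Jflag n d"
    and dim: "dim_row b = ?\<delta> + n" "dim_col b = ?N"
    using b unfolding frames_iff by auto
  let ?F = "map (\<lambda>j. frame_span (?\<delta> + j) b) [0..<Suc n]"
  let ?M = "frame_span (?\<delta> + n) b"
  have MF: "(?M, ?F) \<in> Jflag n d" using fl unfolding frame_flag_def .
  have F: "?F ! j = frame_span (?\<delta> + j) b" if "j \<le> n" for j using that by (simp del: upt_Suc)
  have F0: "frame_span ?\<delta> b = shift_set (int n) ?M"
    using Jflag_facts(2)[OF n_pos d_pos cop MF order_refl] F[of 0] by simp
  have F0j: "frame_span ?\<delta> b \<subseteq> frame_span (?\<delta> + j) b" if "j \<le> n" for j
    using Jflag_facts(5)[OF n_pos d_pos cop MF that] F[of 0] F[OF that] by simp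
  have "?M \<in> Jbar n d" using MF unfolding Jflag_def by blast
  note Jb = Jbar_facts[OF n_pos d_pos cop this]
  have act0: "shifted_act ?H v \<in> ?M" if v: "v \<in> tails 0" for v
  proof -
    have "shifted_act ?H v = (\<Sum>i<n. fls_compose_power (vec_index (abinv n v) i) n * shifted_act ?H (fls_X ^ i))"
      unfolding shifted_act_def row_act_expand[OF n_pos Hm, of v] sum_distrib_left
      by (rule sum.cong[OF refl]) (rule mult.left_commute)
    also have "\<dots> \<in> ?M"
    proof (rule subsp_sum[OF Jb(1)], rule subsp_mult_closed[OF Jb(1,5,4)])
      fix i assume "i \<in> {..<n}"
      then have i: "i < n" by simp
      show "fls_compose_power (vec_index (abinv n v) i) n \<in> tails 0"
        by (rule component_power_series[OF i v])
      then have neg: "fls_nth (fls_compose_power (vec_index (abinv n v) i) n) k = 0" if "k < 0" for k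
        using that unfolding tails_iff by blast
      show "shifted_act ?H (fls_X ^ i) \<in> ?M"
        unfolding shifted_act_frame_matrix[OF i] by (rule row_series_frame_span) (use i in simp)
      fix k assume k: "fls_nth (fls_compose_power (vec_index (abinv n v) i) n) k \<noteq> 0"
      then have "int n dvd k" unfolding fls_nth_compose_power[OF n_pos] by (simp split: if_splits)
      then obtain l where l: "k = int n * l" by (elim dvdE)
      have "0 \<le> k" using k neg by (meson not_less)
      then have "0 \<le> l" unfolding l using n_pos by (simp add: zero_le_mult_iff)
      then have kl: "k = int n * int (nat l)" unfolding l by simp
      show "shift_set k ?M \<subseteq> ?M" unfolding kl by (rule shift_set_multiple_subset[OF n_pos Jb(2)])
    qed
    finally show ?thesis .
  qed
  have actn: "shifted_act ?H v \<in> frame_span ?\<delta> b" if v: "v \<in> tails (int n)" for v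
  proof -
    have v1: "fls_X_intpow (- int n) * v \<in> tails 0" unfolding X_intpow_mult_tails using v by simp
    have "shifted_act ?H v = shifted_act ?H (fls_X_intpow (int n * 1) * (fls_X_intpow (- int n) * v))"
      by (simp only: mult_1_right fls_X_intpow_cancel)
    also have "\<dots> = fls_X_intpow (int n) * shifted_act ?H (fls_X_intpow (- int n) * v)"
      unfolding shifted_act_X_intpow[OF Hm] by simp
    also have "\<dots> \<in> shift_set (int n) ?M" using act0[OF v1] by (rule X_intpow_mult_shift_set)
    finally show ?thesis unfolding F0 .
  qed
  have decomp: "\<exists>v'\<in>tails (int n). shifted_act ?H v =
      (\<Sum>i<n. fls_const (fls_nth v (int i)) * row_series b (?\<delta> + (n - Suc i))) + shifted_act ?H v'"
    if v: "v \<in> tails 0" for v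
  proof -
    let ?p = "\<Sum>i<n. fls_const (fls_nth v (int i)) * fls_X ^ i"
    have "shifted_act ?H v = shifted_act ?H (?p + (v - ?p))" by simp
    also have "\<dots> = (\<Sum>i<n. fls_const (fls_nth v (int i)) * shifted_act ?H (fls_X ^ i)) + shifted_act ?H (v - ?p)"
      unfolding shifted_act_add[OF Hm] shifted_act_lincomb[OF Hm] ..
    also have "(\<Sum>i<n. fls_const (fls_nth v (int i)) * shifted_act ?H (fls_X ^ i)) =
        (\<Sum>i<n. fls_const (fls_nth v (int i)) * row_series b (?\<delta> + (n - Suc i)))"
      by (rule sum.cong) (simp_all add: shifted_act_frame_matrix)
    finally show ?thesis using fls_truncate[OF v, of n] by blast
  qed
  \<comment> \<open>By a power of x, \<open>v\<close> is brought to a lowest degree i0 with 0 \<le>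
    i0 < n. Modulo xM its image is a combination of the last n rows with a nonzero coefficient,
    against independence of the frame.\<close>
  have inj: "v = 0" if v: "row_act n ?H v = 0" for v
  proof (rule ccontr)
    assume v0: "v \<noteq> 0"
    define s where "s = fls_subdegree v"
    define i0 where "i0 = nat (s mod int n)"
    have i0: "i0 < n" "int i0 = s mod int n"
      unfolding i0_def using nat_mod_less[OF n_pos] int_nat_mod[OF n_pos] by blast+
    define v1 where "v1 = fls_X_intpow (int n * (- (s div int n))) * v"
    have si: "s - int n * (s div int n) = int i0" unfolding i0(2) by (simp add: minus_mult_div_eq_mod)
    have "v \<in> tails s" unfolding s_def using v0 by (simp add: tails_subdegree)
    moreover have "int n * (s div int n) \<le> s" using si by linarith
    ultimately have "v \<in> tails (int n * (s div int n))" using tails_mono by blast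
    then have v1: "v1 \<in> tails 0" unfolding v1_def X_intpow_mult_tails by simp
    have e: "int i0 - int n * (- (s div int n)) = s" using si by simp
    have "fls_nth v1 (int i0) = fls_nth v s"
      unfolding v1_def fls_nth_X_intpow_mult e ..
    then have nz: "fls_nth v1 (int i0) \<noteq> 0" using v0 by (simp add: s_def)
    have "shifted_act ?H v1 = 0"
      unfolding v1_def shifted_act_X_intpow[OF Hm] using v by (simp add: shifted_act_def)
    then obtain v' where v': "v' \<in> tails (int n)"
      "(\<Sum>i<n. fls_const (fls_nth v1 (int i)) * row_series b (?\<delta> + (n - Suc i))) + shifted_act ?H v' = 0"
      using decomp[OF v1] by force
    obtain c f where cf: "shifted_act ?H v' = (\<Sum>a<?\<delta>. fls_const (c a) * row_series b a) + f"
      "f \<in> tails (int ?N)"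
      using actn[OF v'(1)] unfolding frame_span_eq dim by blast
    \<comment> \<open>The coefficients of both parts are joined to a relation of all \<delta> + n
      rows; the last n rows occur in reversed order.\<close>
    define c' where "c' a = (if a < ?\<delta> then c a else fls_nth v1 (int (n - Suc (a - ?\<delta>))))" for a
    have "(\<Sum>a<?\<delta> + n. fls_const (c' a) * row_series b a) = (\<Sum>a<?\<delta>. fls_const (c a) * row_series b a) +
        (\<Sum>j<n. fls_const (fls_nth v1 (int (n - Suc j))) * row_series b (?\<delta> + j))"
      unfolding sum_lessThan_add by (simp add: c'_def)
    also have "(\<Sum>j<n. fls_const (fls_nth v1 (int (n - Suc j))) * row_series b (?\<delta> + j)) =
        (\<Sum>j<n. fls_const (fls_nth v1 (int (n - Suc j))) * row_series b (?\<delta> + (n - Suc (n - Suc j))))"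
      by (rule sum.cong) auto
    also have "\<dots> = (\<Sum>i<n. fls_const (fls_nth v1 (int i)) * row_series b (?\<delta> + (n - Suc i)))"
      by (rule sum.nat_diff_reindex)
    also have "(\<Sum>a<?\<delta>. fls_const (c a) * row_series b a) + \<dots> = - f"
      using v'(2) unfolding cf(1) by (simp add: algebra_simps eq_neg_iff_add_eq_0)
    finally have sum: "(\<Sum>a<?\<delta> + n. fls_const (c' a) * row_series b a) = - f" .
    have "- f \<in> tails (int ?N)" using subsp_diff[OF subsp_tails subsp_zero[OF subsp_tails] cf(2)] by simp
    then have mem: "(\<Sum>a<?\<delta> + n. fls_const (c' a) * row_series b a) \<in> tails (int (dim_col b))"
      unfolding sum dim .
    have "c' (?\<delta> + (n - Suc i0)) = 0"
      by (rule independent_rows_lincomb[OF ind _ mem]) (use i0 dim in auto)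
    moreover have "c' (?\<delta> + k) = fls_nth v1 (int (n - Suc k))" for k by (simp add: c'_def)
    moreover have "n - Suc (n - Suc i0) = i0" using i0(1) by simp
    ultimately have "fls_nth v1 (int i0) = 0" by simp
    then show False using nz by simp
  qed
  show G: "?H \<in> carrier (loopGL n)" using Hm inj by (rule loopGL_of_injective[OF n_pos])
  have iH: "loop_inv n (loop_inv n ?H) = ?H" by (rule loop_inv_inv[OF G])
  note iG = loop_inv_closed[OF G]
  let ?V = "\<lambda>k. shifted_act ?H ` tails k"
  have V: "?V k = shifted_chain (loop_inv n ?H) k" for k unfolding shifted_chain_eq iH ..
  have sV: "subsp (?V k)" for k
    unfolding V shifted_chain_def by (rule subsp_shift_set[OF subsp_lattice_chain[OF n_pos iG]])
  have shV: "shift_set (int n * l) (?V k) = ?V (int n * l + k)" for l k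
    unfolding V shifted_chain_def lattice_chain_shift[OF n_pos iG] by (rule shift_set_comm)
  have V0M: "?V 0 \<subseteq> ?M" using act0 by blast
  obtain b' where b': "tails b' \<subseteq> ?V 0"
  proof -
    obtain b'' where "tails b'' \<subseteq> lattice_chain n (loop_inv n ?H) 0"
      using row_act_sandwich[OF n_pos loop_inv_closed[OF iG] order_refl order_refl, of 0]
      unfolding lattice_chain_def by blast
    then have "shift_set (int ?\<delta>) (tails b'') \<subseteq> ?V 0" unfolding V shifted_chain_def by (rule shift_set_mono)
    then show thesis unfolding shift_set_tails by (rule that)
  qed
  have rsV: "row_series b (?\<delta> + j) \<in> ?V (int (n - Suc j))" if j: "j < n" for j
  proof -
    have "n - Suc j < n" "n - Suc (n - Suc j) = j" using j by auto
    then have "row_series b (?\<delta> + j) = shifted_act ?H (fls_X ^ (n - Suc j))"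
      using shifted_act_frame_matrix[of "n - Suc j" b] by simp
    then show ?thesis using X_power_tails[OF n_pos, of "n - Suc j"] by blast
  qed
  have V_mono: "k \<le> l \<Longrightarrow> ?V l \<subseteq> ?V k" for k l by (rule image_mono[OF tails_mono])
  \<comment> \<open>A single Nakayama step: an element of M agrees modulo xM with an element of the
    lattice generated by the last n rows.\<close>
  have split: "\<exists>m'\<in>?V 0. m - m' \<in> shift_set (int n) ?M" if m: "m \<in> ?M" for m
  proof -
    obtain c f where cf: "m = (\<Sum>a<?\<delta> + n. fls_const (c a) * row_series b a) + f" "f \<in> tails (int ?N)"
      using m unfolding frame_span_eq dim by blast
    let ?m' = "\<Sum>j<n. fls_const (c (?\<delta> + j)) * row_series b (?\<delta> + j)"
    have "?m' \<in> ?V 0"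
    proof (rule subsp_lincomb[OF sV])
      fix j assume "j \<in> {..<n}"
      then have "row_series b (?\<delta> + j) \<in> ?V (int (n - Suc j))" using rsV by simp
      then show "row_series b (?\<delta> + j) \<in> ?V 0" using V_mono[of 0 "int (n - Suc j)"] by auto
    qed
    moreover have "m - ?m' \<in> shift_set (int n) ?M"
    proof -
      have "m - ?m' = (\<Sum>a<?\<delta>. fls_const (c a) * row_series b a) + f"
        unfolding cf(1) sum_lessThan_add by simp
      also have "\<dots> \<in> frame_span ?\<delta> b" unfolding frame_span_eq dim using cf(2) by blast
      finally show ?thesis unfolding F0 .
    qed
    ultimately show ?thesis by (rule bexI[rotated])
  qed
  have iterate: "\<exists>m'\<in>?V 0. m - m' \<in> shift_set (int n * int k) ?M" if "m \<in> ?M" for m k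
  proof (induction k)
    case 0
    show ?case
    proof (rule bexI[of _ 0])
      show "m - 0 \<in> shift_set (int n * int 0) ?M" using that by (simp add: shift_set_def)
      show "0 \<in> ?V 0" by (rule subsp_zero[OF sV])
    qed
  next
    case (Suc k)
    then obtain m' where m': "m' \<in> ?V 0" "m - m' \<in> shift_set (int n * int k) ?M" by blast
    then obtain m1 where m1: "m1 \<in> ?M" "m - m' = fls_X_intpow (int n * int k) * m1"
      unfolding shift_set_def[of _ ?M] by blast
    obtain m1' where m1': "m1' \<in> ?V 0" "m1 - m1' \<in> shift_set (int n) ?M" using split[OF m1(1)] by blast
    have "fls_X_intpow (int n * int k) * m1' \<in> shift_set (int n * int k) (?V 0)"
      using m1'(1) by (rule X_intpow_mult_shift_set)
    then have "fls_X_intpow (int n * int k) * m1' \<in> ?V 0"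
      unfolding shV using V_mono[of 0 "int n * int k + 0"] by auto
    from subsp_add[OF sV m'(1) this]
    have "m' + fls_X_intpow (int n * int k) * m1' \<in> ?V 0" .
    moreover have "m - (m' + fls_X_intpow (int n * int k) * m1') \<in> shift_set (int n * int (Suc k)) ?M"
    proof -
      have "m - (m' + fls_X_intpow (int n * int k) * m1') = fls_X_intpow (int n * int k) * (m1 - m1')"
        using m1(2) by (simp add: algebra_simps)
      also have "\<dots> \<in> shift_set (int n * int k) (shift_set (int n) ?M)"
        using m1'(2) by (rule X_intpow_mult_shift_set)
      also have "shift_set (int n * int k) (shift_set (int n) ?M) = shift_set (int n * int (Suc k)) ?M"
        unfolding shift_set_shift_set[OF n_pos] by (simp add: distrib_left add.commute)
      finally show ?thesis .
    qed
    ultimately show ?case by (rule bexI[rotated])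
  qed
  have MV0: "?M \<subseteq> ?V 0"
  proof
    fix m assume m: "m \<in> ?M"
    \<comment> \<open>After this many steps the error lies in x^k M, which is inside \<varpi>^(b') S
      and so inside the lattice generated by the last n rows.\<close>
    let ?k = "nat b'"
    obtain m' where m': "m' \<in> ?V 0" "m - m' \<in> shift_set (int n * int ?k) ?M" using iterate[OF m] by blast
    have "shift_set (int n * int ?k) ?M \<subseteq> shift_set (int n * int ?k) (tails 0)"
      by (rule shift_set_mono[OF Jb(4)])
    also have "\<dots> \<subseteq> tails b'"
    proof -
      have "1 * int ?k \<le> int n * int ?k" by (rule mult_right_mono) (use n_pos in auto)
      then have "b' \<le> int n * int ?k + 0" by linarith
      then show ?thesis unfolding shift_set_tails by (rule tails_mono)
    qed
    finally have "m - m' \<in> ?V 0" using m'(2) b' by blast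
    from subsp_add[OF sV this m'(1)] show "m \<in> ?V 0" by simp
  qed
  then have M_eq: "?M = ?V 0" using V0M by blast
  have Vn: "?V (int n) = frame_span ?\<delta> b"
    using shV[of 1 0] unfolding F0 M_eq by simp
  fix j assume j: "j \<le> n"
  show "?V (int (n - j)) = frame_span (?\<delta> + j) b"
  proof
    show "?V (int (n - j)) \<subseteq> frame_span (?\<delta> + j) b"
    proof
      fix x assume "x \<in> ?V (int (n - j))"
      then obtain v where v: "v \<in> tails (int (n - j))" "x = shifted_act ?H v" by blast
      have "v \<in> tails 0" using v(1) tails_mono[of 0 "int (n - j)"] by auto
      from decomp[OF this] obtain v' where v': "v' \<in> tails (int n)"
        "x = (\<Sum>i<n. fls_const (fls_nth v (int i)) * row_series b (?\<delta> + (n - Suc i))) + shifted_act ?H v'"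
        unfolding v(2) by blast
      show "x \<in> frame_span (?\<delta> + j) b"
        unfolding v'(2)
      proof (rule subsp_add[OF subsp_frame_span], rule subsp_sum[OF subsp_frame_span])
        show "shifted_act ?H v' \<in> frame_span (?\<delta> + j) b" using actn[OF v'(1)] F0j[OF j] by blast
        fix i assume "i \<in> {..<n}"
        then have i: "i < n" by simp
        show "fls_const (fls_nth v (int i)) * row_series b (?\<delta> + (n - Suc i)) \<in> frame_span (?\<delta> + j) b"
        proof (cases "i < n - j")
          case True
          then have "fls_nth v (int i) = 0" using v(1) unfolding tails_iff by simp
          then show ?thesis using subsp_zero[OF subsp_frame_span] by simp
        next
          case False
          then have "?\<delta> + (n - Suc i) < ?\<delta> + j" using i by linarith
          then show ?thesis by (intro subsp_scale[OF subsp_frame_span] row_series_frame_span)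
        qed
      qed
    qed
    show "frame_span (?\<delta> + j) b \<subseteq> ?V (int (n - j))"
    proof
      fix x assume "x \<in> frame_span (?\<delta> + j) b"
      then obtain c f where x: "x = (\<Sum>a<?\<delta> + j. fls_const (c a) * row_series b a) + f" "f \<in> tails (int (dim_col b))"
        unfolding frame_span_eq by blast
      have "?V (int n) \<subseteq> ?V (int (n - j))" by (rule V_mono) simp
      then have sub: "frame_span ?\<delta> b \<subseteq> ?V (int (n - j))" unfolding Vn .
      show "x \<in> ?V (int (n - j))"
        unfolding x(1)
      proof (rule subsp_add[OF sV], rule subsp_lincomb[OF sV])
        show "f \<in> ?V (int (n - j))" using sub tails_frame_span[of b ?\<delta>] x(2) by blast
        fix a assume "a \<in> {..<?\<delta> + j}"
        then have a: "a < ?\<delta> + j" by simp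
        show "row_series b a \<in> ?V (int (n - j))"
        proof (cases "a < ?\<delta>")
          case True
          then show ?thesis using sub row_series_frame_span[OF True, of b] by blast
        next
          case False
          define k where "k = a - ?\<delta>"
          have k: "a = ?\<delta> + k" "k < j" "k < n" using False a j by (auto simp: k_def)
          have "?V (int (n - Suc k)) \<subseteq> ?V (int (n - j))" by (rule V_mono) (use k(2) in simp)
          then show ?thesis unfolding k(1) using rsV[OF k(3)] by blast
        qed
      qed
    qed
  qed
qed

lemma frame_matrix_springer:
  assumes b: "b \<in> frames n d"
  shows "loop_inv n (frame_matrix b) \<in> springer_matrices n d"
    "Phi_rep n d (loop_inv n (frame_matrix b)) = frame_flag n d b"
    "loop_inv n (loop_inv n (frame_matrix b)) = frame_matrix b"
proof -
  note G = frame_matrix_lattices(1)[OF b]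
  show inv: "loop_inv n (loop_inv n (frame_matrix b)) = frame_matrix b" by (rule loop_inv_inv[OF G])
  have ch: "shifted_chain (loop_inv n (frame_matrix b)) (int (n - j)) = frame_span (delta n d + j) b"
    if "j \<le> n" for j
    unfolding shifted_chain_eq inv by (rule frame_matrix_lattices(2)[OF b that])
  show Phi: "Phi_rep n d (loop_inv n (frame_matrix b)) = frame_flag n d b"
    unfolding Phi_rep_shifted_chain frame_flag_def using ch ch[OF order_refl] by (auto simp del: upt_Suc)
  show "loop_inv n (frame_matrix b) \<in> springer_matrices n d"
    unfolding springer_matrices_def[OF n_pos d_pos cop] mem_Collect_eq Phi
    using loop_inv_closed[OF G] b unfolding frames_iff by blast
qed

text \<open>Each coefficient of an entry is an entry of the frame or 0, and the pole order in x is
  at most \<delta> because of the division by \<varpi>^\<delta>.\<close>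

lemma frame_matrix_rational:
  assumes ij: "i < n" "j < n"
  shows "fls_rational (frames n d) {(\<lambda>b. b $$ (i, j)) | i j. i < delta n d + n \<and> j < n + 2 * delta n d}
    (\<lambda>b. frame_matrix b $$ (i, j))"
proof (rule fls_rationalI[where p = "- int (delta n d)"])
  let ?\<delta> = "delta n d" and ?N = "n + 2 * delta n d"
  have nth: "fls_nth (frame_matrix b $$ (i, j)) k =
      fls_nth (row_series b (?\<delta> + (n - Suc i))) (int n * k + int j + int ?\<delta>)" for b k
  proof -
    have "fls_nth (frame_matrix b $$ (i, j)) k = fls_nth (fls_X_intpow (- int ?\<delta>) *
        row_series b (?\<delta> + (n - Suc i))) (int n * k + int j)"
      using ij unfolding frame_matrix_def mat_of_series_def[OF n_pos]
      by (simp only: index_mat prod.case fls_nth_abinv[OF n_pos])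
    then show ?thesis by (simp only: fls_nth_X_intpow_mult diff_minus_eq_add)
  qed
  show "frame_matrix b $$ (i, j) \<in> tails (- int ?\<delta>)" for b
    unfolding tails_iff nth
  proof (intro allI impI)
    fix k assume k: "k < - int ?\<delta>"
    have "int n * (k + 1) \<le> 1 * (k + 1)" by (rule mult_right_mono_neg) (use n_pos k in auto)
    then have "int n * k + int n \<le> k + 1" by (simp add: distrib_left)
    then have "int n * k + int j + int ?\<delta> < 0" using k ij by linarith
    then show "fls_nth (row_series b (?\<delta> + (n - Suc i))) (int n * k + int j + int ?\<delta>) = 0"
      unfolding fls_nth_row_series by simp
  qed
  fix k
  let ?x = "int n * k + int j + int ?\<delta>"
  let ?B = "{(\<lambda>b :: complex mat. b $$ (i, j)) | i j. i < ?\<delta> + n \<and> j < ?N}"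
  have dim: "dim_col b = ?N" if "b \<in> frames n d" for b using that unfolding frames_iff by auto
  show "rational_on (frames n d) ?B (\<lambda>b. fls_nth (frame_matrix b $$ (i, j)) k)"
  proof (cases "0 \<le> ?x \<and> ?x < int ?N")
    case True
    have "rational_on (frames n d) ?B (\<lambda>b. b $$ (?\<delta> + (n - Suc i), nat ?x))"
    proof (rule rational_on_gen)
      have "?\<delta> + (n - Suc i) < ?\<delta> + n" "nat ?x < ?N" using True ij by (auto simp: nat_less_iff)
      then show "(\<lambda>b. b $$ (?\<delta> + (n - Suc i), nat ?x)) \<in> ?B" by blast
    qed
    moreover have "rational_on (frames n d) ?B (\<lambda>b. fls_nth (frame_matrix b $$ (i, j)) k) =
        rational_on (frames n d) ?B (\<lambda>b. b $$ (?\<delta> + (n - Suc i), nat ?x))"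
      by (rule rational_on_cong) (use True dim in \<open>simp add: nth fls_nth_row_series\<close>)
    ultimately show ?thesis by simp
  next
    case False
    have "rational_on (frames n d) ?B (\<lambda>b. fls_nth (frame_matrix b $$ (i, j)) k) =
        rational_on (frames n d) ?B (\<lambda>_. 0)"
    proof (rule rational_on_cong)
      fix b assume "b \<in> frames n d"
      then show "fls_nth (frame_matrix b $$ (i, j)) k = 0"
        unfolding nth fls_nth_row_series dim[OF \<open>b \<in> frames n d\<close>] using False by (simp only: if_False)
    qed
    then show ?thesis by (simp add: rational_on_const)
  qed
qed

text \<open>A single lift works everywhere, hence the constant function 1. The coordinates of g^-1
  come from entries of the frame, those of g from Cramer's rule and the valuation 0 of the
  determinant.\<close>

lemma local_lifts_frames_springer:
  "local_lifts (frame_flag n d) (frames n d)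
     {(\<lambda>b. b $$ (i, j)) | i j. i < delta n d + n \<and> j < n + 2 * delta n d}
     (Phi_rep n d) (springer_matrices n d) (loop_coords n)"
  unfolding local_lifts_def
proof
  let ?B = "{(\<lambda>b :: complex mat. b $$ (i, j)) | i j. i < delta n d + n \<and> j < n + 2 * delta n d}"
  let ?t = "\<lambda>b. loop_inv n (frame_matrix b)"
  have det: "det (frame_matrix b) \<noteq> 0 \<and> fls_subdegree (det (frame_matrix b)) = 0" if b: "b \<in> frames n d" for b
    using subdegree_det_springer_matrices[OF n_pos d_pos cop frame_matrix_springer(1)[OF b]]
      det_loopGL_nonzero[OF frame_matrix_lattices(1)[OF b]]
    unfolding frame_matrix_springer(3)[OF b] by blast
  have rat: "rational_on (frames n d) ?B (\<beta> \<circ> ?t)" if \<beta>: "\<beta> \<in> loop_coords n" for \<beta>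
  proof -
    from \<beta> consider i j k where "i < n" "j < n" "\<beta> = (\<lambda>g. fls_nth (g $$ (i, j)) k)"
      | i j k where "i < n" "j < n" "\<beta> = (\<lambda>g. fls_nth (loop_inv n g $$ (i, j)) k)"
      unfolding loop_coords_def by blast
    then show ?thesis
    proof cases
      case 1
      have "fls_rational (frames n d) ?B (\<lambda>b. loop_inv n (frame_matrix b) $$ (i, j))"
        by (rule fls_rational_loop_inv[OF n_pos frame_matrix_carrier frame_matrix_rational det 1(1,2)])
      then show ?thesis unfolding 1(3) o_def by (rule fls_rational_nth)
    next
      case 2
      have "rational_on (frames n d) ?B (\<beta> \<circ> ?t) =
          rational_on (frames n d) ?B (\<lambda>b. fls_nth (frame_matrix b $$ (i, j)) k)"
        by (rule rational_on_cong) (simp add: 2(3) frame_matrix_springer(3))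
      then show ?thesis using fls_rational_nth[OF frame_matrix_rational[OF 2(1,2)]] by simp
    qed
  qed
  fix b assume "b \<in> frames n d"
  show "\<exists>h\<in>poly_funs ?B. \<exists>s. h b \<noteq> 0 \<and>
      (\<forall>q\<in>frames n d. h q \<noteq> 0 \<longrightarrow> s q \<in> springer_matrices n d \<and> Phi_rep n d (s q) = frame_flag n d q) \<and>
      (\<forall>\<beta>\<in>loop_coords n. rational_on {q \<in> frames n d. h q \<noteq> 0} ?B (\<beta> \<circ> s))"
    by (rule bexI[of _ "\<lambda>_. 1"], rule exI[of _ ?t])
      (use frame_matrix_springer rat in \<open>auto intro: poly_funs.const\<close>)
qed

end

section \<open>The isomorphisms\<close>

lemma local_lifts_cong:
  assumes "\<And>p. p \<in> X \<Longrightarrow> \<rho> p = \<rho>' p" "\<And>q. q \<in> Y \<Longrightarrow> \<sigma> q = \<sigma>' q"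
    and L: "local_lifts \<rho> X A \<sigma> Y B"
  shows "local_lifts \<rho>' X A \<sigma>' Y B"
  unfolding local_lifts_def
proof
  fix p assume "p \<in> X"
  then obtain h s where h: "h \<in> poly_funs A" "h p \<noteq> 0"
    "\<forall>q\<in>X. h q \<noteq> 0 \<longrightarrow> s q \<in> Y \<and> \<sigma> (s q) = \<rho> q"
    "\<forall>\<beta>\<in>B. rational_on {q \<in> X. h q \<noteq> 0} A (\<beta> \<circ> s)"
    using L unfolding local_lifts_def by blast
  have "\<forall>q\<in>X. h q \<noteq> 0 \<longrightarrow> s q \<in> Y \<and> \<sigma>' (s q) = \<rho>' q"
  proof (intro ballI impI conjI)
    fix q assume q: "q \<in> X" "h q \<noteq> 0"
    then have s: "s q \<in> Y" "\<sigma> (s q) = \<rho> q" using h(3) by blast+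
    show "s q \<in> Y" by (rule s(1))
    show "\<sigma>' (s q) = \<rho>' q" using assms(1)[OF q(1)] assms(2)[OF s(1)] s(2) by simp
  qed
  then show "\<exists>h\<in>poly_funs A. \<exists>s. h p \<noteq> 0 \<and> (\<forall>q\<in>X. h q \<noteq> 0 \<longrightarrow> s q \<in> Y \<and> \<sigma>' (s q) = \<rho>' q) \<and>
      (\<forall>\<beta>\<in>B. rational_on {q \<in> X. h q \<noteq> 0} A (\<beta> \<circ> s))"
    using h(1,2,4) by blast
qed

text \<open>
  Hence it need not be known that every member of \<^term>\<open>Jflag n d\<close> is represented by a frame.
\<close>

lemma subvariety_restrict: "subvariety X (topspace (zar X) \<inter> Z) = subvariety X Z"
  by (simp add: subvariety_def subtopology_restrict)

context
  fixes n d :: nat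
  assumes n_pos: "0 < n" and d_pos: "0 < d" and cop: "coprime n d"
begin

abbreviation iwahori_coset :: "loop_mat \<Rightarrow> loop_mat set" where
  "iwahori_coset g \<equiv> g <#\<^bsub>loopGL n\<^esub> iwahori n"

lemma springer_fl0_variety_eq:
  "springer_fl0_variety n d =
     quotient_variety iwahori_coset (coord_variety (springer_matrices n d) (loop_coords n))"
  unfolding springer_fl0_variety_def Union_springer_fl0[OF n_pos d_pos cop] ..

lemma topspace_springer_fl0_variety:
  "topspace (zar (springer_fl0_variety n d)) = iwahori_coset ` springer_matrices n d"
  unfolding springer_fl0_variety_eq topspace_quotient_variety topspace_coord_variety ..

lemma iota_iwahori_coset:
  "g \<in> springer_matrices n d \<Longrightarrow> iota n (iwahori_coset g) = iwahori_coset (iota_mat n g)"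
  by (rule iota_coset[OF n_pos springer_matrices_loopGL[OF n_pos d_pos cop]])

lemma iota_mat_iota_mat: "g \<in> springer_matrices n d \<Longrightarrow> iota_mat n (iota_mat n g) = g"
  by (rule iota_mat_loopGL(3)[OF springer_matrices_loopGL[OF n_pos d_pos cop]])

text \<open>\<iota> exchanges, up to position, the coordinates of g with those of g^-1; both kinds
  belong to \<open>loop_coords\<close>.\<close>

lemma loop_coords_iota:
  assumes "\<beta> \<in> loop_coords n"
  shows "rational_on (springer_matrices n d) (loop_coords n) (\<beta> \<circ> iota_mat n)"
proof -
  note G = springer_matrices_loopGL[OF n_pos d_pos cop]
  from assms consider i j k where "i < n" "j < n" "\<beta> = (\<lambda>g. fls_nth (g $$ (i, j)) k)"
    | i j k where "i < n" "j < n" "\<beta> = (\<lambda>g. fls_nth (loop_inv n g $$ (i, j)) k)"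
    unfolding loop_coords_def by blast
  then show ?thesis
  proof cases
    case 1
    have "n - Suc j < n" "n - Suc i < n" using n_pos by simp_all
    then have "(\<lambda>g. fls_nth (loop_inv n g $$ (n - Suc j, n - Suc i)) k) \<in> loop_coords n"
      unfolding loop_coords_def by blast
    moreover have "rational_on (springer_matrices n d) (loop_coords n) (\<beta> \<circ> iota_mat n) =
        rational_on (springer_matrices n d) (loop_coords n)
          (\<lambda>g. fls_nth (loop_inv n g $$ (n - Suc j, n - Suc i)) k)"
      by (rule rational_on_cong) (simp add: 1 iota_mat_eq[OF G])
    ultimately show ?thesis by (simp add: rational_on_gen)
  next
    case 2
    have "n - Suc j < n" "n - Suc i < n" using n_pos by simp_all
    then have "(\<lambda>g. fls_nth (g $$ (n - Suc j, n - Suc i)) k) \<in> loop_coords n"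
      unfolding loop_coords_def by blast
    moreover have "rational_on (springer_matrices n d) (loop_coords n) (\<beta> \<circ> iota_mat n) =
        rational_on (springer_matrices n d) (loop_coords n) (\<lambda>g. fls_nth (g $$ (n - Suc j, n - Suc i)) k)"
      by (rule rational_on_cong) (simp add: 2 iota_mat_loopGL(2)[OF G])
    ultimately show ?thesis by (simp add: rational_on_gen)
  qed
qed

text \<open>\<open>iota_mat\<close> is a global lift in both directions, being its own inverse on
  representatives.\<close>

lemma variety_iso_iota: "variety_iso (iota n) (springer_fl0_variety n d) (springer_fl0_variety n d)"
  unfolding springer_fl0_variety_eq
proof (rule variety_iso_quotientI)
  let ?G = "springer_matrices n d" and ?A = "loop_coords n"
  have inv: "iota n (iota n (iwahori_coset g)) = iwahori_coset g" if g: "g \<in> ?G" for g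
    unfolding iota_iwahori_coset[OF g] iota_iwahori_coset[OF iota_springer_matrices[OF n_pos d_pos cop g]]
      iota_mat_iota_mat[OF g] ..
  show "inj_on (iota n) (iwahori_coset ` ?G)"
    by (rule inj_on_inverseI[of _ "iota n"]) (use inv in auto)
  have lift: "local_lifts \<rho> ?G ?A \<sigma> ?G ?A"
    if "\<And>g. g \<in> ?G \<Longrightarrow> \<sigma> (iota_mat n g) = \<rho> g" for \<rho> \<sigma> :: "loop_mat \<Rightarrow> loop_mat set"
    unfolding local_lifts_def
  proof
    fix g assume "g \<in> ?G"
    show "\<exists>h\<in>poly_funs ?A. \<exists>s. h g \<noteq> 0 \<and> (\<forall>q\<in>?G. h q \<noteq> 0 \<longrightarrow> s q \<in> ?G \<and> \<sigma> (s q) = \<rho> q) \<and>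
        (\<forall>\<beta>\<in>?A. rational_on {q \<in> ?G. h q \<noteq> 0} ?A (\<beta> \<circ> s))"
    proof (rule bexI[of _ "\<lambda>_. 1"], rule exI[of _ "iota_mat n"], intro conjI ballI impI)
      fix q assume "q \<in> ?G"
      then show "iota_mat n q \<in> ?G" "\<sigma> (iota_mat n q) = \<rho> q"
        using iota_springer_matrices[OF n_pos d_pos cop] that by blast+
    next
      fix \<beta> assume "\<beta> \<in> ?A"
      then show "rational_on {q \<in> ?G. (1 :: complex) \<noteq> 0} ?A (\<beta> \<circ> iota_mat n)"
        using loop_coords_iota by simp
    qed (simp_all add: poly_funs.const)
  qed
  show "local_lifts (iota n \<circ> iwahori_coset) ?G ?A iwahori_coset ?G ?A"
    by (rule lift) (simp add: iota_iwahori_coset)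
  show "local_lifts iwahori_coset ?G ?A (iota n \<circ> iwahori_coset) ?G ?A"
    by (rule lift) (simp add: iota_iwahori_coset[symmetric] inv)
qed

lemma Phi_iwahori_coset: "g \<in> springer_matrices n d \<Longrightarrow> Phi n d (iwahori_coset g) = Phi_rep n d g"
  by (rule Phi_coset[OF n_pos d_pos cop springer_matrices_loopGL[OF n_pos d_pos cop]])

text \<open>The flag determines one period of the chain and thus the whole chain. If g and h have
  the same chain, g^-1 h stabilises every \<varpi>^k S, which characterises the Iwahori
  subgroup.\<close>

lemma Phi_rep_injective:
  assumes g: "g \<in> carrier (loopGL n)" and h: "h \<in> carrier (loopGL n)"
    and eq: "Phi_rep n d g = Phi_rep n d h"
  shows "iwahori_coset g = iwahori_coset h"
proof -
  have nth: "snd (Phi_rep n d x) ! j = shift_set (int (delta n d)) (lattice_chain n x (int (n - j)))"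
    if "j \<le> n" for x j
    unfolding Phi_rep_eq[OF n_pos d_pos cop] using that by (simp del: upt_Suc)
  have base: "lattice_chain n g (int (n - j)) = lattice_chain n h (int (n - j))" if "j \<le> n" for j
  proof -
    have "shift_set (int (delta n d)) (lattice_chain n g (int (n - j))) =
        shift_set (int (delta n d)) (lattice_chain n h (int (n - j)))"
      unfolding nth[OF that, symmetric] eq ..
    from equalityD1[OF this] equalityD2[OF this] show ?thesis
      unfolding shift_set_subset_iff by (rule equalityI)
  qed
  have chain: "lattice_chain n g k = lattice_chain n h k" for k
  proof -
    let ?i = "nat (k mod int n)"
    have i: "n - (n - ?i) = ?i" "int ?i = k mod int n"
      using nat_mod_less[OF n_pos, of k] int_nat_mod[OF n_pos, of k] by auto
    have "lattice_chain n g (int ?i) = lattice_chain n h (int ?i)"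
      using base[of "n - ?i"] unfolding i(1) by simp
    moreover have "lattice_chain n x k = shift_set (int n * (k div int n)) (lattice_chain n x (int ?i))"
      if "x \<in> carrier (loopGL n)" for x
      unfolding i(2) lattice_chain_shift[OF n_pos that, symmetric] by simp
    ultimately show ?thesis using g h by simp
  qed
  define b where "b = loop_inv n g * h"
  have bG: "b \<in> carrier (loopGL n)" unfolding b_def by (rule loopGL_mult[OF loop_inv_closed[OF g] h])
  have "row_act n b ` tails k = tails k" for k
  proof -
    have "row_act n b ` tails k = row_act n h ` lattice_chain n g k"
      unfolding b_def row_act_mult_image[OF n_pos loop_inv_carrier_mat[OF g] loopGL_carrier_mat[OF h]]
        lattice_chain_def ..
    also have "\<dots> = tails k"
      unfolding chain unfolding lattice_chain_def by (rule row_act_inv_image(2)[OF n_pos h])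
    finally show ?thesis .
  qed
  then have b: "b \<in> iwahori n" using iwahori_iff[OF n_pos bG] by blast
  have "g * b = g * loop_inv n g * h"
    unfolding b_def
    by (rule assoc_mult_mat[symmetric, OF loopGL_carrier_mat[OF g] loop_inv_carrier_mat[OF g] loopGL_carrier_mat[OF h]])
  also have "\<dots> = h" unfolding loop_inv_right[OF g] using loopGL_carrier_mat[OF h] by simp
  finally have "h \<in> iwahori_coset g" unfolding mem_l_coset using b by (intro bexI[of _ b]) simp_all
  then show ?thesis by (rule group.l_repr_independence[OF group_loopGL _ g subgroup_iwahori[OF n_pos]])
qed

lemma variety_iso_Phi: "variety_iso (Phi n d) (springer_fl0_variety n d) (Jflag_variety n d)"
  unfolding springer_fl0_variety_eq Jflag_variety_def
proof (rule variety_iso_quotientI)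
  show "inj_on (Phi n d) (iwahori_coset ` springer_matrices n d)"
  proof (rule inj_onI)
    fix x y assume "x \<in> iwahori_coset ` springer_matrices n d" "y \<in> iwahori_coset ` springer_matrices n d"
      and eq: "Phi n d x = Phi n d y"
    then obtain g h where gh: "g \<in> springer_matrices n d" "x = iwahori_coset g"
      "h \<in> springer_matrices n d" "y = iwahori_coset h" by blast
    have "Phi_rep n d g = Phi_rep n d h"
      using eq unfolding gh(2,4) Phi_iwahori_coset[OF gh(1)] Phi_iwahori_coset[OF gh(3)] .
    then show "x = y" unfolding gh(2,4)
      by (rule Phi_rep_injective[OF springer_matrices_loopGL[OF n_pos d_pos cop gh(1)]
            springer_matrices_loopGL[OF n_pos d_pos cop gh(3)]])
  qed
  show "local_lifts (Phi n d \<circ> iwahori_coset) (springer_matrices n d) (loop_coords n) (frame_flag n d)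
      (frames n d) {(\<lambda>b. b $$ (i, j)) | i j. i < delta n d + n \<and> j < n + 2 * delta n d}"
    by (rule local_lifts_cong[OF _ _ local_lifts_springer_frames[OF n_pos d_pos cop]])
      (simp_all add: Phi_iwahori_coset)
  show "local_lifts (frame_flag n d) (frames n d)
      {(\<lambda>b. b $$ (i, j)) | i j. i < delta n d + n \<and> j < n + 2 * delta n d}
      (Phi n d \<circ> iwahori_coset) (springer_matrices n d) (loop_coords n)"
    by (rule local_lifts_cong[OF _ _ local_lifts_frames_springer[OF n_pos d_pos cop]])
      (simp_all add: Phi_iwahori_coset)
qed

text \<open>By the lifts in both directions, frames and matrices have the same image among the
  flagged lattices.\<close>

lemma topspace_Jflag_variety: "topspace (zar (Jflag_variety n d)) = Phi_rep n d ` springer_matrices n d"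
  unfolding Jflag_variety_def topspace_quotient_variety topspace_coord_variety
  using local_lifts_image[OF local_lifts_springer_frames[OF n_pos d_pos cop]]
    local_lifts_image[OF local_lifts_frames_springer[OF n_pos d_pos cop]] by (rule equalityI[rotated])

lemma springer_fl0_le_eq:
  "springer_fl0_le n d c = iwahori_coset `
     {g \<in> springer_matrices n d. int (gap (fst (Phi_rep n d (iota_mat n g)))) \<le> c}"
proof
  show "springer_fl0_le n d c \<subseteq> iwahori_coset `
      {g \<in> springer_matrices n d. int (gap (fst (Phi_rep n d (iota_mat n g)))) \<le> c}"
  proof
    fix C assume C: "C \<in> springer_fl0_le n d c"
    then have "C \<in> springer_fl0 n d" unfolding springer_fl0_le_def by blast
    then obtain g where g: "g \<in> springer_matrices n d" "C = iwahori_coset g"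
      unfolding springer_fl0_eq[OF n_pos d_pos cop] by blast
    then show "C \<in> iwahori_coset ` {g \<in> springer_matrices n d. int (gap (fst (Phi_rep n d (iota_mat n g)))) \<le> c}"
      using C springer_fl0_le_iff[OF n_pos d_pos cop g(1)] by blast
  qed
  show "iwahori_coset ` {g \<in> springer_matrices n d. int (gap (fst (Phi_rep n d (iota_mat n g)))) \<le> c}
      \<subseteq> springer_fl0_le n d c"
    using springer_fl0_le_iff[OF n_pos d_pos cop] by blast
qed

lemma springer_fl0_le_subset: "springer_fl0_le n d c \<subseteq> topspace (zar (springer_fl0_variety n d))"
  unfolding springer_fl0_le_eq topspace_springer_fl0_variety by blast

lemma Phi_iota_springer_fl0_le:
  "(Phi n d \<circ> iota n) ` springer_fl0_le n d c =
     topspace (zar (Jflag_variety n d)) \<inter> Jflag_le n d c"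
proof
  have im: "(Phi n d \<circ> iota n) (iwahori_coset g) = Phi_rep n d (iota_mat n g)" if "g \<in> springer_matrices n d" for g
    unfolding o_apply iota_iwahori_coset[OF that]
    by (rule Phi_iwahori_coset[OF iota_springer_matrices[OF n_pos d_pos cop that]])
  have le: "Phi_rep n d g \<in> Jflag_le n d c \<longleftrightarrow> int (gap (fst (Phi_rep n d g))) \<le> c"
    if "g \<in> springer_matrices n d" for g
    using that unfolding Jflag_le_def springer_matrices_def[OF n_pos d_pos cop]
    by (cases "Phi_rep n d g") simp
  show "(Phi n d \<circ> iota n) ` springer_fl0_le n d c \<subseteq> topspace (zar (Jflag_variety n d)) \<inter> Jflag_le n d c"
  proof
    fix x assume "x \<in> (Phi n d \<circ> iota n) ` springer_fl0_le n d c"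
    then obtain g where g: "g \<in> springer_matrices n d" "int (gap (fst (Phi_rep n d (iota_mat n g)))) \<le> c"
      "x = (Phi n d \<circ> iota n) (iwahori_coset g)" unfolding springer_fl0_le_eq by blast
    note ig = iota_springer_matrices[OF n_pos d_pos cop g(1)]
    show "x \<in> topspace (zar (Jflag_variety n d)) \<inter> Jflag_le n d c"
      unfolding g(3) im[OF g(1)] topspace_Jflag_variety using ig le[OF ig] g(2) by blast
  qed
  show "topspace (zar (Jflag_variety n d)) \<inter> Jflag_le n d c \<subseteq> (Phi n d \<circ> iota n) ` springer_fl0_le n d c"
  proof
    fix x assume x: "x \<in> topspace (zar (Jflag_variety n d)) \<inter> Jflag_le n d c"
    then obtain g where g: "g \<in> springer_matrices n d" "x = Phi_rep n d g"
      unfolding topspace_Jflag_variety by blast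
    note ig = iota_springer_matrices[OF n_pos d_pos cop g(1)]
    \<comment> \<open>The preimage of \<open>Phi_rep n d g\<close> is the coset of
      \<open>iota_mat n g\<close>, as \<iota> is an involution.\<close>
    have "int (gap (fst (Phi_rep n d (iota_mat n (iota_mat n g))))) \<le> c"
      unfolding iota_mat_iota_mat[OF g(1)] using x le[OF g(1)] g(2) by simp
    then have "iwahori_coset (iota_mat n g) \<in> springer_fl0_le n d c"
      unfolding springer_fl0_le_eq using ig by blast
    moreover have "x = (Phi n d \<circ> iota n) (iwahori_coset (iota_mat n g))"
      unfolding im[OF ig] iota_mat_iota_mat[OF g(1)] g(2) ..
    ultimately show "x \<in> (Phi n d \<circ> iota n) ` springer_fl0_le n d c" by (rule rev_image_eqI)
  qed
qed

lemma variety_iso_springer_subvariety: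
  assumes "variety_iso \<phi> (springer_fl0_variety n d) (Jflag_variety n d)"
    and "Z \<subseteq> topspace (zar (springer_fl0_variety n d))"
    and "\<phi> ` Z = topspace (zar (Jflag_variety n d)) \<inter> Jflag_le n d c"
  shows "variety_iso \<phi> (subvariety (springer_fl0_variety n d) Z)
    (subvariety (Jflag_variety n d) (Jflag_le n d c))"
proof -
  have "variety_iso \<phi> (subvariety (springer_fl0_variety n d) Z)
      (subvariety (Jflag_variety n d) (topspace (zar (Jflag_variety n d)) \<inter> Jflag_le n d c))"
    by (rule variety_iso_subvariety[OF assms(1) _ assms(2,3)])
      (unfold springer_fl0_variety_eq, rule reg_quotient_coord_cong)
  then show ?thesis unfolding subvariety_restrict .
qed

end

theorem theorem8p3:
  fixes n d :: nat and c :: int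
  assumes "0 < n" and "0 < d" and "coprime n d"
  shows "variety_iso (iota n) (springer_fl0_variety n d) (springer_fl0_variety n d) \<and>
         variety_iso (Phi n d) (springer_fl0_variety n d) (Jflag_variety n d) \<and>
         variety_iso (Phi n d \<circ> iota n)
           (subvariety (springer_fl0_variety n d) (springer_fl0_le n d c))
           (subvariety (Jflag_variety n d) (Jflag_le n d c)) \<and>
         variety_iso (Phi n d)
           (subvariety (springer_fl0_variety n d) (iota n ` springer_fl0_le n d c))
           (subvariety (Jflag_variety n d) (Jflag_le n d c))"
proof (intro conjI)
  let ?X = "springer_fl0_variety n d" and ?Z = "springer_fl0_le n d c"
  note iota = variety_iso_iota[OF assms] and Phi = variety_iso_Phi[OF assms]
  note sub = springer_fl0_le_subset[OF assms, of c]
  show "variety_iso (iota n) ?X ?X" "variety_iso (Phi n d) ?X (Jflag_variety n d)" by (fact iota, fact Phi)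
  show "variety_iso (Phi n d \<circ> iota n) (subvariety ?X ?Z) (subvariety (Jflag_variety n d) (Jflag_le n d c))"
    by (rule variety_iso_springer_subvariety[OF assms variety_iso_comp[OF iota Phi] sub
          Phi_iota_springer_fl0_le[OF assms]])
  \<comment> \<open>\<iota> permutes the points of the Springer fiber, so the image of a filtration
    step again consists of points of it.\<close>
  have "iota n ` topspace (zar ?X) = topspace (zar ?X)"
    using iota unfolding variety_iso_def by (intro homeomorphic_imp_surjective_map) blast
  then have "iota n ` ?Z \<subseteq> topspace (zar ?X)" using sub by blast
  then show "variety_iso (Phi n d) (subvariety ?X (iota n ` ?Z)) (subvariety (Jflag_variety n d) (Jflag_le n d c))"
    by (rule variety_iso_springer_subvariety[OF assms Phi])
      (use Phi_iota_springer_fl0_le[OF assms, of c] in \<open>simp add: image_comp\<close>)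
qed

end
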